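(* Let $\pi:E\to X$ be a holomorphic vector bundle over a complex manifold $X$ equipped with a smooth Finsler metric $h$. If $(E,h)$ is strictly negatively curved, then the curvature of the induced Hermitian metric $\det h$ on $\det E$ is strictly negative.
   Context: Let $m$ be the rank of $E$ and $Z_E\subset E$ its zero section. A smooth Finsler metric on $E$ is a continuous function $h:E\to\mathbb{R}$ with $h\ge0$, $h(\lambda v)=|\lambda|h(v)$ for $\lambda\in\mathbb{C}$, $v\in E$, and $h$ smooth on $E\setminus Z_E$. $(E,h)$ is strictly negatively curved if $h$ is strictly plurisubharmonic on $E\setminus Z_E$ (complex Hessian positive definite in local holomorphic coordinates of the total space). (For a smooth Hermitian metric, $h$ being the associated norm, this is equivalent to strict negativity of the curvature in the sense of Griffiths.) The induced Hermitian metric $\det h$ on $\det E=\Lambda^mE$ is defined as follows. For $t\in X$ let $B_t=\{v\in E_t\mid h(v)\le1\}$. Given a holomorphic local frame $e_1,\dots,e_m$ of $E$ over an open set $W\subset X$, let $\phi_t:E_t\to\mathbb{C}^m$, $z_1e_1(t)+\cdots+z_me_m(t)\mapsto(z_1,\dots,z_m)$. The local frame $e=e_1\wedge\cdots\wedge e_m$ of $\det E$ has norm $$\|e(t)\|^2_{\det h}=\frac{1}{\mu_0(\phi_t(B_t))},$$ where $\mu_0$ is Lebesgue measure on $\mathbb{C}^m$; this is independent of the choice of frame. The curvature of $\det h$ is locally $-i\partial\bar\partial\ln\|e\|^2_{\det h}$, and it is strictly negative if this real $(1,1)$-form is negative definite at every point. *)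

theory Defs
  imports "HOL-Analysis.Analysis"
begin

section \<open>Differentiability classes and complex derivatives on open subsets of C^N\<close>

(* Meant for open S.  In finite dimension this is the usual class C^k: all iterated directional
   derivatives up to order k exist and are continuous. *)
fun Ck_on :: "nat \<Rightarrow> 'a::euclidean_space set \<Rightarrow> ('a \<Rightarrow> 'b::real_normed_vector) \<Rightarrow> bool" where
  "Ck_on 0 S f \<longleftrightarrow> continuous_on S f"
| "Ck_on (Suc k) S f \<longleftrightarrow>
     (\<forall>x\<in>S. f differentiable (at x)) \<and> (\<forall>v. Ck_on k S (\<lambda>x. frechet_derivative f (at x) v))"

definition Cinf_on :: "'a::euclidean_space set \<Rightarrow> ('a \<Rightarrow> 'b::real_normed_vector) \<Rightarrow> bool" where
  "Cinf_on S f \<longleftrightarrow> (\<forall>k. Ck_on k S f)"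

(* Holomorphy in several variables on an open set: complex differentiability at every point. *)
definition holo_on :: "(complex^'n) set \<Rightarrow> (complex^'n \<Rightarrow> complex) \<Rightarrow> bool" where
  "holo_on S f \<longleftrightarrow>
     (\<forall>x\<in>S. \<exists>f'. (f has_derivative f') (at x) \<and> (\<forall>c v. f' (c *s v) = c * f' v))"

(* d/dz_j = (d/dx_j - i d/dy_j)/2  and  d/dzbar_j = (d/dx_j + i d/dy_j)/2 *)
definition d_z :: "'n::finite \<Rightarrow> (complex^'n \<Rightarrow> complex) \<Rightarrow> complex^'n \<Rightarrow> complex" where
  "d_z j f z = (frechet_derivative f (at z) (axis j 1)
                 - \<i> * frechet_derivative f (at z) (axis j \<i>)) / 2"

definition d_zbar :: "'n::finite \<Rightarrow> (complex^'n \<Rightarrow> complex) \<Rightarrow> complex^'n \<Rightarrow> complex" where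
  "d_zbar j f z = (frechet_derivative f (at z) (axis j 1)
                    + \<i> * frechet_derivative f (at z) (axis j \<i>)) / 2"

definition complex_hessian :: "(complex^'n \<Rightarrow> real) \<Rightarrow> complex^'n \<Rightarrow> complex^'n^'n" where
  "complex_hessian u z = (\<chi> j k. d_z j (d_zbar k (\<lambda>y. complex_of_real (u y))) z)"

definition hermitian_pos_def :: "complex^'n^'n \<Rightarrow> bool" where
  "hermitian_pos_def H \<longleftrightarrow>
     (\<forall>j k. H $ k $ j = cnj (H $ j $ k)) \<and>
     (\<forall>w. w \<noteq> 0 \<longrightarrow> Re (\<Sum>j\<in>UNIV. \<Sum>k\<in>UNIV. H $ j $ k * w $ j * cnj (w $ k)) > 0)"

definition hermitian_neg_def :: "complex^'n^'n \<Rightarrow> bool" where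
  "hermitian_neg_def H \<longleftrightarrow> hermitian_pos_def (- H)"

section \<open>Complex manifolds\<close>

(* The points of the manifold are topspace (mtop M); a chart is a pair of its domain and its
   coordinate map. *)
record ('x, 'n) cmfd =
  mtop :: "'x topology"
  atlas :: "('x set \<times> ('x \<Rightarrow> complex^'n)) set"

definition holomorphic_fun ::
    "('x, 'n::finite) cmfd \<Rightarrow> 'x set \<Rightarrow> ('x \<Rightarrow> complex) \<Rightarrow> bool" where
  "holomorphic_fun M S f \<longleftrightarrow>
     (\<forall>(U, \<phi>) \<in> atlas M. holo_on (\<phi> ` (U \<inter> S)) (f \<circ> inv_into U \<phi>))"

definition complex_manifold :: "('x, 'n::finite) cmfd \<Rightarrow> bool" where
  "complex_manifold M \<longleftrightarrow>
     Hausdorff_space (mtop M) \<and> second_countable (mtop M) \<and>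
     (\<Union>(U, \<phi>) \<in> atlas M. U) = topspace (mtop M) \<and>
     (\<forall>(U, \<phi>) \<in> atlas M.
        openin (mtop M) U \<and> open (\<phi> ` U) \<and>
        homeomorphic_map (subtopology (mtop M) U) (top_of_set (\<phi> ` U)) \<phi>) \<and>
     (\<forall>(U, \<phi>) \<in> atlas M. \<forall>i. holomorphic_fun M U (\<lambda>x. \<phi> x $ i))"

definition smooth_fun :: "('x, 'n::finite) cmfd \<Rightarrow> 'x set \<Rightarrow> ('x \<Rightarrow> real) \<Rightarrow> bool" where
  "smooth_fun M S f \<longleftrightarrow>
     (\<forall>(U, \<phi>) \<in> atlas M. Cinf_on (\<phi> ` (U \<inter> S)) (f \<circ> inv_into U \<phi>))"

definition strictly_psh :: "('x, 'n::finite) cmfd \<Rightarrow> 'x set \<Rightarrow> ('x \<Rightarrow> real) \<Rightarrow> bool" where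
  "strictly_psh M S f \<longleftrightarrow>
     (\<forall>(U, \<phi>) \<in> atlas M.
        Ck_on 2 (\<phi> ` (U \<inter> S)) (f \<circ> inv_into U \<phi>) \<and>
        (\<forall>z \<in> \<phi> ` (U \<inter> S). hermitian_pos_def (complex_hessian (f \<circ> inv_into U \<phi>) z)))"

section \<open>Holomorphic vector bundles\<close>

(* A bundle with fibre C^m, m = CARD('m), so the rank is at least 1.  The operations vadd and
   vscale are meaningful only within one fibre.  A local trivialisation is a pair of an open
   subset W of the base and the C^m-component tau of the map
   v |-> (vproj v, tau v) from the part of the total space above W to W x C^m. *)
record ('x, 'e, 'n, 'm) vbundle =
  vbase :: "('x, 'n) cmfd"
  vtop :: "'e topology"
  vproj :: "'e \<Rightarrow> 'x"
  vadd :: "'e \<Rightarrow> 'e \<Rightarrow> 'e"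
  vscale :: "complex \<Rightarrow> 'e \<Rightarrow> 'e"
  vzero :: "'x \<Rightarrow> 'e"
  trivs :: "('x set \<times> ('e \<Rightarrow> complex^'m)) set"

definition above :: "('x, 'e, 'n::finite, 'm::finite) vbundle \<Rightarrow> 'x set \<Rightarrow> 'e set" where
  "above E W = {v \<in> topspace (vtop E). vproj E v \<in> W}"

definition fibre :: "('x, 'e, 'n::finite, 'm::finite) vbundle \<Rightarrow> 'x \<Rightarrow> 'e set" where
  "fibre E t = above E {t}"

definition zero_section :: "('x, 'e, 'n::finite, 'm::finite) vbundle \<Rightarrow> 'e set" where
  "zero_section E = vzero E ` topspace (mtop (vbase E))"

(* Each tau restricts to a bijection from the fibre onto C^m that respects the operations, so
   the fibres are complex vector spaces of dimension m. *)
definition holomorphic_vector_bundle :: "('x, 'e, 'n::finite, 'm::finite) vbundle \<Rightarrow> bool" where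
  "holomorphic_vector_bundle E \<longleftrightarrow>
     complex_manifold (vbase E) \<and>
     (\<forall>v \<in> topspace (vtop E). vproj E v \<in> topspace (mtop (vbase E))) \<and>
     (\<Union>(W, \<tau>) \<in> trivs E. W) = topspace (mtop (vbase E)) \<and>
     (\<forall>(W, \<tau>) \<in> trivs E.
        openin (mtop (vbase E)) W \<and>
        homeomorphic_map (subtopology (vtop E) (above E W))
          (prod_topology (subtopology (mtop (vbase E)) W) euclidean) (\<lambda>v. (vproj E v, \<tau> v)) \<and>
        (\<forall>t \<in> W.
           vzero E t \<in> fibre E t \<and> \<tau> (vzero E t) = 0 \<and>
           (\<forall>v \<in> fibre E t. \<forall>w \<in> fibre E t.
              vadd E v w \<in> fibre E t \<and> \<tau> (vadd E v w) = \<tau> v + \<tau> w) \<and>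
           (\<forall>c. \<forall>v \<in> fibre E t.
              vscale E c v \<in> fibre E t \<and> \<tau> (vscale E c v) = c *s \<tau> v))) \<and>
     (\<forall>(W, \<tau>) \<in> trivs E. \<forall>(W', \<tau>') \<in> trivs E. \<exists>g :: 'x \<Rightarrow> complex^'m^'m.
        (\<forall>v \<in> above E (W \<inter> W'). \<tau>' v = g (vproj E v) *v \<tau> v) \<and>
        (\<forall>i j. holomorphic_fun (vbase E) (W \<inter> W') (\<lambda>x. g x $ i $ j)))"

(* Charts of the total space: base coordinates together with fibre coordinates, indexed by the
   disjoint sum of the two index types. *)
definition total_space :: "('x, 'e, 'n::finite, 'm::finite) vbundle \<Rightarrow> ('e, 'n + 'm) cmfd" where
  "total_space E =
     \<lparr> mtop = vtop E,
       atlas = {(above E (U \<inter> W),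
                 \<lambda>v. \<chi> k. case k of Inl i \<Rightarrow> \<phi> (vproj E v) $ i | Inr j \<Rightarrow> \<tau> v $ j)
                | U \<phi> W \<tau>. (U, \<phi>) \<in> atlas (vbase E) \<and> (W, \<tau>) \<in> trivs E} \<rparr>"

definition holomorphic_section ::
    "('x, 'e, 'n::finite, 'm::finite) vbundle \<Rightarrow> 'x set \<Rightarrow> ('x \<Rightarrow> 'e) \<Rightarrow> bool" where
  "holomorphic_section E V s \<longleftrightarrow>
     openin (mtop (vbase E)) V \<and> (\<forall>t \<in> V. s t \<in> fibre E t) \<and>
     (\<forall>(W, \<tau>) \<in> trivs E. \<forall>i. holomorphic_fun (vbase E) (V \<inter> W) (\<lambda>t. \<tau> (s t) $ i))"

section \<open>Finsler metrics\<close>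

definition smooth_finsler_metric ::
    "('x, 'e, 'n::finite, 'm::finite) vbundle \<Rightarrow> ('e \<Rightarrow> real) \<Rightarrow> bool" where
  "smooth_finsler_metric E h \<longleftrightarrow>
     continuous_map (vtop E) euclideanreal h \<and>
     (\<forall>v \<in> topspace (vtop E). h v \<ge> 0) \<and>
     (\<forall>c. \<forall>v \<in> topspace (vtop E). h (vscale E c v) = cmod c * h v) \<and>
     smooth_fun (total_space E) (topspace (vtop E) - zero_section E) h"

definition strictly_negatively_curved ::
    "('x, 'e, 'n::finite, 'm::finite) vbundle \<Rightarrow> ('e \<Rightarrow> real) \<Rightarrow> bool" where
  "strictly_negatively_curved E h \<longleftrightarrow>
     strictly_psh (total_space E) (topspace (vtop E) - zero_section E) h"

section \<open>The determinant line bundle\<close>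

definition dual_fibre ::
    "('x, 'e, 'n::finite, 'm::finite) vbundle \<Rightarrow> 'x \<Rightarrow> ('e \<Rightarrow> complex) set" where
  "dual_fibre E t =
     {\<alpha>. (\<forall>v \<in> fibre E t. \<forall>w \<in> fibre E t. \<alpha> (vadd E v w) = \<alpha> v + \<alpha> w) \<and>
         (\<forall>c. \<forall>v \<in> fibre E t. \<alpha> (vscale E c v) = c * \<alpha> v) \<and>
         (\<forall>v. v \<notin> fibre E t \<longrightarrow> \<alpha> v = 0)}"

(* The top exterior power of E_t, as the space of alternating m-linear forms on the dual of E_t,
   with arguments indexed by 'm instead of 1..m (and value 0 outside the dual). *)
definition det_fibre ::
    "('x, 'e, 'n::finite, 'm::finite) vbundle \<Rightarrow> 'x \<Rightarrow> (('m \<Rightarrow> 'e \<Rightarrow> complex) \<Rightarrow> complex) set" where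
  "det_fibre E t =
     {\<omega>. (\<forall>\<alpha> i \<beta> \<gamma>. (\<forall>j. \<alpha> j \<in> dual_fibre E t) \<longrightarrow> \<beta> \<in> dual_fibre E t \<longrightarrow> \<gamma> \<in> dual_fibre E t \<longrightarrow>
             \<omega> (\<alpha>(i := (\<lambda>v. \<beta> v + \<gamma> v))) = \<omega> (\<alpha>(i := \<beta>)) + \<omega> (\<alpha>(i := \<gamma>))) \<and>
         (\<forall>\<alpha> i c. (\<forall>j. \<alpha> j \<in> dual_fibre E t) \<longrightarrow>
             \<omega> (\<alpha>(i := (\<lambda>v. c * \<alpha> i v))) = c * \<omega> \<alpha>) \<and>
         (\<forall>\<alpha> i j. (\<forall>k. \<alpha> k \<in> dual_fibre E t) \<longrightarrow> i \<noteq> j \<longrightarrow> \<alpha> i = \<alpha> j \<longrightarrow> \<omega> \<alpha> = 0) \<and>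
         (\<forall>\<alpha>. (\<exists>j. \<alpha> j \<notin> dual_fibre E t) \<longrightarrow> \<omega> \<alpha> = 0)}"

(* The wedge product of the vectors e j of E_t: (alpha_i) |-> det (alpha_i (e j)). *)
definition wedge ::
    "('x, 'e, 'n::finite, 'm::finite) vbundle \<Rightarrow> 'x \<Rightarrow> ('m \<Rightarrow> 'e) \<Rightarrow>
      (('m \<Rightarrow> 'e \<Rightarrow> complex) \<Rightarrow> complex)" where
  "wedge E t e =
     (\<lambda>\<alpha>. if \<forall>i. \<alpha> i \<in> dual_fibre E t then det (\<chi> i j. \<alpha> i (e j)) else 0)"

(* Relative to a trivialisation tau with component functionals tau_i, the coordinate of omega is
   omega (tau_i), i.e. the coefficient c in omega = c * (e_1 wedge ... wedge e_m) for the local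
   frame e_j corresponding to tau. *)
definition det_coord ::
    "('x, 'e, 'n::finite, 'm::finite) vbundle \<Rightarrow> ('e \<Rightarrow> complex^'m) \<Rightarrow>
      'x \<times> (('m \<Rightarrow> 'e \<Rightarrow> complex) \<Rightarrow> complex) \<Rightarrow> complex^1" where
  "det_coord E \<tau> = (\<lambda>(t, \<omega>). vec (\<omega> (\<lambda>i v. if v \<in> fibre E t then \<tau> v $ i else 0)))"

(* The topology is the one making all the local trivialisations homeomorphisms. *)
definition det_bundle ::
    "('x, 'e, 'n::finite, 'm::finite) vbundle \<Rightarrow>
      ('x, 'x \<times> (('m \<Rightarrow> 'e \<Rightarrow> complex) \<Rightarrow> complex), 'n, 1) vbundle" where
  "det_bundle E =
     \<lparr> vbase = vbase E,
       vtop = topology_generated_by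
         {{(t, \<omega>). t \<in> W \<and> \<omega> \<in> det_fibre E t \<and> (t, det_coord E \<tau> (t, \<omega>)) \<in> Q} | W \<tau> Q.
            (W, \<tau>) \<in> trivs E \<and> openin (prod_topology (mtop (vbase E)) euclidean) Q},
       vproj = fst,
       vadd = (\<lambda>(t, \<omega>) (_, \<omega>'). (t, \<lambda>\<alpha>. \<omega> \<alpha> + \<omega>' \<alpha>)),
       vscale = (\<lambda>c (t, \<omega>). (t, \<lambda>\<alpha>. c * \<omega> \<alpha>)),
       vzero = (\<lambda>t. (t, \<lambda>_. 0)),
       trivs = {(W, det_coord E \<tau>) | W \<tau>. (W, \<tau>) \<in> trivs E} \<rparr>"

(* e is a basis of E_t and \<phi> sends z_1 e_1 + ... + z_m e_m to (z_1, ..., z_m): the linear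
   isomorphism from E_t to C^m taking e to the standard basis. *)
definition fibre_frame ::
    "('x, 'e, 'n::finite, 'm::finite) vbundle \<Rightarrow> 'x \<Rightarrow> ('m \<Rightarrow> 'e) \<Rightarrow> ('e \<Rightarrow> complex^'m) \<Rightarrow> bool"
  where
  "fibre_frame E t e \<phi> \<longleftrightarrow>
     bij_betw \<phi> (fibre E t) UNIV \<and>
     (\<forall>v \<in> fibre E t. \<forall>w \<in> fibre E t. \<phi> (vadd E v w) = \<phi> v + \<phi> w) \<and>
     (\<forall>c. \<forall>v \<in> fibre E t. \<phi> (vscale E c v) = c *s \<phi> v) \<and>
     (\<forall>j. e j \<in> fibre E t \<and> \<phi> (e j) = axis j 1)"

definition finsler_ball ::
    "('x, 'e, 'n::finite, 'm::finite) vbundle \<Rightarrow> ('e \<Rightarrow> real) \<Rightarrow> 'x \<Rightarrow> 'e set" where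
  "finsler_ball E h t = {v \<in> fibre E t. h v \<le> 1}"

(* The norm of det h: the squared norm of c * (e_1 wedge ... wedge e_m) is
   |c|^2 / mu_0 (phi (B_t)); the value does not depend on the basis e. *)
definition det_metric ::
    "('x, 'e, 'n::finite, 'm::finite) vbundle \<Rightarrow> ('e \<Rightarrow> real) \<Rightarrow>
      'x \<times> (('m \<Rightarrow> 'e \<Rightarrow> complex) \<Rightarrow> complex) \<Rightarrow> real" where
  "det_metric E h = (\<lambda>(t, \<omega>). sqrt (THE r. \<exists>e \<phi> c.
     fibre_frame E t e \<phi> \<and> \<omega> = (\<lambda>\<alpha>. c * wedge E t e \<alpha>) \<and>
     r = (cmod c)\<^sup>2 / measure lborel (\<phi> ` finsler_ball E h t)))"

section \<open>Curvature of Hermitian line bundles\<close>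

(* A Hermitian metric on a line bundle, given by its norm.  Regularity is part of
   curvature_strictly_negative below. *)
definition line_bundle_metric ::
    "('x, 'l, 'n::finite, 1) vbundle \<Rightarrow> ('l \<Rightarrow> real) \<Rightarrow> bool" where
  "line_bundle_metric L N \<longleftrightarrow>
     (\<forall>v \<in> topspace (vtop L). N v \<ge> 0 \<and> (N v = 0 \<longleftrightarrow> v \<in> zero_section L)) \<and>
     (\<forall>c. \<forall>v \<in> topspace (vtop L). N (vscale L c v) = cmod c * N v)"

(* The curvature -i d dbar ln |s|^2 = i * Sum K_jk dz_j wedge dzbar_k, for a nowhere vanishing
   holomorphic local section s, in a chart (U, phi) of the base: the matrix K at z. *)
definition curvature_matrix ::
    "('l \<Rightarrow> real) \<Rightarrow> ('x \<Rightarrow> 'l) \<Rightarrow> 'x set \<Rightarrow> ('x \<Rightarrow> complex^'n) \<Rightarrow> complex^'n \<Rightarrow> complex^'n^'n"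
  where
  "curvature_matrix N s U \<phi> z = - complex_hessian (\<lambda>y. ln ((N (s (inv_into U \<phi> y)))\<^sup>2)) z"

(* The C^2 condition ensures that the curvature is defined. *)
definition curvature_strictly_negative ::
    "('x, 'l, 'n::finite, 1) vbundle \<Rightarrow> ('l \<Rightarrow> real) \<Rightarrow> bool" where
  "curvature_strictly_negative L N \<longleftrightarrow>
     line_bundle_metric L N \<and>
     (\<forall>V s. holomorphic_section L V s \<longrightarrow> (\<forall>t \<in> V. s t \<noteq> vzero L t) \<longrightarrow>
        (\<forall>(U, \<phi>) \<in> atlas (vbase L).
           Ck_on 2 (\<phi> ` (U \<inter> V)) (\<lambda>y. ln ((N (s (inv_into U \<phi> y)))\<^sup>2)) \<and>
           (\<forall>z \<in> \<phi> ` (U \<inter> V). hermitian_neg_def (curvature_matrix N s U \<phi> z))))"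

end

theory Submission
  imports Defs "HOL-Complex_Analysis.Cauchy_Integral_Formula"
begin

text \<open>In a chart write \<open>H(z, w)\<close> for \<open>h\<close> and \<open>\<psi> = 2 m ln H\<close>. Up to a constant factor the volume of the fibre ball
  is \<open>V(z) = \<integral> exp (- \<psi>(z, w)) dw\<close> over a shell of the fibre, so \<open>ln V\<close> must be shown strictly
  plurisuperharmonic. The Levi form of \<open>- ln V\<close> in a direction \<open>\<xi>\<close> is the mean of \<open>\<psi>\<^bsub>\<xi>\<xi>\<^esub>\<close> minus the complex variance
  of \<open>\<psi>\<^bsub>\<xi>\<^esub>\<close> with respect to \<open>exp (- \<psi>)\<close>, as in Berndtsson's work on fibrewise integrals. Functions homogeneous of
  degree zero live on the compact projective space of the fibre, so integrations by parts have no boundary terms. If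
  \<open>L\<close> is the Laplacian with weight \<open>\<psi>\<close>, the Bochner formula bounds the norm of \<open>L v\<close> below by the Levi form of \<open>\<psi>\<close>
  along the gradient of \<open>v\<close>. Solving \<open>L v = \<psi>\<^bsub>\<xi>\<^esub> - mean \<psi>\<^bsub>\<xi>\<^esub>\<close> approximately then bounds the Levi form of \<open>- ln V\<close> below
  by the mean of the full Levi form of \<open>\<psi>\<close> at the vector \<open>(\<xi>, grad v)\<close>; this is positive because, by homogeneity, the
  Levi form of \<open>ln H\<close> is that of \<open>H\<close> after removal of the radial component of the vector. Elliptic theory is avoided: the
  range of \<open>L\<close> together with the constants is dense for the Fubini-Study weight by an explicit computation on
  bihomogeneous polynomials and the Stone-Weierstrass theorem, and density persists along the segment of weights from
  Fubini-Study to \<open>\<psi>\<close>.\<close>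

section \<open>Functions of class C^k\<close>

text \<open>Differentiating the volume of a sublevel set directly would mean differentiating a
  moving domain; the homogeneity of \<open>H\<close> trades it for the integral of \<open>H\<close>
  to the power \<open>- 2 * m\<close> over a shell that is the same for all base points. Because
  \<open>exp (- \<psi>)\<close> has exactly this degree, the Ricci curvature of projective space
  drops out of the Bochner formula, and the Levi form of \<psi> is the only curvature term. The
  equation for \<open>v\<close> may be solved with an error because positivity on the shell comes
  with a uniform constant: a small mean square error leaves the strict inequality intact, and no
  regularity of a limit enters. The weight enters \<open>L\<close> only through the divergence, the
  gradient being the Fubini-Study one throughout; moving the weight changes \<open>L\<close> by a
  first-order term, which the Bochner estimate bounds by \<open>L\<close> itself with one constant
  for the whole segment, so finitely many steps suffice. A separate obstacle is that
  \<open>det h\<close> is defined through arbitrary frames: its well-definedness rests on the volume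
  factor of a complex matrix and on the uniqueness of the determinant, both proved by elementary
  matrices.\<close>

abbreviation dd :: "'a::real_normed_vector \<Rightarrow> ('a \<Rightarrow> 'b::real_normed_vector) \<Rightarrow> 'a \<Rightarrow> 'b" where
  "dd v f x \<equiv> frechet_derivative f (at x) v"

lemma dd_eqI: "(f has_derivative f') (at x) \<Longrightarrow> dd v f x = f' v"
  by (drule frechet_derivative_at) simp

lemma has_derivative_dd: "f differentiable (at x) \<Longrightarrow> (f has_derivative (\<lambda>v. dd v f x)) (at x)"
  using frechet_derivative_works[of f "at x"] by simp

text \<open>A derivative at \<open>x\<close> sees the values near \<open>x\<close>, so agreement on
  an open set is what the induction can carry to all higher derivatives.\<close>

lemma Ck_on_cong_imp:
  assumes "open S" "\<And>x. x \<in> S \<Longrightarrow> f x = g x" "Ck_on k S f"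
  shows "Ck_on k S g"
  using assms(2,3)
proof (induction k arbitrary: f g)
  case 0
  then show ?case by (metis Ck_on.simps(1) continuous_on_cong)
next
  case (Suc k)
  have *: "(g has_derivative (\<lambda>v. dd v f x)) (at x)" if "x \<in> S" for x
    using has_derivative_transform_within_open[OF has_derivative_dd \<open>open S\<close> that, of f g] Suc.prems that
    by auto
  then have "dd v f x = dd v g x" if "x \<in> S" for x v
    using dd_eqI[OF *[OF that], of v] by simp
  then have "Ck_on k S (dd v g)" for v
    using Suc.IH[of "dd v f" "dd v g"] Suc.prems by auto
  then show ?case
    using * by (auto simp: differentiable_def)
qed

lemma Ck_on_subset: "Ck_on k S f \<Longrightarrow> T \<subseteq> S \<Longrightarrow> Ck_on k T f"
  by (induction k arbitrary: f) (auto intro: continuous_on_subset)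

lemma Ck_on_Suc_D: "Ck_on (Suc k) S f \<Longrightarrow> Ck_on k S f"
proof (induction k arbitrary: f)
  case 0
  then show ?case
    by (auto intro!: continuous_at_imp_continuous_on differentiable_imp_continuous_within)
next
  case (Suc k)
  then show ?case by (metis Ck_on.simps(2))
qed

lemma Ck_on_le: "Ck_on k S f \<Longrightarrow> j \<le> k \<Longrightarrow> Ck_on j S f"
  by (induction k) (auto simp: le_Suc_eq dest: Ck_on_Suc_D simp del: Ck_on.simps(2))

lemma Ck_on_continuous_on: "Ck_on k S f \<Longrightarrow> continuous_on S f"
  using Ck_on_le[of k S f 0] by simp

lemma Ck_on_differentiable: "Ck_on k S f \<Longrightarrow> k \<ge> 1 \<Longrightarrow> x \<in> S \<Longrightarrow> f differentiable (at x)"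
  using Ck_on_le[of k S f "Suc 0"] by simp

lemma Ck_on_dd: "Ck_on (Suc k) S f \<Longrightarrow> Ck_on k S (dd v f)"
  by (simp only: Ck_on.simps)

lemma Ck_on_SucI:
  assumes "open S" "\<And>x. x \<in> S \<Longrightarrow> (f has_derivative f' x) (at x)"
    "\<And>v. Ck_on k S (\<lambda>x. f' x v)"
  shows "Ck_on (Suc k) S f"
proof -
  have "Ck_on k S (dd v f)" for v
    by (rule Ck_on_cong_imp[OF assms(1) _ assms(3)[of v]]) (simp add: dd_eqI[OF assms(2)])
  then show ?thesis
    using assms(2) unfolding Ck_on.simps differentiable_def by blast
qed

text \<open>Used for holomorphic functions, which are controlled by Cauchy integrals over small
  circles only, and for gluing over trivialising sets.\<close>

lemma Ck_on_Un_local: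
  assumes "open S" and "\<And>x. x \<in> S \<Longrightarrow> \<exists>T. open T \<and> x \<in> T \<and> T \<subseteq> S \<and> Ck_on k T f"
  shows "Ck_on k S f"
  using assms(2)
proof (induction k arbitrary: f)
  case 0
  then show ?case
    by (metis Ck_on.simps(1) continuous_on_eq_continuous_at continuous_at_imp_continuous_on)
next
  case (Suc k)
  have "f differentiable (at x)" if "x \<in> S" for x
    using Suc.prems[OF that] by auto
  moreover have "Ck_on k S (dd v f)" for v
    using Suc.prems by (intro Suc.IH) (metis Ck_on_dd)
  ultimately show ?case by simp
qed

lemma dd_const [simp]: "dd v (\<lambda>y. c) x = 0"
  by simp

lemma Ck_on_const [simp, intro]: "Ck_on k S (\<lambda>x. c)"
proof (induction k arbitrary: c)
  case 0
  show ?case by simp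
next
  case (Suc k)
  show ?case using Suc[of 0] by (simp only: Ck_on.simps dd_const differentiable_const) simp
qed

lemma Ck_on_bounded_linear:
  assumes "open S" "bounded_linear L" "Ck_on k S f"
  shows "Ck_on k S (\<lambda>x. L (f x))"
  using assms(3)
proof (induction k arbitrary: f)
  case 0
  then show ?case
    using bounded_linear.continuous_on[OF assms(2)] by auto
next
  case (Suc k)
  show ?case
  proof (rule Ck_on_SucI[OF \<open>open S\<close>])
    show "((\<lambda>x. L (f x)) has_derivative (\<lambda>v. L (dd v f x))) (at x)" if "x \<in> S" for x
      using bounded_linear.has_derivative[OF assms(2) has_derivative_dd] Suc.prems that by auto
    show "Ck_on k S (\<lambda>x. L (dd v f x))" for v
      using Suc by auto
  qed
qed

lemma Ck_on_id:
  assumes "open S"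
  shows "Ck_on k S (\<lambda>x. x)"
proof (cases k)
  case 0
  then show ?thesis by (simp add: continuous_on_id)
next
  case (Suc n)
  have "Ck_on (Suc n) S (\<lambda>x. x)"
    by (rule Ck_on_SucI[OF assms has_derivative_ident Ck_on_const])
  then show ?thesis using Suc by simp
qed

lemma Ck_on_linear: "open S \<Longrightarrow> bounded_linear L \<Longrightarrow> Ck_on k S L"
  using Ck_on_bounded_linear[of S L k "\<lambda>x. x"] Ck_on_id[of S k] by simp

lemma Ck_on_add:
  assumes "open S" "Ck_on k S f" "Ck_on k S g"
  shows "Ck_on k S (\<lambda>x. f x + g x)"
  using assms(2,3)
proof (induction k arbitrary: f g)
  case 0
  then show ?case by (auto intro: continuous_on_add)
next
  case (Suc k)
  show ?case
  proof (rule Ck_on_SucI[OF \<open>open S\<close>])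
    show "((\<lambda>x. f x + g x) has_derivative (\<lambda>v. dd v f x + dd v g x)) (at x)" if "x \<in> S" for x
      using Suc.prems that by (auto intro!: has_derivative_add has_derivative_dd)
    show "Ck_on k S (\<lambda>x. dd v f x + dd v g x)" for v
      using Suc by auto
  qed
qed

lemma Ck_on_sum:
  assumes "open S" "\<And>i. i \<in> I \<Longrightarrow> Ck_on k S (f i)"
  shows "Ck_on k S (\<lambda>x. \<Sum>i\<in>I. f i x)"
  using assms(2) by (induction I rule: infinite_finite_induct) (auto intro: Ck_on_add[OF assms(1)])

lemma Ck_on_bilinear:
  assumes "open S" "bounded_bilinear P" "Ck_on k S f" "Ck_on k S g"
  shows "Ck_on k S (\<lambda>x. P (f x) (g x))"
  using assms(3,4)
proof (induction k arbitrary: f g)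
  case 0
  then show ?case using bounded_bilinear.continuous_on[OF assms(2)] by auto
next
  case (Suc k)
  show ?case
  proof (rule Ck_on_SucI[OF \<open>open S\<close>])
    show "((\<lambda>x. P (f x) (g x)) has_derivative (\<lambda>v. P (f x) (dd v g x) + P (dd v f x) (g x))) (at x)"
      if "x \<in> S" for x
      using Suc.prems that
      by (auto intro!: bounded_bilinear.FDERIV[OF assms(2)] has_derivative_dd)
    show "Ck_on k S (\<lambda>x. P (f x) (dd v g x) + P (dd v f x) (g x))" for v
      by (intro Ck_on_add[OF \<open>open S\<close>] Suc.IH Ck_on_Suc_D[OF Suc.prems(1)]
          Ck_on_Suc_D[OF Suc.prems(2)] Ck_on_dd[OF Suc.prems(1)] Ck_on_dd[OF Suc.prems(2)])
  qed
qed

lemmas Ck_on_mult = Ck_on_bilinear[OF _ bounded_bilinear_mult]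
lemmas Ck_on_scaleR = Ck_on_bilinear[OF _ bounded_bilinear_scaleR]
lemmas Ck_on_cnj = Ck_on_bounded_linear[OF _ bounded_linear_cnj]
lemmas Ck_on_of_real = Ck_on_bounded_linear[OF _ bounded_linear_of_real]
lemmas Ck_on_minus = Ck_on_bounded_linear[OF _ bounded_linear_minus[OF bounded_linear_ident]]

lemma Ck_on_diff: "open S \<Longrightarrow> Ck_on k S f \<Longrightarrow> Ck_on k S g \<Longrightarrow> Ck_on k S (\<lambda>x. f x - g x)"
  using Ck_on_add[of S k f "\<lambda>x. - g x"] Ck_on_minus[of S k g] by simp

lemma Ck_on_power:
  fixes f :: "'a::euclidean_space \<Rightarrow> 'b::real_normed_algebra_1"
  assumes "open S" "Ck_on k S f"
  shows "Ck_on k S (\<lambda>x. f x ^ n)"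
  by (induction n) (auto intro: Ck_on_mult assms)

text \<open>The chain rule yields \<open>dd (dd v f x) g (f x)\<close>, whose direction depends on
  \<open>x\<close>, whereas the class provides derivatives in fixed directions. Expanding the
  direction in the basis restores fixed directions and lets the induction proceed.\<close>

lemma Ck_on_compose:
  fixes f :: "'a::euclidean_space \<Rightarrow> 'b::euclidean_space" and g :: "'b \<Rightarrow> 'c::real_normed_vector"
  assumes "open S" "f ` S \<subseteq> T" "Ck_on k S f" "Ck_on k T g"
  shows "Ck_on k S (\<lambda>x. g (f x))"
  using assms(3,4)
proof (induction k arbitrary: g)
  case 0
  then show ?case using assms(2) by (auto intro: continuous_on_compose2)
next
  case (Suc k)
  show ?case
  proof (rule Ck_on_SucI[OF \<open>open S\<close>])
    show "((\<lambda>x. g (f x)) has_derivative (\<lambda>v. \<Sum>b\<in>Basis. (dd v f x \<bullet> b) *\<^sub>R dd b g (f x))) (at x)"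
      if "x \<in> S" for x
    proof -
      have f: "(f has_derivative (\<lambda>v. dd v f x)) (at x)"
        using Suc.prems that by (auto intro: has_derivative_dd)
      have g: "(g has_derivative (\<lambda>v. dd v g (f x))) (at (f x))"
        using Suc.prems that assms(2) by (intro has_derivative_dd) auto
      have "dd u g (f x) = (\<Sum>b\<in>Basis. (u \<bullet> b) *\<^sub>R dd b g (f x))" for u
        using linear_sum[OF has_derivative_linear[OF g], of "\<lambda>b. (u \<bullet> b) *\<^sub>R b" Basis]
          linear_cmul[OF has_derivative_linear[OF g]]
        by (simp add: euclidean_representation)
      then have "(\<lambda>v. \<Sum>b\<in>Basis. (dd v f x \<bullet> b) *\<^sub>R dd b g (f x)) = (\<lambda>v. dd (dd v f x) g (f x))"
        by (intro ext) (rule sym)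
      then show ?thesis
        using has_derivative_compose[OF f g] by (simp only:)
    qed
    show "Ck_on k S (\<lambda>x. \<Sum>b\<in>Basis. (dd v f x \<bullet> b) *\<^sub>R dd b g (f x))" for v
    proof (rule Ck_on_sum[OF \<open>open S\<close>], rule Ck_on_scaleR[OF \<open>open S\<close>])
      fix b :: 'b
      show "Ck_on k S (\<lambda>x. dd v f x \<bullet> b)"
        by (rule Ck_on_bounded_linear[OF \<open>open S\<close> bounded_linear_inner_left Ck_on_dd[OF Suc.prems(1)]])
      show "Ck_on k S (\<lambda>x. dd b g (f x))"
        by (rule Suc.IH[OF Ck_on_Suc_D[OF Suc.prems(1)] Ck_on_dd[OF Suc.prems(2)]])
    qed
  qed
qed

lemma Ck_on_inverse_gt0: "Ck_on k {0<..} (inverse :: real \<Rightarrow> real)"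
proof (induction k)
  case (Suc k)
  show ?case
  proof (rule Ck_on_SucI)
    show "(inverse has_derivative (\<lambda>v. v *\<^sub>R (- (inverse x * inverse x)))) (at x)" if "x \<in> {0<..}" for x :: real
      using that by (auto intro!: derivative_eq_intros)
    show "Ck_on k {0<..} (\<lambda>x::real. v *\<^sub>R (- (inverse x * inverse x)))" for v
      by (intro Ck_on_scaleR Ck_on_const Ck_on_minus Ck_on_mult Suc) auto
  qed auto
qed (auto intro!: continuous_intros)

lemma Ck_on_ln_gt0: "Ck_on k {0<..} (ln :: real \<Rightarrow> real)"
proof (cases k)
  case (Suc n)
  show ?thesis unfolding Suc
  proof (rule Ck_on_SucI)
    show "(ln has_derivative (\<lambda>v. v * inverse x)) (at x)" if "x \<in> {0<..}" for x :: real
      using that by (auto intro!: derivative_eq_intros)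
    show "Ck_on n {0<..} (\<lambda>x::real. v * inverse x)" for v
      by (intro Ck_on_mult Ck_on_const Ck_on_inverse_gt0) auto
  qed auto
qed (auto intro!: continuous_intros)

lemma Ck_on_exp: "Ck_on k UNIV (exp :: real \<Rightarrow> real)"
proof (induction k)
  case (Suc k)
  show ?case
  proof (rule Ck_on_SucI)
    show "(exp has_derivative (\<lambda>v. v * exp x)) (at x)" for x :: real
      by (auto intro!: derivative_eq_intros)
    show "Ck_on k UNIV (\<lambda>x::real. v * exp x)" for v
      by (intro Ck_on_mult Ck_on_const Suc) auto
  qed auto
qed (auto intro!: continuous_intros)

text \<open>The mean value theorem is applied first in the direction \<open>u\<close>, to the
  increment along \<open>v\<close>, and then in the direction \<open>v\<close>. The order of these
  two applications fixes the order of the derivatives, so exchanging \<open>u\<close> and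
  \<open>v\<close> yields the other mixed derivative.\<close>

lemma second_difference_mvt:
  fixes f :: "'a::euclidean_space \<Rightarrow> real"
  assumes S: "ball x r \<subseteq> S" "Ck_on 2 S f" and s: "0 < s" "s * (norm u + norm v) < r"
  shows "\<exists>y. norm (y - x) \<le> s * (norm u + norm v) \<and>
    f (x + s *\<^sub>R u + s *\<^sub>R v) - f (x + s *\<^sub>R u) - f (x + s *\<^sub>R v) + f x = s\<^sup>2 * dd v (dd u f) y"
proof -
  have norm_le: "norm (a *\<^sub>R u + b *\<^sub>R v) \<le> s * (norm u + norm v)"
    if "0 \<le> a" "a \<le> s" "0 \<le> b" "b \<le> s" for a b
  proof -
    have "norm (a *\<^sub>R u + b *\<^sub>R v) \<le> a * norm u + b * norm v"
      using that norm_triangle_ineq[of "a *\<^sub>R u" "b *\<^sub>R v"] by simp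
    also have "\<dots> \<le> s * norm u + s * norm v"
      using that by (intro add_mono mult_right_mono) auto
    finally show ?thesis by (simp add: algebra_simps)
  qed
  have in_S: "x + (a *\<^sub>R u + b *\<^sub>R v) \<in> S" if "0 \<le> a" "a \<le> s" "0 \<le> b" "b \<le> s" for a b
  proof (rule subsetD[OF S(1)])
    show "x + (a *\<^sub>R u + b *\<^sub>R v) \<in> ball x r"
      using norm_le[OF that] s norm_minus_cancel[of "a *\<^sub>R u + b *\<^sub>R v"] by (simp add: dist_norm)
  qed
  have f2: "Ck_on (Suc (Suc 0)) S f" using S(2) by (simp add: numeral_2_eq_2)
  have df: "f differentiable (at y)" if "y \<in> S" for y
    using Ck_on_differentiable[OF S(2)] that by simp
  have ddf: "dd u f differentiable (at y)" if "y \<in> S" for y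
    using Ck_on_differentiable[OF Ck_on_dd[OF f2]] that by simp
  have affine: "((\<lambda>a. c + a *\<^sub>R w) has_derivative (\<lambda>h. h *\<^sub>R w)) (at a within T)"
    for c w :: 'a and a T
    by (auto intro!: derivative_eq_intros)
  have d1: "((\<lambda>a. g (c + a *\<^sub>R w)) has_real_derivative dd w g (c + a *\<^sub>R w)) (at a)"
    if g: "g differentiable (at (c + a *\<^sub>R w))" for g :: "'a \<Rightarrow> real" and c w a
  proof -
    note h = has_derivative_compose[OF affine[of c w a UNIV] has_derivative_dd[OF g]]
    have "dd (h *\<^sub>R w) g (c + a *\<^sub>R w) = h * dd w g (c + a *\<^sub>R w)" for h
      using linear_cmul[OF has_derivative_linear[OF has_derivative_dd[OF g]], of h w] by simp
    then have "(\<lambda>h. dd (h *\<^sub>R w) g (c + a *\<^sub>R w)) = (*) (dd w g (c + a *\<^sub>R w))"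
      by (simp add: fun_eq_iff mult.commute)
    then show ?thesis using h by (simp only: has_field_derivative_def)
  qed
  let ?D = "\<lambda>a. f ((x + s *\<^sub>R v) + a *\<^sub>R u) - f (x + a *\<^sub>R u)"
  have "\<exists>a. 0 < a \<and> a < s \<and> ?D s - ?D 0 = (s - 0) * (dd u f ((x + s *\<^sub>R v) + a *\<^sub>R u) - dd u f (x + a *\<^sub>R u))"
  proof (rule MVT2)
    show "0 < s" by fact
    fix a assume a: "0 \<le> a" "a \<le> s"
    have "x + a *\<^sub>R u \<in> S" "(x + s *\<^sub>R v) + a *\<^sub>R u \<in> S"
      using in_S[of a 0] in_S[of a s] a s by (auto simp: algebra_simps)
    then show "(?D has_real_derivative dd u f ((x + s *\<^sub>R v) + a *\<^sub>R u) - dd u f (x + a *\<^sub>R u)) (at a)"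
      by (intro DERIV_diff d1 df)
  qed
  then obtain a where a: "0 < a" "a < s"
    and Da: "?D s - ?D 0 = s * (dd u f ((x + s *\<^sub>R v) + a *\<^sub>R u) - dd u f (x + a *\<^sub>R u))"
    by auto
  let ?G = "\<lambda>b. dd u f ((x + a *\<^sub>R u) + b *\<^sub>R v)"
  have "\<exists>b. 0 < b \<and> b < s \<and> ?G s - ?G 0 = (s - 0) * dd v (dd u f) ((x + a *\<^sub>R u) + b *\<^sub>R v)"
  proof (rule MVT2)
    show "0 < s" by fact
    fix b assume b: "0 \<le> b" "b \<le> s"
    have "(x + a *\<^sub>R u) + b *\<^sub>R v \<in> S"
      using in_S[of a b] a b by (auto simp: algebra_simps)
    then show "(?G has_real_derivative dd v (dd u f) ((x + a *\<^sub>R u) + b *\<^sub>R v)) (at b)"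
      by (intro d1 ddf)
  qed
  then obtain b where b: "0 < b" "b < s" and Gb: "?G s - ?G 0 = s * dd v (dd u f) ((x + a *\<^sub>R u) + b *\<^sub>R v)"
    by auto
  show ?thesis
  proof (intro exI conjI)
    show "norm ((x + a *\<^sub>R u) + b *\<^sub>R v - x) \<le> s * (norm u + norm v)"
      using norm_le[of a b] a b by (simp add: algebra_simps)
    have "f (x + s *\<^sub>R u + s *\<^sub>R v) - f (x + s *\<^sub>R u) - f (x + s *\<^sub>R v) + f x = ?D s - ?D 0"
      by (simp add: algebra_simps)
    also have "\<dots> = s * (?G s - ?G 0)" unfolding Da by (simp add: algebra_simps)
    finally show "f (x + s *\<^sub>R u + s *\<^sub>R v) - f (x + s *\<^sub>R u) - f (x + s *\<^sub>R v) + f x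
       = s\<^sup>2 * dd v (dd u f) ((x + a *\<^sub>R u) + b *\<^sub>R v)"
      unfolding Gb by (simp add: power2_eq_square)
  qed
qed

text \<open>The second difference does not change when \<open>u\<close> and \<open>v\<close> are
  exchanged, so the two mixed derivatives take a common value at points arbitrarily close to
  \<open>x\<close>; by continuity they agree at \<open>x\<close>.\<close>

lemma dd_commute_real:
  fixes f :: "'a::euclidean_space \<Rightarrow> real"
  assumes "open S" "Ck_on 2 S f" "x \<in> S"
  shows "dd u (dd v f) x = dd v (dd u f) x"
proof (rule ccontr)
  assume neq: "dd u (dd v f) x \<noteq> dd v (dd u f) x"
  define e where "e = \<bar>dd u (dd v f) x - dd v (dd u f) x\<bar> / 2"
  have "e > 0" using neq by (simp add: e_def)
  obtain r where r: "r > 0" "ball x r \<subseteq> S"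
    using assms by (meson open_contains_ball)
  have "Ck_on (Suc (Suc 0)) S f" using assms(2) by (simp add: numeral_2_eq_2)
  then have "continuous (at x) (dd u (dd v f))" "continuous (at x) (dd v (dd u f))"
    using assms(1,3) by (auto simp: continuous_on_eq_continuous_at)
  then have ev: "eventually (\<lambda>y. dist (dd u (dd v f) y) (dd u (dd v f) x) < e) (nhds x)"
    "eventually (\<lambda>y. dist (dd v (dd u f) y) (dd v (dd u f) x) < e) (nhds x)"
    using \<open>e > 0\<close> tendsto_at_iff_tendsto_nhds[of "dd u (dd v f)" x]
      tendsto_at_iff_tendsto_nhds[of "dd v (dd u f)" x]
    by (auto simp: continuous_at dest: tendstoD)
  obtain d1 where d1: "d1 > 0" "\<And>y. dist y x < d1 \<Longrightarrow> dist (dd u (dd v f) y) (dd u (dd v f) x) < e"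
    using ev(1) unfolding eventually_nhds_metric by blast
  obtain d2 where d2: "d2 > 0" "\<And>y. dist y x < d2 \<Longrightarrow> dist (dd v (dd u f) y) (dd v (dd u f) x) < e"
    using ev(2) unfolding eventually_nhds_metric by blast
  note d = d1(1) d2(1) d1(2) d2(2)
  define d where "d = min r (min d1 d2)"
  \<comment> \<open>The summand 1 keeps \<open>s\<close> positive when both directions are
    zero.\<close>
  define q where "q = norm u + norm v + 1"
  define s where "s = d / (2 * q)"
  have dpos: "d > 0" using d r by (simp add: d_def)
  have pos: "q > 0" using norm_ge_zero[of u] norm_ge_zero[of v] unfolding q_def by linarith
  have s: "s > 0" using pos dpos by (simp add: s_def)
  have "s * (norm u + norm v) \<le> s * q" using s by (simp add: q_def)
  also have "\<dots> = d / 2" using pos by (simp add: s_def)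
  finally have sd: "s * (norm u + norm v) < d" using dpos by linarith
  obtain y where y: "norm (y - x) \<le> s * (norm u + norm v)"
    "f (x + s *\<^sub>R u + s *\<^sub>R v) - f (x + s *\<^sub>R u) - f (x + s *\<^sub>R v) + f x = s\<^sup>2 * dd v (dd u f) y"
    using second_difference_mvt[OF r(2) assms(2) s, of u v] sd by (auto simp: d_def)
  obtain z where z: "norm (z - x) \<le> s * (norm v + norm u)"
    "f (x + s *\<^sub>R v + s *\<^sub>R u) - f (x + s *\<^sub>R v) - f (x + s *\<^sub>R u) + f x = s\<^sup>2 * dd u (dd v f) z"
    using second_difference_mvt[OF r(2) assms(2) s, of v u] sd by (auto simp: d_def add.commute)
  have "s\<^sup>2 * dd v (dd u f) y = s\<^sup>2 * dd u (dd v f) z"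
    using y(2) z(2) by (simp add: algebra_simps)
  then have "dd v (dd u f) y = dd u (dd v f) z" using s by simp
  moreover have "dist (dd u (dd v f) z) (dd u (dd v f) x) < e" "dist (dd v (dd u f) y) (dd v (dd u f) x) < e"
    using d y(1) z(1) sd by (auto simp: dist_norm d_def add.commute)
  ultimately show False unfolding e_def dist_real_def by (smt (verit) field_sum_of_halves)
qed

lemma dd_bounded_linear:
  "bounded_linear L \<Longrightarrow> f differentiable (at x) \<Longrightarrow> dd v (\<lambda>y. L (f y)) x = L (dd v f x)"
  by (rule dd_eqI[OF bounded_linear.has_derivative[OF _ has_derivative_dd]])

lemma dd_cong:
  assumes "open S" "x \<in> S" "\<And>y. y \<in> S \<Longrightarrow> f y = g y"
  shows "dd v f x = dd v g x"
proof -
  have "(f has_derivative F) (at x) \<longleftrightarrow> (g has_derivative F) (at x)" for F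
    using has_derivative_transform_within_open[where s=S and t=UNIV, OF _ assms(1,2), of f F g]
      has_derivative_transform_within_open[where s=S and t=UNIV, OF _ assms(1,2), of g F f] assms(3) by auto
  then show ?thesis by (simp add: frechet_derivative_def)
qed

lemma dd_commute:
  fixes f :: "'a::euclidean_space \<Rightarrow> 'b::euclidean_space"
  assumes "open S" "Ck_on 2 S f" "x \<in> S"
  shows "dd u (dd v f) x = dd v (dd u f) x"
proof (rule euclidean_eqI)
  fix b :: 'b assume "b \<in> Basis"
  let ?L = "\<lambda>y. y \<bullet> b"
  have L: "bounded_linear ?L" by (rule bounded_linear_inner_left)
  have f2: "Ck_on (Suc (Suc 0)) S f" using assms(2) by (simp add: numeral_2_eq_2)
  have eq: "dd u (dd v (\<lambda>y. ?L (f y))) x = ?L (dd u (dd v f) x)" for u v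
  proof -
    have "dd u (dd v (\<lambda>y. ?L (f y))) x = dd u (\<lambda>y. ?L (dd v f y)) x"
      using f2 by (intro dd_cong[OF assms(1,3)] dd_bounded_linear[OF L]) auto
    also have "\<dots> = ?L (dd u (dd v f) x)"
      using f2 assms(3) by (intro dd_bounded_linear[OF L]) auto
    finally show ?thesis .
  qed
  show "?L (dd u (dd v f) x) = ?L (dd v (dd u f) x)"
    using dd_commute_real[OF assms(1) Ck_on_bounded_linear[OF assms(1) L assms(2)] assms(3), of u v]
    by (simp add: eq)
qed

section \<open>Wirtinger derivatives\<close>

lemma dd_add: "f differentiable (at x) \<Longrightarrow> g differentiable (at x) \<Longrightarrow>
    dd v (\<lambda>y. f y + g y) x = dd v f x + dd v g x"
  by (rule dd_eqI[OF has_derivative_add[OF has_derivative_dd has_derivative_dd]])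

lemma dd_mult:
  fixes f g :: "'a::real_normed_vector \<Rightarrow> 'b::real_normed_algebra"
  shows "f differentiable (at x) \<Longrightarrow> g differentiable (at x) \<Longrightarrow>
    dd v (\<lambda>y. f y * g y) x = f x * dd v g x + dd v f x * g x"
  by (rule dd_eqI[OF has_derivative_mult[OF has_derivative_dd has_derivative_dd]])

lemma d_z_cong:
  assumes "open S" "x \<in> S" "\<And>y. y \<in> S \<Longrightarrow> f y = g y"
  shows "d_z j f x = d_z j g x" "d_zbar j f x = d_zbar j g x"
  using dd_cong[OF assms] by (simp_all add: d_z_def d_zbar_def)

lemma d_z_add:
  assumes "f differentiable (at x)" "g differentiable (at x)"
  shows "d_z j (\<lambda>y. f y + g y) x = d_z j f x + d_z j g x"
    "d_zbar j (\<lambda>y. f y + g y) x = d_zbar j f x + d_zbar j g x"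
  by (simp_all add: d_z_def d_zbar_def dd_add[OF assms] field_simps)

lemma d_z_mult:
  assumes "f differentiable (at x)" "g differentiable (at x)"
  shows "d_z j (\<lambda>y. f y * g y) x = f x * d_z j g x + d_z j f x * g x"
    "d_zbar j (\<lambda>y. f y * g y) x = f x * d_zbar j g x + d_zbar j f x * g x"
  by (simp_all add: d_z_def d_zbar_def dd_mult[OF assms] field_simps)

lemma d_z_const [simp]: "d_z j (\<lambda>y. c) x = 0" "d_zbar j (\<lambda>y. c) x = 0"
  by (simp_all add: d_z_def d_zbar_def)

lemma d_z_cmult:
  assumes "f differentiable (at x)"
  shows "d_z j (\<lambda>y. c * f y) x = c * d_z j f x" "d_zbar j (\<lambda>y. c * f y) x = c * d_zbar j f x"
  using d_z_mult[OF _ assms, of "\<lambda>y. c"] by simp_all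

lemma d_z_minus:
  assumes "f differentiable (at x)"
  shows "d_z j (\<lambda>y. - f y) x = - d_z j f x" "d_zbar j (\<lambda>y. - f y) x = - d_zbar j f x"
  using d_z_cmult[OF assms, of _ "-1"] by simp_all

lemma d_z_diff:
  assumes "f differentiable (at x)" "g differentiable (at x)"
  shows "d_z j (\<lambda>y. f y - g y) x = d_z j f x - d_z j g x"
    "d_zbar j (\<lambda>y. f y - g y) x = d_zbar j f x - d_zbar j g x"
  using d_z_add[OF assms(1), of "\<lambda>y. - g y" j] d_z_minus[OF assms(2), of j] assms(2)
  by (simp_all add: differentiable_minus)

lemma d_z_sum:
  assumes "finite I" "\<And>i. i \<in> I \<Longrightarrow> f i differentiable (at x)"
  shows "d_z j (\<lambda>y. \<Sum>i\<in>I. f i y) x = (\<Sum>i\<in>I. d_z j (f i) x)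
       \<and> d_zbar j (\<lambda>y. \<Sum>i\<in>I. f i y) x = (\<Sum>i\<in>I. d_zbar j (f i) x)"
  using assms by (induction I rule: finite_induct) (simp_all add: d_z_add differentiable_sum)

lemma d_z_cnj:
  assumes "f differentiable (at x)"
  shows "d_z j (\<lambda>y. cnj (f y)) x = cnj (d_zbar j f x)" "d_zbar j (\<lambda>y. cnj (f y)) x = cnj (d_z j f x)"
  by (simp_all add: d_z_def d_zbar_def dd_bounded_linear[OF bounded_linear_cnj assms])

lemma cnj_differentiable [simp]: "f differentiable F \<Longrightarrow> (\<lambda>y. cnj (f y)) differentiable F"
  unfolding differentiable_def using has_derivative_cnj by blast

lemma Ck_on_d_z:
  assumes "open S" "Ck_on (Suc k) S f"
  shows "Ck_on k S (d_z j f)" "Ck_on k S (d_zbar j f)"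
proof -
  have h: "Ck_on k S (\<lambda>x. c * dd v f x)" for c v
    using assms by (intro Ck_on_mult Ck_on_const) auto
  have "Ck_on k S (\<lambda>x. (1/2) * dd (axis j 1) f x + c * dd (axis j \<i>) f x)" for c
    by (intro Ck_on_add h assms(1))
  from this[of "-\<i>/2"] this[of "\<i>/2"] show "Ck_on k S (d_z j f)" "Ck_on k S (d_zbar j f)"
    by (simp_all add: d_z_def[abs_def] d_zbar_def[abs_def] diff_divide_distrib add_divide_distrib)
qed

lemma dd_complex_linear_combination:
  fixes f g :: "'a::real_normed_vector \<Rightarrow> complex"
  assumes "f differentiable (at x)" "g differentiable (at x)"
  shows "dd v (\<lambda>x. (f x + c * g x) / 2) x = (dd v f x + c * dd v g x) / 2"
proof -
  have "((\<lambda>x. (f x + c * g x) / 2) has_derivative (\<lambda>v. (dd v f x + c * dd v g x) / 2)) (at x)"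
    using assms[THEN has_derivative_dd]
    by (auto intro!: derivative_eq_intros simp: add_divide_distrib)
  then show ?thesis by (rule dd_eqI)
qed

lemma d_z_commute:
  assumes "open S" "Ck_on 2 S f" "x \<in> S"
  shows "d_z i (d_zbar j f) x = d_zbar j (d_z i f) x"
    "d_z i (d_z j f) x = d_z j (d_z i f) x"
    "d_zbar i (d_zbar j f) x = d_zbar j (d_zbar i f) x"
proof -
  have f2: "Ck_on (Suc (Suc 0)) S f" using assms(2) by (simp add: numeral_2_eq_2)
  then have d: "dd v f differentiable (at x)" for v using assms(3) by auto
  note c = dd_complex_linear_combination[OF d d]
  have *: "(\<lambda>x. (dd a f x - \<i> * dd b f x) / 2) = (\<lambda>x. (dd a f x + (-\<i>) * dd b f x) / 2)" for a b
    by simp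
  note com = dd_commute[OF assms]
  show "d_z i (d_zbar j f) x = d_zbar j (d_z i f) x"
    unfolding d_z_def[abs_def] d_zbar_def[abs_def] * c
    by (simp add: com[of "axis j 1" "axis i 1"] com[of "axis j \<i>" "axis i 1"]
        com[of "axis j 1" "axis i \<i>"] com[of "axis j \<i>" "axis i \<i>"] field_simps)
  show "d_z i (d_z j f) x = d_z j (d_z i f) x"
    unfolding d_z_def[abs_def] d_zbar_def[abs_def] * c
    by (simp add: com[of "axis j 1" "axis i 1"] com[of "axis j \<i>" "axis i 1"]
        com[of "axis j 1" "axis i \<i>"] com[of "axis j \<i>" "axis i \<i>"] field_simps)
  show "d_zbar i (d_zbar j f) x = d_zbar j (d_zbar i f) x"
    unfolding d_z_def[abs_def] d_zbar_def[abs_def] * c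
    by (simp add: com[of "axis j 1" "axis i 1"] com[of "axis j \<i>" "axis i 1"]
        com[of "axis j 1" "axis i \<i>"] com[of "axis j \<i>" "axis i \<i>"] field_simps)
qed

lemma vec_nth_differentiable [simp]: "(\<lambda>w. w $ k) differentiable F"
  using bounded_linear_imp_differentiable[OF bounded_linear_vec_nth] .

lemma d_z_vec_nth [simp]:
  "d_z j (\<lambda>w. w $ k) x = of_bool (j = k)" "d_zbar j (\<lambda>w. w $ k) x = 0"
proof -
  have "dd v (\<lambda>w. w $ k) x = v $ k" for v :: "complex^'a"
    by (rule dd_eqI[OF bounded_linear_imp_has_derivative[OF bounded_linear_vec_nth]])
  then show "d_z j (\<lambda>w. w $ k) x = of_bool (j = k)" "d_zbar j (\<lambda>w. w $ k) x = 0"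
    by (auto simp: d_z_def d_zbar_def axis_def)
qed

lemma d_z_cnj_vec_nth [simp]:
  "d_z j (\<lambda>w. cnj (w $ k)) x = 0" "d_zbar j (\<lambda>w. cnj (w $ k)) x = of_bool (j = k)"
  by (simp_all add: d_z_cnj)

lemma axis_decomposition:
  fixes a :: "complex^'n"
  shows "a = (\<Sum>j\<in>UNIV. Re (a $ j) *\<^sub>R axis j 1 + Im (a $ j) *\<^sub>R axis j \<i>)"
proof (rule vec_eq_iff[THEN iffD2], rule allI)
  fix k
  have "(\<Sum>j\<in>UNIV. Re (a $ j) *\<^sub>R axis j 1 + Im (a $ j) *\<^sub>R axis j \<i>) $ k
    = (\<Sum>j\<in>UNIV. if j = k then Re (a $ k) *\<^sub>R 1 + Im (a $ k) *\<^sub>R \<i> else 0)"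
    unfolding sum_component by (intro sum.cong refl) (auto simp: axis_def)
  also have "\<dots> = a $ k" by (simp add: complex_eq_iff)
  finally show "a $ k = (\<Sum>j\<in>UNIV. Re (a $ j) *\<^sub>R axis j 1 + Im (a $ j) *\<^sub>R axis j \<i>) $ k" ..
qed

text \<open>The real differential as the sum of its complex linear and its antilinear part.\<close>

lemma dd_eq_d_z:
  fixes f :: "complex^'n \<Rightarrow> complex"
  assumes "f differentiable (at x)"
  shows "dd a f x = (\<Sum>j\<in>UNIV. a $ j * d_z j f x + cnj (a $ j) * d_zbar j f x)"
proof -
  note lin = has_derivative_linear[OF has_derivative_dd[OF assms]]
  have "dd a f x = (\<Sum>j\<in>UNIV. Re (a $ j) *\<^sub>R dd (axis j 1) f x + Im (a $ j) *\<^sub>R dd (axis j \<i>) f x)"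
    by (subst axis_decomposition[of a])
      (simp add: linear_sum[OF lin] linear_add[OF lin] linear_cmul[OF lin])
  also have "\<dots> = (\<Sum>j\<in>UNIV. a $ j * d_z j f x + cnj (a $ j) * d_zbar j f x)"
    by (intro sum.cong refl)
      (simp add: d_z_def d_zbar_def scaleR_conv_of_real complex_eq_iff field_simps)
  finally show ?thesis .
qed

lemma d_z_of_real_compose:
  fixes u :: "complex^'n \<Rightarrow> real"
  assumes "u differentiable (at x)" "(g has_real_derivative g') (at (u x))"
  shows "d_z j (\<lambda>y. complex_of_real (g (u y))) x = of_real g' * d_z j (\<lambda>y. of_real (u y)) x"
    "d_zbar j (\<lambda>y. complex_of_real (g (u y))) x = of_real g' * d_zbar j (\<lambda>y. of_real (u y)) x"
proof -
  have "((\<lambda>y. complex_of_real (g (u y))) has_derivative (\<lambda>v. of_real (g' * dd v u x))) (at x)"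
    using has_derivative_of_real[OF has_derivative_compose[OF has_derivative_dd[OF assms(1)]
          assms(2)[unfolded has_field_derivative_def]]] .
  note 1 = dd_eqI[OF this, unfolded of_real_mult]
  have 2: "dd v (\<lambda>y. complex_of_real (u y)) x = of_real (dd v u x)" for v
    by (rule dd_eqI[OF has_derivative_of_real[OF has_derivative_dd[OF assms(1)]]])
  show "d_z j (\<lambda>y. complex_of_real (g (u y))) x = of_real g' * d_z j (\<lambda>y. of_real (u y)) x"
    "d_zbar j (\<lambda>y. complex_of_real (g (u y))) x = of_real g' * d_zbar j (\<lambda>y. of_real (u y)) x"
    by (simp_all add: d_z_def d_zbar_def 1 2 field_simps)
qed

lemma of_real_differentiable [simp]:
  "u differentiable F \<Longrightarrow> (\<lambda>y. complex_of_real (u y)) differentiable F"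
  unfolding differentiable_def using has_derivative_of_real by blast

lemma cnj_d_z_of_real:
  assumes "u differentiable (at x)"
  shows "cnj (d_z j (\<lambda>y. complex_of_real (u y)) x) = d_zbar j (\<lambda>y. of_real (u y)) x"
    "cnj (d_zbar j (\<lambda>y. complex_of_real (u y)) x) = d_z j (\<lambda>y. of_real (u y)) x"
  using d_z_cnj[of "\<lambda>y. complex_of_real (u y)" x j] assms by simp_all

text \<open>Conjugation exchanges \<open>d_z\<close> and \<open>d_zbar\<close> on a real function;
  commuting the two derivatives then transposes the matrix.\<close>

lemma complex_hessian_hermitian:
  assumes "open S" "Ck_on 2 S u" "x \<in> S"
  shows "complex_hessian u x $ k $ j = cnj (complex_hessian u x $ j $ k)"
proof -
  let ?f = "\<lambda>y. complex_of_real (u y)"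
  have f2: "Ck_on (Suc (Suc 0)) S ?f" "Ck_on (Suc (Suc 0)) S u"
    using assms Ck_on_of_real[OF assms(1,2)] by (simp_all add: numeral_2_eq_2 del: Ck_on.simps)
  have d: "d_zbar k ?f differentiable (at y)" "d_z k ?f differentiable (at y)" "u differentiable (at y)"
    if "y \<in> S" for k y
    using Ck_on_d_z[OF assms(1) f2(1)] Ck_on_differentiable[OF _ _ that] f2 that by auto
  have "cnj (d_z j (d_zbar k ?f) x) = d_zbar j (\<lambda>y. cnj (d_zbar k ?f y)) x"
    using d[OF assms(3)] by (simp add: d_z_cnj)
  also have "\<dots> = d_zbar j (d_z k ?f) x"
    using d by (intro d_z_cong[OF assms(1,3)]) (simp add: cnj_d_z_of_real)
  also have "\<dots> = d_z k (d_zbar j ?f) x"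
    using d_z_commute(1)[OF assms(1) Ck_on_of_real[OF assms(1,2)] assms(3)] by simp
  finally show ?thesis by (simp add: complex_hessian_def)
qed

section \<open>Integrals depending on a parameter\<close>

text \<open>The cutoff \<open>c\<close> vanishes off \<open>K\<close>, so \<open>G\<close> may be
  arbitrary outside \<open>S\<close>: two relatively open sets cover the domain, one where
  \<open>G\<close> is evaluated inside \<open>S\<close> and one where the product is 0. In the
  application to fibre integrals \<open>c\<close> is \<open>bump\<close> and \<open>S\<close> omits
  the zero section.\<close>

lemma continuous_on_param_support:
  fixes G :: "'c::euclidean_space \<Rightarrow> complex" and L :: "'a::euclidean_space \<Rightarrow> 'c"
    and m :: "'b::euclidean_space \<Rightarrow> 'c"
  assumes "open S" "continuous_on S G" "bounded_linear L"
    and "continuous_on (cbox a b) c" "continuous_on (cbox a b) m" "closed K"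
    and "\<And>t. t \<in> cbox a b \<Longrightarrow> t \<notin> K \<Longrightarrow> c t = 0"
    and "\<And>x t. x \<in> D \<Longrightarrow> t \<in> cbox a b \<Longrightarrow> t \<in> K \<Longrightarrow> L x + m t \<in> S"
  shows "continuous_on (D \<times> cbox a b) (\<lambda>(x, t). c t * G (L x + m t))"
proof -
  let ?X = "D \<times> cbox a b" and ?p = "\<lambda>(x, t). L x + m t"
  have p: "continuous_on ?X ?p"
    unfolding split_beta
    by (intro continuous_intros bounded_linear.continuous_on[OF assms(3)]
        continuous_on_compose2[OF assms(5)]) auto
  define A where "A = ?X \<inter> ?p -` S"
  define B where "B = ?X \<inter> snd -` (- K)"
  have AB: "A \<union> B = ?X" using assms(8) by (auto simp: A_def B_def)
  have "openin (top_of_set ?X) A"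
    unfolding A_def using p assms(1) continuous_openin_preimage_gen by blast
  moreover have "openin (top_of_set ?X) B"
    unfolding B_def using assms(6) continuous_openin_preimage_gen[OF continuous_on_snd[OF continuous_on_id]]
    by (metis open_Compl)
  moreover have "continuous_on A (\<lambda>(x, t). c t * G (L x + m t))"
  proof -
    have "continuous_on A (\<lambda>y. G (?p y))"
      by (rule continuous_on_compose2[OF assms(2) continuous_on_subset[OF p]]) (auto simp: A_def)
    moreover have "continuous_on A (\<lambda>y. c (snd y))"
      by (rule continuous_on_compose2[OF assms(4)]) (auto simp: A_def intro!: continuous_intros)
    ultimately show ?thesis unfolding split_beta by (intro continuous_on_mult)
  qed
  moreover have "continuous_on B (\<lambda>(x, t). c t * G (L x + m t))"
    by (rule continuous_on_eq[OF continuous_on_const[of _ 0]]) (auto simp: B_def assms(7))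
  ultimately have "continuous_on (A \<union> B) (\<lambda>(x, t). c t * G (L x + m t))"
    using AB by (intro continuous_on_Un_local_open) auto
  then show ?thesis by (simp add: AB)
qed

lemma has_derivative_integral_param_support:
  fixes G :: "'c::euclidean_space \<Rightarrow> complex" and L :: "'a::euclidean_space \<Rightarrow> 'c"
    and m :: "'b::euclidean_space \<Rightarrow> 'c"
  assumes "open S" "Ck_on 1 S G" "bounded_linear L"
    and "continuous_on (cbox a b) c" "continuous_on (cbox a b) m" "closed K"
    and "\<And>t. t \<in> cbox a b \<Longrightarrow> t \<notin> K \<Longrightarrow> c t = 0"
    and "\<And>x t. x \<in> D \<Longrightarrow> t \<in> cbox a b \<Longrightarrow> t \<in> K \<Longrightarrow> L x + m t \<in> S"
    and "open D" "x0 \<in> D"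
  shows "((\<lambda>x. integral (cbox a b) (\<lambda>t. c t * G (L x + m t))) has_derivative
     (\<lambda>v. integral (cbox a b) (\<lambda>t. c t * dd (L v) G (L x0 + m t)))) (at x0)"
proof -
  obtain r where r: "r > 0" "ball x0 r \<subseteq> D"
    using assms(9,10) by (meson open_contains_ball)
  define U where "U = ball x0 r"
  have UD: "x \<in> D" if "x \<in> U" for x using that r by (auto simp: U_def)
  have G1: "Ck_on (Suc 0) S G" using assms(2) by simp
  have cont: "continuous_on (U \<times> cbox a b) (\<lambda>(x, t). c t * g (L x + m t))" if "continuous_on S g" for g
    by (rule continuous_on_param_support[OF assms(1) that assms(3-7)]) (use assms(8) UD in auto)
  have der: "((\<lambda>x. c t * G (L x + m t)) has_derivative (\<lambda>v. c t * dd (L v) G (L x + m t))) (at x)"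
    if "x \<in> U" "t \<in> cbox a b" for x t
  proof (cases "t \<in> K")
    case True
    then have "G differentiable (at (L x + m t))"
      using Ck_on_differentiable[OF assms(2)] assms(8)[OF UD[OF that(1)] that(2)] by simp
    moreover have "((\<lambda>x. L x + m t) has_derivative L) (at x)"
      using has_derivative_add_const[OF bounded_linear_imp_has_derivative[OF assms(3)]] .
    ultimately have "((\<lambda>x. G (L x + m t)) has_derivative (\<lambda>v. dd (L v) G (L x + m t))) (at x)"
      using has_derivative_compose[OF _ has_derivative_dd] by blast
    then show ?thesis by (rule has_derivative_mult_right)
  next
    case False
    then show ?thesis using assms(7) that by simp
  qed
  \<comment> \<open>The Leibniz rule asks for continuity of the derivative as a bounded linear map,
    which in finite dimension is continuity in each direction.\<close>
  define fx where "fx x t = Blinfun (\<lambda>v. c t * dd (L v) G (L x + m t))" for x t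
  have fx: "blinfun_apply (fx x t) = (\<lambda>v. c t * dd (L v) G (L x + m t))"
    if "x \<in> U" "t \<in> cbox a b" for x t
    unfolding fx_def using der[OF that] by (intro bounded_linear_Blinfun_apply has_derivative_bounded_linear)
  have contfx: "continuous_on (U \<times> cbox a b) (\<lambda>(x, t). fx x t)"
  proof (rule continuous_on_blinfun_componentwise)
    fix v :: 'a
    have "continuous_on (U \<times> cbox a b) (\<lambda>(x, t). c t * dd (L v) G (L x + m t))"
      using cont[OF Ck_on_continuous_on[OF Ck_on_dd[OF G1]]] .
    then show "continuous_on (U \<times> cbox a b) (\<lambda>y. blinfun_apply (case y of (x, t) \<Rightarrow> fx x t) v)"
      by (rule continuous_on_eq) (auto simp: fx)
  qed
  have x0: "x0 \<in> U" using r by (simp add: U_def)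
  have int: "(\<lambda>t. c t * G (L x + m t)) integrable_on cbox a b" if "x \<in> U" for x
    by (rule integrable_continuous, rule continuous_on_compose2[OF cont[OF Ck_on_continuous_on[OF assms(2)]],
        where f="\<lambda>t. (x, t)", simplified]) (use that in \<open>auto intro!: continuous_intros\<close>)
  have deriv: "((\<lambda>x. integral (cbox a b) (\<lambda>t. c t * G (L x + m t))) has_derivative
      blinfun_apply (integral (cbox a b) (fx x0))) (at x0 within U)"
    by (rule leibniz_rule[OF _ int contfx x0])
      (use der fx in \<open>auto simp: U_def intro: has_derivative_at_withinI\<close>)
  have "fx x0 integrable_on cbox a b"
    by (rule integrable_continuous, rule continuous_on_compose2[OF contfx, where f="\<lambda>t. (x0, t)", simplified])
       (use x0 in \<open>auto intro!: continuous_intros\<close>)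
  then have "blinfun_apply (integral (cbox a b) (fx x0)) v =
      integral (cbox a b) (\<lambda>t. c t * dd (L v) G (L x0 + m t))" for v
    using fx[OF x0] by (simp add: blinfun_apply_integral cong: integral_cong)
  then have eq: "blinfun_apply (integral (cbox a b) (fx x0)) =
      (\<lambda>v. integral (cbox a b) (\<lambda>t. c t * dd (L v) G (L x0 + m t)))"
    by (rule ext)
  have "at x0 within U = at x0"
    using at_within_open[of x0 U] x0 by (simp add: U_def)
  then show ?thesis using deriv by (simp only: eq)
qed

text \<open>The derivative of such an integral is an integral of the same shape with
  \<open>G\<close> replaced by \<open>dd (L v) G\<close>, so the induction closes.\<close>

lemma Ck_on_integral_param_support:
  fixes G :: "'c::euclidean_space \<Rightarrow> complex" and L :: "'a::euclidean_space \<Rightarrow> 'c"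
    and m :: "'b::euclidean_space \<Rightarrow> 'c"
  assumes "open S" "Ck_on k S G" "bounded_linear L"
    and "continuous_on (cbox a b) c" "continuous_on (cbox a b) m" "closed K"
    and "\<And>t. t \<in> cbox a b \<Longrightarrow> t \<notin> K \<Longrightarrow> c t = 0"
    and "\<And>x t. x \<in> D \<Longrightarrow> t \<in> cbox a b \<Longrightarrow> t \<in> K \<Longrightarrow> L x + m t \<in> S"
    and "open D"
  shows "Ck_on k D (\<lambda>x. integral (cbox a b) (\<lambda>t. c t * G (L x + m t)))"
  using assms(2)
proof (induction k arbitrary: G)
  case 0
  then have "continuous_on S G" by simp
  then have "continuous_on (D \<times> cbox a b) (\<lambda>(x, t). c t * G (L x + m t))"
    by (rule continuous_on_param_support[OF assms(1) _ assms(3-7)]) (use assms(8) in auto)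
  then show ?case
    unfolding Ck_on.simps by (rule integral_continuous_on_param)
next
  case (Suc k)
  have G1: "Ck_on 1 S G" using Ck_on_le[OF Suc.prems, of 1] by simp
  show ?case
  proof (rule Ck_on_SucI[OF assms(9)])
    show "((\<lambda>x. integral (cbox a b) (\<lambda>t. c t * G (L x + m t))) has_derivative
       (\<lambda>v. integral (cbox a b) (\<lambda>t. c t * dd (L v) G (L x + m t)))) (at x)" if "x \<in> D" for x
      by (rule has_derivative_integral_param_support[OF assms(1) G1 assms(3-7) _ assms(9) that])
        (use assms(8) in auto)
    show "Ck_on k D (\<lambda>x. integral (cbox a b) (\<lambda>t. c t * dd (L v) G (L x + m t)))" for v
      by (rule Suc.IH[OF Ck_on_dd[OF Suc.prems]])
  qed
qed

section \<open>Holomorphic functions of several variables\<close>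

lemma holo_on_dd:
  assumes "holo_on S f" "x \<in> S"
  shows "f differentiable (at x)" "dd (c *s v) f x = c * dd v f x"
proof -
  obtain f' where "(f has_derivative f') (at x)" "\<forall>c v. f' (c *s v) = c * f' v"
    using assms unfolding holo_on_def by blast
  then show "f differentiable (at x)" "dd (c *s v) f x = c * dd v f x"
    using dd_eqI[of f f' x] by (auto simp: differentiable_def)
qed

lemma bounded_linear_scale_vec: "bounded_linear (\<lambda>\<zeta>::complex. \<zeta> *s v)"
  by (rule linear_conv_bounded_linear[THEN iffD1]) (auto intro!: linearI simp: vector_sadd_rdistrib vec_eq_iff)

lemma norm_scale_vec: "norm (c *s (v::complex^'n)) = cmod c * norm v"
  by (simp add: norm_vec_def norm_mult L2_set_right_distrib)

text \<open>Cauchy's formula for the derivative on a disc in the complex line through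
  \<open>x\<close> in direction \<open>v\<close>, the circle being parametrised by [0, 1]. The
  integrand is a fixed factor times \<open>f\<close> at a translate of \<open>x\<close>, the form
  required for differentiation under the integral.\<close>

lemma holo_on_directional_Cauchy:
  assumes "open S" "holo_on S f" "\<rho> > 0" "\<And>\<zeta>. cmod \<zeta> \<le> \<rho> \<Longrightarrow> x + \<zeta> *s v \<in> S"
  shows "dd v f x = integral (cbox 0 1) (\<lambda>t. inverse (of_real \<rho> * exp (2 * of_real pi * \<i> * of_real t))
     * f (x + (of_real \<rho> * exp (2 * of_real pi * \<i> * of_real t)) *s v))"
proof -
  define g where "g \<zeta> = f (x + \<zeta> *s v)" for \<zeta>
  have dg: "(g has_field_derivative dd v f (x + \<zeta> *s v)) (at \<zeta>)" if "cmod \<zeta> \<le> \<rho>" for \<zeta>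
  proof -
    have "((\<lambda>\<zeta>. x + \<zeta> *s v) has_derivative (\<lambda>h. h *s v)) (at \<zeta>)"
      using has_derivative_add[OF has_derivative_const bounded_linear_imp_has_derivative[OF bounded_linear_scale_vec]]
      by fastforce
    from has_derivative_compose[OF this has_derivative_dd[OF holo_on_dd(1)[OF assms(2) assms(4)[OF that]]]]
    have "(g has_derivative (\<lambda>h. dd (h *s v) f (x + \<zeta> *s v))) (at \<zeta>)"
      unfolding g_def .
    then show ?thesis
      unfolding has_field_derivative_def holo_on_dd(2)[OF assms(2) assms(4)[OF that]]
      by (simp add: mult.commute[of _ "dd v f (x + \<zeta> *s v)"])
  qed
  have "continuous_on (cball 0 \<rho>) g"
    using DERIV_isCont[OF dg] by (intro continuous_at_imp_continuous_on ballI) simp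
  moreover have "g holomorphic_on ball 0 \<rho>"
    unfolding holomorphic_on_def field_differentiable_def
  proof
    fix \<zeta> :: complex assume "\<zeta> \<in> ball 0 \<rho>"
    then show "\<exists>f'. (g has_field_derivative f') (at \<zeta> within ball 0 \<rho>)"
      using has_field_derivative_at_within[OF dg, of \<zeta>] by auto
  qed
  ultimately have "(g has_field_derivative 1 / (2 * of_real pi * \<i>) *
      contour_integral (circlepath 0 \<rho>) (\<lambda>u. g u / (u - 0)^2)) (at 0)"
    using Cauchy_derivative_integral_circlepath(2)[of 0 \<rho> g 0] assms(3) by simp
  then have "dd v f x = 1 / (2 * of_real pi * \<i>) * contour_integral (circlepath 0 \<rho>) (\<lambda>u. g u / u^2)"
    using DERIV_unique[OF dg[of 0]] assms(3) by simp
  also have "\<dots> = 1 / (2 * of_real pi * \<i>) * integral {0..1} (\<lambda>t. 2 * of_real pi * \<i> *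
      (inverse (of_real \<rho> * exp (2 * of_real pi * \<i> * of_real t))
       * g (of_real \<rho> * exp (2 * of_real pi * \<i> * of_real t))))"
    unfolding contour_integral_integral vector_derivative_circlepath
    using assms(3) by (intro arg_cong[where f="\<lambda>y. _ * y"] integral_cong)
      (simp add: circlepath field_simps power2_eq_square)
  also have "\<dots> = integral {0..1} (\<lambda>t. inverse (of_real \<rho> * exp (2 * of_real pi * \<i> * of_real t))
       * g (of_real \<rho> * exp (2 * of_real pi * \<i> * of_real t)))"
    by (subst integral_mult_right) simp
  finally show ?thesis by (simp add: g_def)
qed

text \<open>The definition of holomorphy gives pointwise complex differentiability only. Cauchy's
  formula expresses \<open>dd v f\<close> through \<open>f\<close> itself without loss of
  derivatives, so class C^k passes from \<open>f\<close> to \<open>dd v f\<close>.\<close>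

lemma holo_on_Ck_on:
  assumes "open S" "holo_on S f"
  shows "Ck_on k S f"
proof (induction k)
  case 0
  show ?case
    using holo_on_dd(1)[OF assms(2)]
    by (auto intro!: continuous_at_imp_continuous_on differentiable_imp_continuous_within)
next
  case (Suc k)
  have "Ck_on k S (dd v f)" for v
  proof (rule Ck_on_Un_local[OF assms(1)])
    fix x0 assume "x0 \<in> S"
    then obtain r where r: "r > 0" "ball x0 r \<subseteq> S"
      using assms(1) by (meson open_contains_ball)
    \<comment> \<open>A point of the half ball that is moved by at most \<open>r / 2\<close> stays
      in the ball of radius \<open>r\<close>; \<rho> is chosen so that the circles move points by no
      more than that.\<close>
    define T where "T = ball x0 (r/2)"
    define q where "q = norm v + 1"
    define \<rho> where "\<rho> = r / (2 * q)"
    have q: "q > 0" "norm v \<le> q" by (simp_all add: q_def add_nonneg_pos)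
    have \<rho>: "\<rho> > 0" using r q by (simp add: \<rho>_def)
    have "\<rho> * norm v \<le> \<rho> * q" using \<rho> q by simp
    also have "\<dots> = r / 2" using q by (simp add: \<rho>_def)
    finally have \<rho>v: "\<rho> * norm v \<le> r / 2" .
    have TS: "x + \<zeta> *s v \<in> S" if "x \<in> T" "cmod \<zeta> \<le> \<rho>" for x \<zeta>
    proof -
      have "norm (\<zeta> *s v) \<le> r / 2"
        using \<rho>v mult_right_mono[OF that(2) norm_ge_zero[of v]] by (simp add: norm_scale_vec)
      then have "dist x0 (x + \<zeta> *s v) < r"
        using that(1) norm_triangle_ineq[of "x - x0" "\<zeta> *s v"]
        by (simp add: T_def dist_norm norm_minus_commute algebra_simps)
      then show ?thesis using r by auto
    qed
    have "Ck_on k T (\<lambda>x. integral (cbox 0 1) (\<lambda>t. inverse (of_real \<rho> * exp (2 * of_real pi * \<i> * of_real t))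
         * f (x + (of_real \<rho> * exp (2 * of_real pi * \<i> * of_real t)) *s v)))"
      by (rule Ck_on_integral_param_support[OF assms(1) Suc bounded_linear_ident _ _ closed_UNIV])
        (use \<rho> in \<open>auto simp: T_def[symmetric] norm_mult intro!: continuous_intros TS
          linear_continuous_on_compose[OF _ bounded_linear.linear[OF bounded_linear_scale_vec]], simp add: T_def\<close>)
    then have "Ck_on k T (dd v f)"
      by (rule Ck_on_cong_imp[rotated 2])
        (use holo_on_directional_Cauchy[OF assms \<rho> TS] in \<open>simp_all add: T_def\<close>)
    moreover have "x0 \<in> T" "open T" "T \<subseteq> S" using r by (auto simp: T_def)
    ultimately show "\<exists>T. open T \<and> x0 \<in> T \<and> T \<subseteq> S \<and> Ck_on k T (dd v f)" by blast
  qed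
  then show ?case using holo_on_dd(1)[OF assms(2)] by simp
qed

lemma holo_on_d_zbar:
  assumes "holo_on S f" "x \<in> S"
  shows "d_zbar j f x = 0"
proof -
  have "axis j \<i> = \<i> *s axis j (1::complex)" by (simp add: vec_eq_iff axis_def)
  then show ?thesis by (simp add: d_zbar_def holo_on_dd(2)[OF assms])
qed

section \<open>Integration of homogeneous functions over a shell\<close>

text \<open>The square makes the cutoff continuously differentiable across the two spheres.\<close>

definition bump :: "'a::euclidean_space \<Rightarrow> real" where
  "bump w = (max 0 ((w \<bullet> w - 1) * (4 - w \<bullet> w)))\<^sup>2"

text \<open>The gradient of \<open>bump\<close> at \<open>w\<close> is \<open>dbump w\<close> times
  \<open>w\<close>: the 4 collects one 2 from the square and one from the gradient of
  \<open>w \<bullet> w\<close>, and \<open>5 - 2 * (w \<bullet> w)\<close> is the derivative of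
  \<open>(x - 1) * (4 - x)\<close> at \<open>w \<bullet> w\<close>.\<close>

definition dbump :: "'a::euclidean_space \<Rightarrow> real" where
  "dbump w = 4 * max 0 ((w \<bullet> w - 1) * (4 - w \<bullet> w)) * (5 - 2 * (w \<bullet> w))"

lemma bump_nonneg [simp]: "0 \<le> bump w"
  by (simp add: bump_def)

lemma continuous_on_bump: "continuous_on S bump"
  unfolding bump_def by (intro continuous_intros)

lemma continuous_on_dbump: "continuous_on S dbump"
  unfolding dbump_def by (intro continuous_intros)

lemma bump_eq_0:
  assumes "norm w \<le> 1 \<or> 2 \<le> norm w"
  shows "bump w = 0" "dbump w = 0"
proof -
  have "w \<bullet> w \<le> 1 \<or> 4 \<le> w \<bullet> w"
  proof (cases "norm w \<le> 1")
    case True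
    then show ?thesis using power_mono[of "norm w" 1 2] by (simp add: dot_square_norm)
  next
    case False
    then show ?thesis using assms power_mono[of 2 "norm w" 2] by (simp add: dot_square_norm)
  qed
  then have "(w \<bullet> w - 1) * (4 - w \<bullet> w) \<le> 0"
    by (auto intro: mult_nonpos_nonneg mult_nonneg_nonpos)
  then show "bump w = 0" "dbump w = 0"
    by (simp_all add: bump_def dbump_def max_def)
qed

lemma bump_pos: "1 < norm w \<Longrightarrow> norm w < 2 \<Longrightarrow> bump w > 0"
proof -
  assume "1 < norm w" "norm w < 2"
  then have "1 < w \<bullet> w" "w \<bullet> w < 4"
    using power_strict_mono[of 1 "norm w" 2] power_strict_mono[of "norm w" 2 2]
    by (simp_all add: dot_square_norm)
  then show ?thesis by (simp add: bump_def max_def)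
qed

lemma has_derivative_max_square:
  "((\<lambda>x::real. (max 0 x)\<^sup>2) has_real_derivative 2 * max 0 x) (at x)"
proof -
  consider "x < 0" | "x > 0" | "x = 0" by linarith
  then show ?thesis
  proof cases
    case 1
    have "((\<lambda>x::real. (max 0 x)\<^sup>2) has_real_derivative 0) (at x)"
      by (rule has_field_derivative_transform_within_open[OF DERIV_const[of 0], where S="{..<0}"])
        (use 1 in auto)
    then show ?thesis using 1 by simp
  next
    case 2
    have "((\<lambda>x::real. x\<^sup>2) has_real_derivative 2 * x) (at x)"
      by (auto intro!: derivative_eq_intros)
    then have "((\<lambda>x::real. (max 0 x)\<^sup>2) has_real_derivative 2 * x) (at x)"
      by (rule has_field_derivative_transform_within_open[where S="{0<..}"]) (use 2 in auto)
    then show ?thesis using 2 by simp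
  next
    case 3
    have "isCont (\<lambda>x::real. max 0 x) 0" by (intro continuous_intros)
    \<comment> \<open>Caratheodory's criterion: the difference quotient at 0 is
      \<open>max 0 x\<close>, which is continuous with value 0.\<close>
    then show ?thesis unfolding 3 CARAT_DERIV
      by (intro exI[of _ "\<lambda>x. max 0 x"]) (simp add: max_def power2_eq_square)
  qed
qed

lemma has_derivative_bump: "(bump has_derivative (\<lambda>a. dbump w * (w \<bullet> a))) (at w)"
proof -
  let ?p = "\<lambda>w::'a. (w \<bullet> w - 1) * (4 - w \<bullet> w)"
  have "(?p has_derivative (\<lambda>a. 2 * (5 - 2 * (w \<bullet> w)) * (w \<bullet> a))) (at w)"
    by (auto intro!: derivative_eq_intros simp: algebra_simps inner_commute)
  from has_derivative_compose[OF this has_derivative_max_square[unfolded has_field_derivative_def]]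
  moreover have "(\<lambda>a. 2 * max 0 (?p w) * (2 * (5 - 2 * (w \<bullet> w)) * (w \<bullet> a))) = (\<lambda>a. dbump w * (w \<bullet> a))"
    by (simp add: dbump_def fun_eq_iff)
  ultimately show ?thesis unfolding bump_def[abs_def] by simp
qed

lemma continuous_on_cutoff:
  fixes c :: "'a::euclidean_space \<Rightarrow> real" and g :: "'a \<Rightarrow> complex"
  assumes "continuous_on (- {0}) g" "continuous_on UNIV c" "\<And>w. norm w \<le> 1 \<Longrightarrow> c w = 0"
  shows "continuous_on UNIV (\<lambda>w. of_real (c w) * g w)"
proof -
  have "continuous_on (- {0} \<union> ball 0 1) (\<lambda>w. of_real (c w) * g w)"
  proof (rule continuous_on_open_Un)
    show "continuous_on (- {0}) (\<lambda>w. of_real (c w) * g w)"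
      by (intro continuous_intros assms continuous_on_subset[OF assms(2)]) auto
    show "continuous_on (ball 0 1) (\<lambda>w. of_real (c w) * g w)"
      by (rule continuous_on_eq[OF continuous_on_const[of _ 0]]) (use assms(3) in auto)
  qed auto
  moreover have "- {0} \<union> ball (0::'a) 1 = UNIV" by auto
  ultimately show ?thesis by simp
qed

lemma integrable_compact_support:
  fixes g :: "'a::euclidean_space \<Rightarrow> complex"
  assumes "continuous_on UNIV g" "\<And>w. r \<le> norm w \<Longrightarrow> g w = 0"
  shows "integrable lborel g"
proof -
  have "integrable lborel (\<lambda>x. indicator (cball 0 r) x *\<^sub>R g x)"
    by (rule borel_integrable_compact[OF compact_cball continuous_on_subset[OF assms(1)]]) simp
  moreover have "(\<lambda>x. indicator (cball 0 r) x *\<^sub>R g x) = g"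
    using assms(2) by (auto simp: fun_eq_iff indicator_def)
  ultimately show ?thesis by simp
qed

lemma lborel_integral_eq_cbox:
  fixes g :: "'a::euclidean_space \<Rightarrow> complex"
  assumes "integrable lborel g" "\<And>w. w \<notin> cbox a b \<Longrightarrow> g w = 0"
  shows "integral\<^sup>L lborel g = integral (cbox a b) g"
proof -
  have "(g has_integral (integral\<^sup>L lborel g)) UNIV"
    by (rule has_integral_integral_lborel[OF assms(1)])
  moreover have "(\<lambda>w. if w \<in> cbox a b then g w else 0) = g"
    using assms(2) by (auto simp: fun_eq_iff)
  ultimately have "(g has_integral (integral\<^sup>L lborel g)) (cbox a b)"
    using has_integral_restrict_UNIV[of "cbox a b" g] by simp
  then show ?thesis by (simp add: integral_unique)
qed

text \<open>By translation invariance the integral of \<open>h (s *\<^sub>R a + w)\<close> over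
  \<open>w\<close> does not depend on \<open>s\<close>; its derivative at \<open>s = 0\<close> is
  the integral of \<open>dd a h\<close>.\<close>

lemma lborel_integral_dd_eq_0:
  fixes h :: "'a::euclidean_space \<Rightarrow> complex"
  assumes "Ck_on 1 UNIV h" "\<And>w. r \<le> norm w \<Longrightarrow> h w = 0"
  shows "(LINT w|lborel. dd a h w) = 0"
proof -
  have h1: "Ck_on (Suc 0) UNIV h" using assms(1) by simp
  \<comment> \<open>One box that contains the support of every translate with
    \<open>\<bar>s\<bar> < 1\<close>, so that the parameter integral has a fixed domain.\<close>
  obtain u v where uv: "cball 0 (max r 0 + norm a) \<subseteq> cbox u (v::'a)"
    using bounded_subset_cbox_symmetric[OF bounded_cball] by metis
  have out: "r \<le> norm (s *\<^sub>R a + w)" if "\<bar>s\<bar> < 1" "w \<notin> cbox u v" for s w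
  proof -
    have "max r 0 + norm a < norm w"
      using uv that(2) by (meson mem_cball_0 not_le subsetD)
    moreover have "norm (s *\<^sub>R a) \<le> norm a" using that(1) by (simp add: mult_left_le_one_le)
    moreover have "norm w \<le> norm (s *\<^sub>R a + w) + norm (s *\<^sub>R a)"
      using norm_triangle_ineq4[of "s *\<^sub>R a + w" "s *\<^sub>R a"] by simp
    ultimately show ?thesis by linarith
  qed
  have cont: "continuous_on UNIV h" using Ck_on_continuous_on[OF assms(1)] .
  have int_h: "integrable lborel (\<lambda>w. h (s *\<^sub>R a + w))" for s
  proof (rule integrable_compact_support[where r="r + norm (s *\<^sub>R a)"])
    show "continuous_on UNIV (\<lambda>w. h (s *\<^sub>R a + w))"
      by (rule continuous_on_compose2[OF cont]) (auto intro!: continuous_intros)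
    show "h (s *\<^sub>R a + w) = 0" if "r + norm (s *\<^sub>R a) \<le> norm w" for w
      using that norm_triangle_ineq4[of "s *\<^sub>R a + w" "s *\<^sub>R a"] by (intro assms(2)) simp
  qed
  have const: "(LINT w|lborel. h (s *\<^sub>R a + w)) = integral\<^sup>L lborel h" for s
    using integral_distr[of "(+) (s *\<^sub>R a)" lborel borel h] borel_measurable_continuous_onI[OF cont]
    by (simp add: lborel_distr_plus)
  define \<Phi> where "\<Phi> s = integral (cbox u v) (\<lambda>w. 1 * h (s *\<^sub>R a + w))" for s
  have "\<Phi> s = integral\<^sup>L lborel h" if "\<bar>s\<bar> < 1" for s
    unfolding \<Phi>_def mult_1 const[of s, symmetric]
    by (rule lborel_integral_eq_cbox[OF int_h, symmetric]) (use out[OF that] assms(2) in auto)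
  then have const\<Phi>: "((\<lambda>_. integral\<^sup>L lborel h) has_derivative F) (at 0)" if "(\<Phi> has_derivative F) (at 0)" for F
    using has_derivative_transform_within_open[OF that, of "ball 0 1"] by (auto simp: dist_norm)
  have "(\<Phi> has_derivative (\<lambda>t. integral (cbox u v) (\<lambda>w. 1 * dd (t *\<^sub>R a) h (0 *\<^sub>R a + w)))) (at 0)"
    unfolding \<Phi>_def
    by (rule has_derivative_integral_param_support[OF open_UNIV assms(1) bounded_linear_scaleR_left _ _ closed_UNIV,
      where D=UNIV]) (auto intro!: continuous_intros)
  from const\<Phi>[OF this]
  have "(\<lambda>t. integral (cbox u v) (\<lambda>w. 1 * dd (t *\<^sub>R a) h (0 *\<^sub>R a + w))) = (\<lambda>t. 0)"
    using has_derivative_unique[OF _ has_derivative_const] by blast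
  from fun_cong[OF this, of 1] have 0: "integral (cbox u v) (dd a h) = 0" by simp
  have dd0: "dd a h w = 0" if "r < norm w" for w
  proof -
    have "dd a h w = dd a (\<lambda>_. 0) w"
      by (rule dd_cong[of "{w. r < norm w}"])
        (use that assms(2) in \<open>auto intro!: open_Collect_less continuous_intros\<close>)
    then show ?thesis by simp
  qed
  have "(LINT w|lborel. dd a h w) = integral (cbox u v) (dd a h)"
  proof (rule lborel_integral_eq_cbox)
    show "integrable lborel (dd a h)"
      by (rule integrable_compact_support[where r="r + 1"])
        (use Ck_on_continuous_on[OF Ck_on_dd[OF h1]] dd0 in auto)
    show "dd a h w = 0" if "w \<notin> cbox u v" for w
    proof (rule dd0)
      have "max r 0 + norm a < norm w" using uv that by (meson mem_cball_0 not_le subsetD)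
      then show "r < norm w" using norm_ge_zero[of a] by linarith
    qed
  qed
  then show ?thesis using 0 by simp
qed

text \<open>On functions homogeneous of degree \<open>- DIM('a)\<close> this is, up to a constant factor, the integral over the
  unit sphere.\<close>

definition J :: "('a::euclidean_space \<Rightarrow> complex) \<Rightarrow> complex" where
  "J g = (LINT w|lborel. of_real (bump w) * g w)"

lemma J_integrable:
  fixes g :: "'a::euclidean_space \<Rightarrow> complex"
  assumes "continuous_on (- {0}) g"
  shows "integrable lborel (\<lambda>w. of_real (bump w) * g w)"
  by (rule integrable_compact_support[where r=2, OF continuous_on_cutoff[OF assms continuous_on_bump]])
    (simp_all add: bump_eq_0)

lemma J_cong: "(\<And>w. w \<noteq> 0 \<Longrightarrow> f w = g w) \<Longrightarrow> J f = J g"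
  unfolding J_def by (intro Bochner_Integration.integral_cong refl) (metis bump_eq_0(1) mult_zero_left norm_zero of_real_0 zero_le_one)

lemma J_add:
  assumes "continuous_on (- {0}) f" "continuous_on (- {0}) g"
  shows "J (\<lambda>w. f w + g w) = J f + J g"
  unfolding J_def distrib_left
  by (rule Bochner_Integration.integral_add[OF J_integrable[OF assms(1)] J_integrable[OF assms(2)]])

lemma J_diff:
  assumes "continuous_on (- {0}) f" "continuous_on (- {0}) g"
  shows "J (\<lambda>w. f w - g w) = J f - J g"
  unfolding J_def right_diff_distrib
  by (rule Bochner_Integration.integral_diff[OF J_integrable[OF assms(1)] J_integrable[OF assms(2)]])

lemma J_cmult: "J (\<lambda>w. c * g w) = c * J g"
  unfolding J_def by (simp add: mult.left_commute)

lemma J_minus: "J (\<lambda>w. - g w) = - J g"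
  using J_cmult[of "-1" g] by simp

lemma J_sum:
  assumes "\<And>i. i \<in> I \<Longrightarrow> continuous_on (- {0}) (f i)"
  shows "J (\<lambda>w. \<Sum>i\<in>I. f i w) = (\<Sum>i\<in>I. J (f i))"
  unfolding J_def sum_distrib_left
  by (rule Bochner_Integration.integral_sum[OF J_integrable[OF assms]])

lemma J_cnj: "J (\<lambda>w. cnj (g w)) = cnj (J g)"
  unfolding J_def by (simp add: Bochner_Integration.integral_cnj[symmetric])

lemma Re_J_mono:
  assumes "continuous_on (- {0}) f" "continuous_on (- {0}) g"
    and "\<And>w. 1 \<le> norm w \<Longrightarrow> norm w \<le> 2 \<Longrightarrow> Re (f w) \<le> Re (g w)"
  shows "Re (J f) \<le> Re (J g)"
proof -
  have "(LINT w|lborel. Re (of_real (bump w) * f w)) \<le> (LINT w|lborel. Re (of_real (bump w) * g w))"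
  proof (intro integral_mono integrable_Re J_integrable assms)
    fix w :: 'a
    show "Re (of_real (bump w) * f w) \<le> Re (of_real (bump w) * g w)"
      using bump_eq_0(1)[of w] assms(3)[of w] by (cases "norm w \<le> 1 \<or> 2 \<le> norm w") (auto intro: mult_left_mono)
  qed
  then show ?thesis
    unfolding J_def integral_Re[OF J_integrable[OF assms(1)]] integral_Re[OF J_integrable[OF assms(2)]] .
qed

section \<open>Homogeneous functions, and divergences of critical degree\<close>

definition homogeneous :: "int \<Rightarrow> ('a::real_normed_vector \<Rightarrow> complex) \<Rightarrow> bool" where
  "homogeneous d F \<longleftrightarrow> (\<forall>r>0. \<forall>w. w \<noteq> 0 \<longrightarrow> F (r *\<^sub>R w) = of_real (r powi d) * F w)"

lemma homogeneousD: "homogeneous d F \<Longrightarrow> r > 0 \<Longrightarrow> w \<noteq> 0 \<Longrightarrow> F (r *\<^sub>R w) = of_real (r powi d) * F w"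
  by (simp add: homogeneous_def)

lemma homogeneous_mult: "homogeneous d F \<Longrightarrow> homogeneous e G \<Longrightarrow> homogeneous (d + e) (\<lambda>w. F w * G w)"
  by (simp add: homogeneous_def power_int_add)

lemma homogeneous_cnj: "homogeneous d F \<Longrightarrow> homogeneous d (\<lambda>w. cnj (F w))"
  by (simp add: homogeneous_def)

lemma homogeneous_add: "homogeneous d F \<Longrightarrow> homogeneous d G \<Longrightarrow> homogeneous d (\<lambda>w. F w + G w)"
  by (simp add: homogeneous_def distrib_left)

lemma homogeneous_diff: "homogeneous d F \<Longrightarrow> homogeneous d G \<Longrightarrow> homogeneous d (\<lambda>w. F w - G w)"
  by (simp add: homogeneous_def right_diff_distrib)

lemma homogeneous_sum: "(\<And>i. i \<in> I \<Longrightarrow> homogeneous d (F i)) \<Longrightarrow> homogeneous d (\<lambda>w. \<Sum>i\<in>I. F i w)"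
  by (simp add: homogeneous_def sum_distrib_left)

lemma homogeneous_const: "homogeneous 0 (\<lambda>w. c)"
  by (simp add: homogeneous_def)

lemma homogeneous_dd:
  fixes F :: "'a::real_normed_vector \<Rightarrow> complex"
  assumes "homogeneous d F" "\<And>w. w \<noteq> 0 \<Longrightarrow> F differentiable (at w)"
  shows "homogeneous (d - 1) (dd a F)"
  unfolding homogeneous_def
proof (intro allI impI)
  fix r :: real and w :: 'a assume r: "r > 0" and w: "w \<noteq> 0"
  have "((\<lambda>w. F (r *\<^sub>R w)) has_derivative (\<lambda>a. dd (r *\<^sub>R a) F (r *\<^sub>R w))) (at w)"
    using has_derivative_compose[OF bounded_linear_imp_has_derivative[OF bounded_linear_scaleR_right]
        has_derivative_dd[OF assms(2)]] r w by simp
  then have "dd a (\<lambda>w. F (r *\<^sub>R w)) w = dd (r *\<^sub>R a) F (r *\<^sub>R w)" by (rule dd_eqI)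
  moreover have "dd (r *\<^sub>R a) F (r *\<^sub>R w) = of_real r * dd a F (r *\<^sub>R w)"
    using linear_cmul[OF has_derivative_linear[OF has_derivative_dd[OF assms(2)[of "r *\<^sub>R w"]]]] r w
    by (simp add: scaleR_conv_of_real)
  moreover have "dd a (\<lambda>w. F (r *\<^sub>R w)) w = dd a (\<lambda>w. of_real (r powi d) * F w) w"
    by (rule dd_cong[of "- {0}"]) (use w homogeneousD[OF assms(1) r] in auto)
  moreover have "dd a (\<lambda>w. of_real (r powi d) * F w) w = of_real (r powi d) * dd a F w"
    by (rule dd_bounded_linear[OF bounded_linear_mult_right assms(2)[OF w]])
  ultimately have "of_real r * dd a F (r *\<^sub>R w) = of_real (r powi d) * dd a F w" by simp
  moreover have "r powi d = r * r powi (d - 1)"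
    using r by (simp add: power_int_diff)
  ultimately show "dd a F (r *\<^sub>R w) = of_real (r powi (d - 1)) * dd a F w"
    using r by simp
qed

lemma homogeneous_Euler:
  fixes F :: "'a::real_normed_vector \<Rightarrow> complex"
  assumes "homogeneous d F" "F differentiable (at w)" "w \<noteq> 0"
  shows "dd w F w = of_int d * F w"
proof -
  have "((\<lambda>t. t *\<^sub>R w) has_derivative (\<lambda>h. h *\<^sub>R w)) (at 1)"
    by (auto intro!: derivative_eq_intros)
  from has_derivative_compose[OF this] has_derivative_dd[OF assms(2)]
  have "((\<lambda>t. F (t *\<^sub>R w)) has_derivative (\<lambda>h. dd (h *\<^sub>R w) F w)) (at 1)" by simp
  then have 1: "((\<lambda>t. of_real (t powi d) * F w) has_derivative (\<lambda>h. dd (h *\<^sub>R w) F w)) (at 1)"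
    by (rule has_derivative_transform_within_open[of _ _ _ _ "{0<..}"])
      (use homogeneousD[OF assms(1) _ assms(3)] in auto)
  have "((\<lambda>t::real. t powi d) has_real_derivative of_int d) (at 1)"
    by (auto intro!: derivative_eq_intros)
  then have "((\<lambda>t::real. t powi d) has_derivative (*) (of_int d)) (at 1)"
    by (simp add: has_field_derivative_def)
  from has_derivative_mult_left[OF has_derivative_of_real[OF this], of "F w"]
  have 2: "((\<lambda>t. of_real (t powi d) * F w) has_derivative (\<lambda>h. of_real (of_int d * h) * F w)) (at 1)" .
  from fun_cong[OF has_derivative_unique[OF 1 2], of 1] show ?thesis by simp
qed

lemma Ck_on_inner_left: "open S \<Longrightarrow> Ck_on k S (\<lambda>w. w \<bullet> a)"
  by (rule Ck_on_linear[OF _ bounded_linear_inner_left])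

lemma Ck_on_inner_self: "open S \<Longrightarrow> Ck_on k S (\<lambda>w. w \<bullet> w)"
  by (rule Ck_on_bilinear[OF _ bounded_bilinear_inner Ck_on_id Ck_on_id])

lemma Ck_on_inverse_inner_self: "Ck_on k (- {0}) (\<lambda>w::'a::euclidean_space. inverse (w \<bullet> w))"
  by (rule Ck_on_compose[OF _ _ Ck_on_inner_self Ck_on_inverse_gt0]) (auto simp: open_Compl)

text \<open>The derivative of \<open>bump\<close> times \<open>G\<close> integrates to zero, and the
  product rule splits it; what would be a boundary term is thereby concentrated in the radial factor
  \<open>dbump\<close>.\<close>

lemma J_dd_eq_dbump:
  fixes G :: "'a::euclidean_space \<Rightarrow> complex"
  assumes "Ck_on 1 (- {0}) G"
  shows "J (dd a G) = - (LINT w|lborel. of_real (dbump w) * (of_real (w \<bullet> a) * G w))"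
    and "integrable lborel (\<lambda>w. of_real (dbump w) * (of_real (w \<bullet> a) * G w))"
proof -
  have G1: "Ck_on (Suc 0) (- {0}) G" using assms by simp
  have contG: "continuous_on (- {0}) G" by (rule Ck_on_continuous_on[OF assms])
  have contd: "continuous_on (- {0}) (dd v G)" for v by (rule Ck_on_continuous_on[OF Ck_on_dd[OF G1]])
  define h where "h w = of_real (bump w) * G w" for w
  define f' where "f' w v = of_real (bump w) * dd v G w + of_real (dbump w) * (of_real (w \<bullet> v) * G w)" for w v
  have contv: "continuous_on (- {0}) (\<lambda>w. of_real (w \<bullet> v) * G w)" for v
    by (intro continuous_intros contG)
  have h: "(h has_derivative f' w) (at w)" for w
  proof (cases "w = 0")
    case True
    have "((\<lambda>w. 0) has_derivative (\<lambda>v. 0)) (at w)" by simp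
    then have "(h has_derivative (\<lambda>v. 0)) (at w)"
      by (rule has_derivative_transform_within_open[of _ _ _ _ "ball 0 1"])
        (use True in \<open>auto simp: h_def bump_eq_0\<close>)
    moreover have "f' w = (\<lambda>v. 0)" using True by (simp add: f'_def bump_eq_0 fun_eq_iff)
    ultimately show ?thesis by simp
  next
    case False
    then have "G differentiable (at w)" using Ck_on_differentiable[OF assms] by simp
    from has_derivative_mult[OF has_derivative_of_real[OF has_derivative_bump] has_derivative_dd[OF this]]
    have "(h has_derivative (\<lambda>v. of_real (bump w) * dd v G w + of_real (dbump w * (w \<bullet> v)) * G w)) (at w)"
      unfolding h_def .
    moreover have "(\<lambda>v. of_real (bump w) * dd v G w + of_real (dbump w * (w \<bullet> v)) * G w) = f' w"
      by (simp add: f'_def fun_eq_iff)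
    ultimately show ?thesis by simp
  qed
  have cont1: "continuous_on UNIV (\<lambda>w. of_real (bump w) * dd v G w)" for v
    by (rule continuous_on_cutoff[OF contd continuous_on_bump]) (simp add: bump_eq_0)
  have cont2: "continuous_on UNIV (\<lambda>w. of_real (dbump w) * (of_real (w \<bullet> v) * G w))" for v
    by (rule continuous_on_cutoff[OF contv continuous_on_dbump]) (simp add: bump_eq_0)
  have "Ck_on (Suc 0) UNIV h"
    by (rule Ck_on_SucI[OF open_UNIV h]) (simp add: f'_def continuous_on_add[OF cont1 cont2])
  then have "(LINT w|lborel. dd a h w) = 0"
    by (intro lborel_integral_dd_eq_0[where r=2]) (auto simp: h_def bump_eq_0)
  moreover have "dd a h = (\<lambda>w. f' w a)" using dd_eqI[OF h] by (simp add: fun_eq_iff)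
  ultimately have 0: "(LINT w|lborel. f' w a) = 0" by simp
  show int: "integrable lborel (\<lambda>w. of_real (dbump w) * (of_real (w \<bullet> a) * G w))"
    by (rule integrable_compact_support[where r=2, OF cont2]) (simp add: bump_eq_0)
  have "(LINT w|lborel. f' w a) = J (dd a G) + (LINT w|lborel. of_real (dbump w) * (of_real (w \<bullet> a) * G w))"
    unfolding f'_def J_def by (rule Bochner_Integration.integral_add[OF J_integrable[OF contd] int])
  then show "J (dd a G) = - (LINT w|lborel. of_real (dbump w) * (of_real (w \<bullet> a) * G w))"
    using 0 by (simp add: eq_neg_iff_add_eq_0)
qed

text \<open>The derivative of the cutoff contributes nothing: it is radial, and its pairing with a function
  of the critical degree is itself a divergence, namely that of a multiple of the Euler field.\<close>

theorem J_dd_eq_0: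
  fixes F :: "'a::euclidean_space \<Rightarrow> complex"
  assumes F: "Ck_on 1 (- {0}) F" and hom: "homogeneous (1 - int DIM('a)) F"
  shows "J (dd a F) = 0"
proof -
  have op: "open (- {0::'a})" by (simp add: open_Compl)
  \<comment> \<open>\<open>P\<close> has degree \<open>- DIM('a)\<close>, so the field
    \<open>P w\<close> times \<open>w\<close> is divergence free by Euler's identity. Paired with
    the radial gradient of the cutoff it gives back \<open>F w\<close> times
    \<open>w \<bullet> a\<close>, because the factor \<open>w \<bullet> w\<close> cancels the
    denominator of \<open>q\<close>.\<close>
  define q where "q w = (w \<bullet> a) * inverse (w \<bullet> w)" for w
  define P where "P w = F w * of_real (q w)" for w
  have q: "Ck_on 1 (- {0}) q"
    unfolding q_def by (rule Ck_on_mult[OF op Ck_on_inner_left[OF op] Ck_on_inverse_inner_self])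
  have P: "Ck_on 1 (- {0}) P"
    unfolding P_def by (rule Ck_on_mult[OF op F Ck_on_of_real[OF op q]])
  have "homogeneous (- 1) (\<lambda>w. of_real (q w))"
    by (auto simp: homogeneous_def q_def power_int_minus field_simps)
  from homogeneous_mult[OF hom this] have homP: "homogeneous (- int DIM('a)) P"
    by (simp add: P_def[abs_def])
  define G where "G e w = P w * of_real (w \<bullet> e)" for e w
  have G: "Ck_on 1 (- {0}) (G e)" for e
    unfolding G_def by (rule Ck_on_mult[OF op P Ck_on_of_real[OF op Ck_on_inner_left[OF op]]])
  have contG: "continuous_on (- {0}) (dd e (G e))" for e
    using Ck_on_continuous_on[OF Ck_on_dd, of 0 "- {0}" "G e" e] G[of e] by simp
  have Pd: "P differentiable (at w)" if "w \<noteq> 0" for w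
    using Ck_on_differentiable[OF P] that by simp
  have "(\<Sum>e\<in>Basis. dd e (G e) w) = 0" if "w \<noteq> 0" for w
  proof -
    have "dd e (G e) w = of_real (w \<bullet> e) * dd e P w + P w" if "e \<in> Basis" for e
    proof -
      have "((\<lambda>w. P w * of_real (w \<bullet> e)) has_derivative
        (\<lambda>v. P w * of_real (v \<bullet> e) + dd v P w * of_real (w \<bullet> e))) (at w)"
        by (rule has_derivative_mult[OF has_derivative_dd[OF Pd[OF \<open>w \<noteq> 0\<close>]]
              has_derivative_of_real[OF bounded_linear_imp_has_derivative[OF bounded_linear_inner_left]]])
      from dd_eqI[OF this, of e] show ?thesis
        unfolding G_def using that by (simp add: mult.commute)
    qed
    then have "(\<Sum>e\<in>Basis. dd e (G e) w) = (\<Sum>e\<in>Basis. of_real (w \<bullet> e) * dd e P w) + of_nat DIM('a) * P w"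
      by (simp add: sum.distrib)
    also have "(\<Sum>e\<in>Basis. of_real (w \<bullet> e) * dd e P w) = dd w P w"
    proof -
      note lin = has_derivative_linear[OF has_derivative_dd[OF Pd[OF that]]]
      have "dd (\<Sum>e\<in>Basis. (w \<bullet> e) *\<^sub>R e) P w = (\<Sum>e\<in>Basis. of_real (w \<bullet> e) * dd e P w)"
        unfolding linear_sum[OF lin] by (intro sum.cong refl) (simp add: linear_cmul[OF lin] scaleR_conv_of_real)
      then show ?thesis by (simp add: euclidean_representation)
    qed
    also have "\<dots> = - of_nat DIM('a) * P w"
      using homogeneous_Euler[OF homP Pd[OF that] that] by simp
    finally show ?thesis by simp
  qed
  then have "J (\<lambda>w. \<Sum>e\<in>Basis. dd e (G e) w) = J (\<lambda>w::'a. 0)"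
    by (intro J_cong) simp
  then have "(\<Sum>e\<in>Basis. J (dd e (G e))) = 0"
    using J_sum[of Basis "\<lambda>e. dd e (G e)"] contG by (simp add: J_def)
  then have "(\<Sum>e\<in>Basis. (LINT w|lborel. of_real (dbump w) * (of_real (w \<bullet> e) * G e w))) = 0"
    by (simp add: J_dd_eq_dbump(1)[OF G] sum_negf)
  then have "(LINT w|lborel. (\<Sum>e\<in>Basis. of_real (dbump w) * (of_real (w \<bullet> e) * G e w))) = 0"
    using Bochner_Integration.integral_sum[of Basis lborel "\<lambda>e w. of_real (dbump w) * (of_real (w \<bullet> e) * G e w)"]
      J_dd_eq_dbump(2)[OF G] by simp
  moreover have "(\<Sum>e\<in>Basis. of_real (dbump w) * (of_real (w \<bullet> e) * G e w))
      = of_real (dbump w) * (of_real (w \<bullet> a) * F w)" for w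
  proof -
    have "(\<Sum>e\<in>Basis. of_real (dbump w) * (of_real (w \<bullet> e) * G e w))
        = of_real (dbump w) * P w * of_real (\<Sum>e\<in>Basis. (w \<bullet> e) * (w \<bullet> e))"
      unfolding of_real_sum sum_distrib_left by (intro sum.cong refl) (simp add: G_def)
    also have "(\<Sum>e\<in>Basis. (w \<bullet> e) * (w \<bullet> e)) = w \<bullet> w"
      by (rule euclidean_inner[symmetric])
    also have "of_real (dbump w) * P w * of_real (w \<bullet> w) = of_real (dbump w) * (of_real (w \<bullet> a) * F w)"
      by (cases "w = 0") (simp_all add: bump_eq_0 P_def q_def)
    finally show ?thesis .
  qed
  ultimately have "(LINT w|lborel. of_real (dbump w) * (of_real (w \<bullet> a) * F w)) = 0" by simp
  then show ?thesis using J_dd_eq_dbump(1)[OF F] by simp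
qed

lemma open_minus_0: "open (- {0::'a::real_normed_vector})"
  by (simp add: open_Compl)

lemma homogeneous_d_z:
  assumes "homogeneous d F" "\<And>w. w \<noteq> 0 \<Longrightarrow> F differentiable (at w)"
  shows "homogeneous (d - 1) (d_z j F)" "homogeneous (d - 1) (d_zbar j F)"
proof -
  have h: "homogeneous (d - 1) (\<lambda>w. c * dd a F w)" for a c
    using homogeneous_mult[OF homogeneous_const homogeneous_dd[OF assms]] by simp
  have "homogeneous (d - 1) (\<lambda>w. (1/2) * dd (axis j 1) F w + c * dd (axis j \<i>) F w)" for c
    by (rule homogeneous_add[OF h h])
  from this[of "-\<i>/2"] this[of "\<i>/2"] show "homogeneous (d - 1) (d_z j F)" "homogeneous (d - 1) (d_zbar j F)"
    by (simp_all add: d_z_def[abs_def] d_zbar_def[abs_def] diff_divide_distrib add_divide_distrib)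
qed

lemma J_d_z_eq_0:
  fixes F :: "complex^'m \<Rightarrow> complex"
  assumes "Ck_on 1 (- {0}) F" "homogeneous (1 - 2 * int CARD('m)) F"
  shows "J (d_z j F) = 0" "J (d_zbar j F) = 0"
proof -
  have F1: "Ck_on (Suc 0) (- {0}) F" using assms(1) by simp
  have 0: "J (dd a F) = 0" for a
    by (rule J_dd_eq_0[OF assms(1)]) (use assms(2) in \<open>simp add: mult.commute\<close>)
  have cont: "continuous_on (- {0}) (\<lambda>w. c * dd a F w)" for a c
    by (intro continuous_intros Ck_on_continuous_on[OF Ck_on_dd[OF F1]])
  have "J (\<lambda>w. (1/2) * dd (axis j 1) F w + c * dd (axis j \<i>) F w) = 0" for c
    by (simp only: J_add[OF cont cont] J_cmult 0) simp
  from this[of "-\<i>/2"] this[of "\<i>/2"] show "J (d_z j F) = 0" "J (d_zbar j F) = 0"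
    by (simp_all add: d_z_def[abs_def] d_zbar_def[abs_def] diff_divide_distrib add_divide_distrib)
qed

text \<open>The factor \<open>2 * CARD('m)\<close> makes \<open>exp (- \<psi>)\<close> homogeneous of the critical degree, so \<open>\<psi>\<close> is a weight of a
  metric on the dual of the canonical bundle of projective space.\<close>

locale log_weight =
  fixes \<psi> :: "complex^'m \<Rightarrow> real"
  assumes psi_Ck: "Ck_on 2 (- {0}) \<psi>"
    and psi_scale: "\<And>c w. c \<noteq> 0 \<Longrightarrow> w \<noteq> 0 \<Longrightarrow> \<psi> (c *s w) = \<psi> w + 2 * CARD('m) * ln (cmod c)"
begin

definition E :: "complex^'m \<Rightarrow> complex" where
  "E w = of_real (exp (- \<psi> w))"

definition p :: "'m \<Rightarrow> complex^'m \<Rightarrow> complex" where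
  "p j = d_z j (\<lambda>w. of_real (\<psi> w))"

definition q :: "'m \<Rightarrow> 'm \<Rightarrow> complex^'m \<Rightarrow> complex" where
  "q j k = d_zbar k (p j)"

text \<open>The divergence with respect to the density \<open>E\<close>: the sum of the
  \<open>d_z j (E * X j)\<close>, divided by \<open>E\<close>. Up to sign it is the formal adjoint
  of \<open>d_z\<close> for the integral with weight \<open>E\<close>.\<close>

definition divg :: "('m \<Rightarrow> complex^'m \<Rightarrow> complex) \<Rightarrow> complex^'m \<Rightarrow> complex" where
  "divg X w = (\<Sum>j\<in>UNIV. d_z j (X j) w - p j w * X j w)"

lemma E_Ck: "Ck_on 2 (- {0}) E"
  unfolding E_def[abs_def]
  by (rule Ck_on_of_real[OF open_minus_0 Ck_on_compose[OF open_minus_0 _ Ck_on_minus[OF open_minus_0 psi_Ck] Ck_on_exp]]) simp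

lemma E_ne_0 [simp]: "E w \<noteq> 0" by (simp add: E_def)

lemma cnj_E [simp]: "cnj (E w) = E w" by (simp add: E_def)

lemma psi_C_Ck: "Ck_on 2 (- {0}) (\<lambda>w. complex_of_real (\<psi> w))"
  by (rule Ck_on_of_real[OF open_minus_0 psi_Ck])

lemma p_Ck: "Ck_on 1 (- {0}) (p j)"
  unfolding p_def using Ck_on_d_z(1)[OF open_minus_0, of 1] psi_C_Ck by (simp add: numeral_2_eq_2 del: Ck_on.simps)

lemma q_Ck: "Ck_on 0 (- {0}) (q j k)"
  unfolding q_def using Ck_on_d_z(2)[OF open_minus_0, of 0 "p j"] p_Ck[of j] by simp

lemma psi_differentiable: "w \<noteq> 0 \<Longrightarrow> \<psi> differentiable (at w)"
  using Ck_on_differentiable[OF psi_Ck] by simp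

lemma E_differentiable: "w \<noteq> 0 \<Longrightarrow> E differentiable (at w)"
  using Ck_on_differentiable[OF E_Ck] by simp

lemma p_differentiable: "w \<noteq> 0 \<Longrightarrow> p j differentiable (at w)"
  using Ck_on_differentiable[OF p_Ck] by simp

lemma d_z_E:
  assumes "w \<noteq> 0"
  shows "d_z j E w = - p j w * E w" "d_zbar j E w = - cnj (p j w) * E w"
proof -
  have "((\<lambda>x. exp (- x)) has_real_derivative - exp (- \<psi> w)) (at (\<psi> w))"
    by (auto intro!: derivative_eq_intros)
  from d_z_of_real_compose[OF psi_differentiable[OF assms] this, of j] cnj_d_z_of_real(1)[OF psi_differentiable[OF assms], of j]
  show "d_z j E w = - p j w * E w" "d_zbar j E w = - cnj (p j w) * E w"
    by (simp_all add: E_def[abs_def] p_def)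
qed

lemma E_homogeneous: "homogeneous (- 2 * int CARD('m)) E"
  unfolding homogeneous_def
proof (intro allI impI)
  fix r :: real and w :: "complex^'m" assume r: "r > 0" and w: "w \<noteq> 0"
  let ?N = "CARD('m)"
  have "r *\<^sub>R w = complex_of_real r *s w"
    by (simp add: vec_eq_iff) (simp add: scaleR_conv_of_real)
  then have "\<psi> (r *\<^sub>R w) = \<psi> w + 2 * ?N * ln r"
    using psi_scale[of "of_real r" w] r w by simp
  moreover have "exp (2 * ?N * ln r) = r ^ (2 * ?N)"
    using exp_of_nat_mult[of "2 * ?N" "ln r"] r by simp
  moreover have "r powi (- 2 * int ?N) = inverse (r ^ (2 * ?N))"
    using power_int_minus[of r "int (2 * ?N)"] by (simp only: power_int_of_nat) simp
  ultimately have "exp (- \<psi> (r *\<^sub>R w)) = r powi (- 2 * int ?N) * exp (- \<psi> w)"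
    by (simp add: exp_minus exp_diff field_simps)
  then show "E (r *\<^sub>R w) = of_real (r powi (- 2 * int ?N)) * E w"
    by (simp add: E_def)
qed

text \<open>Read off from the derivative of \<open>E\<close>: \<psi> is homogeneous only up to an
  additive logarithm, while \<open>E\<close> is homogeneous in the strict sense.\<close>

lemma p_homogeneous: "homogeneous (- 1) (p j)"
  unfolding homogeneous_def
proof (intro allI impI)
  fix r :: real and w :: "complex^'m" assume r: "r > 0" and w: "w \<noteq> 0"
  let ?M = "- 2 * int CARD('m)"
  have rw: "r *\<^sub>R w \<noteq> 0" using r w by simp
  have "- p j (r *\<^sub>R w) * E (r *\<^sub>R w) = of_real (r powi (?M - 1)) * (- p j w * E w)"
    using homogeneousD[OF homogeneous_d_z(1)[OF E_homogeneous E_differentiable] r w, of j]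
    unfolding d_z_E(1)[OF w] d_z_E(1)[OF rw] .
  also have "r powi (?M - 1) = r powi ?M * r powi (- 1)"
    using r by (simp add: power_int_diff power_int_minus field_simps)
  finally show "p j (r *\<^sub>R w) = of_real (r powi (- 1)) * p j w"
    using homogeneousD[OF E_homogeneous r w] r by (simp add: mult_ac)
qed

text \<open>The degrees of \<open>F\<close>, \<open>X j\<close> and \<open>E\<close> add up to
  \<open>1 - 2 * CARD('m)\<close>, the degree at which total derivatives integrate to zero.\<close>

lemma J_adjoint:
  assumes X: "\<And>j. Ck_on 1 (- {0}) (X j)" "\<And>j. homogeneous (1 - d) (X j)"
    and F: "Ck_on 1 (- {0}) F" "homogeneous d F"
  shows "J (\<lambda>w. F w * divg X w * E w) = - J (\<lambda>w. (\<Sum>j\<in>UNIV. d_z j F w * X j w) * E w)"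
proof -
  note op = open_minus_0
  have E1: "Ck_on 1 (- {0}) E" by (rule Ck_on_le[OF E_Ck]) simp
  have G1: "Ck_on 1 (- {0}) (\<lambda>w. F w * X j w * E w)" for j
    by (rule Ck_on_mult[OF op Ck_on_mult[OF op F(1) X(1)] E1])
  have Gh: "homogeneous (1 - 2 * int CARD('m)) (\<lambda>w. F w * X j w * E w)" for j
    using homogeneous_mult[OF homogeneous_mult[OF F(2) X(2)] E_homogeneous] by simp
  have contG: "continuous_on (- {0}) (d_z j (\<lambda>w. F w * X j w * E w))" for j
    using Ck_on_continuous_on[OF Ck_on_d_z(1)[OF op, of 0]] G1[of j] by simp
  have contE: "continuous_on (- {0}) E" by (rule Ck_on_continuous_on[OF E_Ck])
  have contF: "continuous_on (- {0}) F" by (rule Ck_on_continuous_on[OF F(1)])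
  have contX: "continuous_on (- {0}) (X j)" for j by (rule Ck_on_continuous_on[OF X(1)])
  have contdX: "continuous_on (- {0}) (d_z j (X j))" for j
    using Ck_on_continuous_on[OF Ck_on_d_z(1)[OF op, of 0]] X(1)[of j] by simp
  have contdF: "continuous_on (- {0}) (d_z j F)" for j
    using Ck_on_continuous_on[OF Ck_on_d_z(1)[OF op, of 0]] F(1) by simp
  have contp: "continuous_on (- {0}) (p j)" for j by (rule Ck_on_continuous_on[OF p_Ck])
  have "J (\<lambda>w. (\<Sum>j\<in>UNIV. d_z j F w * X j w) * E w + F w * divg X w * E w) =
      J (\<lambda>w. \<Sum>j\<in>UNIV. d_z j (\<lambda>w. F w * X j w * E w) w)"
  proof (rule J_cong)
    fix w :: "complex^'m" assume w: "w \<noteq> 0"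
    have d: "F differentiable (at w)" "X j differentiable (at w)" "E differentiable (at w)" for j
      using Ck_on_differentiable[OF F(1)] Ck_on_differentiable[OF X(1)] E_differentiable w by auto
    have "d_z j (\<lambda>w. F w * X j w * E w) w
        = d_z j F w * X j w * E w + F w * (d_z j (X j) w - p j w * X j w) * E w" for j
      using d by (simp add: d_z_mult d_z_E[OF w] algebra_simps)
    then show "(\<Sum>j\<in>UNIV. d_z j F w * X j w) * E w + F w * divg X w * E w =
      (\<Sum>j\<in>UNIV. d_z j (\<lambda>w. F w * X j w * E w) w)"
      by (simp add: divg_def sum_distrib_left sum_distrib_right sum.distrib)
  qed
  also have "\<dots> = (\<Sum>j\<in>UNIV. J (d_z j (\<lambda>w. F w * X j w * E w)))"
    by (rule J_sum[OF contG])
  also have "\<dots> = 0" by (simp add: J_d_z_eq_0(1)[OF G1 Gh])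
  also have "J (\<lambda>w. (\<Sum>j\<in>UNIV. d_z j F w * X j w) * E w + F w * divg X w * E w) =
      J (\<lambda>w. (\<Sum>j\<in>UNIV. d_z j F w * X j w) * E w) + J (\<lambda>w. F w * divg X w * E w)"
    unfolding divg_def
    by (intro J_add continuous_intros contF contX contE contdX contdF contp)
  finally show ?thesis by (simp add: add_eq_0_iff)
qed

lemma divg_Ck:
  assumes "\<And>j. Ck_on 2 (- {0}) (X j)"
  shows "Ck_on 1 (- {0}) (divg X)"
proof -
  have "Ck_on 1 (- {0}) (d_z j (X j))" for j
    using Ck_on_d_z(1)[OF open_minus_0, of 1] assms[of j] by (simp add: numeral_2_eq_2 del: Ck_on.simps)
  moreover have "Ck_on 1 (- {0}) (X j)" for j by (rule Ck_on_le[OF assms]) simp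
  ultimately show ?thesis
    unfolding divg_def[abs_def]
    by (intro Ck_on_sum Ck_on_diff Ck_on_mult open_minus_0 p_Ck) auto
qed

lemma divg_homogeneous:
  assumes "\<And>j. Ck_on 1 (- {0}) (X j)" "\<And>j. homogeneous d (X j)"
  shows "homogeneous (d - 1) (divg X)"
proof -
  have "homogeneous (d - 1) (d_z j (X j))" for j
    by (rule homogeneous_d_z(1)[OF assms(2)]) (use Ck_on_differentiable[OF assms(1)] in simp)
  moreover have "homogeneous (d - 1) (\<lambda>w. p j w * X j w)" for j
    using homogeneous_mult[OF p_homogeneous assms(2)] by simp
  ultimately show ?thesis
    unfolding divg_def[abs_def] by (intro homogeneous_sum homogeneous_diff)
qed

text \<open>The first-order term \<open>p j\<close> of the divergence is not holomorphic;
  differentiating it produces the complex Hessian \<open>q\<close> of the weight. This commutator is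
  the origin of the curvature term in the Bochner formula.\<close>

lemma d_zbar_divg:
  assumes X: "\<And>j. Ck_on 2 (- {0}) (X j)" and w: "w \<noteq> 0"
  shows "d_zbar k (divg X) w = divg (\<lambda>j. d_zbar k (X j)) w - (\<Sum>j\<in>UNIV. q j k w * X j w)"
proof -
  have dX: "d_z j (X j) differentiable (at w)" "X j differentiable (at w)" for j
  proof -
    have "Ck_on 1 (- {0}) (d_z j (X j))"
      using Ck_on_d_z(1)[OF open_minus_0, of 1] X[of j] by (simp add: numeral_2_eq_2 del: Ck_on.simps)
    then show "d_z j (X j) differentiable (at w)" using Ck_on_differentiable w by blast
    show "X j differentiable (at w)" using Ck_on_differentiable[OF X] w by simp
  qed
  have "d_zbar k (divg X) w = (\<Sum>j\<in>UNIV. d_zbar k (\<lambda>w. d_z j (X j) w - p j w * X j w) w)"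
    unfolding divg_def[abs_def]
    by (rule d_z_sum[THEN conjunct2]) (auto intro!: differentiable_diff differentiable_mult dX p_differentiable w)
  also have "\<dots> = (\<Sum>j\<in>UNIV. d_z j (d_zbar k (X j)) w - (p j w * d_zbar k (X j) w + q j k w * X j w))"
    by (intro sum.cong refl)
      (simp add: d_z_diff d_z_mult dX p_differentiable w differentiable_mult q_def
        d_z_commute(1)[OF open_minus_0 X])
  finally show ?thesis by (simp add: divg_def sum_subtractf sum.distrib)
qed

text \<open>Integrate by parts to move one divergence onto the other, exchange \<open>d_zbar\<close>
  with \<open>divg\<close>, and integrate by parts back. The last term is a trace with transposed
  indices, not a norm; its sign is settled later, for gradients, in
  \<open>grad_trace_nonneg\<close>.\<close>

theorem Bochner_identity:
  assumes X: "\<And>j. Ck_on 2 (- {0}) (X j)" "\<And>j. homogeneous 1 (X j)"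
  shows "Re (J (\<lambda>w. divg X w * cnj (divg X w) * E w)) =
     Re (J (\<lambda>w. (\<Sum>j\<in>UNIV. \<Sum>k\<in>UNIV. q j k w * X j w * cnj (X k w)) * E w))
   + Re (J (\<lambda>w. (\<Sum>k\<in>UNIV. \<Sum>j\<in>UNIV. d_zbar j (X k) w * cnj (d_zbar k (X j) w)) * E w))"
proof -
  note op = open_minus_0
  have X1: "Ck_on 1 (- {0}) (X j)" for j by (rule Ck_on_le[OF X(1)]) simp
  have dX1: "Ck_on 1 (- {0}) (d_zbar k (X j))" for j k
    using Ck_on_d_z(2)[OF op, of 1] X(1)[of j] by (simp add: numeral_2_eq_2 del: Ck_on.simps)
  have dXh: "homogeneous 0 (d_zbar k (X j))" for j k
    using homogeneous_d_z(2)[OF X(2)] Ck_on_differentiable[OF X1] by simp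
  have divg0: "homogeneous 0 (divg X)"
    using divg_homogeneous[OF X1 X(2)] by simp
  have divd: "divg X differentiable (at w)" if "w \<noteq> 0" for w
    using Ck_on_differentiable[OF divg_Ck[OF X(1)]] that by simp
  have Xd: "X j differentiable (at w)" if "w \<noteq> 0" for w j
    using Ck_on_differentiable[OF X1] that by simp
  have contE: "continuous_on (- {0}) E" by (rule Ck_on_continuous_on[OF E_Ck])
  have contX: "continuous_on (- {0}) (X j)" for j by (rule Ck_on_continuous_on[OF X1])
  have contdX: "continuous_on (- {0}) (d_zbar k (X j))" for j k by (rule Ck_on_continuous_on[OF dX1])
  have contddX: "continuous_on (- {0}) (d_z j (d_zbar k (X j)))" for j k
    using Ck_on_continuous_on[OF Ck_on_d_z(1)[OF op, of 0]] dX1[of k j] by simp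
  have contq: "continuous_on (- {0}) (q j k)" for j k by (rule Ck_on_continuous_on[OF q_Ck])
  have contp: "continuous_on (- {0}) (p j)" for j by (rule Ck_on_continuous_on[OF p_Ck])
  have contdiv: "continuous_on (- {0}) (divg (\<lambda>j. d_zbar k (X j)))" for k
    unfolding divg_def[abs_def] by (intro continuous_intros contddX contp contdX)
  let ?A = "\<lambda>k j. d_zbar k (X j)"
  \<comment> \<open>The remaining divergence is that of the field \<open>?A k\<close> of degree 0,
    integrated by parts against \<open>cnj (X k)\<close> of degree 1.\<close>
  have key: "J (\<lambda>w. cnj (divg (?A k) w) * X k w * E w)
      = - J (\<lambda>w. (\<Sum>j\<in>UNIV. d_zbar j (X k) w * cnj (?A k j w)) * E w)" for k
  proof -
    have "J (\<lambda>w. cnj (divg (?A k) w) * X k w * E w) = cnj (J (\<lambda>w. cnj (X k w) * divg (?A k) w * E w))"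
      unfolding J_cnj[symmetric] by (simp add: mult_ac)
    also have "J (\<lambda>w. cnj (X k w) * divg (?A k) w * E w)
        = - J (\<lambda>w. (\<Sum>j\<in>UNIV. d_z j (\<lambda>w. cnj (X k w)) w * ?A k j w) * E w)"
      by (rule J_adjoint[where d=1])
        (use dX1 dXh homogeneous_cnj[OF X(2)] Ck_on_cnj[OF op X1] in auto)
    also have "cnj (- J (\<lambda>w. (\<Sum>j\<in>UNIV. d_z j (\<lambda>w. cnj (X k w)) w * ?A k j w) * E w))
        = - J (\<lambda>w. (\<Sum>j\<in>UNIV. cnj (d_z j (\<lambda>w. cnj (X k w)) w) * cnj (?A k j w)) * E w)"
      by (simp add: J_cnj[symmetric])
    also have "\<dots> = - J (\<lambda>w. (\<Sum>j\<in>UNIV. d_zbar j (X k) w * cnj (?A k j w)) * E w)"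
      by (intro arg_cong[where f=uminus] J_cong) (simp add: d_z_cnj(1)[OF Xd])
    finally show ?thesis .
  qed
  have "J (\<lambda>w. cnj (divg X w) * divg X w * E w) = - J (\<lambda>w. (\<Sum>k\<in>UNIV. d_z k (\<lambda>w. cnj (divg X w)) w * X k w) * E w)"
    by (rule J_adjoint[where d=0])
      (use X1 X(2) homogeneous_cnj[OF divg0] Ck_on_cnj[OF op divg_Ck[OF X(1)]] in auto)
  also have "J (\<lambda>w. (\<Sum>k\<in>UNIV. d_z k (\<lambda>w. cnj (divg X w)) w * X k w) * E w)
    = J (\<lambda>w. (\<Sum>k\<in>UNIV. cnj (divg (?A k) w) * X k w * E w)
        - cnj ((\<Sum>j\<in>UNIV. \<Sum>k\<in>UNIV. q j k w * X j w * cnj (X k w)) * E w))"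
  proof (rule J_cong)
    fix w :: "complex^'m" assume w: "w \<noteq> 0"
    have "(\<Sum>k\<in>UNIV. d_z k (\<lambda>w. cnj (divg X w)) w * X k w)
        = (\<Sum>k\<in>UNIV. cnj (divg (?A k) w - (\<Sum>j\<in>UNIV. q j k w * X j w)) * X k w)"
      by (intro sum.cong refl) (simp only: d_z_cnj(1)[OF divd[OF w]] d_zbar_divg[OF X(1) w])
    also have "\<dots> = (\<Sum>k\<in>UNIV. cnj (divg (?A k) w) * X k w)
        - (\<Sum>k\<in>UNIV. \<Sum>j\<in>UNIV. cnj (q j k w * X j w * cnj (X k w)))"
      by (simp add: left_diff_distrib sum_subtractf sum_distrib_right)
    also have "(\<Sum>k\<in>UNIV. \<Sum>j\<in>UNIV. cnj (q j k w * X j w * cnj (X k w)))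
        = cnj (\<Sum>j\<in>UNIV. \<Sum>k\<in>UNIV. q j k w * X j w * cnj (X k w))"
      by (subst sum.swap) simp
    finally show "(\<Sum>k\<in>UNIV. d_z k (\<lambda>w. cnj (divg X w)) w * X k w) * E w =
      (\<Sum>k\<in>UNIV. cnj (divg (?A k) w) * X k w * E w)
        - cnj ((\<Sum>j\<in>UNIV. \<Sum>k\<in>UNIV. q j k w * X j w * cnj (X k w)) * E w)"
      by (simp add: left_diff_distrib sum_distrib_right)
  qed
  also have "\<dots> = (\<Sum>k\<in>UNIV. J (\<lambda>w. cnj (divg (?A k) w) * X k w * E w))
      - cnj (J (\<lambda>w. (\<Sum>j\<in>UNIV. \<Sum>k\<in>UNIV. q j k w * X j w * cnj (X k w)) * E w))"
  proof -
    have "continuous_on (- {0}) (\<lambda>w. cnj (divg (?A k) w) * X k w * E w)" for k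
      by (intro continuous_intros contdiv contX contE)
    moreover have "continuous_on (- {0}) (\<lambda>w. cnj ((\<Sum>j\<in>UNIV. \<Sum>k\<in>UNIV. q j k w * X j w * cnj (X k w)) * E w))"
      by (intro continuous_intros contq contX contE)
    ultimately show ?thesis
      by (subst J_diff) (simp_all only: J_cnj J_sum continuous_on_sum)
  qed
  also have "(\<Sum>k\<in>UNIV. J (\<lambda>w. cnj (divg (?A k) w) * X k w * E w))
      = (\<Sum>k\<in>UNIV. - J (\<lambda>w. (\<Sum>j\<in>UNIV. d_zbar j (X k) w * cnj (?A k j w)) * E w))"
    by (simp only: key)
  also have "(\<Sum>k\<in>UNIV. - J (\<lambda>w. (\<Sum>j\<in>UNIV. d_zbar j (X k) w * cnj (?A k j w)) * E w))
      = - J (\<lambda>w. (\<Sum>k\<in>UNIV. \<Sum>j\<in>UNIV. d_zbar j (X k) w * cnj (?A k j w)) * E w)"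
    unfolding sum_distrib_right[where r="E w" for w]
    by (subst J_sum) (auto intro!: continuous_intros contdX contE simp: sum_negf sum_distrib_right)
  finally have "J (\<lambda>w. cnj (divg X w) * divg X w * E w) =
     J (\<lambda>w. (\<Sum>k\<in>UNIV. \<Sum>j\<in>UNIV. d_zbar j (X k) w * cnj (?A k j w)) * E w)
   + cnj (J (\<lambda>w. (\<Sum>j\<in>UNIV. \<Sum>k\<in>UNIV. q j k w * X j w * cnj (X k w)) * E w))"
    by simp
  then show ?thesis by (simp add: mult.commute[of "divg X w" for w])
qed

end

section \<open>The weighted Laplacian on invariant functions\<close>

text \<open>Complex homogeneity of nonnegative degree makes \<open>F\<close> holomorphic along the
  punctured line through \<open>w\<close>, so its antiholomorphic radial derivative
  vanishes.\<close>

lemma complex_Euler: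
  fixes F :: "complex^'m \<Rightarrow> complex"
  assumes "F differentiable (at w)" "\<And>c. c \<noteq> 0 \<Longrightarrow> F (c *s w) = c ^ n * F w"
  shows "(\<Sum>j\<in>UNIV. cnj (w $ j) * d_zbar j F w) = 0"
proof -
  have "((\<lambda>c. c *s w) has_derivative (\<lambda>h. h *s w)) (at 1)"
    by (rule bounded_linear_imp_has_derivative[OF bounded_linear_scale_vec])
  from has_derivative_compose[OF this, of F] has_derivative_dd[OF assms(1)]
  have "((\<lambda>c. F (c *s w)) has_derivative (\<lambda>h. dd (h *s w) F w)) (at 1)" by simp
  then have 1: "((\<lambda>c. c ^ n * F w) has_derivative (\<lambda>h. dd (h *s w) F w)) (at 1)"
    by (rule has_derivative_transform_within_open[of _ _ _ _ "- {0}"])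
      (use assms(2) in \<open>auto simp: open_Compl\<close>)
  have "((\<lambda>c. c ^ n * F w) has_field_derivative of_nat n * F w) (at 1)"
    by (auto intro!: derivative_eq_intros)
  then have "((\<lambda>c. c ^ n * F w) has_derivative (*) (of_nat n * F w)) (at 1)"
    by (simp add: has_field_derivative_def)
  from has_derivative_unique[OF 1 this]
  have eq: "dd (h *s w) F w = of_nat n * F w * h" for h by (rule fun_cong)
  \<comment> \<open>Combining the directions \<open>w\<close> and \<i> times \<open>w\<close>
    isolates the antilinear part of the differential.\<close>
  have "2 * (\<Sum>j\<in>UNIV. cnj (w $ j) * d_zbar j F w) = dd (1 *s w) F w + \<i> * dd (\<i> *s w) F w"
    unfolding dd_eq_d_z[OF assms(1)] sum_distrib_left sum.distrib[symmetric]
    by (intro sum.cong refl) (simp add: algebra_simps)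
  also have "\<dots> = 0" unfolding eq by (simp add: algebra_simps)
  finally show ?thesis by simp
qed

text \<open>The affine form covers three cases: invariant functions (\<open>k = 1\<close>,
  \<open>l = 0\<close>), fields of degree one (\<open>k = c\<close>, \<open>l = 0\<close>) and
  weights (\<open>k = 1\<close>, \<open>l\<close> a logarithm).\<close>

lemma d_z_scale:
  fixes F :: "complex^'m \<Rightarrow> complex"
  assumes F: "\<And>w. w \<noteq> 0 \<Longrightarrow> F (c *s w) = k * F w + l"
    and d: "\<And>w. w \<noteq> 0 \<Longrightarrow> F differentiable (at w)" and c: "c \<noteq> 0" and w: "w \<noteq> 0"
  shows "c * d_z j F (c *s w) = k * d_z j F w" "cnj c * d_zbar j F (c *s w) = k * d_zbar j F w"
proof -
  have cw: "c *s w \<noteq> 0" using c w by simp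
  have lin: "bounded_linear (\<lambda>w::complex^'m. c *s w)"
    by (rule linear_conv_bounded_linear[THEN iffD1]) (auto intro!: linearI simp: vec_eq_iff algebra_simps)
  from has_derivative_compose[OF bounded_linear_imp_has_derivative[OF this] has_derivative_dd[OF d[OF cw]]]
  have "((\<lambda>w. F (c *s w)) has_derivative (\<lambda>a. dd (c *s a) F (c *s w))) (at w)" .
  then have 1: "((\<lambda>w. k * F w + l) has_derivative (\<lambda>a. dd (c *s a) F (c *s w))) (at w)"
    by (rule has_derivative_transform_within_open[of _ _ _ _ "- {0}"])
      (use F w in \<open>auto simp: open_Compl\<close>)
  have 2: "((\<lambda>w. k * F w + l) has_derivative (\<lambda>a. k * dd a F w)) (at w)"
    by (rule has_derivative_add_const[OF has_derivative_mult_right[OF has_derivative_dd[OF d[OF w]]]])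
  have eq: "k * dd a F w = dd (c *s a) F (c *s w)" for a
    using has_derivative_unique[OF 2 1] by (rule fun_cong)
  have ax: "dd (c *s axis j a) F (c *s w) = c * a * d_z j F (c *s w) + cnj (c * a) * d_zbar j F (c *s w)" for a
  proof -
    have "dd (c *s axis j a) F (c *s w) = (\<Sum>k\<in>UNIV. if k = j then
        c * a * d_z j F (c *s w) + cnj (c * a) * d_zbar j F (c *s w) else 0)"
      unfolding dd_eq_d_z[OF d[OF cw]] by (intro sum.cong refl) (auto simp: axis_def)
    then show ?thesis by simp
  qed
  have "2 * (k * d_z j F w) = k * dd (axis j 1) F w - \<i> * (k * dd (axis j \<i>) F w)"
    "2 * (k * d_zbar j F w) = k * dd (axis j 1) F w + \<i> * (k * dd (axis j \<i>) F w)"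
    by (simp_all add: d_z_def d_zbar_def field_simps)
  then show "c * d_z j F (c *s w) = k * d_z j F w" "cnj c * d_zbar j F (c *s w) = k * d_zbar j F w"
    unfolding eq ax by (simp_all add: algebra_simps)
qed

lemma d_zbar_invariant:
  fixes v :: "complex^'m \<Rightarrow> complex"
  assumes v: "\<And>c w. c \<noteq> 0 \<Longrightarrow> w \<noteq> 0 \<Longrightarrow> v (c *s w) = v w"
    and d: "\<And>w. w \<noteq> 0 \<Longrightarrow> v differentiable (at w)" and c: "c \<noteq> 0" and w: "w \<noteq> 0"
  shows "cnj c * d_zbar j v (c *s w) = d_zbar j v w"
  using d_z_scale(2)[of v c 1 0 w j, OF _ d c w] v[OF c] by simp

section \<open>Functions on projective space and their lifted gradients\<close>

definition invariant :: "(complex^'m \<Rightarrow> complex) \<Rightarrow> bool" where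
  "invariant v \<longleftrightarrow> (\<forall>c w. c \<noteq> 0 \<longrightarrow> w \<noteq> 0 \<longrightarrow> v (c *s w) = v w)"

text \<open>Three derivatives, because \<open>grad v\<close> must be of class C^2 for
  \<open>Bochner_identity\<close>.\<close>

definition test_fun :: "(complex^'m \<Rightarrow> complex) \<Rightarrow> bool" where
  "test_fun v \<longleftrightarrow> Ck_on 3 (- {0}) v \<and> invariant v"

lemma invariantD: "invariant v \<Longrightarrow> c \<noteq> 0 \<Longrightarrow> w \<noteq> 0 \<Longrightarrow> v (c *s w) = v w"
  by (simp add: invariant_def)

lemma scaleR_vec_conv: "r *\<^sub>R (w::complex^'m) = complex_of_real r *s w"
  by (simp add: vec_eq_iff) (simp add: scaleR_conv_of_real)

lemma invariant_homogeneous: "invariant v \<Longrightarrow> homogeneous 0 v"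
  by (simp add: homogeneous_def scaleR_vec_conv invariantD)

definition sq :: "complex^'m \<Rightarrow> complex" where
  "sq w = of_real (w \<bullet> w)"

lemma sq_eq_sum: "sq w = (\<Sum>k\<in>UNIV. w $ k * cnj (w $ k))"
  by (simp add: sq_def inner_vec_def complex_mult_cnj cmod_power2 flip: power2_norm_eq_inner)

lemma sq_Ck: "open S \<Longrightarrow> Ck_on k S sq"
  unfolding sq_def[abs_def] by (rule Ck_on_of_real[OF _ Ck_on_inner_self])

lemma sq_differentiable [simp]: "sq differentiable (at w)"
  using Ck_on_differentiable[OF sq_Ck[of UNIV 1]] by simp

lemma d_z_sq:
  fixes w :: "complex^'a"
  shows "d_z j sq w = cnj (w $ j)" "d_zbar j sq w = w $ j"
proof -
  have eq: "sq = (\<lambda>w. \<Sum>k\<in>UNIV. w $ k * cnj (w $ k))" by (rule ext) (rule sq_eq_sum)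
  have d: "(\<lambda>w. w $ k * cnj (w $ k)) differentiable (at w)" for k :: 'a
    by (intro differentiable_mult) simp_all
  have "d_z j (\<lambda>w. w $ k * cnj (w $ k)) w = (if k = j then cnj (w $ j) else 0)"
    "d_zbar j (\<lambda>w. w $ k * cnj (w $ k)) w = (if k = j then w $ j else 0)" for k
    by (auto simp: d_z_mult)
  with d_z_sum[of UNIV "\<lambda>k w. (w::complex^'a) $ k * cnj (w $ k)" w j] d
  show "d_z j sq w = cnj (w $ j)" "d_zbar j sq w = w $ j"
    unfolding eq by auto
qed

lemma sq_scale: "sq (c *s w) = c * cnj c * sq w"
  by (simp add: sq_eq_sum sum_distrib_left algebra_simps)

lemma sq_ne_0: "w \<noteq> 0 \<Longrightarrow> sq w \<noteq> 0"
  by (simp add: sq_def)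

lemma cnj_sq [simp]: "cnj (sq w) = sq w"
  by (simp add: sq_def)

text \<open>The lift to degree one of the Fubini-Study gradient of \<open>v\<close>.\<close>

definition grad :: "(complex^'m \<Rightarrow> complex) \<Rightarrow> 'm \<Rightarrow> complex^'m \<Rightarrow> complex" where
  "grad v j w = sq w * d_zbar j v w"

lemma test_fun_Ck: "test_fun v \<Longrightarrow> k \<le> 3 \<Longrightarrow> Ck_on k (- {0}) v"
  unfolding test_fun_def using Ck_on_le by blast

lemma test_fun_differentiable: "test_fun v \<Longrightarrow> w \<noteq> 0 \<Longrightarrow> v differentiable (at w)"
  using Ck_on_differentiable[OF test_fun_Ck[of v 1]] by simp

lemma d_zbar_test_fun_Ck: "test_fun v \<Longrightarrow> Ck_on 2 (- {0}) (d_zbar j v)"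
  using Ck_on_d_z(2)[OF open_minus_0, of 2 v j] test_fun_Ck[of v 3]
  by (simp add: numeral_3_eq_3 numeral_2_eq_2 del: Ck_on.simps)

lemma grad_Ck: "test_fun v \<Longrightarrow> Ck_on 2 (- {0}) (grad v j)"
  unfolding grad_def[abs_def]
  by (rule Ck_on_mult[OF open_minus_0 sq_Ck[OF open_minus_0] d_zbar_test_fun_Ck])

lemma grad_scale:
  assumes "test_fun v" "c \<noteq> 0" "w \<noteq> 0"
  shows "grad v j (c *s w) = c * grad v j w"
proof -
  have "cnj c * d_zbar j v (c *s w) = d_zbar j v w"
    using assms by (intro d_zbar_invariant test_fun_differentiable) (auto simp: test_fun_def invariantD)
  then show ?thesis by (simp add: grad_def sq_scale)
qed

lemma grad_homogeneous: "test_fun v \<Longrightarrow> homogeneous 1 (grad v j)"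
  by (simp add: homogeneous_def scaleR_vec_conv grad_scale)

text \<open>Invariance kills the antiholomorphic radial derivative. The gradient is thus orthogonal
  to the radial direction, in which the Levi form of a weight degenerates.\<close>

lemma grad_orthogonal:
  assumes "test_fun v" "w \<noteq> 0"
  shows "(\<Sum>j\<in>UNIV. cnj (w $ j) * grad v j w) = 0"
proof -
  have "(\<Sum>j\<in>UNIV. cnj (w $ j) * d_zbar j v w) = 0"
    by (rule complex_Euler[where n=0]) (use assms in \<open>auto simp: test_fun_def invariantD test_fun_differentiable\<close>)
  moreover have "(\<Sum>j\<in>UNIV. cnj (w $ j) * grad v j w) = sq w * (\<Sum>j\<in>UNIV. cnj (w $ j) * d_zbar j v w)"
    by (simp add: grad_def sum_distrib_left algebra_simps)
  ultimately show ?thesis by simp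
qed

lemma grad_add:
  assumes "test_fun u" "test_fun v" "w \<noteq> 0"
  shows "grad (\<lambda>w. u w + v w) j w = grad u j w + grad v j w"
  using assms by (simp add: grad_def d_z_add test_fun_differentiable distrib_left)

lemma grad_cmult:
  assumes "test_fun v" "w \<noteq> 0"
  shows "grad (\<lambda>w. c * v w) j w = c * grad v j w"
  using assms by (simp add: grad_def d_z_cmult test_fun_differentiable)

text \<open>Symmetrising \<open>d_zbar j (grad v k)\<close> by a multiple of \<open>w\<close> turns the trace into a sum of squares;
  the correction terms vanish because \<open>grad v\<close> is homogeneous and orthogonal to \<open>w\<close>.\<close>

lemma grad_trace_nonneg:
  assumes v: "test_fun v" and w: "w \<noteq> 0"
  shows "Re (\<Sum>k\<in>UNIV. \<Sum>j\<in>UNIV. d_zbar j (grad v k) w * cnj (d_zbar k (grad v j) w)) \<ge> 0"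
proof -
  define B where "B k j = d_zbar j (grad v k) w" for k j
  define b where "b j = d_zbar j v w" for j
  \<comment> \<open>\<open>T k j\<close> is \<open>sq w\<close> times a second derivative plus
    \<open>w $ j * b k + w $ k * b j\<close>, which is symmetric in \<open>k\<close> and
    \<open>j\<close>.\<close>
  define T where "T k j = B k j + w $ k * b j" for k j
  have dd: "d_zbar k v differentiable (at w)" for k
    using Ck_on_differentiable[OF d_zbar_test_fun_Ck[OF v]] w by simp
  have B: "B k j = w $ j * b k + sq w * d_zbar j (d_zbar k v) w" for k j
    unfolding B_def grad_def[abs_def] b_def by (simp add: d_z_mult dd d_z_sq)
  have symT: "T k j = T j k" for k j
    unfolding T_def B using d_z_commute(3)[OF open_minus_0 test_fun_Ck[OF v], of w j k] w by simp
  have Bw: "(\<Sum>j\<in>UNIV. cnj (w $ j) * B k j) = 0" for k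
    unfolding B_def
    by (rule complex_Euler[where n=1])
      (use Ck_on_differentiable[OF grad_Ck[OF v]] grad_scale[OF v] w in auto)
  have bw: "(\<Sum>j\<in>UNIV. cnj (w $ j) * b j) = 0"
    unfolding b_def
    by (rule complex_Euler[where n=0]) (use v w in \<open>auto simp: test_fun_def invariantD test_fun_differentiable\<close>)
  have "(\<Sum>k\<in>UNIV. \<Sum>j\<in>UNIV. T k j * cnj (T j k)) =
     (\<Sum>k\<in>UNIV. \<Sum>j\<in>UNIV. B k j * cnj (B j k))
   + (\<Sum>k\<in>UNIV. \<Sum>j\<in>UNIV. cnj (b k) * (cnj (w $ j) * B k j))
   + (\<Sum>k\<in>UNIV. \<Sum>j\<in>UNIV. b j * (w $ k * cnj (B j k)))
   + (\<Sum>k\<in>UNIV. \<Sum>j\<in>UNIV. (w $ k * cnj (b k)) * (cnj (w $ j) * b j))"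
    unfolding sum.distrib[symmetric] T_def by (intro sum.cong refl) (simp add: algebra_simps)
  also have "(\<Sum>k\<in>UNIV. \<Sum>j\<in>UNIV. cnj (b k) * (cnj (w $ j) * B k j)) = 0"
    by (simp add: Bw flip: sum_distrib_left)
  also have "(\<Sum>k\<in>UNIV. \<Sum>j\<in>UNIV. b j * (w $ k * cnj (B j k))) =
      cnj (\<Sum>k\<in>UNIV. \<Sum>j\<in>UNIV. cnj (b k) * (cnj (w $ j) * B k j))"
    by (subst sum.swap) (simp add: algebra_simps)
  also have "(\<Sum>k\<in>UNIV. \<Sum>j\<in>UNIV. cnj (b k) * (cnj (w $ j) * B k j)) = 0"
    by (simp add: Bw flip: sum_distrib_left)
  also have "(\<Sum>k\<in>UNIV. \<Sum>j\<in>UNIV. (w $ k * cnj (b k)) * (cnj (w $ j) * b j)) = 0"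
    by (simp add: bw flip: sum_distrib_left)
  finally have "(\<Sum>k\<in>UNIV. \<Sum>j\<in>UNIV. B k j * cnj (B j k)) = (\<Sum>k\<in>UNIV. \<Sum>j\<in>UNIV. T k j * cnj (T k j))"
    using symT by (simp add: symT)
  also have "Re \<dots> \<ge> 0" by (auto simp: complex_mult_cnj intro!: sum_nonneg)
  finally show ?thesis by (simp add: B_def)
qed

lemma test_fun_add: "test_fun u \<Longrightarrow> test_fun v \<Longrightarrow> test_fun (\<lambda>w. u w + v w)"
  by (simp add: test_fun_def Ck_on_add[OF open_minus_0] invariant_def del: Ck_on.simps)

lemma test_fun_cmult: "test_fun v \<Longrightarrow> test_fun (\<lambda>w. c * v w)"
  by (simp add: test_fun_def Ck_on_mult[OF open_minus_0] invariant_def del: Ck_on.simps)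

lemma test_fun_const: "test_fun (\<lambda>w. c)"
  by (simp add: test_fun_def invariant_def)

section \<open>The weighted Laplacian and its Bochner estimate\<close>

context log_weight begin

lemma contE: "continuous_on (- {0}) E" by (rule Ck_on_continuous_on[OF E_Ck])
lemma contp: "continuous_on (- {0}) (p j)" by (rule Ck_on_continuous_on[OF p_Ck])
lemma contq: "continuous_on (- {0}) (q j k)" by (rule Ck_on_continuous_on[OF q_Ck])

definition levi :: "complex^'m \<Rightarrow> ('m \<Rightarrow> complex) \<Rightarrow> complex" where
  "levi w X = (\<Sum>j\<in>UNIV. \<Sum>k\<in>UNIV. q j k w * X j * cnj (X k))"

text \<open>Only the divergence depends on the weight, the gradient being always that of the
  Fubini-Study metric; a change of weight therefore changes \<open>L\<close> by a first-order
  operator.\<close>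

definition L :: "(complex^'m \<Rightarrow> complex) \<Rightarrow> complex^'m \<Rightarrow> complex" where
  "L v = divg (grad v)"

lemma cont_grad: "test_fun v \<Longrightarrow> continuous_on (- {0}) (grad v j)"
  using Ck_on_continuous_on[OF grad_Ck] .

lemma cont_L: "test_fun v \<Longrightarrow> continuous_on (- {0}) (L v)"
  unfolding L_def by (rule Ck_on_continuous_on[OF divg_Ck[OF grad_Ck]])

lemma cont_levi: "test_fun v \<Longrightarrow> continuous_on (- {0}) (\<lambda>w. levi w (\<lambda>j. grad v j w))"
  unfolding levi_def by (intro continuous_intros contq cont_grad)

text \<open>The trace term of \<open>Bochner_identity\<close> is dropped, since it is nonnegative
  for a gradient.\<close>

lemma L_Bochner:
  assumes v: "test_fun v"
  shows "Re (J (\<lambda>w. levi w (\<lambda>j. grad v j w) * E w)) \<le> Re (J (\<lambda>w. L v w * cnj (L v w) * E w))"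
proof -
  let ?t = "\<lambda>w. (\<Sum>k\<in>UNIV. \<Sum>j\<in>UNIV. d_zbar j (grad v k) w * cnj (d_zbar k (grad v j) w)) * E w"
  have c: "continuous_on (- {0}) (d_zbar j (grad v k))" for j k
    using Ck_on_continuous_on[OF Ck_on_d_z(2)[OF open_minus_0, of 1 "grad v k"]] grad_Ck[OF v, of k]
    by (simp add: numeral_2_eq_2 del: Ck_on.simps)
  have "Re (J (\<lambda>w::complex^'m. 0)) \<le> Re (J ?t)"
  proof (rule Re_J_mono)
    show "continuous_on (- {0}) ?t" by (intro continuous_intros c contE)
    fix w :: "complex^'m" assume "1 \<le> norm w"
    then have "w \<noteq> 0" by auto
    then show "Re 0 \<le> Re (?t w)" using grad_trace_nonneg[OF v] by (simp add: E_def)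
  qed simp
  then have "0 \<le> Re (J ?t)" by (simp add: J_def)
  then show ?thesis
    using Bochner_identity[of "grad v", OF grad_Ck[OF v] grad_homogeneous[OF v]]
    by (simp add: levi_def L_def)
qed

lemma J_L_adjoint:
  assumes v: "test_fun v" and f: "Ck_on 1 (- {0}) f" "homogeneous 0 f"
  shows "J (\<lambda>w. f w * cnj (L v w) * E w) = - J (\<lambda>w. (\<Sum>j\<in>UNIV. d_zbar j f w * cnj (grad v j w)) * E w)"
proof -
  have "J (\<lambda>w. f w * cnj (L v w) * E w) = cnj (J (\<lambda>w. cnj (f w) * L v w * E w))"
    by (simp add: J_cnj[symmetric])
  also have "J (\<lambda>w. cnj (f w) * L v w * E w) = - J (\<lambda>w. (\<Sum>j\<in>UNIV. d_z j (\<lambda>w. cnj (f w)) w * grad v j w) * E w)"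
    unfolding L_def
    by (rule J_adjoint[where d=0])
      (use grad_homogeneous[OF v] Ck_on_le[OF grad_Ck[OF v], of 1] homogeneous_cnj[OF f(2)]
        Ck_on_cnj[OF open_minus_0 f(1)] in auto)
  also have "cnj \<dots> = - J (\<lambda>w. (\<Sum>j\<in>UNIV. cnj (d_z j (\<lambda>w. cnj (f w)) w) * cnj (grad v j w)) * E w)"
    by (simp add: J_cnj[symmetric])
  also have "\<dots> = - J (\<lambda>w. (\<Sum>j\<in>UNIV. d_zbar j f w * cnj (grad v j w)) * E w)"
    using Ck_on_differentiable[OF f(1)]
    by (intro arg_cong[where f=uminus] J_cong) (simp add: d_z_cnj)
  finally show ?thesis .
qed

text \<open>Integration by parts against the constant 1. The range of \<open>L\<close> is orthogonal
  to the constants, which is why density of the range can be claimed only after adding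
  constants.\<close>

lemma J_L_eq_0:
  assumes v: "test_fun v"
  shows "J (\<lambda>w. cnj (L v w) * E w) = 0" "J (\<lambda>w. L v w * E w) = 0"
proof -
  show 0: "J (\<lambda>w. cnj (L v w) * E w) = 0"
    using J_L_adjoint[OF v Ck_on_const homogeneous_const, of 1] by (simp add: J_def)
  have "J (\<lambda>w. L v w * E w) = cnj (J (\<lambda>w. cnj (L v w) * E w))"
    by (simp add: J_cnj[symmetric])
  then show "J (\<lambda>w. L v w * E w) = 0" using 0 by simp
qed

lemma p_scale:
  assumes "c \<noteq> 0" "w \<noteq> 0"
  shows "c * p j (c *s w) = p j w"
  unfolding p_def using d_z_scale(1)[of "\<lambda>w. complex_of_real (\<psi> w)" c 1 "of_real (2 * CARD('m) * ln (cmod c))" w j]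
    psi_scale[OF assms(1)] psi_differentiable assms by simp

text \<open>Serves the iteration in \<open>dense_range_perturb\<close>, where a residual must again
  be an invariant function.\<close>

lemma L_invariant:
  assumes v: "test_fun v"
  shows "invariant (L v)"
  unfolding invariant_def
proof (intro allI impI)
  fix c :: complex and w :: "complex^'m" assume cw: "c \<noteq> 0" "w \<noteq> 0"
  have "c * d_z j (grad v j) (c *s w) = c * d_z j (grad v j) w" for j
    by (rule d_z_scale(1)[where l=0])
      (use grad_scale[OF v] Ck_on_differentiable[OF grad_Ck[OF v]] cw in auto)
  moreover have "p j (c *s w) * grad v j (c *s w) = p j w * grad v j w" for j
    using grad_scale[OF v cw, of j] p_scale[OF cw, of j] by (metis mult.assoc mult.commute)
  ultimately show "L v (c *s w) = L v w"
    using cw by (simp add: L_def divg_def)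
qed

lemma L_add:
  assumes "test_fun u" "test_fun v" "w \<noteq> 0"
  shows "L (\<lambda>w. u w + v w) w = L u w + L v w"
proof -
  have d: "grad u j differentiable (at w)" "grad v j differentiable (at w)" for j
    using Ck_on_differentiable[OF grad_Ck] assms by auto
  have "d_z j (grad (\<lambda>w. u w + v w) j) w = d_z j (\<lambda>w. grad u j w + grad v j w) w" for j
    by (rule d_z_cong(1)[OF open_minus_0]) (use assms grad_add in auto)
  then show ?thesis
    using assms by (simp add: L_def divg_def grad_add d_z_add d sum.distrib[symmetric] algebra_simps)
qed

lemma L_cmult:
  assumes "test_fun v" "w \<noteq> 0"
  shows "L (\<lambda>w. c * v w) w = c * L v w"
proof -
  have d: "grad v j differentiable (at w)" for j
    using Ck_on_differentiable[OF grad_Ck] assms by auto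
  have "d_z j (grad (\<lambda>w. c * v w) j) w = d_z j (\<lambda>w. c * grad v j w) w" for j
    by (rule d_z_cong(1)[OF open_minus_0]) (use assms grad_cmult in auto)
  then show ?thesis
    using assms by (simp add: L_def divg_def grad_cmult d_z_cmult d sum_distrib_left algebra_simps)
qed

text \<open>Pythagoras: a function whose mean with weight \<open>E\<close> is zero is orthogonal to
  the constants.\<close>

lemma Re_J_square_add_const:
  assumes "continuous_on (- {0}) u" "J (\<lambda>w. u w * E w) = 0"
  shows "Re (J (\<lambda>w. (u w + c) * cnj (u w + c) * E w)) =
    Re (J (\<lambda>w. u w * cnj (u w) * E w)) + (cmod c)\<^sup>2 * Re (J E)"
proof -
  note [continuous_intros] = assms(1) contE
  have "J (\<lambda>w. cnj (u w) * E w) = 0"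
    using assms(2) J_cnj[of "\<lambda>w. u w * E w"] by simp
  moreover have "J (\<lambda>w. (u w + c) * cnj (u w + c) * E w) =
      J (\<lambda>w. u w * cnj (u w) * E w + (cnj c * (u w * E w) + (c * (cnj (u w) * E w) + (c * cnj c) * E w)))"
    by (simp add: algebra_simps)
  moreover have "\<dots> = J (\<lambda>w. u w * cnj (u w) * E w) + (cnj c * J (\<lambda>w. u w * E w)
      + (c * J (\<lambda>w. cnj (u w) * E w) + (c * cnj c) * J E))"
    unfolding J_cmult[symmetric]
    by (subst J_add, (intro continuous_intros)+)+ simp
  ultimately show ?thesis
    using assms(2) by (simp add: complex_mult_cnj cmod_power2 flip: of_real_power)
qed

end

section \<open>The Fubini-Study weight\<close>

text \<open>Polynomials of bidegree \<open>(a, b)\<close> in \<open>w\<close> and its conjugate,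
  generated so that derivatives and Euler's identities follow by rule induction. Zero belongs to
  every bidegree, so that derivatives which vanish keep a bidegree.\<close>

inductive bihom :: "nat \<Rightarrow> nat \<Rightarrow> (complex^'m \<Rightarrow> complex) \<Rightarrow> bool" where
  bihom_zero: "bihom a b (\<lambda>w. 0)"
| bihom_const: "bihom 0 0 (\<lambda>w. c)"
| bihom_add: "bihom a b P \<Longrightarrow> bihom a b Q \<Longrightarrow> bihom a b (\<lambda>w. P w + Q w)"
| bihom_nth: "bihom a b P \<Longrightarrow> bihom (Suc a) b (\<lambda>w. w $ j * P w)"
| bihom_cnj_nth: "bihom a b P \<Longrightarrow> bihom a (Suc b) (\<lambda>w. cnj (w $ j) * P w)"

lemma bihom_cmult: "bihom a b P \<Longrightarrow> bihom a b (\<lambda>w. c * P w)"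
proof (induction rule: bihom.induct)
  case (bihom_nth a b P j)
  then show ?case using bihom.bihom_nth[of a b "\<lambda>w. c * P w" j] by (simp add: mult.left_commute)
next
  case (bihom_cnj_nth a b P j)
  then show ?case using bihom.bihom_cnj_nth[of a b "\<lambda>w. c * P w" j] by (simp add: mult.left_commute)
qed (auto simp: distrib_left intro: bihom.intros)

lemma bihom_mult: "bihom a b P \<Longrightarrow> bihom c d Q \<Longrightarrow> bihom (a + c) (b + d) (\<lambda>w. P w * Q w)"
  by (induction rule: bihom.induct)
    (auto simp: distrib_right mult.assoc intro: bihom.intros bihom_cmult)

lemma bihom_sum: "(\<And>i. i \<in> I \<Longrightarrow> bihom a b (P i)) \<Longrightarrow> bihom a b (\<lambda>w. \<Sum>i\<in>I. P i w)"
  by (induction I rule: infinite_finite_induct) (auto intro: bihom.intros)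

lemma bihom_sq: "bihom 1 1 (sq :: complex^'m \<Rightarrow> complex)"
proof -
  have "bihom (Suc 0) (Suc 0) (\<lambda>w. w $ k * (cnj (w $ k) * 1))" for k :: 'm
    by (intro bihom.intros)
  then have "bihom 1 1 (\<lambda>w. \<Sum>k\<in>UNIV. w $ k * cnj ((w::complex^'m) $ k))"
    by (intro bihom_sum) simp
  then show ?thesis by (simp add: sq_eq_sum[abs_def])
qed

lemma bihom_sq_power: "bihom k k (\<lambda>w. sq w ^ k)"
proof (induction k)
  case (Suc k)
  then show ?case using bihom_mult[OF bihom_sq Suc] by simp
qed (auto intro: bihom_const)

lemma bihom_Ck: "bihom a b P \<Longrightarrow> Ck_on k UNIV P"
proof (induction rule: bihom.induct)
  case (bihom_nth a b P j)
  show ?case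
    by (rule Ck_on_mult[OF open_UNIV Ck_on_linear[OF open_UNIV bounded_linear_vec_nth] bihom_nth.IH])
next
  case (bihom_cnj_nth a b P j)
  show ?case
    by (rule Ck_on_mult[OF open_UNIV Ck_on_cnj[OF open_UNIV Ck_on_linear[OF open_UNIV bounded_linear_vec_nth]]
          bihom_cnj_nth.IH])
qed (auto intro: Ck_on_add)

lemma bihom_differentiable: "bihom a b P \<Longrightarrow> P differentiable (at w)"
  using Ck_on_differentiable[OF bihom_Ck[where k=1]] by simp

lemma bihom_scale: "bihom a b P \<Longrightarrow> P (c *s w) = c ^ a * cnj c ^ b * P w"
  by (induction rule: bihom.induct) (auto simp: algebra_simps)

lemma bihom_0_0: "bihom a b P \<Longrightarrow> a = 0 \<Longrightarrow> b = 0 \<Longrightarrow> \<exists>c. P = (\<lambda>w. c)"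
  by (induction rule: bihom.induct) auto

text \<open>The case distinction on the degree stands in for a negative bidegree: in degree 0 the
  derivative vanishes.\<close>

lemma bihom_d_z:
  "bihom a b P \<Longrightarrow> (a = 0 \<longrightarrow> (\<forall>w. d_z i P w = 0)) \<and> (\<forall>a'. a = Suc a' \<longrightarrow> bihom a' b (d_z i P))"
proof (induction rule: bihom.induct)
  case (bihom_add a b P Q)
  have "d_z i (\<lambda>w. P w + Q w) = (\<lambda>w. d_z i P w + d_z i Q w)"
    using bihom_add.hyps by (simp add: fun_eq_iff d_z_add bihom_differentiable)
  then show ?case using bihom_add.IH by (auto intro: bihom.intros)
next
  case (bihom_nth a b P j)
  have "d_z i (\<lambda>w. w $ j * P w) = (\<lambda>w. w $ j * d_z i P w + of_bool (i = j) * P w)"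
    using bihom_nth.hyps by (simp add: fun_eq_iff d_z_mult bihom_differentiable)
  moreover have "bihom a b (\<lambda>w. w $ j * d_z i P w)"
    using bihom_nth.IH by (cases a) (auto intro: bihom.intros)
  ultimately show ?case using bihom_nth.hyps by (auto intro: bihom.intros bihom_cmult)
next
  case (bihom_cnj_nth a b P j)
  have "d_z i (\<lambda>w. cnj (w $ j) * P w) = (\<lambda>w. cnj (w $ j) * d_z i P w)"
    using bihom_cnj_nth.hyps by (simp add: fun_eq_iff d_z_mult bihom_differentiable)
  then show ?case using bihom_cnj_nth.IH by (auto intro: bihom.intros)
qed (auto simp: d_z_const[abs_def] intro: bihom.intros)

lemma bihom_d_zbar:
  "bihom a b P \<Longrightarrow> (b = 0 \<longrightarrow> (\<forall>w. d_zbar i P w = 0)) \<and> (\<forall>b'. b = Suc b' \<longrightarrow> bihom a b' (d_zbar i P))"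
proof (induction rule: bihom.induct)
  case (bihom_add a b P Q)
  have "d_zbar i (\<lambda>w. P w + Q w) = (\<lambda>w. d_zbar i P w + d_zbar i Q w)"
    using bihom_add.hyps by (simp add: fun_eq_iff d_z_add bihom_differentiable)
  then show ?case using bihom_add.IH by (auto intro: bihom.intros)
next
  case (bihom_cnj_nth a b P j)
  have "d_zbar i (\<lambda>w. cnj (w $ j) * P w) = (\<lambda>w. cnj (w $ j) * d_zbar i P w + of_bool (i = j) * P w)"
    using bihom_cnj_nth.hyps by (simp add: fun_eq_iff d_z_mult bihom_differentiable)
  moreover have "bihom a b (\<lambda>w. cnj (w $ j) * d_zbar i P w)"
    using bihom_cnj_nth.IH by (cases b) (auto intro: bihom.intros)
  ultimately show ?case using bihom_cnj_nth.hyps by (auto intro: bihom.intros bihom_cmult)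
next
  case (bihom_nth a b P j)
  have "d_zbar i (\<lambda>w. w $ j * P w) = (\<lambda>w. w $ j * d_zbar i P w)"
    using bihom_nth.hyps by (simp add: fun_eq_iff d_z_mult bihom_differentiable)
  then show ?case using bihom_nth.IH by (auto intro: bihom.intros)
qed (auto simp: d_z_const[abs_def] intro: bihom.intros)

lemma bihom_Euler:
  fixes P :: "complex^'m \<Rightarrow> complex"
  assumes "bihom a b P"
  shows "(\<Sum>i\<in>UNIV. w $ i * d_z i P w) = of_nat a * P w \<and> (\<Sum>i\<in>UNIV. cnj (w $ i) * d_zbar i P w) = of_nat b * P w"
  using assms
proof (induction rule: bihom.induct)
  case (bihom_add a b P Q)
  then show ?case
    by (simp add: d_z_add bihom_differentiable distrib_left sum.distrib)
next
  case (bihom_nth a b P j)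
  have "(\<Sum>i\<in>UNIV. w $ i * d_z i (\<lambda>w. w $ j * P w) w)
      = w $ j * (\<Sum>i\<in>UNIV. w $ i * d_z i P w) + (\<Sum>i\<in>UNIV. if i = j then w $ j * P w else 0)"
    unfolding sum_distrib_left sum.distrib[symmetric] using bihom_nth.hyps
    by (intro sum.cong refl) (simp add: d_z_mult bihom_differentiable algebra_simps)
  moreover have "(\<Sum>i\<in>UNIV. cnj (w $ i) * d_zbar i (\<lambda>w. w $ j * P w) w)
      = w $ j * (\<Sum>i\<in>UNIV. cnj (w $ i) * d_zbar i P w)"
    unfolding sum_distrib_left using bihom_nth.hyps
    by (intro sum.cong refl) (simp add: d_z_mult bihom_differentiable algebra_simps)
  ultimately show ?case using bihom_nth.IH by (simp add: algebra_simps)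
next
  case (bihom_cnj_nth a b P j)
  have "(\<Sum>i\<in>UNIV. cnj (w $ i) * d_zbar i (\<lambda>w. cnj (w $ j) * P w) w)
      = cnj (w $ j) * (\<Sum>i\<in>UNIV. cnj (w $ i) * d_zbar i P w) + (\<Sum>i\<in>UNIV. if i = j then cnj (w $ j) * P w else 0)"
    unfolding sum_distrib_left sum.distrib[symmetric] using bihom_cnj_nth.hyps
    by (intro sum.cong refl) (simp add: d_z_mult bihom_differentiable algebra_simps)
  moreover have "(\<Sum>i\<in>UNIV. w $ i * d_z i (\<lambda>w. cnj (w $ j) * P w) w)
      = cnj (w $ j) * (\<Sum>i\<in>UNIV. w $ i * d_z i P w)"
    unfolding sum_distrib_left using bihom_cnj_nth.hyps
    by (intro sum.cong refl) (simp add: d_z_mult bihom_differentiable algebra_simps)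
  ultimately show ?case using bihom_cnj_nth.IH by (simp add: algebra_simps)
qed auto

definition fs_fun :: "nat \<Rightarrow> (complex^'m \<Rightarrow> complex) \<Rightarrow> complex^'m \<Rightarrow> complex" where
  "fs_fun k P w = P w * inverse (sq w) ^ k"

lemma inverse_sq_Ck: "Ck_on k (- {0}) (\<lambda>w. inverse (sq w))"
proof -
  have "Ck_on k (- {0}) (\<lambda>w::complex^'a. complex_of_real (inverse (w \<bullet> w)))"
    by (rule Ck_on_of_real[OF open_minus_0 Ck_on_inverse_inner_self])
  then show ?thesis by (simp add: sq_def of_real_inverse)
qed

lemma d_z_inverse_sq_power:
  fixes w :: "complex^'m"
  assumes w: "w \<noteq> 0"
  shows "d_z j (\<lambda>w. inverse (sq w) ^ k) w = - of_nat k * cnj (w $ j) * inverse (sq w) ^ Suc k"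
    "d_zbar j (\<lambda>w. inverse (sq w) ^ k) w = - of_nat k * (w $ j) * inverse (sq w) ^ Suc k"
proof -
  have d: "((\<lambda>x. inverse x ^ k) has_real_derivative - of_nat k * inverse (w \<bullet> w) ^ Suc k) (at (w \<bullet> w))"
    using DERIV_power[OF DERIV_inverse[of "w \<bullet> w"], of k] w by (cases k) (simp_all add: algebra_simps)
  have eq: "(\<lambda>w. inverse (sq w) ^ k) = (\<lambda>w::complex^'m. complex_of_real (inverse (w \<bullet> w) ^ k))"
    by (simp add: sq_def)
  have "(\<lambda>w. w \<bullet> w) differentiable (at w)"
    using Ck_on_differentiable[OF Ck_on_inner_self[of UNIV 1]] by simp
  from d_z_of_real_compose[OF this d, of j] d_z_sq[of j w]
  show "d_z j (\<lambda>w. inverse (sq w) ^ k) w = - of_nat k * cnj (w $ j) * inverse (sq w) ^ Suc k"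
    "d_zbar j (\<lambda>w. inverse (sq w) ^ k) w = - of_nat k * (w $ j) * inverse (sq w) ^ Suc k"
    unfolding eq by (simp_all add: sq_def[abs_def])
qed

lemma inverse_sq_power_differentiable: "w \<noteq> 0 \<Longrightarrow> (\<lambda>w. inverse (sq w) ^ k) differentiable (at w)"
  using Ck_on_differentiable[OF Ck_on_power[OF open_minus_0 inverse_sq_Ck[of 1]]] by simp

lemma fs_fun_test:
  assumes "bihom k k P"
  shows "test_fun (fs_fun k P)"
proof -
  have "Ck_on 3 (- {0}) (fs_fun k P)"
    unfolding fs_fun_def[abs_def]
    by (intro Ck_on_mult Ck_on_power inverse_sq_Ck open_minus_0 Ck_on_subset[OF bihom_Ck[OF assms]]) simp
  moreover have "invariant (fs_fun k P)"
    by (auto simp: invariant_def fs_fun_def bihom_scale[OF assms] sq_scale power_mult_distrib field_simps)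
  ultimately show ?thesis by (simp add: test_fun_def)
qed

lemma fs_weight: "log_weight (\<lambda>w::complex^'m. real CARD('m) * ln (w \<bullet> w))"
proof
  have "Ck_on 2 (- {0}) (\<lambda>w::complex^'m. ln (w \<bullet> w))"
    by (rule Ck_on_compose[OF open_minus_0 _ Ck_on_inner_self[OF open_minus_0] Ck_on_ln_gt0]) auto
  then show "Ck_on 2 (- {0}) (\<lambda>w::complex^'m. real CARD('m) * ln (w \<bullet> w))"
    by (intro Ck_on_mult Ck_on_const open_minus_0)
  fix c :: complex and w :: "complex^'m"
  assume "c \<noteq> 0" "w \<noteq> 0"
  moreover have "(c *s w) \<bullet> (c *s w) = (cmod c)\<^sup>2 * (w \<bullet> w)"
    by (simp add: power_mult_distrib norm_scale_vec flip: power2_norm_eq_inner)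
  ultimately show "real CARD('m) * ln ((c *s w) \<bullet> (c *s w)) = real CARD('m) * ln (w \<bullet> w) + 2 * CARD('m) * ln (cmod c)"
    by (simp add: ln_mult ln_realpow algebra_simps)
qed

interpretation fs: log_weight "\<lambda>w::complex^'m. real CARD('m) * ln (w \<bullet> w)"
  by (rule fs_weight)

lemma fs_p:
  fixes w :: "complex^'m"
  assumes "w \<noteq> 0"
  shows "fs.p j w = of_nat CARD('m) * (cnj (w $ j) * inverse (sq w))"
proof -
  have d: "((\<lambda>x. real CARD('m) * ln x) has_real_derivative real CARD('m) * inverse (w \<bullet> w)) (at (w \<bullet> w))"
    using assms by (auto intro!: derivative_eq_intros simp: divide_inverse)
  have "(\<lambda>w::complex^'m. w \<bullet> w) differentiable (at w)"
    using Ck_on_differentiable[OF Ck_on_inner_self[of UNIV 1]] by simp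
  from d_z_of_real_compose(1)[OF this d, of j] d_z_sq(1)[of j w]
  show ?thesis
    unfolding fs.p_def by (simp add: sq_def[abs_def] mult_ac)
qed

lemma fs_q:
  fixes w :: "complex^'m"
  assumes "w \<noteq> 0"
  shows "fs.q j k w = of_nat CARD('m) * (of_bool (j = k) * inverse (sq w) - cnj (w $ j) * w $ k * inverse (sq w) ^ 2)"
proof -
  have d: "(\<lambda>w. cnj ((w::complex^'m) $ j)) differentiable (at w)" "(\<lambda>w. inverse (sq (w::complex^'m))) differentiable (at w)"
    using inverse_sq_power_differentiable[OF assms, of 1] by auto
  have "fs.q j k w = d_zbar k (\<lambda>w. of_nat CARD('m) * (cnj (w $ j) * inverse (sq w))) w"
    unfolding fs.q_def using assms by (intro d_z_cong(2)[OF open_minus_0]) (auto simp: fs_p)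
  also have "\<dots> = of_nat CARD('m) * (cnj (w $ j) * d_zbar k (\<lambda>w. inverse (sq w)) w + of_bool (k = j) * inverse (sq w))"
    using d by (subst d_z_cmult(2), intro differentiable_mult) (simp_all add: d_z_mult)
  also have "d_zbar k (\<lambda>w. inverse (sq w)) w = - (w $ k * inverse (sq w) ^ 2)"
    using d_z_inverse_sq_power(2)[OF assms, of k 1] by (simp add: numeral_2_eq_2)
  finally show ?thesis by (simp add: algebra_simps eq_commute)
qed

text \<open>Orthogonality of \<open>X\<close> to \<open>w\<close> removes the rank-one part of the
  Fubini-Study Hessian.\<close>

lemma fs_levi:
  fixes w :: "complex^'m"
  assumes "w \<noteq> 0" "(\<Sum>j\<in>UNIV. cnj (w $ j) * X j) = 0"
  shows "fs.levi w X = of_nat CARD('m) * inverse (sq w) * (\<Sum>j\<in>UNIV. X j * cnj (X j))"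
proof -
  let ?N = "of_nat CARD('m) :: complex"
  have "fs.levi w X = (\<Sum>j\<in>UNIV. \<Sum>k\<in>UNIV. if k = j then ?N * inverse (sq w) * (X j * cnj (X j)) else 0)
      - (\<Sum>j\<in>UNIV. \<Sum>k\<in>UNIV. (?N * inverse (sq w) ^ 2 * (cnj (w $ j) * X j)) * (w $ k * cnj (X k)))"
    unfolding fs.levi_def sum_subtractf[symmetric]
    by (intro sum.cong refl) (simp add: fs_q[OF assms(1)] algebra_simps)
  also have "(\<Sum>j\<in>UNIV. \<Sum>k\<in>UNIV. (?N * inverse (sq w) ^ 2 * (cnj (w $ j) * X j)) * (w $ k * cnj (X k)))
      = (\<Sum>j\<in>UNIV. ?N * inverse (sq w) ^ 2 * (cnj (w $ j) * X j)) * (\<Sum>k\<in>UNIV. w $ k * cnj (X k))"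
    by (rule sum_product[symmetric])
  also have "(\<Sum>j\<in>UNIV. ?N * inverse (sq w) ^ 2 * (cnj (w $ j) * X j)) = 0"
    by (simp add: assms(2) flip: sum_distrib_left)
  finally show ?thesis by (simp add: sum_distrib_left)
qed

text \<open>The first-order terms, one from \<open>d_z j\<close> of \<open>sq\<close> and one from
  the weight, are both multiples of the antiholomorphic radial derivative, which is zero for
  invariant functions. A multiple of the flat Laplacian remains.\<close>

lemma fs_L:
  assumes v: "test_fun v" and w: "w \<noteq> 0"
  shows "fs.L v w = sq w * (\<Sum>j\<in>UNIV. d_z j (d_zbar j v) w)"
proof -
  have 0: "(\<Sum>j\<in>UNIV. cnj (w $ j) * d_zbar j v w) = 0"
    by (rule complex_Euler[where n=0]) (use v w in \<open>auto simp: test_fun_def invariantD test_fun_differentiable\<close>)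
  have d: "d_zbar j v differentiable (at w)" for j
    using Ck_on_differentiable[OF d_zbar_test_fun_Ck[OF v]] w by simp
  have "fs.L v w = (\<Sum>j\<in>UNIV. (1 - of_nat CARD('a)) * (cnj (w $ j) * d_zbar j v w) + sq w * d_z j (d_zbar j v) w)"
    unfolding fs.L_def fs.divg_def
    using sq_ne_0[OF w]
    by (intro sum.cong refl) (simp add: grad_def[abs_def] d_z_mult d d_z_sq fs_p[OF w] algebra_simps)
  also have "\<dots> = (1 - of_nat CARD('a)) * (\<Sum>j\<in>UNIV. cnj (w $ j) * d_zbar j v w)
      + sq w * (\<Sum>j\<in>UNIV. d_z j (d_zbar j v) w)"
    by (simp add: sum.distrib sum_distrib_left)
  finally show ?thesis by (simp add: 0)
qed

text \<open>\<open>fs.L\<close> is triangular with respect to the degree: on bidegree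
  \<open>(k + 1, k + 1)\<close> it acts as multiplication by \<open>- (k + 1) * (k + m)\<close>, an
  eigenvalue of the Laplacian of projective space, up to a term of bidegree \<open>(k, k)\<close>.
  As these numbers are nonzero, the operator can be inverted degree by degree.\<close>

lemma fs_L_fs_fun:
  fixes P :: "complex^'m \<Rightarrow> complex"
  assumes P: "bihom (Suc k) (Suc k) P" and w: "w \<noteq> 0"
  shows "fs.L (fs_fun (Suc k) P) w = fs_fun k (\<lambda>w. \<Sum>j\<in>UNIV. d_z j (d_zbar j P) w) w
     - of_nat (Suc k * (k + CARD('m))) * fs_fun (Suc k) P w"
proof -
  define K :: complex where "K = of_nat (Suc k)"
  define R where "R n w = inverse (sq w) ^ n" for n and w :: "complex^'m"
  have sR: "sq w * R (Suc n) w = R n w" for n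
    using sq_ne_0[OF w] by (simp add: R_def)
  have sP: "sq w * (P w * R (Suc (Suc (Suc k))) w) = P w * R (Suc (Suc k)) w"
    using sR[of "Suc (Suc k)"] by (simp add: mult.left_commute)
  have ff: "fs_fun n Q w = Q w * R n w" for n Q
    by (simp add: fs_fun_def R_def)
  note Pd = bihom_differentiable[OF P]
  have dP: "bihom (Suc k) k (d_zbar j P)" for j using bihom_d_zbar[OF P] by simp
  note dPd = bihom_differentiable[OF dP]
  have Rd: "R n differentiable (at u)" if "u \<noteq> 0" for n u
    using inverse_sq_power_differentiable[OF that] by (simp add: R_def[abs_def])
  have d_R: "d_z j (R n) u = - of_nat n * cnj (u $ j) * R (Suc n) u"
     "d_zbar j (R n) u = - of_nat n * (u $ j) * R (Suc n) u" if "u \<noteq> 0" for j n u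
    using d_z_inverse_sq_power[OF that] by (simp_all add: R_def[abs_def])
  have 1: "d_zbar j (fs_fun (Suc k) P) u = d_zbar j P u * R (Suc k) u - K * (P u * (u $ j * R (Suc (Suc k)) u))"
    if "u \<noteq> 0" for j u
    using Pd Rd[OF that] d_R(2)[OF that]
    by (simp add: fs_fun_def[abs_def] d_z_mult K_def algebra_simps flip: R_def)
  have 2: "d_z j (d_zbar j (fs_fun (Suc k) P)) w
     = d_z j (d_zbar j P) w * R (Suc k) w - K * (cnj (w $ j) * d_zbar j P w) * R (Suc (Suc k)) w
       - K * (w $ j * d_z j P w) * R (Suc (Suc k)) w - K * P w * R (Suc (Suc k)) w
       + K * (K + 1) * P w * (w $ j * cnj (w $ j)) * R (Suc (Suc (Suc k))) w" for j
  proof -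
    have "d_z j (d_zbar j (fs_fun (Suc k) P)) w =
        d_z j (\<lambda>u. d_zbar j P u * R (Suc k) u - K * (P u * (u $ j * R (Suc (Suc k)) u))) w"
      by (rule d_z_cong(1)[OF open_minus_0]) (use w 1 in auto)
    also have "\<dots> = d_z j (\<lambda>u. d_zbar j P u * R (Suc k) u) w - K * d_z j (\<lambda>u. P u * (u $ j * R (Suc (Suc k)) u)) w"
      by (subst d_z_diff(1), (intro differentiable_mult differentiable_const Pd dPd Rd[OF w] vec_nth_differentiable)+,
          subst d_z_cmult(1), (intro differentiable_mult Pd Rd[OF w] vec_nth_differentiable)+, rule refl)
    also have "d_z j (\<lambda>u. d_zbar j P u * R (Suc k) u) w = d_zbar j P w * (- K * cnj (w $ j) * R (Suc (Suc k)) w) + d_z j (d_zbar j P) w * R (Suc k) w"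
      by (subst d_z_mult(1)[OF dPd Rd[OF w]]) (simp add: d_R[OF w] K_def)
    also have "d_z j (\<lambda>u. P u * (u $ j * R (Suc (Suc k)) u)) w = P w * (w $ j * (- (K + 1) * cnj (w $ j) * R (Suc (Suc (Suc k))) w) + R (Suc (Suc k)) w)
        + d_z j P w * (w $ j * R (Suc (Suc k)) w)"
      by (subst d_z_mult(1)[OF Pd], intro differentiable_mult Rd[OF w] vec_nth_differentiable,
          subst d_z_mult(1)[OF vec_nth_differentiable Rd[OF w]]) (simp add: d_R[OF w] K_def)
    finally show ?thesis by (simp add: algebra_simps)
  qed
  have "(\<Sum>j\<in>UNIV. d_z j (d_zbar j (fs_fun (Suc k) P)) w)
     = (\<Sum>j\<in>UNIV. d_z j (d_zbar j P) w) * R (Suc k) w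
       - K * (\<Sum>j\<in>UNIV. cnj (w $ j) * d_zbar j P w) * R (Suc (Suc k)) w
       - K * (\<Sum>j\<in>UNIV. w $ j * d_z j P w) * R (Suc (Suc k)) w - of_nat CARD('m) * (K * P w * R (Suc (Suc k)) w)
       + K * (K + 1) * P w * (\<Sum>j\<in>UNIV. w $ j * cnj (w $ j)) * R (Suc (Suc (Suc k))) w"
    unfolding 2 by (simp add: sum.distrib sum_subtractf sum_distrib_left sum_distrib_right)
  \<comment> \<open>Euler's identities give \<open>K * P w\<close> for both middle sums, and
    \<open>- K * K - K * K - m * K + K * (K + 1)\<close> is \<open>- K * (K + m - 1)\<close>, with
    \<open>m\<close> for \<open>CARD('m)\<close>.\<close>
  also have "\<dots> = (\<Sum>j\<in>UNIV. d_z j (d_zbar j P) w) * R (Suc k) w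
      - K * (K + of_nat CARD('m) - 1) * P w * R (Suc (Suc k)) w"
    using bihom_Euler[OF P, of w]
    by (simp add: sP sR K_def[symmetric] sq_eq_sum[symmetric] algebra_simps del: of_nat_Suc)
  finally have "fs.L (fs_fun (Suc k) P) w = sq w * ((\<Sum>j\<in>UNIV. d_z j (d_zbar j P) w) * R (Suc k) w
      - K * (K + of_nat CARD('m) - 1) * P w * R (Suc (Suc k)) w)"
    using fs_L[OF fs_fun_test[OF P] w] by simp
  also have "\<dots> = (\<Sum>j\<in>UNIV. d_z j (d_zbar j P) w) * (sq w * R (Suc k) w)
      - K * (K + of_nat CARD('m) - 1) * P w * (sq w * R (Suc (Suc k)) w)"
    by (simp add: algebra_simps)
  also have "\<dots> = (\<Sum>j\<in>UNIV. d_z j (d_zbar j P) w) * R k w - K * (K + of_nat CARD('m) - 1) * P w * R (Suc k) w"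
    unfolding sR ..
  finally show ?thesis
    by (simp add: ff K_def algebra_simps)
qed

section \<open>Density of the range\<close>

text \<open>The mean square over the shell carries no weight, so that a single norm serves every
  weight of the segment; on the shell each density \<open>E\<close> is bounded above and
  below.\<close>

definition sqn :: "(complex^'m \<Rightarrow> complex) \<Rightarrow> real" where
  "sqn u = Re (J (\<lambda>w. u w * cnj (u w)))"

lemma sqn_cong: "(\<And>w. w \<noteq> 0 \<Longrightarrow> u w = v w) \<Longrightarrow> sqn u = sqn v"
  unfolding sqn_def by (intro arg_cong[where f=Re] J_cong) simp

lemma sqn_mono:
  assumes "continuous_on (- {0}) u" "continuous_on (- {0}) v"
    and "\<And>w. 1 \<le> norm w \<Longrightarrow> norm w \<le> 2 \<Longrightarrow> cmod (u w) \<le> cmod (v w)"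
  shows "sqn u \<le> sqn v"
  unfolding sqn_def
proof (rule Re_J_mono)
  fix w :: "complex^'a" assume "1 \<le> norm w" "norm w \<le> 2"
  then have "(cmod (u w))\<^sup>2 \<le> (cmod (v w))\<^sup>2" using assms(3) by (intro power_mono) auto
  then show "Re (u w * cnj (u w)) \<le> Re (v w * cnj (v w))"
    by (simp only: complex_norm_square[symmetric] Re_complex_of_real)
qed (intro continuous_intros assms)+

lemma sqn_0 [simp]: "sqn (\<lambda>w. 0) = 0"
  by (simp add: sqn_def J_def)

lemma sqn_nonneg: "continuous_on (- {0}) u \<Longrightarrow> 0 \<le> sqn u"
  using sqn_mono[of "\<lambda>w. 0" u] by simp

lemma sqn_cmult: "sqn (\<lambda>w. c * u w) = (cmod c)\<^sup>2 * sqn u"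
proof -
  have "J (\<lambda>w. c * u w * cnj (c * u w)) = (c * cnj c) * J (\<lambda>w. u w * cnj (u w))"
    unfolding J_cmult[symmetric] by (simp add: mult_ac)
  also have "c * cnj c = of_real ((cmod c)\<^sup>2)" by (rule complex_norm_square[symmetric])
  finally show ?thesis unfolding sqn_def by simp
qed

text \<open>The parallelogram law, with the square of the difference dropped.\<close>

lemma sqn_add_le:
  assumes "continuous_on (- {0}) u" "continuous_on (- {0}) v"
  shows "sqn (\<lambda>w. u w + v w) \<le> 2 * sqn u + 2 * sqn v"
proof -
  note [continuous_intros] = assms
  have "sqn (\<lambda>w. u w + v w) + sqn (\<lambda>w. u w - v w) = 2 * sqn u + 2 * sqn v"
  proof -
    have "J (\<lambda>w. (u w + v w) * cnj (u w + v w)) + J (\<lambda>w. (u w - v w) * cnj (u w - v w))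
       = J (\<lambda>w. (u w + v w) * cnj (u w + v w) + (u w - v w) * cnj (u w - v w))"
      by (rule J_add[symmetric]) (intro continuous_intros)+
    also have "\<dots> = J (\<lambda>w. 2 * (u w * cnj (u w)) + 2 * (v w * cnj (v w)))"
      by (rule J_cong) (simp add: algebra_simps)
    also have "\<dots> = 2 * J (\<lambda>w. u w * cnj (u w)) + 2 * J (\<lambda>w. v w * cnj (v w))"
      unfolding J_cmult[symmetric] by (rule J_add) (intro continuous_intros)+
    finally have "Re (J (\<lambda>w. (u w + v w) * cnj (u w + v w))) + Re (J (\<lambda>w. (u w - v w) * cnj (u w - v w)))
       = 2 * Re (J (\<lambda>w. u w * cnj (u w))) + 2 * Re (J (\<lambda>w. v w * cnj (v w)))"
      by (drule_tac arg_cong[where f=Re]) (simp only: plus_complex.sel Re_complex_of_real, simp)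
    then show ?thesis unfolding sqn_def .
  qed
  moreover have "0 \<le> sqn (\<lambda>w. u w - v w)"
    by (rule sqn_nonneg) (intro continuous_intros)
  ultimately show ?thesis by linarith
qed

lemma shell_bounded:
  fixes g :: "complex^'m \<Rightarrow> 'b::real_normed_vector"
  assumes "continuous_on (- {0}) g"
  obtains B where "B > 0" "\<And>w. 1 \<le> norm w \<Longrightarrow> norm w \<le> 2 \<Longrightarrow> norm (g w) \<le> B"
proof -
  have eq: "{w::complex^'m. 1 \<le> norm w \<and> norm w \<le> 2} = cball 0 2 - ball 0 1" by auto
  have "compact {w::complex^'m. 1 \<le> norm w \<and> norm w \<le> 2}"
    unfolding eq by (intro compact_diff compact_cball open_ball)
  moreover have "continuous_on {w::complex^'m. 1 \<le> norm w \<and> norm w \<le> 2} g"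
    by (rule continuous_on_subset[OF assms]) auto
  ultimately have "bounded (g ` {w. 1 \<le> norm w \<and> norm w \<le> 2})"
    by (intro compact_imp_bounded compact_continuous_image)
  then obtain B where "B > 0" "\<forall>x \<in> g ` {w. 1 \<le> norm w \<and> norm w \<le> 2}. norm x \<le> B"
    by (auto simp: bounded_pos)
  then show ?thesis using that by auto
qed

section \<open>Density of rational functions on projective space\<close>

definition fs_rational :: "(complex^'m \<Rightarrow> complex) \<Rightarrow> bool" where
  "fs_rational v \<longleftrightarrow> (\<exists>k P. bihom k k P \<and> (\<forall>w. w \<noteq> 0 \<longrightarrow> v w = fs_fun k P w))"

text \<open>Powers of \<open>sq\<close> bring two quotients to a common denominator.\<close>

lemma fs_fun_lift:
  assumes "w \<noteq> 0"
  shows "fs_fun (k + l) (\<lambda>w. P w * sq w ^ l) w = fs_fun k P w"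
  using sq_ne_0[OF assms] by (simp add: fs_fun_def power_add field_simps)

lemma fs_rational_const: "fs_rational (\<lambda>w. c)"
  unfolding fs_rational_def by (intro exI[of _ 0] exI[of _ "\<lambda>w. c"]) (auto simp: fs_fun_def intro: bihom_const)

lemma fs_rational_add:
  assumes "fs_rational u" "fs_rational v"
  shows "fs_rational (\<lambda>w. u w + v w)"
proof -
  obtain k P where u: "bihom k k P" "\<And>w. w \<noteq> 0 \<Longrightarrow> u w = fs_fun k P w" using assms(1) by (auto simp: fs_rational_def)
  obtain l Q where v: "bihom l l Q" "\<And>w. w \<noteq> 0 \<Longrightarrow> v w = fs_fun l Q w" using assms(2) by (auto simp: fs_rational_def)
  have "bihom (k + l) (k + l) (\<lambda>w. P w * sq w ^ l + Q w * sq w ^ k)"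
    using bihom_mult[OF u(1) bihom_sq_power[of l]] bihom_mult[OF v(1) bihom_sq_power[of k]]
    by (intro bihom_add) (simp_all add: add.commute)
  moreover have "u w + v w = fs_fun (k + l) (\<lambda>w. P w * sq w ^ l + Q w * sq w ^ k) w" if "w \<noteq> 0" for w
    unfolding u(2)[OF that] v(2)[OF that] fs_fun_lift[OF that, of k l P, symmetric]
      fs_fun_lift[OF that, of l k Q, symmetric]
    by (simp add: fs_fun_def distrib_right add.commute)
  ultimately show ?thesis unfolding fs_rational_def by blast
qed

lemma fs_rational_mult:
  assumes "fs_rational u" "fs_rational v"
  shows "fs_rational (\<lambda>w. u w * v w)"
proof -
  obtain k P where u: "bihom k k P" "\<And>w. w \<noteq> 0 \<Longrightarrow> u w = fs_fun k P w" using assms(1) by (auto simp: fs_rational_def)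
  obtain l Q where v: "bihom l l Q" "\<And>w. w \<noteq> 0 \<Longrightarrow> v w = fs_fun l Q w" using assms(2) by (auto simp: fs_rational_def)
  have "u w * v w = fs_fun (k + l) (\<lambda>w. P w * Q w) w" if "w \<noteq> 0" for w
    by (simp add: u(2)[OF that] v(2)[OF that] fs_fun_def power_add)
  then show ?thesis unfolding fs_rational_def using bihom_mult[OF u(1) v(1)] by blast
qed

lemma fs_rational_sum: "(\<And>i. i \<in> I \<Longrightarrow> fs_rational (v i)) \<Longrightarrow> fs_rational (\<lambda>w. \<Sum>i\<in>I. v i w)"
  by (induction I rule: infinite_finite_induct) (auto intro: fs_rational_add fs_rational_const)

text \<open>The orthogonal projection onto the complex line spanned by \<open>w\<close>. It embeds
  projective space in a space of matrices, so that the Stone-Weierstrass theorem for polynomials on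
  a compact subset of a Euclidean space applies.\<close>

definition proj :: "complex^'m \<Rightarrow> complex^'m^'m" where
  "proj w = (\<chi> i j. w $ i * cnj (w $ j) * inverse (sq w))"

lemma fs_rational_proj: "fs_rational (\<lambda>w. proj w $ i $ j)"
proof -
  have "bihom (Suc 0) (Suc 0) (\<lambda>w. w $ i * (cnj (w $ j) * 1))"
    by (intro bihom.intros)
  then show ?thesis
    unfolding fs_rational_def
    by (intro exI[of _ 1] exI[of _ "\<lambda>w. w $ i * cnj (w $ j)"]) (simp add: fs_fun_def proj_def)
qed

lemma cnj_proj: "cnj (proj w $ i $ j) = proj w $ j $ i"
  by (simp add: proj_def mult_ac)

lemma fs_rational_real_polynomial:
  fixes f :: "complex^'m^'m \<Rightarrow> real"
  assumes "real_polynomial_function f"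
  shows "fs_rational (\<lambda>w. of_real (f (proj w)))"
  using assms
proof (induction rule: real_polynomial_function.induct)
  case (linear f)
  interpret f: bounded_linear f by fact
  define \<alpha> where "\<alpha> i j = complex_of_real (f (axis i (axis j 1)))" for i j
  define \<beta> where "\<beta> i j = complex_of_real (f (axis i (axis j \<i>)))" for i j
  have "M = (\<Sum>i\<in>UNIV. \<Sum>j\<in>UNIV. Re (M $ i $ j) *\<^sub>R axis i (axis j 1) + Im (M $ i $ j) *\<^sub>R axis i (axis j \<i>))"
    for M :: "complex^'m^'m"
  proof -
    have *: "(\<Sum>j\<in>UNIV. Re (M $ i $ j) *\<^sub>R axis i (axis j 1) + Im (M $ i $ j) *\<^sub>R axis i (axis j \<i>)) = axis i (M $ i)" for i
    proof -
      have "(\<Sum>j\<in>UNIV. Re (M $ i $ j) *\<^sub>R axis i (axis j 1) + Im (M $ i $ j) *\<^sub>R axis i (axis j \<i>))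
        = axis i (\<Sum>j\<in>UNIV. Re (M $ i $ j) *\<^sub>R axis j 1 + Im (M $ i $ j) *\<^sub>R axis j \<i>)"
        by (auto simp: vec_eq_iff axis_def sum_component)
      then show ?thesis by (simp only: axis_decomposition[of "M $ i", symmetric])
    qed
    show ?thesis unfolding * by (simp add: vec_eq_iff sum_component axis_def if_distrib[where f="\<lambda>x::complex^'m. x $ k" for k] cong: if_cong)
  qed
  note M = this
  have fM: "f M = (\<Sum>i\<in>UNIV. \<Sum>j\<in>UNIV. Re (M $ i $ j) * f (axis i (axis j 1)) + Im (M $ i $ j) * f (axis i (axis j \<i>)))" for M
    using arg_cong[OF M[of M], of f] by (simp add: f.sum f.add f.scaleR)
  have "complex_of_real (f (proj w)) = (\<Sum>i\<in>UNIV. \<Sum>j\<in>UNIV.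
       (\<alpha> i j / 2 - \<i> * \<beta> i j / 2) * proj w $ i $ j + (\<alpha> i j / 2 + \<i> * \<beta> i j / 2) * proj w $ j $ i)" for w
    unfolding fM[of "proj w"] of_real_sum
  proof (intro sum.cong refl)
    fix i j
    \<comment> \<open>A real linear form involves real and imaginary parts of the entries. The
      matrix being Hermitian, both are combinations of the entries at \<open>(i, j)\<close> and
      \<open>(j, i)\<close>, which are rational.\<close>
    have "complex_of_real (Re (proj w $ i $ j)) = (proj w $ i $ j + proj w $ j $ i) / 2"
      "complex_of_real (Im (proj w $ i $ j)) = - (\<i> / 2) * (proj w $ i $ j - proj w $ j $ i)"
      unfolding cnj_proj[of w i j, symmetric] by (simp_all add: complex_eq_iff)
    then show "complex_of_real (Re (proj w $ i $ j) * f (axis i (axis j 1)) + Im (proj w $ i $ j) * f (axis i (axis j \<i>)))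
       = (\<alpha> i j / 2 - \<i> * \<beta> i j / 2) * proj w $ i $ j + (\<alpha> i j / 2 + \<i> * \<beta> i j / 2) * proj w $ j $ i"
      unfolding \<alpha>_def \<beta>_def by (simp only: of_real_add of_real_mult) (simp add: algebra_simps add_divide_distrib diff_divide_distrib)
  qed
  then show ?case
    by (simp only:) (intro fs_rational_sum fs_rational_add fs_rational_mult fs_rational_const fs_rational_proj)
qed (auto intro: fs_rational_const fs_rational_add fs_rational_mult)

lemma fs_rational_polynomial:
  fixes f :: "complex^'m^'m \<Rightarrow> complex"
  assumes "polynomial_function f"
  shows "fs_rational (\<lambda>w. f (proj w))"
proof -
  have "real_polynomial_function (\<lambda>x. f x \<bullet> b)" if "b \<in> Basis" for b
    using assms that by (simp add: polynomial_function_iff_Basis_inner)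
  from this[of 1] this[of \<i>]
  have "real_polynomial_function (\<lambda>x. Re (f x))" "real_polynomial_function (\<lambda>x. Im (f x))"
    by (simp_all add: Basis_complex_def inner_complex_def)
  then have "fs_rational (\<lambda>w. of_real (Re (f (proj w))) + \<i> * of_real (Im (f (proj w))))"
    by (intro fs_rational_add fs_rational_mult fs_rational_const fs_rational_real_polynomial)
  then show ?thesis by (simp add: complex_eq[symmetric])
qed

text \<open>Equal projections mean equal lines; the scalar is found by comparing column
  \<open>j\<close> of the two matrices, for a nonzero coordinate \<open>w $ j\<close>.\<close>

lemma proj_eq_imp:
  assumes "proj u = proj w" "u \<noteq> 0" "w \<noteq> 0"
  obtains c where "c \<noteq> 0" "w = c *s u"
proof -
  obtain j where j: "w $ j \<noteq> 0" using assms(3) by (auto simp: vec_eq_iff)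
  define c where "c = sq w * inverse (sq u) * cnj (u $ j) * inverse (cnj (w $ j))"
  have "w $ i = c * u $ i" for i
  proof -
    have "proj u $ i $ j = proj w $ i $ j" using assms(1) by simp
    then have "w $ i * cnj (w $ j) * inverse (sq w) = u $ i * cnj (u $ j) * inverse (sq u)"
      by (simp add: proj_def)
    then show ?thesis
      using j sq_ne_0[OF assms(2)] sq_ne_0[OF assms(3)] by (simp add: c_def field_simps)
  qed
  then have w: "w = c *s u" by (simp add: vec_eq_iff)
  then have "c \<noteq> 0" using assms(3) by auto
  then show ?thesis using w that by blast
qed

lemma proj_scale: "c \<noteq> 0 \<Longrightarrow> proj (c *s w) = proj w"
  by (simp add: proj_def vec_eq_iff sq_scale field_simps)

text \<open>An invariant function factors through \<open>proj\<close>. On the compact set of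
  projections it is approximated by polynomials, and polynomials in the entries of
  \<open>proj w\<close> are rational in the sense of \<open>fs_rational\<close>.\<close>

lemma fs_rational_dense:
  fixes g :: "complex^'m \<Rightarrow> complex"
  assumes g: "continuous_on (- {0}) g" "invariant g" and e: "e > 0"
  shows "\<exists>v. fs_rational v \<and> (\<forall>w. w \<noteq> 0 \<longrightarrow> cmod (g w - v w) < e)"
proof -
  let ?S = "sphere 0 1 :: (complex^'m) set"
  define Q where "Q = proj ` ?S"
  define G where "G M = g (SOME w. w \<in> ?S \<and> proj w = M)" for M
  have Gproj: "G (proj w) = g w" if w: "w \<in> ?S" for w
  proof -
    define u where "u = (SOME u. u \<in> ?S \<and> proj u = proj w)"
    have "u \<in> ?S \<and> proj u = proj w"
      unfolding u_def by (rule someI[of _ w]) (use w in simp)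
    moreover from this w obtain c where "c \<noteq> 0" "w = c *s u"
      by (metis proj_eq_imp dist_0_norm mem_sphere norm_zero zero_neq_one)
    moreover have "G (proj w) = g u" by (simp add: G_def u_def)
    ultimately show ?thesis
      using invariantD[OF g(2), of c u] by (cases "u = 0") auto
  qed
  have cp: "continuous_on ?S proj"
    unfolding proj_def sq_def
    by (intro continuous_intros) auto
  have cg: "continuous_on ?S g" by (rule continuous_on_subset[OF g(1)]) auto
  have "compact Q" unfolding Q_def by (rule compact_continuous_image[OF cp compact_sphere])
  \<comment> \<open>\<open>proj\<close> maps compact subsets of the sphere to compact sets, so
    preimages of closed sets under \<open>G\<close> are closed: continuity passes to the
    quotient.\<close>
  moreover have "continuous_on Q G"
    unfolding continuous_on_closed_vimage[OF compact_imp_closed[OF \<open>compact Q\<close>]]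
  proof (intro allI impI)
    fix B :: "complex set" assume "closed B"
    have "closed (g -` B \<inter> ?S)"
      using cg \<open>closed B\<close> continuous_on_closed_vimage[of ?S g] by auto
    then have "compact (g -` B \<inter> ?S)"
      using compact_Int_closed[OF compact_sphere] by (metis Int_assoc Int_commute inf.idem)
    moreover have "continuous_on (g -` B \<inter> ?S) proj" by (rule continuous_on_subset[OF cp]) auto
    ultimately have "compact (proj ` (g -` B \<inter> ?S))" by (intro compact_continuous_image)
    moreover have "proj ` (g -` B \<inter> ?S) = G -` B \<inter> Q"
      using Gproj by (auto simp: Q_def)
    ultimately show "closed (G -` B \<inter> Q)" using compact_imp_closed by simp
  qed
  ultimately obtain f where f: "polynomial_function f" "\<And>M. M \<in> Q \<Longrightarrow> norm (G M - f M) < e"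
    using Stone_Weierstrass_polynomial_function[of Q G e] e by blast
  have "cmod (g w - f (proj w)) < e" if "w \<noteq> 0" for w
  proof -
    define c where "c = complex_of_real (inverse (norm w))"
    have c: "c \<noteq> 0" using that by (simp add: c_def)
    have "c *s w \<in> ?S" using that by (simp add: c_def norm_scale_vec norm_inverse)
    then have "cmod (g (c *s w) - f (proj (c *s w))) < e"
      using f(2)[of "proj (c *s w)"] Gproj by (auto simp: Q_def)
    then show ?thesis using invariantD[OF g(2) c that] by (simp add: proj_scale[OF c])
  qed
  then show ?thesis using fs_rational_polynomial[OF f(1)] by blast
qed

text \<open>The triangular formula \<open>fs_L_fs_fun\<close> is inverted: the remainder of bidegree
  \<open>(k, k)\<close> is in the range modulo constants by induction, and in bidegree
  \<open>(0, 0)\<close> there are only constants.\<close>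

lemma fs_range:
  assumes "bihom k k P"
  shows "\<exists>u c. test_fun u \<and> (\<forall>w. w \<noteq> 0 \<longrightarrow> fs.L u w + c = fs_fun k P w)"
  using assms
proof (induction k arbitrary: P)
  case 0
  then obtain c where "P = (\<lambda>w. c)" using bihom_0_0 by blast
  moreover have "fs.L (\<lambda>w. 0) w = 0" if "w \<noteq> 0" for w :: "complex^'a"
    using fs.L_cmult[OF test_fun_const that, of 0 0] by simp
  ultimately show ?case
    by (intro exI[of _ "\<lambda>w. 0"] exI[of _ c]) (simp add: fs_fun_def test_fun_const)
next
  case (Suc k)
  let ?P' = "\<lambda>w. \<Sum>j\<in>UNIV. d_z j (d_zbar j P) w"
  \<comment> \<open>The reciprocal of the eigenvalue in degree \<open>k + 1\<close>, up to
    sign.\<close>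
  define \<mu> where "\<mu> = inverse (complex_of_nat (Suc k * (k + CARD('a))))"
  have mu: "\<mu> * of_nat (Suc k * (k + CARD('a))) = 1"
    unfolding \<mu>_def by (rule left_inverse) (simp only: of_nat_eq_0_iff, simp)
  have "bihom k k ?P'"
    by (intro bihom_sum) (use bihom_d_zbar[OF Suc.prems] bihom_d_z in blast)
  from Suc.IH[OF this] obtain u c where u: "test_fun u" "\<And>w. w \<noteq> 0 \<Longrightarrow> fs.L u w + c = fs_fun k ?P' w"
    by blast
  note v = fs_fun_test[OF Suc.prems]
  have uv: "test_fun (\<lambda>w. u w + - 1 * fs_fun (Suc k) P w)"
    by (intro test_fun_add test_fun_cmult u v)
  have "fs.L (\<lambda>w. \<mu> * (u w + - 1 * fs_fun (Suc k) P w)) w + \<mu> * c = fs_fun (Suc k) P w" if w: "w \<noteq> 0" for w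
  proof -
    have "fs.L (\<lambda>w. \<mu> * (u w + - 1 * fs_fun (Suc k) P w)) w + \<mu> * c
        = \<mu> * ((fs.L u w + c) - fs.L (fs_fun (Suc k) P) w)"
      unfolding fs.L_cmult[OF uv w] fs.L_add[OF u(1) test_fun_cmult[OF v] w] fs.L_cmult[OF v w]
      by (simp add: algebra_simps)
    also have "\<dots> = \<mu> * (of_nat (Suc k * (k + CARD('a))) * fs_fun (Suc k) P w)"
      unfolding u(2)[OF w] fs_L_fs_fun[OF Suc.prems w] by simp
    finally show ?thesis using mu by (simp only: mult.assoc[symmetric]) simp
  qed
  then show ?case using test_fun_cmult[OF uv] by blast
qed

definition (in log_weight) dense_range :: bool where
  "dense_range \<longleftrightarrow> (\<forall>g. continuous_on (- {0}) g \<longrightarrow> invariant g \<longrightarrow>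
     (\<forall>e>0. \<exists>v c. test_fun v \<and> sqn (\<lambda>w. g w - (L v w + c)) < e))"

lemma fs_dense_range: "log_weight.dense_range (\<lambda>w::complex^'m. real CARD('m) * ln (w \<bullet> w))"
  unfolding fs.dense_range_def
proof (intro allI impI)
  fix g :: "complex^'m \<Rightarrow> complex" and e :: real
  assume g: "continuous_on (- {0}) g" "invariant g" and e: "e > 0"
  define a where "a = sqn (\<lambda>w::complex^'m. 1)"
  have a: "a \<ge> 0" unfolding a_def by (rule sqn_nonneg) (rule continuous_on_const)
  \<comment> \<open>Adding 1 avoids a division by zero; a uniform error below \<open>d\<close> then
    has mean square at most \<open>e / 2\<close>.\<close>
  define q where "q = a + 1"
  have q: "q > 0" using a by (simp add: q_def)
  define d where "d = sqrt (e / q / 2)"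
  have d: "d > 0" "d\<^sup>2 * q = e / 2" using e q by (simp_all add: d_def)
  obtain v where v: "fs_rational v" "\<And>w. w \<noteq> 0 \<Longrightarrow> cmod (g w - v w) < d"
    using fs_rational_dense[OF g d(1)] by blast
  obtain k P where P: "bihom k k P" "\<And>w. w \<noteq> 0 \<Longrightarrow> v w = fs_fun k P w"
    using v(1) by (auto simp: fs_rational_def)
  obtain u c where u: "test_fun u" "\<And>w. w \<noteq> 0 \<Longrightarrow> fs.L u w + c = fs_fun k P w"
    using fs_range[OF P(1)] by blast
  have "sqn (\<lambda>w. g w - (fs.L u w + c)) \<le> sqn (\<lambda>w::complex^'m. of_real d * 1)"
  proof (rule sqn_mono)
    show "continuous_on (- {0}) (\<lambda>w. g w - (fs.L u w + c))"
      by (intro continuous_intros g fs.cont_L u)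
    fix w :: "complex^'m" assume "1 \<le> norm w"
    then have "w \<noteq> 0" by auto
    then show "cmod (g w - (fs.L u w + c)) \<le> cmod (of_real d * 1)"
      using v(2)[of w] P(2)[of w] u(2)[of w] d by simp
  qed (rule continuous_on_const)
  also have "\<dots> = d\<^sup>2 * a" unfolding sqn_cmult a_def by simp
  also have "\<dots> \<le> d\<^sup>2 * q" by (intro mult_left_mono) (auto simp: q_def)
  also have "\<dots> < e" using d e by simp
  finally show "\<exists>v c. test_fun v \<and> sqn (\<lambda>w. g w - (fs.L v w + c)) < e"
    using u(1) by blast
qed

section \<open>The continuity method\<close>

lemma norm_sum_mult_power2_le:
  fixes a b :: "'m::finite \<Rightarrow> complex"
  assumes "\<And>j. cmod (a j) \<le> M"
  shows "(cmod (\<Sum>j\<in>UNIV. a j * b j))\<^sup>2 \<le> real CARD('m) * M\<^sup>2 * (\<Sum>j\<in>UNIV. (cmod (b j))\<^sup>2)"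
proof -
  have "(cmod (\<Sum>j\<in>UNIV. a j * b j))\<^sup>2 \<le> (\<Sum>j\<in>UNIV. M * cmod (b j))\<^sup>2"
    by (intro power_mono order_trans[OF norm_sum] sum_mono)
      (auto simp: norm_mult intro: mult_right_mono assms)
  also have "\<dots> \<le> (\<Sum>j\<in>(UNIV::'m set). M\<^sup>2) * (\<Sum>j\<in>UNIV. (cmod (b j))\<^sup>2)"
    by (rule Cauchy_Schwarz_ineq_sum)
  finally show ?thesis by simp
qed

context log_weight begin

text \<open>The relative bound behind the continuity method: Cauchy-Schwarz reduces the left side to
  the squared gradient, positivity turns that into the Levi form, \<open>L_Bochner\<close> bounds it
  by the norm of \<open>L v\<close>, and orthogonality to the constants admits \<open>c\<close>. The
  factor involves only bounds that can be shared by all weights of the segment.\<close>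

lemma perturbation_bound:
  fixes D :: "'m \<Rightarrow> complex^'m \<Rightarrow> complex"
  assumes v: "test_fun v" and D: "\<And>j. continuous_on (- {0}) (D j)"
    and M: "\<And>j w. 1 \<le> norm w \<Longrightarrow> norm w \<le> 2 \<Longrightarrow> cmod (D j w) \<le> M"
    and e: "0 < e1" "\<And>w. 1 \<le> norm w \<Longrightarrow> norm w \<le> 2 \<Longrightarrow> e1 \<le> exp (- \<psi> w) \<and> exp (- \<psi> w) \<le> e2"
    and \<kappa>: "\<kappa> > 0" "\<And>w X. 1 \<le> norm w \<Longrightarrow> norm w \<le> 2 \<Longrightarrow> (\<Sum>j\<in>UNIV. cnj (w $ j) * X j) = 0 \<Longrightarrow>
        \<kappa> * (\<Sum>j\<in>UNIV. (cmod (X j))\<^sup>2) \<le> Re (levi w X)"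
  shows "sqn (\<lambda>w. \<Sum>j\<in>UNIV. D j w * grad v j w)
      \<le> real CARD('m) * M\<^sup>2 * e2 / (\<kappa> * e1) * sqn (\<lambda>w. L v w + c)"
proof -
  note [continuous_intros] = D cont_grad[OF v] contE cont_L[OF v] cont_levi[OF v]
  let ?N = "real CARD('m) * M\<^sup>2" and ?D = "\<lambda>w. \<Sum>j\<in>UNIV. D j w * grad v j w"
  have N: "?N \<ge> 0" by simp
  have "\<kappa> * e1 * sqn ?D = Re (J (\<lambda>w. of_real (\<kappa> * e1) * (?D w * cnj (?D w))))"
    unfolding sqn_def J_cmult by simp
  also have "\<dots> \<le> Re (J (\<lambda>w. of_real ?N * (levi w (\<lambda>j. grad v j w) * E w)))"
  proof (rule Re_J_mono)
    fix w :: "complex^'m" assume w: "1 \<le> norm w" "norm w \<le> 2"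
    then have w0: "w \<noteq> 0" by auto
    let ?X2 = "\<Sum>j\<in>UNIV. (cmod (grad v j w))\<^sup>2"
    have X2: "?X2 \<ge> 0" by (simp add: sum_nonneg)
    have lev: "\<kappa> * ?X2 \<le> Re (levi w (\<lambda>j. grad v j w))"
      by (rule \<kappa>(2)[OF w grad_orthogonal[OF v w0]])
    have "(\<kappa> * e1) * (cmod (?D w))\<^sup>2 \<le> (\<kappa> * e1) * (?N * ?X2)"
      using norm_sum_mult_power2_le[of "\<lambda>j. D j w" M "\<lambda>j. grad v j w"] M[OF w] \<kappa>(1) e(1)
      by (intro mult_left_mono) auto
    also have "\<dots> = ?N * ((\<kappa> * ?X2) * e1)" by (simp add: mult_ac)
    also have "\<dots> \<le> ?N * (Re (levi w (\<lambda>j. grad v j w)) * exp (- \<psi> w))"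
      using lev e(2)[OF w] e(1) \<kappa>(1) X2
      by (intro mult_left_mono[OF _ N] mult_mono) (auto intro: order_trans[OF _ lev])
    finally have "\<kappa> * e1 * (cmod (?D w))\<^sup>2 \<le> ?N * (Re (levi w (\<lambda>j. grad v j w)) * exp (- \<psi> w))" .
    then show "Re (of_real (\<kappa> * e1) * (?D w * cnj (?D w))) \<le> Re (of_real ?N * (levi w (\<lambda>j. grad v j w) * E w))"
      by (simp only: complex_norm_square[symmetric] of_real_mult[symmetric] Re_complex_of_real)
        (simp add: E_def)
  qed (intro continuous_intros)+
  also have "\<dots> = ?N * Re (J (\<lambda>w. levi w (\<lambda>j. grad v j w) * E w))"
    unfolding J_cmult by simp
  also have "\<dots> \<le> ?N * Re (J (\<lambda>w. L v w * cnj (L v w) * E w))"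
    by (intro mult_left_mono[OF L_Bochner[OF v] N])
  also have "\<dots> \<le> ?N * Re (J (\<lambda>w. (L v w + c) * cnj (L v w + c) * E w))"
  proof (rule mult_left_mono[OF _ N])
    have "Re (J (\<lambda>w::complex^'m. 0)) \<le> Re (J E)"
      by (rule Re_J_mono[OF continuous_on_const contE]) (simp add: E_def)
    then have "0 \<le> Re (J E)" by (simp add: J_def)
    then show "Re (J (\<lambda>w. L v w * cnj (L v w) * E w)) \<le> Re (J (\<lambda>w. (L v w + c) * cnj (L v w + c) * E w))"
      unfolding Re_J_square_add_const[OF cont_L[OF v] J_L_eq_0(2)[OF v]] by simp
  qed
  also have "\<dots> \<le> ?N * Re (J (\<lambda>w. of_real e2 * ((L v w + c) * cnj (L v w + c))))"
  proof (rule mult_left_mono[OF _ N], rule Re_J_mono)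
    fix w :: "complex^'m" assume w: "1 \<le> norm w" "norm w \<le> 2"
    show "Re ((L v w + c) * cnj (L v w + c) * E w) \<le> Re (of_real e2 * ((L v w + c) * cnj (L v w + c)))"
      unfolding E_def complex_norm_square[symmetric] of_real_mult[symmetric] Re_complex_of_real
      using e(2)[OF w] by (simp add: mult.commute mult_right_mono)
  qed (intro continuous_intros)+
  also have "\<dots> = ?N * e2 * sqn (\<lambda>w. L v w + c)"
    unfolding J_cmult sqn_def by simp
  finally show ?thesis
    using \<kappa>(1) e(1) by (simp add: field_simps)
qed

end

text \<open>A Neumann series in disguise: solve approximately with the old operator, take the
  first-order error into the next residual and repeat. Each round at least halves the squared norm
  of the residual.\<close>

lemma dense_range_perturb:
  fixes \<psi> \<psi>' :: "complex^'m \<Rightarrow> real"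
  assumes "log_weight \<psi>" "log_weight \<psi>'" and dense: "log_weight.dense_range \<psi>"
    and D: "\<And>j. continuous_on (- {0}) (D j)"
    and p: "\<And>j w. w \<noteq> 0 \<Longrightarrow> log_weight.p \<psi>' j w = log_weight.p \<psi> j w + D j w"
    and small: "\<And>v c. test_fun v \<Longrightarrow> sqn (\<lambda>w. \<Sum>j\<in>UNIV. D j w * grad v j w) \<le> sqn (\<lambda>w. log_weight.L \<psi> v w + c) / 16"
  shows "log_weight.dense_range \<psi>'"
proof -
  interpret A: log_weight \<psi> by fact
  interpret B: log_weight \<psi>' by fact
  define K where "K v w = (\<Sum>j\<in>UNIV. D j w * grad v j w)" for v w
  have L: "B.L v w = A.L v w - K v w" if "w \<noteq> 0" for v w
    unfolding A.L_def B.L_def A.divg_def B.divg_def K_def sum_subtractf[symmetric]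
    by (intro sum.cong refl) (simp add: p[OF that] algebra_simps)
  show ?thesis
    unfolding B.dense_range_def
  proof (intro allI impI)
    fix g :: "complex^'m \<Rightarrow> complex" and e :: real
    assume g: "continuous_on (- {0}) g" "invariant g" and e: "e > 0"
    have "\<exists>v c. test_fun v \<and> sqn (\<lambda>w. g w - (B.L v w + c)) \<le> (1/2) ^ n * sqn g" for n
    proof (induction n)
      case 0
      have "sqn (\<lambda>w. g w - (B.L (\<lambda>w. 0) w + 0)) = sqn g"
        using B.L_cmult[OF test_fun_const, of _ 0 0] by (intro sqn_cong) simp
      then show ?case
        by (intro exI[of _ "\<lambda>w. 0"] exI[of _ 0] conjI test_fun_const) simp
    next
      case (Suc n)
      then obtain v c where v: "test_fun v" and vc: "sqn (\<lambda>w. g w - (B.L v w + c)) \<le> (1/2) ^ n * sqn g" by blast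
      define r where "r w = g w - (B.L v w + c)" for w
      have r: "continuous_on (- {0}) r"
        unfolding r_def by (intro continuous_intros g B.cont_L v)
      have r': "invariant r"
        using g(2) B.L_invariant[OF v] by (auto simp: invariant_def r_def)
      have r0: "sqn r \<ge> 0" by (rule sqn_nonneg[OF r])
      show ?case
      \<comment> \<open>The tolerance \<open>sqn r / 9\<close> below has to be positive, so an exact
        solution is treated apart.\<close>
      proof (cases "sqn r = 0")
        case True
        then have "sqn (\<lambda>w. g w - (B.L v w + c)) \<le> (1/2) ^ Suc n * sqn g"
          using sqn_nonneg[OF g(1)] by (simp add: r_def[symmetric])
        then show ?thesis using v by blast
      next
        case False
        \<comment> \<open>Once \<open>sqn q < sqn r / 9\<close>, the new residual is at most
          \<open>2 * sqn q + (2 * sqn r + 2 * sqn q) / 8\<close>, which is below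
          \<open>sqn r / 2\<close>; the numbers 9 and 16 are chosen for this.\<close>
        then have "sqn r / 9 > 0" using r0 by simp
        then obtain u d where u: "test_fun u" and ud: "sqn (\<lambda>w. r w - (A.L u w + d)) < sqn r / 9"
          using dense r r' unfolding A.dense_range_def by blast
        have cgrad: "continuous_on (- {0}) (grad u j)" for j by (rule A.cont_grad[OF u])
        have cK: "continuous_on (- {0}) (K u)"
          unfolding K_def by (intro continuous_intros D cgrad)
        have cL: "continuous_on (- {0}) (A.L u)" by (rule A.cont_L[OF u])
        define q where "q w = r w - (A.L u w + d)" for w
        have cq: "continuous_on (- {0}) q" unfolding q_def by (intro continuous_intros r cL)
        have cnq: "continuous_on (- {0}) (\<lambda>w. - 1 * q w)" by (intro continuous_intros cq)
        have "sqn (\<lambda>w. A.L u w + d) = sqn (\<lambda>w. r w + - 1 * q w)"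
          by (intro sqn_cong) (simp add: q_def)
        also have "\<dots> \<le> 2 * sqn r + 2 * sqn q"
          using sqn_add_le[OF r cnq] unfolding sqn_cmult by simp
        finally have Lu: "sqn (\<lambda>w. A.L u w + d) \<le> 2 * sqn r + 2 * sqn q" .
        have "sqn (\<lambda>w. g w - (B.L (\<lambda>w. v w + u w) w + (c + d))) = sqn (\<lambda>w. q w + K u w)"
          by (intro sqn_cong) (simp add: B.L_add[OF v u] q_def r_def L)
        also have "\<dots> \<le> 2 * sqn q + 2 * sqn (K u)"
          by (rule sqn_add_le[OF cq cK])
        also have "\<dots> \<le> 2 * sqn q + 2 * (sqn (\<lambda>w. A.L u w + d) / 16)"
          using small[OF u, of d, folded K_def] by simp
        also have "\<dots> \<le> (1/2) * sqn r"
          using Lu ud by (simp add: q_def[symmetric])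
        also have "\<dots> \<le> (1/2) ^ Suc n * sqn g"
          using vc by (simp add: r_def[symmetric])
        finally show ?thesis using test_fun_add[OF v u] by blast
      qed
    qed
    moreover obtain n where "(1/2) ^ n * sqn g < e"
    proof -
      have "(\<lambda>n. (1/2) ^ n * sqn g) \<longlonglongrightarrow> 0 * sqn g"
        by (intro tendsto_mult tendsto_const LIMSEQ_realpow_zero) auto
      then have "eventually (\<lambda>n. (1/2) ^ n * sqn g < e) sequentially"
        using e by (intro order_tendstoD) auto
      then show ?thesis using that by (auto simp: eventually_sequentially)
    qed
    ultimately show "\<exists>v c. test_fun v \<and> sqn (\<lambda>w. g w - (B.L v w + c)) < e"
      by (meson le_less_trans)
  qed
qed

text \<open>Weight, first derivative and Levi form are affine in \<open>s\<close>, so a common lower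
  bound of the Levi forms at the two ends persists along the segment.\<close>

lemma log_weight_convex_combination:
  fixes \<psi>0 \<psi>1 :: "complex^'m \<Rightarrow> real"
  assumes "log_weight \<psi>0" "log_weight \<psi>1"
  defines "\<psi> \<equiv> \<lambda>s w. (1 - s) * \<psi>0 w + s * \<psi>1 w"
  shows "log_weight (\<psi> s)"
    and "w \<noteq> 0 \<Longrightarrow> log_weight.p (\<psi> s) j w = of_real (1 - s) * log_weight.p \<psi>0 j w + of_real s * log_weight.p \<psi>1 j w"
    and "w \<noteq> 0 \<Longrightarrow> log_weight.levi (\<psi> s) w X = of_real (1 - s) * log_weight.levi \<psi>0 w X + of_real s * log_weight.levi \<psi>1 w X"
proof -
  interpret A: log_weight \<psi>0 by fact
  interpret B: log_weight \<psi>1 by fact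
  show C: "log_weight (\<psi> s)"
  proof
    show "Ck_on 2 (- {0}) (\<psi> s)"
      unfolding \<psi>_def
      by (rule Ck_on_add[OF open_minus_0 Ck_on_mult[OF open_minus_0 Ck_on_const A.psi_Ck]
            Ck_on_mult[OF open_minus_0 Ck_on_const B.psi_Ck]])
    show "\<psi> s (c *s w) = \<psi> s w + 2 * CARD('m) * ln (cmod c)" if "c \<noteq> 0" "w \<noteq> 0" for c w
      unfolding \<psi>_def A.psi_scale[OF that] B.psi_scale[OF that] by (simp add: algebra_simps)
  qed
  interpret C: log_weight "\<psi> s" by (rule C)
  have p: "C.p j w = of_real (1 - s) * A.p j w + of_real s * B.p j w" if "w \<noteq> 0" for j w
  proof -
    have d: "(\<lambda>w. complex_of_real (\<psi>0 w)) differentiable (at w)" "(\<lambda>w. complex_of_real (\<psi>1 w)) differentiable (at w)"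
      using A.psi_differentiable[OF that] B.psi_differentiable[OF that] by simp_all
    have "C.p j w = d_z j (\<lambda>w. of_real (1 - s) * of_real (\<psi>0 w) + of_real s * of_real (\<psi>1 w)) w"
      unfolding C.p_def unfolding \<psi>_def by (simp only: of_real_add of_real_mult)
    also have "\<dots> = of_real (1 - s) * A.p j w + of_real s * B.p j w"
      unfolding A.p_def B.p_def
      by (subst d_z_add(1), (intro differentiable_mult differentiable_const d)+) (simp only: d_z_cmult(1)[OF d(1)] d_z_cmult(1)[OF d(2)])
    finally show ?thesis .
  qed
  then show "w \<noteq> 0 \<Longrightarrow> C.p j w = of_real (1 - s) * A.p j w + of_real s * B.p j w" .
  have q: "C.q j k w = of_real (1 - s) * A.q j k w + of_real s * B.q j k w" if "w \<noteq> 0" for j k w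
  proof -
    note d = A.p_differentiable[OF that, of j] B.p_differentiable[OF that, of j]
    have "C.q j k w = d_zbar k (\<lambda>w. of_real (1 - s) * A.p j w + of_real s * B.p j w) w"
      unfolding C.q_def by (rule d_z_cong(2)[OF open_minus_0]) (use that p in auto)
    also have "\<dots> = of_real (1 - s) * A.q j k w + of_real s * B.q j k w"
      unfolding A.q_def B.q_def
      by (subst d_z_add(2), (intro differentiable_mult differentiable_const d)+) (simp only: d_z_cmult(2)[OF d(1)] d_z_cmult(2)[OF d(2)])
    finally show ?thesis .
  qed
  show "w \<noteq> 0 \<Longrightarrow> C.levi w X = of_real (1 - s) * A.levi w X + of_real s * B.levi w X"
    unfolding A.levi_def B.levi_def C.levi_def sum_distrib_left sum.distrib[symmetric]
    by (intro sum.cong refl) (simp add: q algebra_simps)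
qed

text \<open>Density of the range is propagated from the Fubini-Study weight along the segment of weights.\<close>

theorem dense_range_positive_weight:
  fixes \<psi> :: "complex^'m \<Rightarrow> real"
  assumes \<psi>: "log_weight \<psi>" and \<kappa>: "\<kappa> > 0"
    "\<And>w X. 1 \<le> norm w \<Longrightarrow> norm w \<le> 2 \<Longrightarrow> (\<Sum>j\<in>UNIV. cnj (w $ j) * X j) = 0 \<Longrightarrow>
        \<kappa> * (\<Sum>j\<in>UNIV. (cmod (X j))\<^sup>2) \<le> Re (log_weight.levi \<psi> w X)"
  shows "log_weight.dense_range \<psi>"
proof -
  define \<psi>0 where "\<psi>0 w = real CARD('m) * ln (w \<bullet> w)" for w :: "complex^'m"
  have \<psi>0: "log_weight \<psi>0" unfolding \<psi>0_def by (rule fs_weight)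
  interpret A: log_weight \<psi>0 by (rule \<psi>0)
  interpret B: log_weight \<psi> by (rule \<psi>)
  define \<phi> where "\<phi> s w = (1 - s) * \<psi>0 w + s * \<psi> w" for s w
  note conv = log_weight_convex_combination[OF \<psi>0 \<psi>, folded \<phi>_def]
  \<comment> \<open>The Fubini-Study Levi form of a vector orthogonal to \<open>w\<close> is at
    least \<open>1 / 4\<close> of its squared length on the shell, because there
    \<open>w \<bullet> w \<le> 4\<close>.\<close>
  define \<kappa>' where "\<kappa>' = min \<kappa> (1/4)"
  have k': "\<kappa>' > 0" using \<kappa>(1) by (simp add: \<kappa>'_def)
  have lev0: "\<kappa>' * (\<Sum>j\<in>UNIV. (cmod (X j))\<^sup>2) \<le> Re (A.levi w X)"
    if w: "1 \<le> norm w" "norm w \<le> 2" and X: "(\<Sum>j\<in>UNIV. cnj (w $ j) * X j) = 0" for w X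
  proof -
    have w0: "w \<noteq> 0" using w by auto
    have ww: "0 < w \<bullet> w" "w \<bullet> w \<le> 4"
      using w0 power_mono[OF w(2), of 2] by (simp_all add: dot_square_norm)
    have X2: "(\<Sum>j\<in>UNIV. X j * cnj (X j)) = of_real (\<Sum>j\<in>UNIV. (cmod (X j))\<^sup>2)"
      unfolding of_real_sum by (intro sum.cong refl complex_norm_square[symmetric])
    have "A.levi w X = of_real (real CARD('m) * inverse (w \<bullet> w) * (\<Sum>j\<in>UNIV. (cmod (X j))\<^sup>2))"
      using fs_levi[OF w0 X] unfolding \<psi>0_def[symmetric] X2
      by (simp only: sq_def of_real_mult of_real_inverse of_real_of_nat_eq)
    then have "Re (A.levi w X) = real CARD('m) * inverse (w \<bullet> w) * (\<Sum>j\<in>UNIV. (cmod (X j))\<^sup>2)"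
      by (simp only: Re_complex_of_real)
    moreover have "\<kappa>' \<le> real CARD('m) * inverse (w \<bullet> w)"
    proof -
      have "inverse 4 \<le> inverse (w \<bullet> w)" using ww by (intro le_imp_inverse_le) auto
      moreover have "1 * inverse (w \<bullet> w) \<le> real CARD('m) * inverse (w \<bullet> w)"
        using ww by (intro mult_right_mono) (auto simp: Suc_le_eq)
      ultimately show ?thesis by (simp add: \<kappa>'_def)
    qed
    ultimately show ?thesis by (simp add: mult_right_mono sum_nonneg)
  qed
  have lev1: "\<kappa>' * (\<Sum>j\<in>UNIV. (cmod (X j))\<^sup>2) \<le> Re (B.levi w X)"
    if "1 \<le> norm w" "norm w \<le> 2" "(\<Sum>j\<in>UNIV. cnj (w $ j) * X j) = 0" for w X
    using \<kappa>(2)[OF that] by (rule order_trans[rotated]) (auto simp: \<kappa>'_def intro!: mult_right_mono sum_nonneg)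
  have lev: "\<kappa>' * (\<Sum>j\<in>UNIV. (cmod (X j))\<^sup>2) \<le> Re (log_weight.levi (\<phi> s) w X)"
    if s: "0 \<le> s" "s \<le> 1" and w: "1 \<le> norm w" "norm w \<le> 2" and X: "(\<Sum>j\<in>UNIV. cnj (w $ j) * X j) = 0" for s w X
  proof -
    have "w \<noteq> 0" using w by auto
    from conv(3)[OF this, of s X]
    have "Re (log_weight.levi (\<phi> s) w X) = (1 - s) * Re (A.levi w X) + s * Re (B.levi w X)"
      by (simp del: of_real_diff)
    moreover have "(1 - s) * (\<kappa>' * (\<Sum>j\<in>UNIV. (cmod (X j))\<^sup>2)) + s * (\<kappa>' * (\<Sum>j\<in>UNIV. (cmod (X j))\<^sup>2))
        \<le> (1 - s) * Re (A.levi w X) + s * Re (B.levi w X)"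
      using s lev0[OF w X] lev1[OF w X] by (intro add_mono mult_left_mono) auto
    ultimately show ?thesis by (simp add: algebra_simps)
  qed
  obtain b0 where "b0 > 0" and b0: "\<And>w. 1 \<le> norm w \<Longrightarrow> norm w \<le> 2 \<Longrightarrow> norm (\<psi>0 w) \<le> b0"
    by (rule shell_bounded[OF Ck_on_continuous_on[OF A.psi_Ck]], rule that, assumption, blast)
  obtain b1 where "b1 > 0" and b1: "\<And>w. 1 \<le> norm w \<Longrightarrow> norm w \<le> 2 \<Longrightarrow> norm (\<psi> w) \<le> b1"
    by (rule shell_bounded[OF Ck_on_continuous_on[OF B.psi_Ck]], rule that, assumption, blast)
  define b where "b = max b0 b1"
  have bound: "exp (- b) \<le> exp (- \<phi> s w) \<and> exp (- \<phi> s w) \<le> exp b"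
    if s: "0 \<le> s" "s \<le> 1" and w: "1 \<le> norm w" "norm w \<le> 2" for s w
  proof -
    have "\<bar>\<phi> s w\<bar> \<le> (1 - s) * \<bar>\<psi>0 w\<bar> + s * \<bar>\<psi> w\<bar>"
      unfolding \<phi>_def using s by (intro order_trans[OF abs_triangle_ineq]) (simp add: abs_mult)
    also have "\<dots> \<le> (1 - s) * b + s * b"
      using s b0[OF w] b1[OF w] by (intro add_mono mult_left_mono) (auto simp: b_def)
    finally have "\<bar>\<phi> s w\<bar> \<le> b" by (simp add: algebra_simps)
    then show ?thesis by auto
  qed
  define D where "D j w = B.p j w - A.p j w" for j w
  have contD: "continuous_on (- {0}) (D j)" for j
    unfolding D_def by (intro continuous_intros A.contp B.contp)
  have "\<forall>j. \<exists>M. \<forall>w. 1 \<le> norm w \<longrightarrow> norm w \<le> 2 \<longrightarrow> cmod (D j w) \<le> M"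
  proof
    fix j
    obtain B where "B > 0" and "\<And>w. 1 \<le> norm w \<Longrightarrow> norm w \<le> 2 \<Longrightarrow> cmod (D j w) \<le> B"
      using shell_bounded[OF contD] by blast
    then show "\<exists>M. \<forall>w. 1 \<le> norm w \<longrightarrow> norm w \<le> 2 \<longrightarrow> cmod (D j w) \<le> M" by blast
  qed
  from choice[OF this] obtain M' where M': "\<And>j w. 1 \<le> norm w \<Longrightarrow> norm w \<le> 2 \<Longrightarrow> cmod (D j w) \<le> M' j" by blast
  define M where "M = (\<Sum>j\<in>UNIV. \<bar>M' j\<bar>)"
  have M: "cmod (D j w) \<le> M" if "1 \<le> norm w" "norm w \<le> 2" for j w
  proof -
    have "cmod (D j w) \<le> \<bar>M' j\<bar>" using M'[OF that, of j] by simp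
    also have "\<dots> \<le> M" unfolding M_def by (intro member_le_sum) auto
    finally show ?thesis .
  qed
  define C where "C = real CARD('m) * M\<^sup>2 * exp b / (\<kappa>' * exp (- b))"
  have C0: "C \<ge> 0" using k' by (simp add: C_def)
  \<comment> \<open>\<open>C\<close> serves every point of the segment. A step of length
    \<open>h\<close> multiplies the squared first-order term by \<open>h\<^sup>2\<close>, and
    \<open>n\<close> makes \<open>h\<^sup>2 * C\<close> at most \<open>1 / 16\<close>, the threshold
    of \<open>dense_range_perturb\<close>.\<close>
  obtain n :: nat where n: "n > 0" "16 * C \<le> (real n)\<^sup>2"
  proof -
    obtain n :: nat where n: "16 * C + 1 < real n" using reals_Archimedean2 by blast
    then have "1 \<le> real n" using C0 by linarith
    then have "real n \<le> (real n)\<^sup>2" by (simp add: power2_eq_square)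
    with n have "16 * C \<le> (real n)\<^sup>2" by linarith
    moreover have "n > 0" using \<open>1 \<le> real n\<close> by auto
    ultimately show ?thesis using that by blast
  qed
  define h where "h = 1 / real n"
  have h: "h > 0" "h\<^sup>2 * C \<le> 1/16" using n by (simp_all add: h_def field_simps)
  have "log_weight.dense_range (\<phi> (real i * h))" if "i \<le> n" for i
    using that
  proof (induction i)
    case 0
    have "\<phi> 0 = \<psi>0" by (simp add: \<phi>_def fun_eq_iff)
    then show ?case using fs_dense_range by (simp add: \<psi>0_def[abs_def])
  next
    case (Suc i)
    let ?s = "real i * h" and ?t = "real (Suc i) * h"
    have s: "0 \<le> ?s" "?s \<le> 1"
      using Suc.prems n(1) by (simp_all add: h_def field_simps)
    interpret S: log_weight "\<phi> ?s" by (rule conv(1))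
    show ?case
    proof (rule dense_range_perturb[OF conv(1) conv(1), of ?s "\<lambda>j w. of_real h * D j w" ?t])
      show "S.dense_range" using Suc by simp
      show "continuous_on (- {0}) (\<lambda>w. of_real h * D j w)" for j by (intro continuous_intros contD)
      show "log_weight.p (\<phi> ?t) j w = S.p j w + of_real h * D j w" if "w \<noteq> 0" for j w
        unfolding conv(2)[OF that] D_def by (simp add: algebra_simps)
      fix v :: "complex^'m \<Rightarrow> complex" and c assume v: "test_fun v"
      have "sqn (\<lambda>w. \<Sum>j\<in>UNIV. D j w * grad v j w) \<le> C * sqn (\<lambda>w. S.L v w + c)"
        unfolding C_def
        by (rule S.perturbation_bound[OF v contD M _ bound[OF s] k' lev[OF s]]) auto
      then have "h\<^sup>2 * sqn (\<lambda>w. \<Sum>j\<in>UNIV. D j w * grad v j w) \<le> h\<^sup>2 * (C * sqn (\<lambda>w. S.L v w + c))"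
        by (intro mult_left_mono) auto
      also have "\<dots> \<le> 1/16 * sqn (\<lambda>w. S.L v w + c)"
        unfolding mult.assoc[symmetric] using h(2)
        by (intro mult_right_mono sqn_nonneg) (auto intro!: continuous_intros S.cont_L[OF v])
      finally have "h\<^sup>2 * sqn (\<lambda>w. \<Sum>j\<in>UNIV. D j w * grad v j w) \<le> sqn (\<lambda>w. S.L v w + c) / 16" by simp
      moreover have "sqn (\<lambda>w. \<Sum>j\<in>UNIV. of_real h * D j w * grad v j w) = h\<^sup>2 * sqn (\<lambda>w. \<Sum>j\<in>UNIV. D j w * grad v j w)"
        using sqn_cmult[of "of_real h" "\<lambda>w. \<Sum>j\<in>UNIV. D j w * grad v j w"]
        by (simp add: sum_distrib_left mult.assoc)
      ultimately show "sqn (\<lambda>w. \<Sum>j\<in>UNIV. of_real h * D j w * grad v j w) \<le> sqn (\<lambda>w. S.L v w + c) / 16" by simp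
    qed
  qed
  from this[of n] have "log_weight.dense_range (\<phi> 1)" using n(1) by (simp add: h_def)
  moreover have "\<phi> 1 = \<psi>" by (simp add: \<phi>_def fun_eq_iff)
  ultimately show ?thesis by simp
qed

section \<open>The variance inequality\<close>

lemma J_add3:
  assumes "continuous_on (- {0}) f" "continuous_on (- {0}) g" "continuous_on (- {0}) h"
  shows "J (\<lambda>w. f w + (g w + h w)) = J f + (J g + J h)"
  by (simp only: J_add assms continuous_on_add)

lemma J_add4:
  assumes "continuous_on (- {0}) f" "continuous_on (- {0}) g" "continuous_on (- {0}) h" "continuous_on (- {0}) k"
  shows "J (\<lambda>w. f w + (g w + (h w + k w))) = J f + (J g + (J h + J k))"
  by (simp only: J_add assms continuous_on_add)

lemma J_1_pos: "0 < Re (J (\<lambda>w::complex^'m. 1))"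
proof -
  have int: "integrable lborel (\<lambda>w::complex^'m. complex_of_real (bump w) * 1)"
    by (rule J_integrable[OF continuous_on_const])
  then have int': "integrable lborel (bump :: complex^'m \<Rightarrow> real)"
    using integrable_Re[OF int] by simp
  have eq: "Re (J (\<lambda>w::complex^'m. 1)) = (LINT w|lborel. bump (w::complex^'m))"
    unfolding J_def using integral_Re[OF int] by simp
  have "(LINT w|lborel. bump (w::complex^'m)) \<noteq> 0"
  proof
    assume "(LINT w|lborel. bump (w::complex^'m)) = 0"
    then have "AE w in lborel. bump (w::complex^'m) = 0"
      using integral_nonneg_eq_0_iff_AE[OF int'] by simp
    then have "AE w in lborel. (w::complex^'m) \<notin> ball 0 2 - cball 0 1"
      by (rule AE_mp) (rule AE_I2, use bump_pos in force)
    then have "ball (0::complex^'m) 2 - cball 0 1 \<in> null_sets lborel"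
      by (subst (asm) AE_iff_null_sets[symmetric]) auto
    moreover obtain e :: "complex^'m" where e: "e \<in> Basis" using nonempty_Basis by blast
    \<comment> \<open>A ball inside the open shell, where the cutoff is positive; its measure is
      positive, which contradicts a null shell.\<close>
    have "ball ((3/2) *\<^sub>R e) (1/2) \<subseteq> ball (0::complex^'m) 2 - cball 0 1"
    proof
      fix x assume "x \<in> ball ((3/2) *\<^sub>R e) (1/2)"
      then have x: "norm ((3/2) *\<^sub>R e - x) < 1/2" by (simp add: dist_norm)
      have "norm ((3/2) *\<^sub>R e) = 3/2" using e by simp
      then have "\<bar>3/2 - norm x\<bar> < 1/2" using norm_triangle_ineq3[of "(3/2) *\<^sub>R e" x] x by linarith
      then have "norm x < 2" "1 < norm x" by linarith+
      then show "x \<in> ball 0 2 - cball 0 1" by simp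
    qed
    ultimately have "ball ((3/2) *\<^sub>R e) (1/2) \<in> null_sets lborel"
      by (auto intro: null_sets_subset)
    then have "measure lborel (ball ((3/2) *\<^sub>R e) (1/2)) = 0"
      by (simp add: measure_def null_setsD1)
    then show False
      using content_ball_pos[of "1/2" "(3/2) *\<^sub>R e"] by simp
  qed
  moreover have "0 \<le> (LINT w|lborel. bump (w::complex^'m))" by simp
  ultimately show ?thesis unfolding eq by linarith
qed

context log_weight begin

lemma E_shell_bounds:
  "\<exists>e1 e2. 0 < e1 \<and> 0 < e2 \<and>
    (\<forall>w. 1 \<le> norm w \<longrightarrow> norm w \<le> 2 \<longrightarrow> e1 \<le> exp (- \<psi> w) \<and> exp (- \<psi> w) \<le> e2)"
proof -
  obtain b where "b > 0" and b: "\<And>w. 1 \<le> norm w \<Longrightarrow> norm w \<le> 2 \<Longrightarrow> norm (\<psi> w) \<le> b"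
    by (rule shell_bounded[OF Ck_on_continuous_on[OF psi_Ck]], rule that, assumption, blast)
  have "exp (- b) \<le> exp (- \<psi> w) \<and> exp (- \<psi> w) \<le> exp b" if "1 \<le> norm w" "norm w \<le> 2" for w
    using b[OF that] by auto
  then show ?thesis by (intro exI[of _ "exp (- b)"] exI[of _ "exp b"]) simp
qed

lemma J_E: "J E = of_real (Re (J E))" "0 < Re (J E)"
proof -
  have "cnj (J E) = J E" unfolding J_cnj[symmetric] by simp
  then show "J E = of_real (Re (J E))" by (simp add: complex_eq_iff)
  obtain e1 e2 where e: "0 < e1" "0 < e2"
    "\<And>w. 1 \<le> norm w \<Longrightarrow> norm w \<le> 2 \<Longrightarrow> e1 \<le> exp (- \<psi> w) \<and> exp (- \<psi> w) \<le> e2"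
    using E_shell_bounds by blast
  have "Re (J (\<lambda>w::complex^'m. of_real e1 * 1)) \<le> Re (J E)"
    by (rule Re_J_mono[OF continuous_on_const contE]) (use e(3) in \<open>simp add: E_def\<close>)
  then have "e1 * Re (J (\<lambda>w::complex^'m. 1)) \<le> Re (J E)"
    unfolding J_cmult by simp
  then show "0 < Re (J E)"
    using mult_pos_pos[OF e(1) J_1_pos[where 'm='m]] by linarith
qed

text \<open>Take for \<open>X\<close> the gradient of an approximate solution \<open>v\<close> of \<open>L v = f - mean f\<close>: after integration the mixed
  term becomes minus twice the variance of \<open>f\<close>, and the Levi term is at most the variance by \<open>L_Bochner\<close>.\<close>

theorem variance_less:
  assumes dense: dense_range
    and f: "Ck_on 1 (- {0}) f" "invariant f" and u: "continuous_on (- {0}) u"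
    and c0: "c0 > 0" "\<And>w X. 1 \<le> norm w \<Longrightarrow> norm w \<le> 2 \<Longrightarrow>
      c0 \<le> Re (u w) + 2 * Re (\<Sum>j\<in>UNIV. d_zbar j f w * cnj (X j)) + Re (levi w X)"
  shows "Re (J (\<lambda>w. f w * cnj (f w) * E w)) - (cmod (J (\<lambda>w. f w * E w)))\<^sup>2 / Re (J E)
      < Re (J (\<lambda>w. u w * E w))"
proof -
  define Z where "Z = Re (J E)"
  have Z: "Z > 0" "J E = of_real Z" using J_E by (simp_all add: Z_def)
  define m where "m = J (\<lambda>w. f w * E w) / of_real Z"
  define f0 where "f0 w = f w - m" for w
  have cf: "continuous_on (- {0}) f" by (rule Ck_on_continuous_on[OF f(1)])
  have cf0: "continuous_on (- {0}) f0" unfolding f0_def by (intro continuous_intros cf)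
  have "J (\<lambda>w. f0 w * E w) = J (\<lambda>w. f w * E w - m * E w)"
    by (simp add: f0_def left_diff_distrib)
  also have "\<dots> = J (\<lambda>w. f w * E w) - m * J E"
    unfolding J_cmult[symmetric] by (rule J_diff) (intro continuous_intros cf contE)+
  also have "\<dots> = 0" using Z by (simp add: m_def)
  finally have f00: "J (\<lambda>w. f0 w * E w) = 0" .
  have "Re (J (\<lambda>w. f w * cnj (f w) * E w)) = Re (J (\<lambda>w. f0 w * cnj (f0 w) * E w)) + (cmod m)\<^sup>2 * Z"
    using Re_J_square_add_const[OF cf0 f00, of m] by (simp add: f0_def Z_def)
  moreover have "(cmod m)\<^sup>2 * Z = (cmod (J (\<lambda>w. f w * E w)))\<^sup>2 / Z"
    using Z by (simp add: m_def norm_divide power_divide power2_eq_square)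
  ultimately have var: "Re (J (\<lambda>w. f w * cnj (f w) * E w)) - (cmod (J (\<lambda>w. f w * E w)))\<^sup>2 / Re (J E)
      = Re (J (\<lambda>w. f0 w * cnj (f0 w) * E w))"
    by (simp add: Z_def)
  obtain e1 e2 where "0 < e1" and e: "0 < e2"
    "\<And>w. 1 \<le> norm w \<Longrightarrow> norm w \<le> 2 \<Longrightarrow> e1 \<le> exp (- \<psi> w) \<and> exp (- \<psi> w) \<le> e2"
    using E_shell_bounds by blast
  \<comment> \<open>Passing to the weight \<open>E\<close> costs at most the factor
    \<open>e2\<close>, so with this tolerance the weighted error stays below \<open>c0 * Z\<close>,
    the total mass of the uniform slack \<open>c0\<close>.\<close>
  have "c0 * Z / e2 > 0" using c0 Z e by simp
  moreover have "invariant f0" using f(2) by (simp add: invariant_def f0_def)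
  ultimately obtain v c where v: "test_fun v" and vc: "sqn (\<lambda>w. f0 w - (L v w + c)) < c0 * Z / e2"
    using dense cf0 unfolding dense_range_def by blast
  note cL = cont_L[OF v] and cg = cont_grad[OF v]
  have cdf: "continuous_on (- {0}) (d_zbar j f)" for j
    using Ck_on_continuous_on[OF Ck_on_d_z(2)[OF open_minus_0, of 0 f]] f(1) by simp
  note [continuous_intros] = cL cg cdf cf0 cf contE u cont_levi[OF v]
  let ?S = "\<lambda>w. \<Sum>j\<in>UNIV. d_zbar j f w * cnj (grad v j w)"
  have "c0 * Z = Re (J (\<lambda>w. of_real c0 * E w))" unfolding J_cmult Z by simp
  also have "\<dots> \<le> Re (J (\<lambda>w. u w * E w + (2 * (?S w * E w) + levi w (\<lambda>j. grad v j w) * E w)))"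
  proof (rule Re_J_mono)
    fix w :: "complex^'m" assume w: "1 \<le> norm w" "norm w \<le> 2"
    have "c0 * exp (- \<psi> w) \<le> (Re (u w) + 2 * Re (?S w) + Re (levi w (\<lambda>j. grad v j w))) * exp (- \<psi> w)"
      by (intro mult_right_mono c0(2)[OF w]) simp
    then show "Re (of_real c0 * E w) \<le> Re (u w * E w + (2 * (?S w * E w) + levi w (\<lambda>j. grad v j w) * E w))"
      by (simp add: E_def algebra_simps del: Re_sum)
  qed (intro continuous_intros)+
  also have "J (\<lambda>w. u w * E w + (2 * (?S w * E w) + levi w (\<lambda>j. grad v j w) * E w))
      = J (\<lambda>w. u w * E w) + (2 * J (\<lambda>w. ?S w * E w) + J (\<lambda>w. levi w (\<lambda>j. grad v j w) * E w))"
    unfolding J_cmult[symmetric] by (rule J_add3) (intro continuous_intros)+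
  \<comment> \<open>Integration by parts turns the mixed term into the pairing of \<open>f\<close>
    with \<open>L v\<close>; the mean \<open>m\<close> may be removed from \<open>f\<close> because
    \<open>L v\<close> is orthogonal to the constants.\<close>
  also have "J (\<lambda>w. ?S w * E w) = - J (\<lambda>w. f w * cnj (L v w) * E w)"
    using J_L_adjoint[OF v f(1) invariant_homogeneous[OF f(2)]] by simp
  also have "J (\<lambda>w. f w * cnj (L v w) * E w) = J (\<lambda>w. f0 w * cnj (L v w) * E w + m * (cnj (L v w) * E w))"
    by (simp add: f0_def algebra_simps)
  also have "\<dots> = J (\<lambda>w. f0 w * cnj (L v w) * E w) + m * J (\<lambda>w. cnj (L v w) * E w)"
    unfolding J_cmult[symmetric] by (rule J_add) (intro continuous_intros)+
  finally have 1: "c0 * Z \<le> Re (J (\<lambda>w. u w * E w)) - 2 * Re (J (\<lambda>w. f0 w * cnj (L v w) * E w))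
      + Re (J (\<lambda>w. L v w * cnj (L v w) * E w))"
    using L_Bochner[OF v] J_L_eq_0(1)[OF v] by simp
  have diff0: "J (\<lambda>w. (f0 w - L v w) * E w) = 0"
  proof -
    have "J (\<lambda>w. (f0 w - L v w) * E w) = J (\<lambda>w. f0 w * E w) - J (\<lambda>w. L v w * E w)"
      unfolding left_diff_distrib by (rule J_diff) (intro continuous_intros)+
    then show ?thesis using f00 J_L_eq_0(2)[OF v] by simp
  qed
  \<comment> \<open>Both \<open>f0\<close> and \<open>L v\<close> have mean zero, so dropping the
    constant \<open>c\<close> can only lower the norm.\<close>
  have "Re (J (\<lambda>w. (f0 w - L v w) * cnj (f0 w - L v w) * E w))
      \<le> Re (J (\<lambda>w. ((f0 w - L v w) + - c) * cnj ((f0 w - L v w) + - c) * E w))"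
    by (subst Re_J_square_add_const[OF _ diff0]) (use J_E in \<open>auto intro!: continuous_intros\<close>)
  also have "\<dots> \<le> Re (J (\<lambda>w. of_real e2 * ((f0 w - (L v w + c)) * cnj (f0 w - (L v w + c)))))"
  proof (rule Re_J_mono)
    fix w :: "complex^'m" assume w: "1 \<le> norm w" "norm w \<le> 2"
    have eq: "f0 w - L v w + - c = f0 w - (L v w + c)" by simp
    show "Re ((f0 w - L v w + - c) * cnj (f0 w - L v w + - c) * E w)
      \<le> Re (of_real e2 * ((f0 w - (L v w + c)) * cnj (f0 w - (L v w + c))))"
      unfolding eq E_def complex_norm_square[symmetric] of_real_mult[symmetric] Re_complex_of_real
      using e(2)[OF w] by (simp add: mult.commute mult_right_mono)
  qed (intro continuous_intros)+
  also have "\<dots> = e2 * sqn (\<lambda>w. f0 w - (L v w + c))" unfolding J_cmult sqn_def by simp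
  also have "\<dots> < c0 * Z" using vc e(1) by (simp add: field_simps)
  finally have 2: "Re (J (\<lambda>w. (f0 w - L v w) * cnj (f0 w - L v w) * E w)) < c0 * Z" .
  have "J (\<lambda>w. (f0 w - L v w) * cnj (f0 w - L v w) * E w)
      = J (\<lambda>w. f0 w * cnj (f0 w) * E w + (- 1 * (f0 w * cnj (L v w) * E w)
         + (- 1 * cnj (f0 w * cnj (L v w) * E w) + L v w * cnj (L v w) * E w)))"
    by (simp add: algebra_simps)
  also have "\<dots> = J (\<lambda>w. f0 w * cnj (f0 w) * E w) + (- 1 * J (\<lambda>w. f0 w * cnj (L v w) * E w)
         + (- 1 * cnj (J (\<lambda>w. f0 w * cnj (L v w) * E w)) + J (\<lambda>w. L v w * cnj (L v w) * E w)))"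
    unfolding J_cmult[symmetric] J_cnj[symmetric]
    by (rule J_add4) (intro continuous_intros)+
  \<comment> \<open>Compared with the inequality \<open>1\<close>, all terms that contain
    \<open>v\<close> cancel and the variance of \<open>f\<close> is left.\<close>
  finally have "Re (J (\<lambda>w. f0 w * cnj (f0 w) * E w)) - 2 * Re (J (\<lambda>w. f0 w * cnj (L v w) * E w))
      + Re (J (\<lambda>w. L v w * cnj (L v w) * E w)) < c0 * Z"
    using 2 by simp
  then show ?thesis unfolding var using 1 by linarith
qed

end

section \<open>Base and fibre coordinates\<close>

definition join :: "complex^'n \<Rightarrow> complex^'m \<Rightarrow> complex^('n + 'm)" where
  "join z w = (\<chi> k. case k of Inl i \<Rightarrow> z $ i | Inr j \<Rightarrow> w $ j)"

lemma join_nth [simp]: "join z w $ Inl i = z $ i" "join z w $ Inr j = w $ j"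
  by (simp_all add: join_def)

lemma vec_sum_eqI:
  assumes "\<And>i. x $ Inl i = y $ Inl i" "\<And>j. x $ Inr j = y $ Inr j"
  shows "x = y"
  unfolding vec_eq_iff
proof
  fix k show "x $ k = y $ k" using assms by (cases k) auto
qed

lemma join_add: "join z w + join z' w' = join (z + z') (w + w')"
  by (rule vec_sum_eqI) auto

lemma join_scaleR: "r *\<^sub>R join z w = join (r *\<^sub>R z) (r *\<^sub>R w)"
  by (rule vec_sum_eqI) auto

lemma join_0 [simp]: "join 0 0 = 0"
  by (rule vec_sum_eqI) auto

lemma join_inject [simp]: "join z w = join z' w' \<longleftrightarrow> z = z' \<and> w = w'"
proof
  assume eq: "join z w = join z' w'"
  have "z $ i = z' $ i" "w $ j = w' $ j" for i j
    using arg_cong[OF eq, of "\<lambda>p. p $ Inl i"] arg_cong[OF eq, of "\<lambda>p. p $ Inr j"] by simp_all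
  then show "z = z' \<and> w = w'" by (simp add: vec_eq_iff)
qed simp

lemma join_eq_0_iff [simp]: "join z w = 0 \<longleftrightarrow> z = 0 \<and> w = 0"
  using join_inject[of z w 0 0] by simp

lemma bounded_linear_join_left: "bounded_linear (\<lambda>z. join z 0)"
  by (rule linear_conv_bounded_linear[THEN iffD1]) (auto intro!: linearI simp: join_add join_scaleR)

lemma bounded_linear_join_right: "bounded_linear (\<lambda>w. join 0 w)"
  by (rule linear_conv_bounded_linear[THEN iffD1]) (auto intro!: linearI simp: join_add join_scaleR)

lemma continuous_on_join:
  assumes "continuous_on T f" "continuous_on T g"
  shows "continuous_on T (\<lambda>t. join (f t) (g t))"
proof -
  have "(\<lambda>t. join (f t) (g t)) = (\<lambda>t. join (f t) 0 + join 0 (g t))"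
    by (simp add: join_add)
  then show ?thesis
    using continuous_on_add[OF bounded_linear.continuous_on[OF bounded_linear_join_left assms(1)]
        bounded_linear.continuous_on[OF bounded_linear_join_right assms(2)]]
    by (simp only:)
qed

lemma UNIV_sum_split:
  fixes f :: "'n::finite + 'm::finite \<Rightarrow> 'a::comm_monoid_add"
  shows "sum f UNIV = (\<Sum>i\<in>UNIV. f (Inl i)) + (\<Sum>j\<in>UNIV. f (Inr j))"
proof -
  have "sum f (UNIV <+> UNIV) = (\<Sum>i\<in>UNIV. f (Inl i)) + (\<Sum>j\<in>UNIV. f (Inr j))"
    using sum.Plus[of UNIV UNIV f] by (simp add: comp_def del: UNIV_Plus_UNIV)
  then show ?thesis by simp
qed

lemma norm_join: "(norm (join z w))\<^sup>2 = (norm z)\<^sup>2 + (norm w)\<^sup>2"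
  by (simp add: norm_vec_def L2_set_def UNIV_sum_split sum_nonneg)

lemma axis_Inl: "axis (Inl i) a = join (axis i a) 0"
  by (rule vec_sum_eqI) (auto simp: axis_def)

lemma axis_Inr: "axis (Inr j) a = join 0 (axis j a)"
  by (rule vec_sum_eqI) (auto simp: axis_def)

lemma has_derivative_slice:
  assumes "F differentiable (at (join z w))"
  shows "((\<lambda>z. F (join z w)) has_derivative (\<lambda>a. dd (join a 0) F (join z w))) (at z)"
    and "((\<lambda>w. F (join z w)) has_derivative (\<lambda>a. dd (join 0 a) F (join z w))) (at w)"
proof -
  have "((\<lambda>z. join z 0 + join 0 w) has_derivative (\<lambda>a. join a 0)) (at z)"
    by (rule has_derivative_add_const[OF bounded_linear_imp_has_derivative[OF bounded_linear_join_left]])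
  then have 1: "((\<lambda>z. join z w) has_derivative (\<lambda>a. join a 0)) (at z)"
    by (simp add: join_add)
  show "((\<lambda>z. F (join z w)) has_derivative (\<lambda>a. dd (join a 0) F (join z w))) (at z)"
    by (rule has_derivative_compose[OF 1 has_derivative_dd[OF assms]])
  have "((\<lambda>w. join 0 w + join z 0) has_derivative (\<lambda>a. join 0 a)) (at w)"
    by (rule has_derivative_add_const[OF bounded_linear_imp_has_derivative[OF bounded_linear_join_right]])
  then have 2: "((\<lambda>w. join z w) has_derivative (\<lambda>a. join 0 a)) (at w)"
    by (simp add: join_add)
  show "((\<lambda>w. F (join z w)) has_derivative (\<lambda>a. dd (join 0 a) F (join z w))) (at w)"
    by (rule has_derivative_compose[OF 2 has_derivative_dd[OF assms]])
qed

lemma d_z_slice: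
  assumes "F differentiable (at (join z w))"
  shows "d_z j (\<lambda>w. F (join z w)) w = d_z (Inr j) F (join z w)"
    "d_zbar j (\<lambda>w. F (join z w)) w = d_zbar (Inr j) F (join z w)"
  by (simp_all add: d_z_def d_zbar_def dd_eqI[OF has_derivative_slice(2)[OF assms]] axis_Inr)

text \<open>The chart domain without the zero section, on which the metric is
  differentiable.\<close>

definition fibres :: "(complex^'n) set \<Rightarrow> (complex^('n::finite + 'm::finite)) set" where
  "fibres D = {join z w | z w. z \<in> D \<and> w \<noteq> 0}"

lemma join_in_fibres [simp]: "join z w \<in> fibres D \<longleftrightarrow> z \<in> D \<and> w \<noteq> 0"
  by (auto simp: fibres_def)

lemma fibresE:
  assumes "p \<in> fibres D"
  obtains z w where "p = join z w" "z \<in> D" "w \<noteq> 0"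
  using assms by (auto simp: fibres_def)

lemma open_fibres:
  fixes D :: "(complex^'n) set"
  assumes "open D"
  shows "open (fibres D :: (complex^('n + 'm::finite)) set)"
proof -
  define a where "a p = (\<chi> i. p $ Inl i)" for p :: "complex^('n + 'm)"
  define b where "b p = (\<chi> j. p $ Inr j)" for p :: "complex^('n + 'm)"
  have ab: "p = join (a p) (b p)" for p by (rule vec_sum_eqI) (auto simp: a_def b_def)
  have "fibres D = a -` D \<inter> b -` (- {0})"
  proof (rule set_eqI)
    fix p show "p \<in> fibres D \<longleftrightarrow> p \<in> a -` D \<inter> b -` (- {0})"
      using join_in_fibres[of "a p" "b p" D] ab[of p] by simp
  qed
  moreover have "continuous_on UNIV a" "continuous_on UNIV b"
    unfolding a_def b_def by (intro continuous_intros)+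
  ultimately show ?thesis
    using assms open_minus_0 by (metis open_Int open_vimage)
qed

lemma Ck_on_slice:
  assumes "open D" "Ck_on k (fibres D) F" "z \<in> D"
  shows "Ck_on k (- {0}) (\<lambda>w. F (join z w))"
proof (rule Ck_on_compose[OF open_minus_0 _ _ assms(2)])
  show "(\<lambda>w. join z w) ` (- {0}) \<subseteq> fibres D" using assms(3) by auto
  have "Ck_on k (- {0}) (\<lambda>w. join z 0 + join 0 w)"
    by (rule Ck_on_add[OF open_minus_0 Ck_on_const Ck_on_linear[OF open_minus_0 bounded_linear_join_right]])
  then show "Ck_on k (- {0}) (\<lambda>w. join z w)" by (simp add: join_add)
qed

section \<open>Differentiation of shell integrals\<close>

lemma J_eq_integral:
  fixes g :: "'a::euclidean_space \<Rightarrow> complex"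
  assumes "continuous_on (- {0}) g" "cball 0 2 \<subseteq> cbox a b"
  shows "J g = integral (cbox a b) (\<lambda>w. of_real (bump w) * g w)"
  unfolding J_def
proof (rule lborel_integral_eq_cbox[OF J_integrable[OF assms(1)]])
  fix w assume "w \<notin> cbox a b"
  then have "2 < norm w" using assms(2) by (meson mem_cball_0 not_le subsetD)
  then show "of_real (bump w) * g w = 0" by (simp add: bump_eq_0)
qed

text \<open>\<open>bump\<close> vanishes for \<open>norm w \<le> 1\<close>, so the integral ignores
  the zero vector, near which \<open>G\<close> is uncontrolled. This is the role of the support set
  \<open>?K\<close> in the parameter lemmas.\<close>

lemma J_slice:
  fixes G :: "complex^('n::finite + 'm::finite) \<Rightarrow> complex"
  assumes D: "open D" and G: "Ck_on k (fibres D) G"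
  shows "Ck_on k D (\<lambda>z. J (\<lambda>w. G (join z w)))"
    and "z \<in> D \<Longrightarrow> k \<ge> 1 \<Longrightarrow> d_z i (\<lambda>z. J (\<lambda>w. G (join z w))) z = J (\<lambda>w. d_z (Inl i) G (join z w))"
    and "z \<in> D \<Longrightarrow> k \<ge> 1 \<Longrightarrow> d_zbar i (\<lambda>z. J (\<lambda>w. G (join z w))) z = J (\<lambda>w. d_zbar (Inl i) G (join z w))"
proof -
  obtain u v where uv: "cball (0::complex^'m) 2 \<subseteq> cbox u v"
    using bounded_subset_cbox_symmetric[OF bounded_cball] by metis
  let ?K = "{w::complex^'m. 1 \<le> norm w}"
  have K: "closed ?K" by (intro closed_Collect_le continuous_intros)
  have bump0: "complex_of_real (bump t) = 0" if "t \<notin> ?K" for t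
    using that by (simp add: bump_eq_0)
  have mem: "join x 0 + join 0 t \<in> fibres D" if "x \<in> D" "t \<in> ?K" for x t
    using that by (auto simp: join_add)
  have cb: "continuous_on (cbox u v) (\<lambda>t. complex_of_real (bump t))"
    by (intro continuous_intros continuous_on_bump)
  have cm: "continuous_on (cbox u v) (\<lambda>t. join 0 t)"
    by (intro continuous_on_join continuous_intros)
  have slice_cont: "continuous_on (- {0}) (\<lambda>w. F (join z w))" if "Ck_on 0 (fibres D) F" "z \<in> D" for F z
    using Ck_on_slice[OF D that] by simp
  define \<Phi> where "\<Phi> z = integral (cbox u v) (\<lambda>t. of_real (bump t) * G (join z 0 + join 0 t))" for z
  have J_Phi: "J (\<lambda>w. G (join z w)) = \<Phi> z" if "z \<in> D" for z
    using J_eq_integral[OF slice_cont[OF Ck_on_le[OF G] that] uv] by (simp add: \<Phi>_def join_add)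
  have "Ck_on k D \<Phi>"
    unfolding \<Phi>_def
    by (rule Ck_on_integral_param_support[OF open_fibres[OF D] G bounded_linear_join_left cb cm K bump0 mem D]) auto
  then show "Ck_on k D (\<lambda>z. J (\<lambda>w. G (join z w)))"
    by (rule Ck_on_cong_imp[OF D, rotated]) (simp add: J_Phi)
  assume z: "z \<in> D" and k: "k \<ge> 1"
  have G1: "Ck_on 1 (fibres D) G" by (rule Ck_on_le[OF G k])
  then have G1': "Ck_on (Suc 0) (fibres D) G" by simp
  have "(\<Phi> has_derivative (\<lambda>a. integral (cbox u v) (\<lambda>t. of_real (bump t) * dd (join a 0) G (join z 0 + join 0 t)))) (at z)"
    unfolding \<Phi>_def
    by (rule has_derivative_integral_param_support[OF open_fibres[OF D] G1 bounded_linear_join_left cb cm K bump0 mem D z]) auto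
  then have "dd a \<Phi> z = integral (cbox u v) (\<lambda>t. of_real (bump t) * dd (join a 0) G (join z 0 + join 0 t))" for a
    by (rule dd_eqI)
  moreover have "J (\<lambda>w. dd (join a 0) G (join z w))
      = integral (cbox u v) (\<lambda>t. of_real (bump t) * dd (join a 0) G (join z 0 + join 0 t))" for a
    using J_eq_integral[OF slice_cont[OF Ck_on_dd[OF G1'] z] uv] by (simp add: join_add)
  moreover have "dd a (\<lambda>z. J (\<lambda>w. G (join z w))) z = dd a \<Phi> z" for a
    by (rule dd_cong[OF D z]) (simp add: J_Phi)
  ultimately have dJ: "dd a (\<lambda>z. J (\<lambda>w. G (join z w))) z = J (\<lambda>w. dd (join a 0) G (join z w))" for a
    by simp
  have cont: "continuous_on (- {0}) (\<lambda>w. c * dd (join a 0) G (join z w))" for a c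
    by (intro continuous_intros slice_cont[OF Ck_on_dd[OF G1'] z])
  have "J (\<lambda>w. (1/2) * dd (join (axis i 1) 0) G (join z w) + c * dd (join (axis i \<i>) 0) G (join z w))
     = (1/2) * J (\<lambda>w. dd (join (axis i 1) 0) G (join z w)) + c * J (\<lambda>w. dd (join (axis i \<i>) 0) G (join z w))" for c
    by (simp only: J_add[OF cont cont] J_cmult)
  from this[of "-\<i>/2"] this[of "\<i>/2"]
  show "d_z i (\<lambda>z. J (\<lambda>w. G (join z w))) z = J (\<lambda>w. d_z (Inl i) G (join z w))"
    "d_zbar i (\<lambda>z. J (\<lambda>w. G (join z w))) z = J (\<lambda>w. d_zbar (Inl i) G (join z w))"
    by (simp_all add: d_z_def d_zbar_def dJ axis_Inl diff_divide_distrib add_divide_distrib)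
qed

section \<open>The logarithm of a plurisubharmonic homogeneous function\<close>

definition hform :: "complex^'n^'n \<Rightarrow> complex^'n \<Rightarrow> complex^'n \<Rightarrow> complex" where
  "hform A x y = (\<Sum>a\<in>UNIV. \<Sum>b\<in>UNIV. A $ a $ b * x $ a * cnj (y $ b))"

lemma hform_diff_left: "hform A (x - y) z = hform A x z - hform A y z"
  unfolding hform_def sum_subtractf[symmetric] by (intro sum.cong refl) (simp add: algebra_simps)

lemma hform_diff_right: "hform A x (y - z) = hform A x y - hform A x z"
  unfolding hform_def sum_subtractf[symmetric] by (intro sum.cong refl) (simp add: algebra_simps)

lemma hform_scale_left: "hform A (c *s x) y = c * hform A x y"
  unfolding hform_def sum_distrib_left by (intro sum.cong refl) (simp add: algebra_simps)

lemma hform_scale_right: "hform A x (c *s y) = cnj c * hform A x y"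
  unfolding hform_def sum_distrib_left by (intro sum.cong refl) (simp add: algebra_simps)

lemma hermitian_pos_def_iff:
  "hermitian_pos_def A \<longleftrightarrow> (\<forall>j k. A $ k $ j = cnj (A $ j $ k)) \<and> (\<forall>x. x \<noteq> 0 \<longrightarrow> 0 < Re (hform A x x))"
  by (simp add: hermitian_pos_def_def hform_def)

lemma cnj_hform:
  assumes "hermitian_pos_def A"
  shows "cnj (hform A x y) = hform A y x"
proof -
  have "cnj (A $ j $ k) = A $ k $ j" for j k using assms unfolding hermitian_pos_def_def by metis
  then have "cnj (hform A x y) = (\<Sum>a\<in>UNIV. \<Sum>b\<in>UNIV. A $ b $ a * y $ b * cnj (x $ a))"
    unfolding hform_def cnj_sum by (intro sum.cong refl) (simp add: algebra_simps)
  then show ?thesis unfolding hform_def by (subst sum.swap)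
qed

text \<open>The minimum over the compact product of \<open>K\<close> with the unit sphere, extended
  to all vectors by scaling.\<close>

lemma hform_uniform_lower_bound:
  fixes A :: "'a::topological_space \<Rightarrow> complex^'n^'n"
  assumes "compact K" "K \<noteq> {}" and A: "\<And>a b. continuous_on K (\<lambda>t. A t $ a $ b)"
    and pos: "\<And>t. t \<in> K \<Longrightarrow> hermitian_pos_def (A t)"
  shows "\<exists>c>0. \<forall>t\<in>K. \<forall>x. c * (norm x)\<^sup>2 \<le> Re (hform (A t) x x)"
proof -
  let ?X = "K \<times> sphere (0::complex^'n) 1"
  have nonempty: "sphere (0::complex^'n) 1 \<noteq> {}" by simp
  have cA: "continuous_on ?X (\<lambda>p. A (fst p) $ a $ b)" for a b
    by (rule continuous_on_compose2[OF A continuous_on_fst[OF continuous_on_id]]) auto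
  have cx: "continuous_on ?X (\<lambda>p. snd p $ a)" "continuous_on ?X (\<lambda>p. cnj (snd p $ a))" for a
    by (intro continuous_intros)+
  have ct: "continuous_on ?X (\<lambda>p. Re (hform (A (fst p)) (snd p) (snd p)))"
    unfolding hform_def by (intro continuous_on_Re continuous_on_sum continuous_on_mult cA cx)
  have X: "compact ?X" "?X \<noteq> {}" using assms(1,2) nonempty by (auto intro: compact_Times)
  obtain p0 where p0: "p0 \<in> ?X"
    "\<And>p. p \<in> ?X \<Longrightarrow> Re (hform (A (fst p0)) (snd p0) (snd p0)) \<le> Re (hform (A (fst p)) (snd p) (snd p))"
    using continuous_attains_inf[OF X ct] by blast
  define c where "c = Re (hform (A (fst p0)) (snd p0) (snd p0))"
  have "snd p0 \<noteq> 0" using p0(1) by auto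
  then have c: "c > 0" using pos[of "fst p0"] p0(1) by (auto simp: c_def hermitian_pos_def_iff)
  have "c * (norm x)\<^sup>2 \<le> Re (hform (A t) x x)" if t: "t \<in> K" for t x
  proof (cases "x = 0")
    case True
    then show ?thesis by (simp add: hform_def)
  next
    case False
    define y where "y = complex_of_real (inverse (norm x)) *s x"
    have "norm y = 1" using False by (simp add: y_def norm_scale_vec norm_inverse)
    then have cy: "c \<le> Re (hform (A t) y y)" using p0(2)[of "(t, y)"] t by (simp add: c_def)
    have "x = complex_of_real (norm x) *s y" using False by (simp add: y_def vec_eq_iff)
    then have "hform (A t) x x = hform (A t) (complex_of_real (norm x) *s y) (complex_of_real (norm x) *s y)" by simp
    also have "\<dots> = of_real ((norm x)\<^sup>2) * hform (A t) y y"
      by (simp add: hform_scale_left hform_scale_right power2_eq_square)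
    finally have "hform (A t) x x = of_real ((norm x)\<^sup>2) * hform (A t) y y" .
    then have "Re (hform (A t) x x) = (norm x)\<^sup>2 * Re (hform (A t) y y)"
      by (simp del: of_real_power)
    then show ?thesis using cy by (simp add: mult.commute[of c] mult_left_mono)
  qed
  then show ?thesis using c by blast
qed

text \<open>The analytic content of a negatively curved Finsler metric in one chart of the total
  space. The data contain nonnegativity; strict positivity off the zero section is derived in
  \<open>H_pos\<close>.\<close>

locale finsler_chart =
  fixes D :: "(complex^'n::finite) set" and H :: "complex^('n + 'm::finite) \<Rightarrow> real"
  assumes open_D: "open D" and H_Ck: "Ck_on 2 (fibres D) H"
    and H_scale: "\<And>z c w. z \<in> D \<Longrightarrow> H (join z (c *s w)) = cmod c * H (join z w)"
    and H_nonneg: "\<And>z w. z \<in> D \<Longrightarrow> 0 \<le> H (join z w)"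
    and H_psh: "\<And>p. p \<in> fibres D \<Longrightarrow> hermitian_pos_def (complex_hessian H p)"
begin

abbreviation S :: "(complex^('n + 'm)) set" where "S \<equiv> fibres D"

lemma open_S: "open S" by (rule open_fibres[OF open_D])

definition HC :: "complex^('n + 'm) \<Rightarrow> complex" where "HC p = of_real (H p)"

lemma HC_Ck: "Ck_on 2 S HC"
  unfolding HC_def[abs_def] by (rule Ck_on_of_real[OF open_S H_Ck])

lemma H_differentiable: "p \<in> S \<Longrightarrow> H differentiable (at p)"
  using Ck_on_differentiable[OF H_Ck] by simp

lemma HC_differentiable: "p \<in> S \<Longrightarrow> HC differentiable (at p)"
  using Ck_on_differentiable[OF HC_Ck] by simp

lemma dHC_Ck: "Ck_on 1 S (d_z a HC)" "Ck_on 1 S (d_zbar a HC)"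
  using Ck_on_d_z[OF open_S, of 1 HC] HC_Ck by (simp_all add: numeral_2_eq_2 del: Ck_on.simps)

lemma dHC_differentiable:
  assumes "p \<in> S"
  shows "d_z a HC differentiable (at p)" "d_zbar a HC differentiable (at p)"
  using Ck_on_differentiable[OF dHC_Ck(1) _ assms] Ck_on_differentiable[OF dHC_Ck(2) _ assms] by auto

section \<open>Euler identities and the Levi forms of the metric and of its logarithm\<close>

definition vert :: "complex^('n + 'm) \<Rightarrow> complex^('n + 'm)" where
  "vert p = (\<chi> k. case k of Inl i \<Rightarrow> 0 | Inr j \<Rightarrow> p $ Inr j)"

lemma vert_join [simp]: "vert (join z w) = join 0 w"
  by (rule vec_sum_eqI) (auto simp: vert_def)

lemma cnj_d_z_HC: "p \<in> S \<Longrightarrow> cnj (d_z a HC p) = d_zbar a HC p"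
  unfolding HC_def[abs_def] by (rule cnj_d_z_of_real(1)[OF H_differentiable])

text \<open>\<open>H (join z (c *s w))\<close> is differentiated at \<open>c = 1\<close>, where
  \<open>cmod c\<close> has derivative \<open>Re\<close>, half linear and half antilinear; hence the
  factor \<open>1 / 2\<close>.\<close>

lemma Euler_zbar:
  assumes p: "p \<in> S"
  shows "(\<Sum>b\<in>UNIV. cnj (vert p $ b) * d_zbar b HC p) = HC p / 2"
proof -
  obtain z w where zw: "p = join z w" "z \<in> D" "w \<noteq> 0" using fibresE[OF p] by metis
  have "((\<lambda>c. c *s w) has_derivative (\<lambda>h. h *s w)) (at 1)"
    by (rule bounded_linear_imp_has_derivative[OF bounded_linear_scale_vec])
  moreover have "((\<lambda>w. HC (join z w)) has_derivative (\<lambda>a. dd (join 0 a) HC (join z w))) (at (1 *s w))"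
    using has_derivative_slice(2)[OF HC_differentiable[of "join z w"]] p zw by simp
  ultimately have "((\<lambda>c. HC (join z (c *s w))) has_derivative (\<lambda>h. dd (join 0 (h *s w)) HC (join z w))) (at 1)"
    by (rule has_derivative_compose)
  moreover have "HC (join z (c *s w)) = of_real (cmod c) * HC p" for c
    using H_scale[OF zw(2), of c w] by (simp add: HC_def zw(1))
  ultimately have 1: "((\<lambda>c. of_real (cmod c) * HC p) has_derivative (\<lambda>h. dd (join 0 (h *s w)) HC (join z w))) (at 1)"
    by simp
  have "((\<lambda>c::complex. norm c) has_derivative (\<lambda>h. h \<bullet> sgn 1)) (at 1)"
    by (rule has_derivative_norm) simp
  from has_derivative_mult_left[OF has_derivative_of_real[OF this], of "HC p"]
  have 2: "((\<lambda>c. of_real (cmod c) * HC p) has_derivative (\<lambda>h. of_real (Re h) * HC p)) (at 1)"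
    by (simp add: inner_complex_def)
  have eq: "dd (join 0 (h *s w)) HC p = of_real (Re h) * HC p" for h
    using fun_cong[OF has_derivative_unique[OF 1 2], of h] by (simp add: zw(1))
  have v: "vert p = join 0 w" by (simp add: zw(1))
  have "2 * (\<Sum>b\<in>UNIV. cnj (vert p $ b) * d_zbar b HC p) = dd (join 0 (1 *s w)) HC p + \<i> * dd (join 0 (\<i> *s w)) HC p"
    unfolding dd_eq_d_z[OF HC_differentiable[OF p]] sum_distrib_left sum.distrib[symmetric] v
  proof (intro sum.cong refl)
    fix b :: "'n + 'm"
    show "2 * (cnj (join 0 w $ b) * d_zbar b HC p) =
      join 0 (1 *s w) $ b * d_z b HC p + cnj (join 0 (1 *s w) $ b) * d_zbar b HC p +
      \<i> * (join 0 (\<i> *s w) $ b * d_z b HC p + cnj (join 0 (\<i> *s w) $ b) * d_zbar b HC p)"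
      by (cases b) (simp_all add: algebra_simps)
  qed
  also have "\<dots> = HC p" unfolding eq by simp
  finally show ?thesis by (simp add: eq_divide_eq mult.commute)
qed

lemma Euler_z:
  assumes p: "p \<in> S"
  shows "(\<Sum>b\<in>UNIV. vert p $ b * d_z b HC p) = HC p / 2"
proof -
  have "(\<Sum>b\<in>UNIV. vert p $ b * d_z b HC p) = cnj (\<Sum>b\<in>UNIV. cnj (vert p $ b) * d_zbar b HC p)"
    by (simp add: cnj_d_z_HC[OF p, symmetric])
  then show ?thesis unfolding Euler_zbar[OF p] by (simp add: HC_def)
qed

abbreviation hess :: "complex^('n + 'm) \<Rightarrow> complex^('n + 'm)^('n + 'm)" where
  "hess \<equiv> complex_hessian H"

lemma hess_nth: "hess p $ a $ b = d_z a (d_zbar b HC) p"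
  by (simp add: complex_hessian_def HC_def[abs_def])

lemma vert_differentiable: "(\<lambda>p. cnj (vert p $ b)) differentiable (at p)"
  by (cases b) (simp_all add: vert_def)

lemma d_z_cnj_vert: "d_z a (\<lambda>p. cnj (vert p $ b)) p = 0"
  by (cases b) (simp_all add: vert_def)

text \<open>\<open>cnj (vert p $ b)\<close> is antiholomorphic, so \<open>d_z a\<close> applied to
  Euler's identity differentiates only the other factor.\<close>

lemma hess_vert_row:
  assumes p: "p \<in> S"
  shows "(\<Sum>b\<in>UNIV. hess p $ a $ b * cnj (vert p $ b)) = d_z a HC p / 2"
proof -
  have d: "(\<lambda>p. cnj (vert p $ b) * d_zbar b HC p) differentiable (at p)" for b
    by (intro differentiable_mult vert_differentiable dHC_differentiable p)
  have "d_z a (\<lambda>p. \<Sum>b\<in>UNIV. cnj (vert p $ b) * d_zbar b HC p) p = d_z a (\<lambda>p. (1/2) * HC p) p"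
    by (rule d_z_cong(1)[OF open_S p]) (simp add: Euler_zbar)
  moreover have "d_z a (\<lambda>p. \<Sum>b\<in>UNIV. cnj (vert p $ b) * d_zbar b HC p) p
      = (\<Sum>b\<in>UNIV. d_z a (\<lambda>p. cnj (vert p $ b) * d_zbar b HC p) p)"
    using d_z_sum[of UNIV "\<lambda>b p. cnj (vert p $ b) * d_zbar b HC p" p a] d by simp
  moreover have "d_z a (\<lambda>p. cnj (vert p $ b) * d_zbar b HC p) p = hess p $ a $ b * cnj (vert p $ b)" for b
    by (simp add: d_z_mult(1)[OF vert_differentiable dHC_differentiable(2)[OF p]] d_z_cnj_vert hess_nth)
  ultimately have "(\<Sum>b\<in>UNIV. hess p $ a $ b * cnj (vert p $ b)) = d_z a (\<lambda>p. (1/2) * HC p) p"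
    by (simp only:)
  then show ?thesis
    by (simp only: d_z_cmult(1)[OF HC_differentiable[OF p]]) simp
qed

definition grad_form :: "complex^('n + 'm) \<Rightarrow> complex^('n + 'm) \<Rightarrow> complex" where
  "grad_form p y = (\<Sum>a\<in>UNIV. d_z a HC p * y $ a)"

lemma hform_hess_vert:
  assumes p: "p \<in> S"
  shows "hform (hess p) y (vert p) = grad_form p y / 2"
    and "hform (hess p) (vert p) (vert p) = HC p / 4"
proof -
  have 1: "hform (hess p) y (vert p) = grad_form p y / 2" for y
  proof -
    have "hform (hess p) y (vert p) = (\<Sum>a\<in>UNIV. y $ a * (\<Sum>b\<in>UNIV. hess p $ a $ b * cnj (vert p $ b)))"
      unfolding hform_def sum_distrib_left by (intro sum.cong refl) (simp add: mult_ac)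
    then show ?thesis
      unfolding hess_vert_row[OF p] grad_form_def by (simp add: sum_divide_distrib mult.commute)
  qed
  then show "hform (hess p) y (vert p) = grad_form p y / 2" .
  have g: "grad_form p (vert p) = HC p / 2"
    unfolding grad_form_def using Euler_z[OF p] by (simp add: mult.commute)
  show "hform (hess p) (vert p) (vert p) = HC p / 4" unfolding 1 g by simp
qed

text \<open>Strict plurisubharmonicity is tested on the vertical radial vector, along which the Levi
  form equals \<open>HC p / 4\<close>.\<close>

lemma H_pos:
  assumes p: "p \<in> S"
  shows "0 < H p"
proof -
  obtain z w where zw: "p = join z w" "z \<in> D" "w \<noteq> 0" using fibresE[OF p] by metis
  then have "vert p \<noteq> 0" by simp
  then have "0 < Re (hform (hess p) (vert p) (vert p))"
    using H_psh[OF p] by (simp add: hermitian_pos_def_iff)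
  then show ?thesis unfolding hform_hess_vert(2)[OF p] by (simp add: HC_def)
qed

definition \<psi> :: "complex^('n + 'm) \<Rightarrow> real" where
  "\<psi> p = 2 * real CARD('m) * ln (H p)"

definition \<psi>C :: "complex^('n + 'm) \<Rightarrow> complex" where "\<psi>C p = of_real (\<psi> p)"

lemma psi_Ck: "Ck_on 2 S \<psi>"
proof -
  have "Ck_on 2 S (\<lambda>p. ln (H p))"
    by (rule Ck_on_compose[OF open_S _ H_Ck Ck_on_ln_gt0]) (use H_pos in auto)
  then show ?thesis
    unfolding \<psi>_def by (rule Ck_on_mult[OF open_S Ck_on_const])
qed

lemma psiC_Ck: "Ck_on 2 S \<psi>C"
  unfolding \<psi>C_def[abs_def] by (rule Ck_on_of_real[OF open_S psi_Ck])

lemma dpsiC_Ck: "Ck_on 1 S (d_z a \<psi>C)" "Ck_on 1 S (d_zbar a \<psi>C)"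
  using Ck_on_d_z[OF open_S, of 1 \<psi>C] psiC_Ck by (simp_all add: numeral_2_eq_2 del: Ck_on.simps)

lemma d_psiC:
  assumes p: "p \<in> S"
  shows "d_z a \<psi>C p = 2 * of_nat CARD('m) * (d_z a HC p * inverse (HC p))"
    "d_zbar a \<psi>C p = 2 * of_nat CARD('m) * (d_zbar a HC p * inverse (HC p))"
proof -
  have d: "((\<lambda>x. 2 * real CARD('m) * ln x) has_real_derivative 2 * real CARD('m) * inverse (H p)) (at (H p))"
    using H_pos[OF p] by (auto intro!: derivative_eq_intros simp: divide_inverse)
  from d_z_of_real_compose[OF H_differentiable[OF p] d, of a]
  show "d_z a \<psi>C p = 2 * of_nat CARD('m) * (d_z a HC p * inverse (HC p))"
    "d_zbar a \<psi>C p = 2 * of_nat CARD('m) * (d_zbar a HC p * inverse (HC p))"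
    unfolding \<psi>C_def[abs_def] \<psi>_def HC_def[abs_def] by (simp_all add: mult_ac)
qed

definition hess\<psi> :: "complex^('n + 'm) \<Rightarrow> complex^('n + 'm)^('n + 'm)" where
  "hess\<psi> p = (\<chi> a b. d_z a (d_zbar b \<psi>C) p)"

lemma hess_psi:
  assumes p: "p \<in> S"
  shows "hess\<psi> p $ a $ b = 2 * of_nat CARD('m) *
    (hess p $ a $ b * inverse (HC p) - d_z a HC p * cnj (d_z b HC p) * inverse (HC p) ^ 2)"
proof -
  have inv: "(\<lambda>p. inverse (HC p)) differentiable (at p)"
    "d_z a (\<lambda>p. inverse (HC p)) p = - (inverse (HC p) ^ 2 * d_z a HC p)"
  proof -
    have d: "(inverse has_real_derivative - (inverse (H p) ^ 2)) (at (H p))"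
      using H_pos[OF p] DERIV_inverse[of "H p"] by (simp add: numeral_2_eq_2)
    from d_z_of_real_compose(1)[OF H_differentiable[OF p] d, of a]
    show "d_z a (\<lambda>p. inverse (HC p)) p = - (inverse (HC p) ^ 2 * d_z a HC p)"
      unfolding HC_def[abs_def] by simp
    have "(\<lambda>p. inverse (H p)) differentiable (at p)"
      using differentiable_compose[OF _ H_differentiable[OF p], of inverse] H_pos[OF p]
      by (metis d has_field_derivative_imp_has_derivative differentiable_def)
    then show "(\<lambda>p. inverse (HC p)) differentiable (at p)"
      unfolding HC_def[abs_def] of_real_inverse[symmetric] by (rule of_real_differentiable)
  qed
  have "d_z a (d_zbar b \<psi>C) p = d_z a (\<lambda>p. 2 * of_nat CARD('m) * (d_zbar b HC p * inverse (HC p))) p"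
    by (rule d_z_cong(1)[OF open_S p]) (rule d_psiC)
  also have "\<dots> = 2 * of_nat CARD('m) * d_z a (\<lambda>p. d_zbar b HC p * inverse (HC p)) p"
    by (rule d_z_cmult(1)) (intro differentiable_mult inv dHC_differentiable p)
  also have "d_z a (\<lambda>p. d_zbar b HC p * inverse (HC p)) p
      = d_zbar b HC p * (- (inverse (HC p) ^ 2 * d_z a HC p)) + hess p $ a $ b * inverse (HC p)"
    by (simp only: d_z_mult(1)[OF dHC_differentiable(2)[OF p] inv(1)] inv(2) hess_nth)
  finally show ?thesis
    by (simp add: hess\<psi>_def cnj_d_z_HC[OF p] algebra_simps)
qed

text \<open>The Levi form of \<open>ln H\<close> is that of \<open>H\<close> after removing the component along the fibre direction.\<close>

lemma hform_hess_psi: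
  assumes p: "p \<in> S"
  obtains t where "hform (hess\<psi> p) y y =
    of_real (2 * real CARD('m) / H p) * hform (hess p) (y - t *s vert p) (y - t *s vert p)"
proof -
  have H0: "HC p \<noteq> 0" using H_pos[OF p] by (simp add: HC_def)
  define g where "g = grad_form p y"
  \<comment> \<open>The coefficient of the orthogonal projection of \<open>y\<close> onto
    \<open>vert p\<close> for the Hessian form, namely \<open>(g / 2) / (HC p / 4)\<close>.\<close>
  define t where "t = 2 * g * inverse (HC p)"
  have cH: "cnj (HC p) = HC p" by (simp add: HC_def)
  have 1: "hform (hess p) y (vert p) = g / 2" by (simp add: g_def hform_hess_vert(1)[OF p])
  have 2: "hform (hess p) (vert p) y = cnj g / 2"
    using cnj_hform[OF H_psh[OF p], of y "vert p"] unfolding 1 by simp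
  have "hform (hess p) (y - t *s vert p) (y - t *s vert p) = hform (hess p) y y - cnj t * (g / 2) - t * (cnj g / 2)
      + t * cnj t * (HC p / 4)"
    by (simp add: hform_diff_left hform_diff_right hform_scale_left hform_scale_right 1 2 hform_hess_vert(2)[OF p]
        algebra_simps)
  also have "\<dots> = hform (hess p) y y - g * cnj g * inverse (HC p)"
    using H0 by (simp add: t_def cH field_simps)
  finally have Q: "hform (hess p) (y - t *s vert p) (y - t *s vert p) = hform (hess p) y y - g * cnj g * inverse (HC p)" .
  have "hform (hess\<psi> p) y y = (\<Sum>a\<in>UNIV. \<Sum>b\<in>UNIV. (2 * of_nat CARD('m) * inverse (HC p)) * (hess p $ a $ b * y $ a * cnj (y $ b))
      - (2 * of_nat CARD('m) * inverse (HC p) ^ 2) * ((d_z a HC p * y $ a) * cnj (d_z b HC p * y $ b)))"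
    unfolding hform_def hess_psi[OF p] by (intro sum.cong refl) (simp add: algebra_simps)
  also have "\<dots> = (2 * of_nat CARD('m) * inverse (HC p)) * hform (hess p) y y
      - (2 * of_nat CARD('m) * inverse (HC p) ^ 2) * (\<Sum>a\<in>UNIV. \<Sum>b\<in>UNIV. (d_z a HC p * y $ a) * cnj (d_z b HC p * y $ b))"
    unfolding hform_def by (simp only: sum_subtractf sum_distrib_left)
  also have "(\<Sum>a\<in>UNIV. \<Sum>b\<in>UNIV. (d_z a HC p * y $ a) * cnj (d_z b HC p * y $ b)) = g * cnj g"
    unfolding g_def grad_form_def cnj_sum by (rule sum_product[symmetric])
  also have "(2 * of_nat CARD('m) * inverse (HC p)) * hform (hess p) y y - (2 * of_nat CARD('m) * inverse (HC p) ^ 2) * (g * cnj g)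
      = (2 * of_nat CARD('m) * inverse (HC p)) * hform (hess p) (y - t *s vert p) (y - t *s vert p)"
    unfolding Q by (simp add: algebra_simps power2_eq_square)
  also have "2 * of_nat CARD('m) * inverse (HC p) = complex_of_real (2 * real CARD('m) / H p)"
    by (simp add: HC_def divide_inverse)
  finally show ?thesis by (rule that)
qed

lemma hess_continuous: "continuous_on S (\<lambda>p. hess p $ a $ b)"
  unfolding hess_nth
  using Ck_on_continuous_on[OF Ck_on_d_z(1)[OF open_S, of 0]] dHC_Ck(2)[of b] by simp

lemma slice_continuous:
  assumes "z \<in> D" "continuous_on S F"
  shows "continuous_on (- {0}) (\<lambda>w. F (join z w))"
  by (rule continuous_on_compose2[OF assms(2)])
    (use assms(1) in \<open>auto intro!: continuous_on_join continuous_intros\<close>)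

text \<open>The scalar \<open>t\<close> is unavoidable because the Levi form of \<psi> degenerates
  in the vertical radial direction; compactness of the shell makes \<kappa> uniform in
  \<open>w\<close>.\<close>

lemma levi_psi_lower_bound:
  assumes z: "z \<in> D"
  shows "\<exists>\<kappa>>0. \<forall>w y. 1 \<le> norm w \<longrightarrow> norm w \<le> 2 \<longrightarrow>
    (\<exists>t. \<kappa> * (norm (y - t *s join 0 w))\<^sup>2 \<le> Re (hform (hess\<psi> (join z w)) y y))"
proof -
  let ?K = "{w::complex^'m. 1 \<le> norm w \<and> norm w \<le> 2}"
  have eq: "?K = cball 0 2 - ball 0 1" by auto
  have "compact ?K" unfolding eq by (intro compact_diff compact_cball open_ball)
  moreover have "?K \<noteq> {}"
  proof -
    obtain e :: "complex^'m" where "e \<in> Basis" using nonempty_Basis by blast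
    then have "e \<in> ?K" by simp
    then show ?thesis by blast
  qed
  moreover have "continuous_on ?K (\<lambda>w. hess (join z w) $ a $ b)" for a b
    by (rule continuous_on_subset[OF slice_continuous[OF z hess_continuous]]) auto
  ultimately have "\<exists>c>0. \<forall>w\<in>?K. \<forall>x. c * (norm x)\<^sup>2 \<le> Re (hform (hess (join z w)) x x)"
  proof (rule hform_uniform_lower_bound)
    fix w assume "w \<in> ?K"
    then have "w \<noteq> 0" by auto
    then show "hermitian_pos_def (hess (join z w))" using z by (intro H_psh) simp
  qed
  then obtain c where c: "c > 0" "\<And>w x. w \<in> ?K \<Longrightarrow> c * (norm x)\<^sup>2 \<le> Re (hform (hess (join z w)) x x)" by blast
  obtain B where B: "B > 0" "\<And>w. w \<in> ?K \<Longrightarrow> norm (H (join z w)) \<le> B"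
  proof -
    have "bounded ((\<lambda>w. H (join z w)) ` ?K)"
      by (intro compact_imp_bounded compact_continuous_image \<open>compact ?K\<close>
          continuous_on_subset[OF slice_continuous[OF z Ck_on_continuous_on[OF H_Ck]]]) auto
    then show ?thesis using that unfolding bounded_pos by blast
  qed
  \<comment> \<open>\<open>c\<close> bounds the Hessian form of \<open>H\<close> from below and
    \<open>B\<close> bounds \<open>H\<close> from above on the shell.\<close>
  define \<kappa> where "\<kappa> = 2 * real CARD('m) / B * c"
  have "\<exists>t. \<kappa> * (norm (y - t *s join 0 w))\<^sup>2 \<le> Re (hform (hess\<psi> (join z w)) y y)"
    if w: "1 \<le> norm w" "norm w \<le> 2" for w y
  proof -
    have "w \<noteq> 0" using w by auto
    then have p: "join z w \<in> S" using z by simp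
    obtain t where t: "hform (hess\<psi> (join z w)) y y = of_real (2 * real CARD('m) / H (join z w)) *
        hform (hess (join z w)) (y - t *s vert (join z w)) (y - t *s vert (join z w))"
      using hform_hess_psi[OF p] by blast
    let ?Q = "Re (hform (hess (join z w)) (y - t *s join 0 w) (y - t *s join 0 w))"
    have Q: "c * (norm (y - t *s join 0 w))\<^sup>2 \<le> ?Q" using c(2) w by simp
    have "2 * real CARD('m) / B \<le> 2 * real CARD('m) / H (join z w)"
      using B(2)[of w] w H_pos[OF p] by (intro divide_left_mono) auto
    then have "(2 * real CARD('m) / B) * (c * (norm (y - t *s join 0 w))\<^sup>2) \<le> 2 * real CARD('m) / H (join z w) * ?Q"
      using Q c(1) B(1) H_pos[OF p] by (intro mult_mono) auto
    moreover have "Re (hform (hess\<psi> (join z w)) y y) = 2 * real CARD('m) / H (join z w) * ?Q"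
      unfolding t vert_join by (simp del: of_real_divide)
    ultimately show ?thesis by (intro exI[of _ t]) (simp add: \<kappa>_def)
  qed
  moreover have "\<kappa> > 0" using B(1) c(1) by (simp add: \<kappa>_def)
  ultimately show ?thesis by blast
qed

end

section \<open>Positivity of the fibre integral\<close>

context finsler_chart begin

text \<open>The logarithm turns the homogeneity of \<open>H\<close> into an additive constant,
  multiplied by the factor \<open>2 * CARD('m)\<close> of the critical degree.\<close>

lemma slice_weight:
  assumes z: "z \<in> D"
  shows "log_weight (\<lambda>w. \<psi> (join z w))"
proof
  show "Ck_on 2 (- {0}) (\<lambda>w. \<psi> (join z w))"
    by (rule Ck_on_slice[OF open_D psi_Ck z])
  fix c :: complex and w :: "complex^'m" assume cw: "c \<noteq> 0" "w \<noteq> 0"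
  have "0 < H (join z w)" using z cw by (intro H_pos) simp
  then show "\<psi> (join z (c *s w)) = \<psi> (join z w) + 2 * CARD('m) * ln (cmod c)"
    using cw by (simp add: \<psi>_def H_scale[OF z] ln_mult algebra_simps)
qed

definition EE :: "complex^('n + 'm) \<Rightarrow> complex" where
  "EE p = of_real (exp (- \<psi> p))"

lemma EE_Ck: "Ck_on 2 S EE"
  unfolding EE_def[abs_def]
  by (rule Ck_on_of_real[OF open_S Ck_on_compose[OF open_S _ Ck_on_minus[OF open_S psi_Ck] Ck_on_exp]]) simp

lemma psi_differentiable: "p \<in> S \<Longrightarrow> \<psi> differentiable (at p)"
  using Ck_on_differentiable[OF psi_Ck] by simp

lemma EE_differentiable: "p \<in> S \<Longrightarrow> EE differentiable (at p)"
  using Ck_on_differentiable[OF EE_Ck] by simp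

lemma dpsiC_differentiable:
  assumes "p \<in> S"
  shows "d_z a \<psi>C differentiable (at p)" "d_zbar a \<psi>C differentiable (at p)"
  using Ck_on_differentiable[OF dpsiC_Ck(1) _ assms] Ck_on_differentiable[OF dpsiC_Ck(2) _ assms] by auto

lemma d_EE:
  assumes p: "p \<in> S"
  shows "d_z a EE p = - d_z a \<psi>C p * EE p" "d_zbar a EE p = - d_zbar a \<psi>C p * EE p"
proof -
  have "((\<lambda>x. exp (- x)) has_real_derivative - exp (- \<psi> p)) (at (\<psi> p))"
    by (auto intro!: derivative_eq_intros)
  from d_z_of_real_compose[OF psi_differentiable[OF p] this, of a]
  show "d_z a EE p = - d_z a \<psi>C p * EE p" "d_zbar a EE p = - d_zbar a \<psi>C p * EE p"
    by (simp_all add: EE_def[abs_def] \<psi>C_def[abs_def])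
qed

lemma cnj_d_z_psiC: "p \<in> S \<Longrightarrow> cnj (d_z a \<psi>C p) = d_zbar a \<psi>C p"
  unfolding \<psi>C_def[abs_def] by (rule cnj_d_z_of_real(1)[OF psi_differentiable])

lemma dd_EE:
  assumes p: "p \<in> S"
  shows "d_z a (d_zbar b EE) p = d_z a \<psi>C p * cnj (d_z b \<psi>C p) * EE p - hess\<psi> p $ a $ b * EE p"
proof -
  have "d_z a (d_zbar b EE) p = d_z a (\<lambda>p. - 1 * (d_zbar b \<psi>C p * EE p)) p"
    by (rule d_z_cong(1)[OF open_S p]) (simp add: d_EE)
  also have "\<dots> = - 1 * d_z a (\<lambda>p. d_zbar b \<psi>C p * EE p) p"
    by (rule d_z_cmult(1)) (intro differentiable_mult dpsiC_differentiable EE_differentiable p)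
  also have "d_z a (\<lambda>p. d_zbar b \<psi>C p * EE p) p = d_zbar b \<psi>C p * (- d_z a \<psi>C p * EE p) + hess\<psi> p $ a $ b * EE p"
    by (simp only: d_z_mult(1)[OF dpsiC_differentiable(2)[OF p] EE_differentiable[OF p]] d_EE[OF p] hess\<psi>_def vec_lambda_beta)
  finally show ?thesis by (simp add: cnj_d_z_psiC[OF p])
qed

definition VC :: "complex^'n \<Rightarrow> complex" where
  "VC z = J (\<lambda>w. EE (join z w))"

definition V :: "complex^'n \<Rightarrow> real" where
  "V z = Re (VC z)"

lemma V_pos:
  assumes z: "z \<in> D"
  shows "0 < V z" "VC z = of_real (V z)"
proof -
  interpret W: log_weight "\<lambda>w. \<psi> (join z w)" by (rule slice_weight[OF z])
  have "VC z = J W.E" by (simp add: VC_def EE_def W.E_def[abs_def])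
  then show "0 < V z" "VC z = of_real (V z)" using W.J_E by (simp_all add: V_def)
qed

lemma VC_Ck: "Ck_on 2 D VC"
  unfolding VC_def[abs_def] by (rule J_slice(1)[OF open_D EE_Ck])

lemma V_Ck: "Ck_on 2 D V"
  unfolding V_def[abs_def] by (rule Ck_on_bounded_linear[OF open_D bounded_linear_Re VC_Ck])

lemma ln_V_Ck: "Ck_on 2 D (\<lambda>z. - ln (V z))"
  by (rule Ck_on_minus[OF open_D Ck_on_compose[OF open_D _ V_Ck Ck_on_ln_gt0]]) (use V_pos in auto)

lemma d_VC:
  assumes z: "z \<in> D"
  shows "d_z i VC z = J (\<lambda>w. - d_z (Inl i) \<psi>C (join z w) * EE (join z w))"
    and "d_zbar i VC z = J (\<lambda>w. - d_zbar (Inl i) \<psi>C (join z w) * EE (join z w))"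
proof -
  have "d_z i VC z = J (\<lambda>w. d_z (Inl i) EE (join z w))" "d_zbar i VC z = J (\<lambda>w. d_zbar (Inl i) EE (join z w))"
    unfolding VC_def[abs_def] using J_slice(2,3)[OF open_D EE_Ck z] by simp_all
  moreover have "J (\<lambda>w. d_z (Inl i) EE (join z w)) = J (\<lambda>w. - d_z (Inl i) \<psi>C (join z w) * EE (join z w))"
    "J (\<lambda>w. d_zbar (Inl i) EE (join z w)) = J (\<lambda>w. - d_zbar (Inl i) \<psi>C (join z w) * EE (join z w))"
    using z by (intro J_cong d_EE, simp)+
  ultimately show "d_z i VC z = J (\<lambda>w. - d_z (Inl i) \<psi>C (join z w) * EE (join z w))"
    "d_zbar i VC z = J (\<lambda>w. - d_zbar (Inl i) \<psi>C (join z w) * EE (join z w))" by simp_all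
qed

lemma dd_VC:
  assumes z: "z \<in> D"
  shows "d_z i (d_zbar k VC) z = J (\<lambda>w. d_z (Inl i) \<psi>C (join z w) * cnj (d_z (Inl k) \<psi>C (join z w)) * EE (join z w)
      - hess\<psi> (join z w) $ Inl i $ Inl k * EE (join z w))"
proof -
  have E1: "Ck_on 1 S (d_zbar (Inl k) EE)"
    using Ck_on_d_z(2)[OF open_S, of 1 EE] EE_Ck by (simp add: numeral_2_eq_2 del: Ck_on.simps)
  have "d_z i (d_zbar k VC) z = d_z i (\<lambda>z. J (\<lambda>w. d_zbar (Inl k) EE (join z w))) z"
    by (rule d_z_cong(1)[OF open_D z]) (simp add: VC_def[abs_def] J_slice(3)[OF open_D EE_Ck])
  also have "\<dots> = J (\<lambda>w. d_z (Inl i) (d_zbar (Inl k) EE) (join z w))"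
    by (rule J_slice(2)[OF open_D E1 z]) simp
  also have "\<dots> = J (\<lambda>w. d_z (Inl i) \<psi>C (join z w) * cnj (d_z (Inl k) \<psi>C (join z w)) * EE (join z w)
      - hess\<psi> (join z w) $ Inl i $ Inl k * EE (join z w))"
    using z by (intro J_cong dd_EE) simp
  finally show ?thesis .
qed

lemma hessian_ln_V:
  assumes z: "z \<in> D"
  shows "complex_hessian (\<lambda>z. - ln (V z)) z $ i $ k =
    d_z i VC z * d_zbar k VC z * inverse (VC z) ^ 2 - d_z i (d_zbar k VC) z * inverse (VC z)"
proof -
  have Vd: "V differentiable (at z)" if "z \<in> D" for z using Ck_on_differentiable[OF V_Ck _ that] by simp
  have VC: "VC z = of_real (V z)" if "z \<in> D" for z using V_pos(2)[OF that] .
  have dV: "d_z i (\<lambda>z. of_real (V z)) z = d_z i VC z" "d_zbar i (\<lambda>z. of_real (V z)) z = d_zbar i VC z" if "z \<in> D" for i z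
    by (rule d_z_cong[OF open_D that], simp add: VC)+
  have 1: "d_zbar k (\<lambda>z. of_real (- ln (V z))) z = - 1 * (d_zbar k VC z * inverse (of_real (V z)))" if "z \<in> D" for z
  proof -
    have d: "((\<lambda>x. - ln x) has_real_derivative - inverse (V z)) (at (V z))"
      using V_pos(1)[OF that] by (auto intro!: derivative_eq_intros simp: divide_inverse)
    show ?thesis using d_z_of_real_compose(2)[OF Vd[OF that] d, of k] unfolding dV[OF that] by simp
  qed
  have dVd: "d_zbar k VC differentiable (at z)"
    using Ck_on_differentiable[OF _ _ z, of 1 "d_zbar k VC"] Ck_on_d_z(2)[OF open_D, of 1 VC k] VC_Ck
    by (simp add: numeral_2_eq_2 del: Ck_on.simps)
  have di: "(inverse has_real_derivative - (inverse (V z) ^ 2)) (at (V z))"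
    using V_pos(1)[OF z] DERIV_inverse[of "V z"] by (simp add: numeral_2_eq_2)
  have inv: "d_z i (\<lambda>z. inverse (of_real (V z))) z = - (inverse (of_real (V z)) ^ 2 * d_z i VC z)"
    using d_z_of_real_compose(1)[OF Vd[OF z] di, of i] unfolding dV[OF z] by simp
  have invd: "(\<lambda>z. inverse (complex_of_real (V z))) differentiable (at z)"
  proof -
    have "Ck_on 1 D (\<lambda>z. inverse (V z))"
      by (rule Ck_on_compose[OF open_D _ Ck_on_le[OF V_Ck] Ck_on_inverse_gt0]) (use V_pos in auto)
    then have "(\<lambda>z. inverse (V z)) differentiable (at z)" using Ck_on_differentiable z by blast
    then show ?thesis unfolding of_real_inverse[symmetric] by (rule of_real_differentiable)
  qed
  have "complex_hessian (\<lambda>z. - ln (V z)) z $ i $ k = d_z i (d_zbar k (\<lambda>z. of_real (- ln (V z)))) z"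
    by (simp add: complex_hessian_def)
  also have "\<dots> = d_z i (\<lambda>z. - 1 * (d_zbar k VC z * inverse (of_real (V z)))) z"
    by (rule d_z_cong(1)[OF open_D z]) (rule 1)
  also have "\<dots> = - 1 * d_z i (\<lambda>z. d_zbar k VC z * inverse (of_real (V z))) z"
    by (rule d_z_cmult(1)) (intro differentiable_mult dVd invd)
  also have "d_z i (\<lambda>z. d_zbar k VC z * inverse (of_real (V z))) z
      = d_zbar k VC z * (- (inverse (of_real (V z)) ^ 2 * d_z i VC z)) + d_z i (d_zbar k VC) z * inverse (of_real (V z))"
    by (simp only: d_z_mult(1)[OF dVd invd] inv)
  finally show ?thesis by (simp add: VC[OF z])
qed

text \<open>Strictness survives the scalar \<open>t\<close> of \<open>levi_psi_lower_bound\<close>: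
  subtracting a vertical vector from \<open>join \<xi> x\<close> does not touch the component \<xi>,
  so the Levi form is at least \<kappa> times the squared norm of \<xi>, whatever \<open>x\<close>
  is.\<close>

theorem ln_V_strictly_psh:
  assumes z: "z \<in> D"
  shows "hermitian_pos_def (complex_hessian (\<lambda>z. - ln (V z)) z)"
  unfolding hermitian_pos_def_iff
proof (intro conjI allI impI)
  show "complex_hessian (\<lambda>z. - ln (V z)) z $ k $ j = cnj (complex_hessian (\<lambda>z. - ln (V z)) z $ j $ k)" for j k
    by (rule complex_hessian_hermitian[OF open_D ln_V_Ck z])
  fix \<xi> :: "complex^'n" assume \<xi>: "\<xi> \<noteq> 0"
  interpret W: log_weight "\<lambda>w. \<psi> (join z w)" by (rule slice_weight[OF z])
  have E: "W.E = (\<lambda>w. EE (join z w))" by (simp add: W.E_def[abs_def] EE_def)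
  have p: "join z w \<in> S" if "w \<noteq> 0" for w using z that by simp
  have psiCd: "\<psi>C differentiable (at (join z w))" if "w \<noteq> 0" for w
    using Ck_on_differentiable[OF psiC_Ck _ p[OF that]] by simp
  have Wp: "W.p j w = d_z (Inr j) \<psi>C (join z w)" if "w \<noteq> 0" for j w
    unfolding W.p_def using d_z_slice(1)[OF psiCd[OF that], of j] by (simp add: \<psi>C_def)
  have Wq: "W.q j k w = hess\<psi> (join z w) $ Inr j $ Inr k" if "w \<noteq> 0" for j k w
  proof -
    have "W.q j k w = d_zbar k (\<lambda>w. d_z (Inr j) \<psi>C (join z w)) w"
      unfolding W.q_def by (rule d_z_cong(2)[OF open_minus_0]) (use that Wp in auto)
    also have "\<dots> = d_zbar (Inr k) (d_z (Inr j) \<psi>C) (join z w)"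
      by (rule d_z_slice(2)[OF dpsiC_differentiable(1)[OF p[OF that]]])
    finally show ?thesis
      using d_z_commute(1)[OF open_S psiC_Ck p[OF that]] by (simp add: hess\<psi>_def)
  qed
  \<comment> \<open>The derivative of the weight in the base direction \<xi>; \<open>u\<close> is
    the Levi form of the weight in that direction.\<close>
  define f where "f w = (\<Sum>i\<in>UNIV. \<xi> $ i * d_z (Inl i) \<psi>C (join z w))" for w
  define u where "u w = (\<Sum>i\<in>UNIV. \<Sum>k\<in>UNIV. hess\<psi> (join z w) $ Inl i $ Inl k * \<xi> $ i * cnj (\<xi> $ k))" for w
  have fC: "Ck_on 1 (- {0}) f"
    unfolding f_def
    by (intro Ck_on_sum Ck_on_mult Ck_on_const open_minus_0 Ck_on_slice[OF open_D dpsiC_Ck(1) z])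
  have hcont: "continuous_on (- {0}) (\<lambda>w. hess\<psi> (join z w) $ a $ b)" for a b
  proof -
    have "continuous_on S (d_z a (d_zbar b \<psi>C))"
      using Ck_on_continuous_on[OF Ck_on_d_z(1)[OF open_S, of 0]] dpsiC_Ck(2)[of b] by simp
    from slice_continuous[OF z this] show ?thesis by (simp add: hess\<psi>_def)
  qed
  have ucont: "continuous_on (- {0}) u"
    unfolding u_def by (intro continuous_on_sum continuous_on_mult hcont continuous_on_const)
  have finv: "invariant f"
    unfolding invariant_def
  proof (intro allI impI)
    fix c :: complex and w :: "complex^'m" assume cw: "c \<noteq> 0" "w \<noteq> 0"
    \<comment> \<open>Scaling \<open>w\<close> adds to the weight a constant that does not depend on
      \<open>z\<close>, which base derivatives do not see.\<close>
    have "d_z (Inl i) \<psi>C (join z (c *s w)) = d_z (Inl i) \<psi>C (join z w)" for i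
    proof -
      have eq: "\<psi>C (join z' (c *s w)) = \<psi>C (join z' w) + of_real (2 * CARD('m) * ln (cmod c))" if "z' \<in> D" for z'
        using log_weight.psi_scale[OF slice_weight[OF that] cw] by (simp add: \<psi>C_def)
      have dz: "d_z i (\<lambda>z. \<psi>C (join z w)) z = d_z (Inl i) \<psi>C (join z w)" if "w \<noteq> 0" for w
        by (simp add: d_z_def dd_eqI[OF has_derivative_slice(1)[OF psiCd[OF that]]] axis_Inl)
      have dd: "(\<lambda>z. \<psi>C (join z w)) differentiable (at z)"
        using has_derivative_slice(1)[OF psiCd[OF cw(2)]] by (auto simp: differentiable_def)
      have "d_z (Inl i) \<psi>C (join z (c *s w)) = d_z i (\<lambda>z. \<psi>C (join z (c *s w))) z"
        using dz[of "c *s w"] cw by simp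
      also have "\<dots> = d_z i (\<lambda>z. \<psi>C (join z w) + of_real (2 * CARD('m) * ln (cmod c))) z"
        by (rule d_z_cong(1)[OF open_D z]) (rule eq)
      also have "\<dots> = d_z i (\<lambda>z. \<psi>C (join z w)) z"
        by (subst d_z_add(1)[OF dd]) simp_all
      finally show ?thesis using dz[OF cw(2)] by simp
    qed
    then show "f (c *s w) = f w" by (simp add: f_def)
  qed
  \<comment> \<open>The blocks of the Hessian: base with base is \<open>u\<close>, base with fibre
    pairs \<open>d_zbar j f\<close> with \<open>X\<close>, fibre with base is the conjugate of that,
    and fibre with fibre is the Levi form of the slice.\<close>
  have split: "hform (hess\<psi> (join z w)) (join \<xi> (\<chi> j. X j)) (join \<xi> (\<chi> j. X j))
      = u w + (\<Sum>j\<in>UNIV. d_zbar j f w * cnj (X j)) + cnj (\<Sum>j\<in>UNIV. d_zbar j f w * cnj (X j)) + W.levi w X"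
    if w: "w \<noteq> 0" for w X
  proof -
    have dfi: "(\<lambda>w. \<xi> $ i * d_z (Inl i) \<psi>C (join z w)) differentiable (at w)" for i
      using Ck_on_differentiable[OF Ck_on_slice[OF open_D dpsiC_Ck(1) z]] w
      by (intro differentiable_mult differentiable_const) simp
    have sl: "(\<lambda>w. d_z (Inl i) \<psi>C (join z w)) differentiable (at w)" for i
      using Ck_on_differentiable[OF Ck_on_slice[OF open_D dpsiC_Ck(1) z]] w by simp
    have df: "d_zbar j f w = (\<Sum>i\<in>UNIV. hess\<psi> (join z w) $ Inl i $ Inr j * \<xi> $ i)" for j
    proof -
      have "d_zbar j f w = (\<Sum>i\<in>UNIV. d_zbar j (\<lambda>w. \<xi> $ i * d_z (Inl i) \<psi>C (join z w)) w)"
        unfolding f_def[abs_def] using d_z_sum[of UNIV "\<lambda>i w. \<xi> $ i * d_z (Inl i) \<psi>C (join z w)" w j] dfi by simp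
      also have "\<dots> = (\<Sum>i\<in>UNIV. hess\<psi> (join z w) $ Inl i $ Inr j * \<xi> $ i)"
      proof (intro sum.cong refl)
        fix i
        have "d_zbar j (\<lambda>w. d_z (Inl i) \<psi>C (join z w)) w = hess\<psi> (join z w) $ Inl i $ Inr j"
          using d_z_slice(2)[OF dpsiC_differentiable(1)[OF p[OF w]], of j]
            d_z_commute(1)[OF open_S psiC_Ck p[OF w]] by (simp add: hess\<psi>_def)
        then show "d_zbar j (\<lambda>w. \<xi> $ i * d_z (Inl i) \<psi>C (join z w)) w = hess\<psi> (join z w) $ Inl i $ Inr j * \<xi> $ i"
          by (simp add: d_z_cmult(2)[OF sl])
      qed
      finally show ?thesis .
    qed
    have herm: "hess\<psi> (join z w) $ a $ b = cnj (hess\<psi> (join z w) $ b $ a)" for a b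
      using complex_hessian_hermitian[OF open_S psi_Ck p[OF w], of a b]
      by (simp add: complex_hessian_def hess\<psi>_def \<psi>C_def[abs_def])
    have "hform (hess\<psi> (join z w)) (join \<xi> (\<chi> j. X j)) (join \<xi> (\<chi> j. X j))
      = u w + (\<Sum>i\<in>UNIV. \<Sum>j\<in>UNIV. hess\<psi> (join z w) $ Inl i $ Inr j * \<xi> $ i * cnj (X j))
        + (\<Sum>j\<in>UNIV. \<Sum>k\<in>UNIV. hess\<psi> (join z w) $ Inr j $ Inl k * X j * cnj (\<xi> $ k)) + W.levi w X"
      unfolding hform_def u_def W.levi_def by (simp add: UNIV_sum_split sum.distrib Wq[OF w] add.assoc)
    also have "(\<Sum>i\<in>UNIV. \<Sum>j\<in>UNIV. hess\<psi> (join z w) $ Inl i $ Inr j * \<xi> $ i * cnj (X j))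
        = (\<Sum>j\<in>UNIV. d_zbar j f w * cnj (X j))"
      unfolding df sum_distrib_right by (rule sum.swap)
    also have "(\<Sum>j\<in>UNIV. \<Sum>k\<in>UNIV. hess\<psi> (join z w) $ Inr j $ Inl k * X j * cnj (\<xi> $ k))
        = cnj (\<Sum>j\<in>UNIV. d_zbar j f w * cnj (X j))"
      unfolding df sum_distrib_right cnj_sum
      by (intro sum.cong refl) (simp add: herm[of "Inr _" "Inl _"] mult_ac)
    finally show ?thesis .
  qed
  obtain \<kappa> where \<kappa>: "\<kappa> > 0" and low: "\<And>w y. 1 \<le> norm w \<Longrightarrow> norm w \<le> 2 \<Longrightarrow>
      \<exists>t. \<kappa> * (norm (y - t *s join 0 w))\<^sup>2 \<le> Re (hform (hess\<psi> (join z w)) y y)"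
    using levi_psi_lower_bound[OF z] by blast
  have dense: "W.dense_range"
  proof (rule dense_range_positive_weight[OF slice_weight[OF z] \<kappa>])
    fix w :: "complex^'m" and X :: "'m \<Rightarrow> complex"
    assume w: "1 \<le> norm w" "norm w \<le> 2" and orth: "(\<Sum>j\<in>UNIV. cnj (w $ j) * X j) = 0"
    have w0: "w \<noteq> 0" using w by auto
    define x where "x = (\<chi> j. X j)"
    obtain t where t: "\<kappa> * (norm (join (0::complex^'n) x - t *s join 0 w))\<^sup>2 \<le> Re (hform (hess\<psi> (join z w)) (join 0 x) (join 0 x))"
      using low[OF w, of "join 0 x"] by blast
    have "join (0::complex^'n) x - t *s join 0 w = join 0 (x - t *s w)"
      by (rule vec_sum_eqI) simp_all
    then have n1: "(norm (join (0::complex^'n) x - t *s join 0 w))\<^sup>2 = (norm (x - t *s w))\<^sup>2"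
      by (simp only: norm_join) simp
    \<comment> \<open>As \<open>x\<close> is orthogonal to \<open>w\<close>, subtracting
      \<open>t *s w\<close> cannot shorten it, and \<open>t\<close> can be discarded.\<close>
    have "(norm (x - t *s w))\<^sup>2 = (norm x)\<^sup>2 + (norm (t *s w))\<^sup>2 - 2 * (x \<bullet> (t *s w))"
      by (simp add: power2_norm_eq_inner inner_diff_left inner_diff_right inner_commute)
    moreover have "x \<bullet> (t *s w) = Re (cnj t * (\<Sum>j\<in>UNIV. cnj (w $ j) * X j))"
      unfolding inner_vec_def sum_distrib_left Re_sum x_def
      by (intro sum.cong refl) (simp add: inner_complex_def algebra_simps)
    ultimately have n2: "(norm x)\<^sup>2 \<le> (norm (x - t *s w))\<^sup>2" by (simp add: orth)
    have n3: "(norm x)\<^sup>2 = (\<Sum>j\<in>UNIV. (cmod (X j))\<^sup>2)"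
      by (simp add: norm_vec_def L2_set_def x_def sum_nonneg)
    have "hform (hess\<psi> (join z w)) (join 0 x) (join 0 x) = W.levi w X"
      unfolding hform_def W.levi_def by (simp add: UNIV_sum_split Wq[OF w0] x_def)
    with t have "\<kappa> * (norm (x - t *s w))\<^sup>2 \<le> Re (W.levi w X)" unfolding n1 by simp
    moreover have "\<kappa> * (norm x)\<^sup>2 \<le> \<kappa> * (norm (x - t *s w))\<^sup>2"
      using n2 \<kappa> by (intro mult_left_mono) auto
    ultimately show "\<kappa> * (\<Sum>j\<in>UNIV. (cmod (X j))\<^sup>2) \<le> Re (W.levi w X)"
      unfolding n3 by linarith
  qed
  have "Re (J (\<lambda>w. f w * cnj (f w) * W.E w)) - (cmod (J (\<lambda>w. f w * W.E w)))\<^sup>2 / Re (J W.E)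
      < Re (J (\<lambda>w. u w * W.E w))"
  proof (rule W.variance_less[OF dense fC finv ucont])
    show "\<kappa> * (norm \<xi>)\<^sup>2 > 0" using \<kappa> \<xi> by simp
    fix w :: "complex^'m" and X :: "'m \<Rightarrow> complex" assume w: "1 \<le> norm w" "norm w \<le> 2"
    then have w0: "w \<noteq> 0" by auto
    define x where "x = (\<chi> j. X j)"
    obtain t where t: "\<kappa> * (norm (join \<xi> x - t *s join 0 w))\<^sup>2 \<le> Re (hform (hess\<psi> (join z w)) (join \<xi> x) (join \<xi> x))"
      using low[OF w, of "join \<xi> x"] by blast
    have "join \<xi> x - t *s join 0 w = join \<xi> (x - t *s w)"
      by (rule vec_sum_eqI) simp_all
    then have "(norm \<xi>)\<^sup>2 \<le> (norm (join \<xi> x - t *s join 0 w))\<^sup>2"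
      by (simp add: norm_join)
    then have "\<kappa> * (norm \<xi>)\<^sup>2 \<le> Re (hform (hess\<psi> (join z w)) (join \<xi> x) (join \<xi> x))"
      using t mult_left_mono[of _ _ \<kappa>] \<kappa> by (meson less_imp_le order_trans)
    also have "\<dots> = Re (u w) + 2 * Re (\<Sum>j\<in>UNIV. d_zbar j f w * cnj (X j)) + Re (W.levi w X)"
      unfolding x_def split[OF w0] by (simp only: plus_complex.sel cnj.sel)
    finally show "\<kappa> * (norm \<xi>)\<^sup>2 \<le> Re (u w) + 2 * Re (\<Sum>j\<in>UNIV. d_zbar j f w * cnj (X j)) + Re (W.levi w X)" .
  qed
  moreover have JE: "J W.E = VC z" "Re (J W.E) = V z" by (simp_all add: E VC_def V_def)
  ultimately have var: "Re (J (\<lambda>w. f w * cnj (f w) * W.E w)) - (cmod (J (\<lambda>w. f w * W.E w)))\<^sup>2 / V z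
      < Re (J (\<lambda>w. u w * W.E w))" by simp
  have Econt: "continuous_on (- {0}) (\<lambda>w. EE (join z w))"
    by (rule slice_continuous[OF z Ck_on_continuous_on[OF EE_Ck]])
  have dcont: "continuous_on (- {0}) (\<lambda>w. d_z a \<psi>C (join z w))" for a
    by (rule slice_continuous[OF z Ck_on_continuous_on[OF dpsiC_Ck(1)]])
  have sum1: "(\<Sum>i\<in>UNIV. \<xi> $ i * d_z i VC z) = - J (\<lambda>w. f w * W.E w)"
  proof -
    have "J (\<lambda>w. f w * W.E w) = J (\<lambda>w. \<Sum>i\<in>UNIV. \<xi> $ i * (d_z (Inl i) \<psi>C (join z w) * EE (join z w)))"
      unfolding f_def E sum_distrib_right by (simp add: mult_ac)
    also have "\<dots> = (\<Sum>i\<in>UNIV. J (\<lambda>w. \<xi> $ i * (d_z (Inl i) \<psi>C (join z w) * EE (join z w))))"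
      by (rule J_sum) (intro continuous_on_mult continuous_on_const dcont Econt)
    also have "\<dots> = (\<Sum>i\<in>UNIV. - (\<xi> $ i * d_z i VC z))"
      unfolding d_VC(1)[OF z] by (simp add: J_cmult J_minus)
    finally show ?thesis by (simp add: sum_negf)
  qed
  have cnj_dVC: "d_zbar k VC z = cnj (d_z k VC z)" for k
  proof -
    have "d_zbar k VC z = d_zbar k (\<lambda>z. of_real (V z)) z" "d_z k VC z = d_z k (\<lambda>z. of_real (V z)) z"
      by (rule d_z_cong[OF open_D z], simp add: V_pos(2))+
    then show ?thesis using cnj_d_z_of_real(1)[of V z k] Ck_on_differentiable[OF V_Ck _ z] by simp
  qed
  have sum2: "(\<Sum>i\<in>UNIV. \<Sum>k\<in>UNIV. d_z i (d_zbar k VC) z * \<xi> $ i * cnj (\<xi> $ k))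
      = J (\<lambda>w. f w * cnj (f w) * W.E w) - J (\<lambda>w. u w * W.E w)"
  proof -
    let ?g = "\<lambda>i k w. d_z (Inl i) \<psi>C (join z w) * cnj (d_z (Inl k) \<psi>C (join z w)) * EE (join z w)
        - hess\<psi> (join z w) $ Inl i $ Inl k * EE (join z w)"
    have gcont: "continuous_on (- {0}) (\<lambda>w. (\<xi> $ i * cnj (\<xi> $ k)) * ?g i k w)" for i k
      by (intro continuous_on_mult continuous_on_diff continuous_on_cnj continuous_on_const dcont Econt hcont)
    have ff: "f w * cnj (f w) = (\<Sum>i\<in>UNIV. \<Sum>k\<in>UNIV. (\<xi> $ i * d_z (Inl i) \<psi>C (join z w)) * cnj (\<xi> $ k * d_z (Inl k) \<psi>C (join z w)))" for w
      unfolding f_def cnj_sum by (rule sum_product)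
    have "J (\<lambda>w. f w * cnj (f w) * W.E w) - J (\<lambda>w. u w * W.E w) = J (\<lambda>w. f w * cnj (f w) * W.E w - u w * W.E w)"
      unfolding E
      by (rule J_diff[symmetric]) (intro continuous_on_mult continuous_on_cnj Ck_on_continuous_on[OF fC] Econt ucont)+
    also have "\<dots> = J (\<lambda>w. \<Sum>i\<in>UNIV. \<Sum>k\<in>UNIV. (\<xi> $ i * cnj (\<xi> $ k)) * ?g i k w)"
      unfolding ff u_def E sum_distrib_right sum_subtractf[symmetric]
      by (intro arg_cong[where f=J] ext sum.cong refl) (simp add: algebra_simps)
    also have "\<dots> = (\<Sum>i\<in>UNIV. J (\<lambda>w. \<Sum>k\<in>UNIV. (\<xi> $ i * cnj (\<xi> $ k)) * ?g i k w))"
      by (rule J_sum) (intro continuous_on_sum gcont)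
    also have "\<dots> = (\<Sum>i\<in>UNIV. \<Sum>k\<in>UNIV. (\<xi> $ i * cnj (\<xi> $ k)) * J (?g i k))"
      unfolding J_cmult[symmetric] by (intro sum.cong refl J_sum gcont)
    finally show ?thesis unfolding dd_VC[OF z] by (simp add: mult_ac)
  qed
  \<comment> \<open>Expressed through \<open>f\<close> and \<open>u\<close>, the Hessian of
    \<open>- ln V\<close> becomes \<open>inverse (V z)\<close> times the gap in the inequality
    \<open>var\<close>.\<close>
  have "hform (complex_hessian (\<lambda>z. - ln (V z)) z) \<xi> \<xi>
      = (\<Sum>i\<in>UNIV. \<Sum>k\<in>UNIV. inverse (VC z) ^ 2 * ((\<xi> $ i * d_z i VC z) * cnj (\<xi> $ k * d_z k VC z))
        - inverse (VC z) * (d_z i (d_zbar k VC) z * \<xi> $ i * cnj (\<xi> $ k)))"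
    unfolding hform_def hessian_ln_V[OF z] cnj_dVC by (intro sum.cong refl) (simp add: algebra_simps)
  also have "\<dots> = inverse (VC z) ^ 2 * (\<Sum>i\<in>UNIV. \<Sum>k\<in>UNIV. (\<xi> $ i * d_z i VC z) * cnj (\<xi> $ k * d_z k VC z))
      - inverse (VC z) * (\<Sum>i\<in>UNIV. \<Sum>k\<in>UNIV. d_z i (d_zbar k VC) z * \<xi> $ i * cnj (\<xi> $ k))"
    by (simp only: sum_subtractf sum_distrib_left)
  also have "(\<Sum>i\<in>UNIV. \<Sum>k\<in>UNIV. (\<xi> $ i * d_z i VC z) * cnj (\<xi> $ k * d_z k VC z))
      = of_real ((cmod (J (\<lambda>w. f w * W.E w)))\<^sup>2)"
  proof -
    have "(\<Sum>i\<in>UNIV. \<Sum>k\<in>UNIV. (\<xi> $ i * d_z i VC z) * cnj (\<xi> $ k * d_z k VC z))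
        = (\<Sum>i\<in>UNIV. \<xi> $ i * d_z i VC z) * cnj (\<Sum>k\<in>UNIV. \<xi> $ k * d_z k VC z)"
      unfolding cnj_sum by (rule sum_product[symmetric])
    then show ?thesis unfolding sum1 complex_norm_square by simp
  qed
  finally have "hform (complex_hessian (\<lambda>z. - ln (V z)) z) \<xi> \<xi>
      = of_real (inverse (V z) ^ 2 * (cmod (J (\<lambda>w. f w * W.E w)))\<^sup>2)
       - of_real (inverse (V z)) * (J (\<lambda>w. f w * cnj (f w) * W.E w) - J (\<lambda>w. u w * W.E w))"
    unfolding sum2 V_pos(2)[OF z] by simp
  then have "Re (hform (complex_hessian (\<lambda>z. - ln (V z)) z) \<xi> \<xi>)
      = inverse (V z) ^ 2 * (cmod (J (\<lambda>w. f w * W.E w)))\<^sup>2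
       - inverse (V z) * (Re (J (\<lambda>w. f w * cnj (f w) * W.E w)) - Re (J (\<lambda>w. u w * W.E w)))"
    by (simp del: of_real_mult of_real_power of_real_inverse)
  also have "\<dots> = inverse (V z) * (Re (J (\<lambda>w. u w * W.E w)) -
      (Re (J (\<lambda>w. f w * cnj (f w) * W.E w)) - (cmod (J (\<lambda>w. f w * W.E w)))\<^sup>2 / V z))"
    by (simp add: algebra_simps power2_eq_square divide_inverse)
  also have "\<dots> > 0"
    using var V_pos(1)[OF z] by simp
  finally show "0 < Re (hform (complex_hessian (\<lambda>z. - ln (V z)) z) \<xi> \<xi>)" .
qed

end

section \<open>The volume of the unit ball\<close>

lemma nn_integral_lborel_scaleR:
  fixes f :: "'a::euclidean_space \<Rightarrow> ennreal"
  assumes "f \<in> borel_measurable borel" "s > 0"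
  shows "(\<integral>\<^sup>+w. f w \<partial>lborel) = (\<integral>\<^sup>+w. ennreal (s ^ DIM('a)) * f (s *\<^sub>R w) \<partial>lborel)"
proof -
  have "(\<integral>\<^sup>+w. f w \<partial>lborel) = (\<integral>\<^sup>+w. f w \<partial>density (distr lborel borel (\<lambda>x::'a. 0 + s *\<^sub>R x)) (\<lambda>_. \<bar>s\<bar> ^ DIM('a)))"
    using lborel_affine[of s "0::'a"] assms(2) by simp
  also have "\<dots> = (\<integral>\<^sup>+w. ennreal (s ^ DIM('a)) * f (s *\<^sub>R w) \<partial>lborel)"
    using assms by (simp add: nn_integral_density nn_integral_distr)
  finally show ?thesis .
qed

text \<open>Writing a negative power as an integral over \<open>s \<ge> x\<close> opens the
  layer-cake argument, with \<open>x = G w\<close>.\<close>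

lemma nn_integral_inverse_power:
  fixes x :: real
  assumes "x > 0" "N > 0"
  shows "(\<integral>\<^sup>+s. ennreal (real N * inverse s ^ Suc N) * indicator {x..} s \<partial>lborel) = ennreal (inverse x ^ N)"
proof -
  have "(\<integral>\<^sup>+s. ennreal (real N * inverse s ^ Suc N) * indicator {x..} s \<partial>lborel) = ennreal (0 - (- (inverse x ^ N)))"
  proof (rule nn_integral_FTC_atLeast)
    show "(\<lambda>s. real N * inverse s ^ Suc N) \<in> borel_measurable borel" by measurable
    fix s assume s: "x \<le> s"
    then have s0: "s > 0" using assms(1) by linarith
    have "((\<lambda>x. inverse x ^ N) has_real_derivative of_nat N * (- (inverse s ^ Suc (Suc 0)) * inverse s ^ (N - Suc 0))) (at s)"
      using s0 by (intro DERIV_power DERIV_inverse) simp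
    from DERIV_minus[OF this]
    show "((\<lambda>s. - (inverse s ^ N)) has_real_derivative real N * inverse s ^ Suc N) (at s)"
      using assms(2) by (cases N) (simp_all add: algebra_simps)
    show "0 \<le> real N * inverse s ^ Suc N" using s0 by simp
  next
    have "((\<lambda>s::real. - (inverse s ^ N)) \<longlongrightarrow> - (0 ^ N)) at_top"
      by (intro tendsto_intros tendsto_inverse_0_at_top filterlim_ident)
    moreover have "- (0 ^ N) = (0::real)" using assms(2) by simp
    ultimately show "((\<lambda>s. - (inverse s ^ N)) \<longlongrightarrow> 0) (at_top :: real filter)"
      by (simp only:)
  qed
  then show ?thesis by simp
qed

text \<open>The mass of the cutoff along a ray for the measure \<open>DIM('a) * ds / s\<close>. The
  chosen basis vector merely provides a vector of length one.\<close>

definition radial_mass :: "'a::euclidean_space itself \<Rightarrow> ennreal" where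
  "radial_mass _ = (\<integral>\<^sup>+s. ennreal (real DIM('a) * inverse s * bump (s *\<^sub>R (SOME e::'a. e \<in> Basis))) * indicator {0<..} s \<partial>lborel)"

lemma bump_cong: "norm v = norm w \<Longrightarrow> bump v = bump w"
  by (simp add: bump_def dot_square_norm)

lemma measurable_bump [measurable]: "bump \<in> borel_measurable borel"
  by (rule borel_measurable_continuous_onI[OF continuous_on_bump])

text \<open>The measure \<open>ds / s\<close> is invariant under dilations and \<open>bump\<close>
  is radial, so every ray carries the same mass.\<close>

lemma nn_integral_radial:
  fixes u :: "'a::euclidean_space"
  assumes "u \<noteq> 0"
  shows "(\<integral>\<^sup>+s. ennreal (real DIM('a) * inverse s * bump (s *\<^sub>R u)) * indicator {0<..} s \<partial>lborel) = radial_mass TYPE('a)"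
proof -
  let ?e = "SOME e::'a. e \<in> Basis"
  have "?e \<in> Basis" using some_in_eq[of "Basis :: 'a set"] nonempty_Basis by blast
  then have e: "norm ?e = 1" by simp
  let ?r = "norm u"
  have r: "?r > 0" using assms by simp
  have "radial_mass TYPE('a) = \<bar>?r\<bar> * (\<integral>\<^sup>+s. ennreal (real DIM('a) * inverse (0 + ?r * s) * bump ((0 + ?r * s) *\<^sub>R ?e))
      * indicator {0<..} (0 + ?r * s) \<partial>lborel)"
    unfolding radial_mass_def using r by (intro nn_integral_real_affine) measurable
  also have "\<dots> = ?r * (\<integral>\<^sup>+s. ennreal (real DIM('a) * inverse (?r * s) * bump ((?r * s) *\<^sub>R ?e))
      * indicator {0<..} s \<partial>lborel)"
  proof -
    have "(indicator {0<..} (?r * s) :: ennreal) = indicator {0<..} s" for s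
      using r by (auto simp: indicator_def zero_less_mult_iff)
    then show ?thesis by simp
  qed
  also have "\<dots> = (\<integral>\<^sup>+s. ennreal ?r * (ennreal (real DIM('a) * inverse (?r * s) * bump ((?r * s) *\<^sub>R ?e))
      * indicator {0<..} s) \<partial>lborel)"
    by (rule nn_integral_cmult[symmetric]) measurable
  also have "\<dots> = (\<integral>\<^sup>+s. ennreal (real DIM('a) * inverse s * bump (s *\<^sub>R u)) * indicator {0<..} s \<partial>lborel)"
  proof (rule nn_integral_cong)
    fix s :: real
    have b: "bump ((?r * s) *\<^sub>R ?e) = bump (s *\<^sub>R u)" by (rule bump_cong) (simp add: e mult.commute abs_mult)
    show "ennreal ?r * (ennreal (real DIM('a) * inverse (?r * s) * bump ((?r * s) *\<^sub>R ?e)) * indicator {0<..} s)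
       = ennreal (real DIM('a) * inverse s * bump (s *\<^sub>R u)) * indicator {0<..} s"
    proof (cases "s > 0")
      case True
      then have "ennreal ?r * ennreal (real DIM('a) * inverse (?r * s) * bump (s *\<^sub>R u)) = ennreal (real DIM('a) * inverse s * bump (s *\<^sub>R u))"
        using r by (subst ennreal_mult[symmetric]) auto
      then show ?thesis using True r unfolding b by simp
    next
      case False
      then show ?thesis using r by (auto simp: zero_less_mult_iff)
    qed
  qed
  finally show ?thesis by simp
qed

text \<open>Layer cake, then Fubini and the substitution \<open>w = s *\<^sub>R u\<close>:
  homogeneity turns \<open>G w \<le> s\<close> into \<open>G u \<le> 1\<close>, which no longer
  contains \<open>s\<close>, and the integral over \<open>s\<close> becomes the constant
  \<open>radial_mass\<close>.\<close>

lemma nn_integral_shell_eq: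
  fixes G :: "'a::euclidean_space \<Rightarrow> real"
  assumes G: "continuous_on UNIV G" "\<And>r w. r > 0 \<Longrightarrow> G (r *\<^sub>R w) = r * G w" "\<And>w. w \<noteq> 0 \<Longrightarrow> 0 < G w"
  shows "(\<integral>\<^sup>+w. ennreal (bump w * inverse (G w) ^ DIM('a)) \<partial>lborel) = radial_mass TYPE('a) * emeasure lborel {w. G w \<le> 1}"
proof -
  let ?N = "DIM('a)" and ?A = "{w. G w \<le> 1}"
  have Gm [measurable]: "G \<in> borel_measurable borel" by (rule borel_measurable_continuous_onI[OF G(1)])
  have A [measurable]: "?A \<in> sets borel" by measurable
  define \<Phi> where "\<Phi> w s = ennreal (bump w) * (ennreal (real ?N * inverse s ^ Suc ?N) * (indicator {0<..} s * indicator {x. G (fst x) \<le> snd x} (w, s)))"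
    for w :: 'a and s :: real
  have m\<Phi> [measurable]: "case_prod \<Phi> \<in> borel_measurable (lborel \<Otimes>\<^sub>M lborel)"
    unfolding \<Phi>_def by measurable
  have "(\<integral>\<^sup>+w. ennreal (bump w * inverse (G w) ^ ?N) \<partial>lborel) = (\<integral>\<^sup>+w. \<integral>\<^sup>+s. \<Phi> w s \<partial>lborel \<partial>lborel)"
  proof (rule nn_integral_cong)
    fix w :: 'a
    show "ennreal (bump w * inverse (G w) ^ ?N) = (\<integral>\<^sup>+s. \<Phi> w s \<partial>lborel)"
    proof (cases "w = 0")
      case True
      then show ?thesis by (simp add: \<Phi>_def bump_eq_0)
    next
      case False
      then have Gw: "G w > 0" using G(3) by simp
      have "(\<integral>\<^sup>+s. \<Phi> w s \<partial>lborel) = (\<integral>\<^sup>+s. ennreal (bump w) * (ennreal (real ?N * inverse s ^ Suc ?N) * indicator {G w..} s) \<partial>lborel)"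
        unfolding \<Phi>_def using Gw by (intro nn_integral_cong) (auto simp: indicator_def)
      also have "\<dots> = ennreal (bump w) * ennreal (inverse (G w) ^ ?N)"
        by (subst nn_integral_cmult) (measurable, subst nn_integral_inverse_power[OF Gw], auto)
      finally show ?thesis using Gw by (simp add: ennreal_mult)
    qed
  qed
  also have "\<dots> = (\<integral>\<^sup>+s. \<integral>\<^sup>+w. \<Phi> w s \<partial>lborel \<partial>lborel)"
    by (rule lborel_pair.Fubini'[symmetric]) measurable
  also have "\<dots> = (\<integral>\<^sup>+s. \<integral>\<^sup>+u. ennreal (real ?N * inverse s * bump (s *\<^sub>R u)) * indicator {0<..} s * indicator ?A u \<partial>lborel \<partial>lborel)"
  proof (rule nn_integral_cong)
    fix s :: real
    show "(\<integral>\<^sup>+w. \<Phi> w s \<partial>lborel) = (\<integral>\<^sup>+u. ennreal (real ?N * inverse s * bump (s *\<^sub>R u)) * indicator {0<..} s * indicator ?A u \<partial>lborel)"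
    proof (cases "s > 0")
      case False
      then show ?thesis by (simp add: \<Phi>_def)
    next
      case True
      have "(\<integral>\<^sup>+w. \<Phi> w s \<partial>lborel) = (\<integral>\<^sup>+u. ennreal (s ^ ?N) * \<Phi> (s *\<^sub>R u) s \<partial>lborel)"
        by (rule nn_integral_lborel_scaleR[OF _ True]) (unfold \<Phi>_def, measurable)
      also have "\<dots> = (\<integral>\<^sup>+u. ennreal (real ?N * inverse s * bump (s *\<^sub>R u)) * indicator {0<..} s * indicator ?A u \<partial>lborel)"
      proof (rule nn_integral_cong)
        fix u :: 'a
        have "ennreal (s ^ ?N) * (ennreal (bump (s *\<^sub>R u)) * ennreal (real ?N * inverse s ^ Suc ?N)) = ennreal (real ?N * inverse s * bump (s *\<^sub>R u))"
          using True by (simp add: ennreal_mult[symmetric] field_simps)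
        moreover have "G (s *\<^sub>R u) \<le> s \<longleftrightarrow> G u \<le> 1" using G(2)[OF True] True by simp
        ultimately show "ennreal (s ^ ?N) * \<Phi> (s *\<^sub>R u) s = ennreal (real ?N * inverse s * bump (s *\<^sub>R u)) * indicator {0<..} s * indicator ?A u"
          using True by (auto simp: \<Phi>_def indicator_def)
      qed
      finally show ?thesis .
    qed
  qed
  also have "\<dots> = (\<integral>\<^sup>+u. \<integral>\<^sup>+s. ennreal (real ?N * inverse s * bump (s *\<^sub>R u)) * indicator {0<..} s * indicator ?A u \<partial>lborel \<partial>lborel)"
    by (rule lborel_pair.Fubini') measurable
  also have "\<dots> = (\<integral>\<^sup>+u. radial_mass TYPE('a) * indicator ?A u \<partial>lborel)"
  proof (rule nn_integral_cong_AE)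
    have "AE u in lborel. (u::'a) \<noteq> 0" by (rule AE_lborel_singleton)
    then show "AE u in lborel. (\<integral>\<^sup>+s. ennreal (real ?N * inverse s * bump (s *\<^sub>R u)) * indicator {0<..} s * indicator ?A u \<partial>lborel)
        = radial_mass TYPE('a) * indicator ?A u"
    proof (rule AE_mp, intro AE_I2 impI)
      fix u :: 'a assume u: "u \<noteq> 0"
      have "(\<integral>\<^sup>+s. ennreal (real ?N * inverse s * bump (s *\<^sub>R u)) * indicator {0<..} s * indicator ?A u \<partial>lborel)
        = (\<integral>\<^sup>+s. ennreal (real ?N * inverse s * bump (s *\<^sub>R u)) * indicator {0<..} s \<partial>lborel) * indicator ?A u"
        by (rule nn_integral_multc) measurable
      then show "(\<integral>\<^sup>+s. ennreal (real ?N * inverse s * bump (s *\<^sub>R u)) * indicator {0<..} s * indicator ?A u \<partial>lborel)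
        = radial_mass TYPE('a) * indicator ?A u" by (simp add: nn_integral_radial[OF u])
    qed
  qed
  also have "\<dots> = radial_mass TYPE('a) * emeasure lborel ?A"
    by (simp add: nn_integral_cmult_indicator)
  finally show ?thesis .
qed

lemma shell_integral:
  fixes G :: "'a::euclidean_space \<Rightarrow> real"
  assumes "continuous_on UNIV G" "\<And>w. w \<noteq> 0 \<Longrightarrow> 0 < G w"
  shows "(\<integral>\<^sup>+w. ennreal (bump w * inverse (G w) ^ n) \<partial>lborel) = ennreal (Re (J (\<lambda>w. of_real (inverse (G w) ^ n))))"
proof -
  let ?g = "\<lambda>w. complex_of_real (inverse (G w) ^ n)"
  have "continuous_on (- {0}) ?g"
    using assms(2) by (intro continuous_intros continuous_on_subset[OF assms(1)]) (auto simp: less_le)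
  note int = J_integrable[OF this]
  have "Re (J ?g) = (LINT w|lborel. Re (of_real (bump w) * ?g w))"
    unfolding J_def by (rule integral_Re[OF int, symmetric])
  also have eq: "(\<lambda>w. Re (of_real (bump w) * ?g w)) = (\<lambda>w. bump w * inverse (G w) ^ n)"
    by (rule ext) (simp only: of_real_mult[symmetric] Re_complex_of_real)
  finally have J: "Re (J ?g) = (LINT w|lborel. bump w * inverse (G w) ^ n)" .
  have "integrable lborel (\<lambda>w. bump w * inverse (G w) ^ n)"
    using integrable_Re[OF int] unfolding eq .
  moreover have "0 \<le> bump w * inverse (G w) ^ n" for w
    using assms(2)[of w] by (cases "w = 0") (auto simp: bump_eq_0)
  ultimately show ?thesis unfolding J by (intro nn_integral_eq_integral) auto
qed

text \<open>The constant is the reciprocal of \<open>radial_mass\<close>, shown to be finite and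
  nonzero by the test case \<open>G = norm\<close>. Being the same for all \<open>G\<close>, it
  contributes only an additive constant to the logarithm of the volume.\<close>

theorem ball_volume_eq_J:
  "\<exists>C>0. \<forall>G :: complex^'m \<Rightarrow> real. continuous_on UNIV G \<longrightarrow> (\<forall>r>0. \<forall>w. G (r *\<^sub>R w) = r * G w) \<longrightarrow>
     (\<forall>w. w \<noteq> 0 \<longrightarrow> 0 < G w) \<longrightarrow>
     measure lborel {w. G w \<le> 1} = C * Re (J (\<lambda>w. of_real (inverse (G w) ^ (2 * CARD('m)))))"
proof -
  let ?c = "radial_mass TYPE(complex^'m)"
  have eq: "ennreal (Re (J (\<lambda>w. of_real (inverse (G w) ^ (2 * CARD('m)))))) = ?c * emeasure lborel {w. G w \<le> 1}"
    if "continuous_on UNIV G" "\<And>r w. r > 0 \<Longrightarrow> G (r *\<^sub>R w) = r * G w" "\<And>w. w \<noteq> 0 \<Longrightarrow> 0 < G w"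
    for G :: "complex^'m \<Rightarrow> real"
    using nn_integral_shell_eq[OF that] shell_integral[OF that(1,3), of "2 * CARD('m)"]
    by (simp add: mult.commute[of 2])
  let ?j = "Re (J (\<lambda>w::complex^'m. of_real (inverse (norm w) ^ (2 * CARD('m)))))"
  have n: "ennreal ?j = ?c * emeasure lborel (cball (0::complex^'m) 1)"
    using eq[of norm] by (simp add: continuous_on_norm_id cball_def)
  have jpos: "?j > 0"
  proof -
    have "Re (J (\<lambda>w::complex^'m. of_real (inverse 2 ^ (2 * CARD('m))) * 1)) \<le> ?j"
    proof (rule Re_J_mono)
      show "continuous_on (- {0}) (\<lambda>w::complex^'m. complex_of_real (inverse (norm w) ^ (2 * CARD('m))))"
        by (intro continuous_intros) auto
      fix w :: "complex^'m" assume "1 \<le> norm w" "norm w \<le> 2"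
      then have "inverse 2 ^ (2 * CARD('m)) \<le> inverse (norm w) ^ (2 * CARD('m))"
        by (intro power_mono le_imp_inverse_le) auto
      then show "Re (of_real (inverse 2 ^ (2 * CARD('m))) * 1) \<le> Re (complex_of_real (inverse (norm w) ^ (2 * CARD('m))))"
        by (simp only: mult_1_right Re_complex_of_real)
    qed (rule continuous_on_const)
    then have "inverse 2 ^ (2 * CARD('m)) * Re (J (\<lambda>w::complex^'m. 1)) \<le> ?j"
      unfolding J_cmult by (simp del: of_real_power)
    moreover have "0 < inverse 2 ^ (2 * CARD('m)) * Re (J (\<lambda>w::complex^'m. 1))"
      by (intro mult_pos_pos J_1_pos) simp
    ultimately show ?thesis by linarith
  qed
  have "emeasure lborel (cball (0::complex^'m) 1) \<noteq> 0"
  proof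
    assume "emeasure lborel (cball (0::complex^'m) 1) = 0"
    then have "ennreal ?j = 0" unfolding n by simp
    then show False using jpos by simp
  qed
  moreover have "?c * emeasure lborel (cball (0::complex^'m) 1) \<noteq> top"
    unfolding n[symmetric] by simp
  ultimately have "?c \<noteq> top" by (auto simp: ennreal_top_mult)
  moreover have "?c \<noteq> 0" using n jpos by auto
  ultimately obtain c where c: "?c = ennreal c" "c > 0"
    by (metis ennreal_cases ennreal_0 less_eq_real_def)
  show ?thesis
  proof (intro exI[of _ "inverse c"] conjI allI impI)
    show "0 < inverse c" using c by simp
    fix G :: "complex^'m \<Rightarrow> real"
    assume G: "continuous_on UNIV G" "\<forall>r>0. \<forall>w. G (r *\<^sub>R w) = r * G w" "\<forall>w. w \<noteq> 0 \<longrightarrow> 0 < G w"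
    let ?r = "Re (J (\<lambda>w. of_real (inverse (G w) ^ (2 * CARD('m)))))"
    have e: "ennreal ?r = ennreal c * emeasure lborel {w. G w \<le> 1}"
      using eq[of G] G c(1) by simp
    have r0: "?r \<ge> 0"
    proof -
      have "Re (J (\<lambda>w::complex^'m. 0)) \<le> ?r"
        using G(1,3) by (intro Re_J_mono)
          (auto intro!: continuous_intros continuous_on_subset[OF G(1)] simp: less_le simp flip: of_real_power of_real_inverse)
      then show ?thesis by (simp add: J_def)
    qed
    have "enn2real (ennreal ?r) = c * measure lborel {w. G w \<le> 1}"
      unfolding e using c(2) by (simp add: enn2real_mult measure_def)
    then have "?r = c * measure lborel {w. G w \<le> 1}" using r0 by simp
    then show "measure lborel {w. G w \<le> 1} = inverse c * ?r" using c(2) by simp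
  qed
qed

section \<open>Complex determinants and Lebesgue measure\<close>

definition transvection :: "'n \<Rightarrow> 'n \<Rightarrow> 'a::field \<Rightarrow> 'a^'n^'n" where
  "transvection i j c = (\<chi> k l. of_bool (k = l) + (if k = i \<and> l = j then c else 0))"

lemma transvection_mult_left: "(transvection i j c ** A) $ k $ l = A $ k $ l + (if k = i then c * A $ j $ l else 0)"
proof -
  have "(transvection i j c ** A) $ k $ l
      = (\<Sum>m\<in>UNIV. (if m = k then A $ k $ l else 0) + (if m = j then (if k = i then c * A $ j $ l else 0) else 0))"
    unfolding matrix_matrix_mult_def transvection_def
    by (simp only: vec_lambda_beta) (intro sum.cong refl, auto simp: algebra_simps)
  then show ?thesis by (simp add: sum.distrib)
qed

lemma transvection_mult_right: "(A ** transvection i j c) $ k $ l = A $ k $ l + (if l = j then c * A $ k $ i else 0)"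
proof -
  have "(A ** transvection i j c) $ k $ l
      = (\<Sum>m\<in>UNIV. (if m = l then A $ k $ l else 0) + (if m = i then (if l = j then c * A $ k $ i else 0) else 0))"
    unfolding matrix_matrix_mult_def transvection_def
    by (simp only: vec_lambda_beta) (intro sum.cong refl, auto simp: algebra_simps)
  then show ?thesis by (simp add: sum.distrib)
qed

lemma transvection_add: "i \<noteq> j \<Longrightarrow> transvection i j c ** transvection i j d = transvection i j (c + d)"
  unfolding vec_eq_iff transvection_mult_left by (auto simp: transvection_def)

lemma transvection_0: "transvection i j 0 = mat 1"
  by (simp add: vec_eq_iff transvection_def mat_def)

lemma det_transvection:
  assumes "i \<noteq> j"
  shows "det (transvection i j c) = 1"
proof -
  have "transvection i j c = (\<chi> k. if k = i then row i (mat 1) + c *s row j (mat 1) else row k (mat 1))"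
    using assms by (auto simp: vec_eq_iff transvection_def row_def mat_def)
  then show ?thesis using det_row_operation[OF assms, of "mat 1" c] by simp
qed

text \<open>Gaussian elimination by transvections alone, without exchanging or scaling rows, so that
  neither determinants nor volumes change on the way. It ends at a diagonal matrix or at one with a
  zero row.\<close>

lemma matrix_induct_transvection:
  fixes P :: "'a::field^'n^'n \<Rightarrow> bool"
  assumes zero_row: "\<And>A i. row i A = 0 \<Longrightarrow> P A"
    and diagonal: "\<And>A. (\<And>i j. i \<noteq> j \<Longrightarrow> A $ i $ j = 0) \<Longrightarrow> P A"
    and left: "\<And>A i j c. i \<noteq> j \<Longrightarrow> P (transvection i j c ** A) \<Longrightarrow> P A"
    and right: "\<And>A i j c. i \<noteq> j \<Longrightarrow> P (A ** transvection i j c) \<Longrightarrow> P A"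
  shows "P A"
proof -
  \<comment> \<open>\<open>K\<close> collects the columns that may still have entries off the
    diagonal.\<close>
  have main: "P A" if "finite K" "\<And>i j. j \<notin> K \<Longrightarrow> i \<noteq> j \<Longrightarrow> A $ i $ j = 0" for A and K :: "'n set"
    using that
  proof (induction K arbitrary: A rule: finite_induct)
    case empty
    then show ?case using diagonal by blast
  next
    case (insert k K)
    \<comment> \<open>\<open>L\<close> collects the rows whose entry in column \<open>k\<close> may
      still have to be cleared.\<close>
    have pivot: "P A" if "finite L" "A $ k $ k \<noteq> 0" "\<And>i j. j \<notin> insert k K \<Longrightarrow> i \<noteq> j \<Longrightarrow> A $ i $ j = 0"
      "\<And>i. i \<notin> L \<Longrightarrow> i \<noteq> k \<Longrightarrow> A $ i $ k = 0" for A L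
      using that
    proof (induction L arbitrary: A rule: finite_induct)
      case empty
      show ?case
      proof (rule insert.IH)
        fix i j assume "j \<notin> K" "i \<noteq> j"
        then show "A $ i $ j = 0" using empty.prems by (cases "j = k") auto
      qed
    next
      case (insert l L)
      note IHL = insert.IH and premsL = insert.prems
      show ?case
      proof (cases "l = k")
        case True
        show ?thesis
          by (rule IHL) (use premsL True in auto)
      next
        case False
        let ?c = "- (A $ l $ k / A $ k $ k)"
        have "P (transvection l k ?c ** A)"
        proof (rule IHL)
          show "(transvection l k ?c ** A) $ k $ k \<noteq> 0"
            using premsL(1) False by (simp add: transvection_mult_left)
          fix i j assume "j \<notin> insert k K" "i \<noteq> j"
          then show "(transvection l k ?c ** A) $ i $ j = 0"
            using premsL(2) by (auto simp: transvection_mult_left)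
        next
          fix i assume "i \<notin> L" "i \<noteq> k"
          then show "(transvection l k ?c ** A) $ i $ k = 0"
            using premsL(1,3) by (auto simp: transvection_mult_left)
        qed
        then show ?thesis using left[OF False] by blast
      qed
    qed
    show ?case
    proof (cases "A $ k $ k = 0")
      case False
      show ?thesis by (rule pivot[of UNIV]) (use False insert.prems in auto)
    next
      case kk: True
      show ?thesis
      proof (cases "\<exists>j\<in>K. A $ k $ j \<noteq> 0")
        case True
        then obtain j where j: "j \<in> K" "A $ k $ j \<noteq> 0" by blast
        then have jk: "j \<noteq> k" using insert.hyps by auto
        \<comment> \<open>Adding column \<open>j\<close> to column \<open>k\<close> creates a
          nonzero pivot.\<close>
        have "P (A ** transvection j k 1)"
        proof (rule pivot[of UNIV])
          show "(A ** transvection j k 1) $ k $ k \<noteq> 0"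
            using j kk by (simp add: transvection_mult_right)
          fix i l assume "l \<notin> insert k K" "i \<noteq> l"
          then show "(A ** transvection j k 1) $ i $ l = 0"
            using insert.prems by (auto simp: transvection_mult_right)
        qed auto
        then show ?thesis by (rule right[OF jk])
      next
        case False
        \<comment> \<open>Columns outside \<open>insert k K\<close> have no entries off the
          diagonal, so nothing is left in row \<open>k\<close>.\<close>
        have "row k A = 0"
          unfolding vec_eq_iff
        proof
          fix j show "row k A $ j = 0 $ j"
            using False kk insert.prems[of j k] by (cases "j = k"; cases "j \<in> K") (auto simp: row_def)
        qed
        then show ?thesis by (rule zero_row)
      qed
    qed
  qed
  show ?thesis by (rule main[of UNIV]) auto
qed

definition row_upd :: "'a^'n^'n \<Rightarrow> 'n \<Rightarrow> 'a^'n \<Rightarrow> 'a^'n^'n" where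
  "row_upd A i x = (\<chi> k. if k = i then x else A $ k)"

lemma row_upd_same [simp]: "row_upd A i (A $ i) = A"
  by (simp add: row_upd_def vec_eq_iff)

lemma row_upd_nth: "row_upd A i x $ k = (if k = i then x else A $ k)"
  by (simp add: row_upd_def)

section \<open>Uniqueness of the determinant among alternating forms\<close>

definition row_alternating :: "('a::field^'n^'n \<Rightarrow> 'a) \<Rightarrow> bool" where
  "row_alternating F \<longleftrightarrow>
     (\<forall>A i x y. F (row_upd A i (x + y)) = F (row_upd A i x) + F (row_upd A i y)) \<and>
     (\<forall>A i c x. F (row_upd A i (c *s x)) = c * F (row_upd A i x)) \<and>
     (\<forall>A i j. i \<noteq> j \<longrightarrow> A $ i = A $ j \<longrightarrow> F A = 0)"

lemma row_alternating_transvection: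
  assumes "row_alternating F" "i \<noteq> j"
  shows "F (transvection i j c ** A) = F A"
proof -
  have "transvection i j c ** A = row_upd A i (A $ i + c *s A $ j)"
    by (auto simp: vec_eq_iff transvection_mult_left row_upd_def)
  then have "F (transvection i j c ** A) = F (row_upd A i (A $ i)) + c * F (row_upd A i (A $ j))"
    using assms(1) unfolding row_alternating_def by metis
  moreover have "F (row_upd A i (A $ j)) = 0"
    using assms unfolding row_alternating_def by (metis row_upd_nth)
  ultimately show ?thesis by simp
qed

lemma row_alternating_mult_right:
  assumes "row_alternating F"
  shows "row_alternating (\<lambda>A. F (A ** B))"
proof -
  have upd: "row_upd A i x ** B = row_upd (A ** B) i (x v* B)" for A i x
    by (simp add: vec_eq_iff row_upd_def matrix_matrix_mult_def vector_matrix_mult_def mult.commute)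
  have nth: "(A ** B) $ i = A $ i v* B" for A i
    by (simp add: vec_eq_iff matrix_matrix_mult_def vector_matrix_mult_def mult.commute)
  have "(x + y) v* B = x v* B + y v* B" "(c *s x) v* B = c *s (x v* B)" for x y c
    by (simp_all add: vec_eq_iff vector_matrix_mult_def distrib_left sum.distrib sum_distrib_left mult_ac)
  then show ?thesis
    using assms unfolding row_alternating_def upd by (simp add: nth)
qed

text \<open>The induction runs over \<open>A\<close> for all \<open>F\<close> at once: a row
  operation leaves every alternating form unchanged, while a column operation is undone by passing
  to the form composed with right multiplication.\<close>

lemma row_alternating_eq_det:
  fixes F :: "'a::field^'n^'n \<Rightarrow> 'a"
  assumes "row_alternating F"
  shows "F A = det A * F (mat 1)"
  using assms
proof (induction A arbitrary: F rule: matrix_induct_transvection)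
  case (1 A i)
  have "A = row_upd A i (0 *s 0)" using 1(1) by (auto simp: vec_eq_iff row_upd_def row_def)
  then have "F A = 0 * F (row_upd A i 0)" using 1(2) unfolding row_alternating_def by metis
  moreover have "det A = 0" using 1(1) by (rule det_zero_row)
  ultimately show ?case by simp
next
  case (2 A)
  \<comment> \<open>Interpolates between the identity and \<open>A\<close>, replacing one row at a
    time.\<close>
  define M where "M K = (\<chi> k. if k \<in> K then A $ k else axis k 1)" for K
  have "F (M K) = (\<Prod>k\<in>K. A $ k $ k) * F (mat 1)" if "finite K" for K
    using that
  proof (induction K rule: finite_induct)
    case empty
    have "M {} = mat 1" by (simp add: M_def vec_eq_iff mat_def axis_def eq_commute)
    then show ?case by simp
  next
    case (insert k K)
    have "M (insert k K) = row_upd (M K) k (A $ k $ k *s axis k 1)"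
      using 2(1) by (auto simp: M_def vec_eq_iff row_upd_def axis_def)
    moreover have "row_upd (M K) k (axis k 1) = M K"
      using insert.hyps by (auto simp: M_def vec_eq_iff row_upd_def)
    ultimately have "F (M (insert k K)) = A $ k $ k * F (M K)"
      using 2(2) unfolding row_alternating_def by metis
    then show ?case using insert by simp
  qed
  from this[of UNIV] have "F A = (\<Prod>k\<in>UNIV. A $ k $ k) * F (mat 1)" by (simp add: M_def)
  then show ?case using det_diagonal[of A] 2(1) by simp
next
  case (3 A i j c)
  have "F (transvection i j c ** A) = det (transvection i j c ** A) * F (mat 1)" by (rule 3(2)[OF 3(3)])
  then show ?case
    by (simp add: row_alternating_transvection[OF 3(3,1)] det_mul det_transvection[OF 3(1)])
next
  case (4 A i j c)
  have "F ((A ** transvection i j c) ** transvection i j (- c)) =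
      det (A ** transvection i j c) * F (mat 1 ** transvection i j (- c))"
    by (rule 4(2)[OF row_alternating_mult_right[OF 4(3)]])
  moreover have "(A ** transvection i j c) ** transvection i j (- c) = A"
    by (simp add: matrix_mul_assoc[symmetric] transvection_add[OF 4(1)] transvection_0)
  moreover have "F (mat 1 ** transvection i j (- c)) = F (mat 1)"
    using row_alternating_transvection[OF 4(3,1), of "- c" "mat 1"] by simp
  ultimately show ?case by (simp add: det_mul det_transvection[OF 4(1)])
qed

text \<open>Both sides are iterated integrals of the indicator of \<open>{(x, y). x \<in> B \<and> inv f y + x \<in> S}\<close>.\<close>

lemma emeasure_linear_image_proportional:
  fixes f :: "'a::euclidean_space \<Rightarrow> 'a"
  assumes f: "linear f" "bij f" and S: "S \<in> sets borel" and B: "B \<in> sets borel"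
  shows "emeasure lborel B * emeasure lborel (f ` S) = emeasure lborel S * emeasure lborel (f ` B)"
proof -
  define g where "g = inv f"
  have gf: "g (f x) = x" "f (g x) = x" for x
    using f(2) by (simp_all add: g_def bij_is_inj bij_is_surj surj_f_inv_f)
  have g: "linear g"
    unfolding g_def using f by (simp add: linear_injective_imp_surjective bij_is_inj inj_linear_imp_inv_linear)
  have fm [measurable]: "f \<in> borel_measurable borel" and gm [measurable]: "g \<in> borel_measurable borel"
    using f(1) g by (auto intro: borel_measurable_continuous_onI linear_continuous_on simp: linear_conv_bounded_linear)
  note [measurable] = S B
  have im: "emeasure lborel (f ` T) = (\<integral>\<^sup>+y. indicator T (g y) \<partial>lborel)" if [measurable]: "T \<in> sets borel" for T
  proof -
    have eq: "f ` T = g -` T" using gf by (auto simp: image_iff) metis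
    have "g -` T \<in> sets borel" using measurable_sets[OF gm that] by simp
    then have "emeasure lborel (f ` T) = (\<integral>\<^sup>+y. indicator (g -` T) y \<partial>lborel)"
      unfolding eq by simp
    then show ?thesis by (simp add: indicator_vimage)
  qed
  have shift: "(\<integral>\<^sup>+y. k (y + a) \<partial>lborel) = (\<integral>\<^sup>+y. k y \<partial>lborel)"
    if [measurable]: "k \<in> borel_measurable borel" for k :: "'a \<Rightarrow> ennreal" and a
  proof -
    have "(\<integral>\<^sup>+y. k y \<partial>lborel) = (\<integral>\<^sup>+y. k y \<partial>distr lborel borel ((+) a))" by (simp add: lborel_distr_plus)
    also have "\<dots> = (\<integral>\<^sup>+y. k (a + y) \<partial>lborel)" by (rule nn_integral_distr) measurable
    finally show ?thesis by (simp add: add.commute)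
  qed
  have reflect: "(\<integral>\<^sup>+y. k (a - y) \<partial>lborel) = (\<integral>\<^sup>+y. k y \<partial>lborel)"
    if [measurable]: "k \<in> borel_measurable borel" for k :: "'a \<Rightarrow> ennreal" and a
  proof -
    have "(\<integral>\<^sup>+y. k y \<partial>lborel) = (\<integral>\<^sup>+y. k y \<partial>density (distr lborel borel (\<lambda>x. a + (- 1) *\<^sub>R x)) (\<lambda>_. ennreal (\<bar>- 1\<bar> ^ DIM('a))))"
      using lborel_affine[of "- 1" a, symmetric] by simp
    also have "\<dots> = (\<integral>\<^sup>+y. k (a - y) \<partial>lborel)"
      by (simp add: nn_integral_density nn_integral_distr)
    finally show ?thesis by simp
  qed
  have "emeasure lborel B * emeasure lborel (f ` S) = (\<integral>\<^sup>+x. indicator B x \<partial>lborel) * emeasure lborel (f ` S)"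
    by simp
  also have "\<dots> = (\<integral>\<^sup>+x. indicator B x * (\<integral>\<^sup>+y. indicator S (g y) \<partial>lborel) \<partial>lborel)"
    unfolding im[OF S] by (rule nn_integral_multc[symmetric]) measurable
  also have "\<dots> = (\<integral>\<^sup>+x. \<integral>\<^sup>+y. indicator B x * indicator S (g y + x) \<partial>lborel \<partial>lborel)"
  proof (rule nn_integral_cong)
    fix x :: 'a
    have "(\<integral>\<^sup>+y. indicator S (g y) \<partial>lborel) = (\<integral>\<^sup>+y. indicator S (g (y + f x)) \<partial>lborel :: ennreal)"
      by (rule shift[symmetric]) measurable
    also have "\<dots> = (\<integral>\<^sup>+y. indicator S (g y + x) \<partial>lborel)"
      by (simp add: linear_add[OF g] gf)
    finally show "indicator B x * (\<integral>\<^sup>+y. indicator S (g y) \<partial>lborel) = (\<integral>\<^sup>+y. indicator B x * indicator S (g y + x) \<partial>lborel :: ennreal)"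
      by (simp add: nn_integral_cmult)
  qed
  also have "\<dots> = (\<integral>\<^sup>+y. \<integral>\<^sup>+x. indicator B x * indicator S (g y + x) \<partial>lborel \<partial>lborel)"
    by (rule lborel_pair.Fubini') measurable
  also have "\<dots> = (\<integral>\<^sup>+y. \<integral>\<^sup>+x. indicator B (x - g y) * indicator S x \<partial>lborel \<partial>lborel)"
  proof (rule nn_integral_cong)
    fix y :: 'a
    have "(\<integral>\<^sup>+x. indicator B (x + - g y) * indicator S (g y + (x + - g y)) \<partial>lborel)
        = (\<integral>\<^sup>+x. indicator B x * indicator S (g y + x) \<partial>lborel :: ennreal)"
      by (rule shift) measurable
    then show "(\<integral>\<^sup>+x. indicator B x * indicator S (g y + x) \<partial>lborel) = (\<integral>\<^sup>+x. indicator B (x - g y) * indicator S x \<partial>lborel :: ennreal)"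
      by simp
  qed
  also have "\<dots> = (\<integral>\<^sup>+x. \<integral>\<^sup>+y. indicator B (x - g y) * indicator S x \<partial>lborel \<partial>lborel)"
    by (rule lborel_pair.Fubini') measurable
  also have "\<dots> = (\<integral>\<^sup>+x. emeasure lborel (f ` B) * indicator S x \<partial>lborel)"
  proof (rule nn_integral_cong)
    fix x :: 'a
    have "(\<integral>\<^sup>+y. indicator B (x - g y) \<partial>lborel) = (\<integral>\<^sup>+y. indicator B (x - g (f x - y)) \<partial>lborel :: ennreal)"
      by (rule reflect[symmetric]) measurable
    also have "\<dots> = emeasure lborel (f ` B)"
      by (simp add: linear_diff[OF g] gf im[OF B])
    finally show "(\<integral>\<^sup>+y. indicator B (x - g y) * indicator S x \<partial>lborel) = emeasure lborel (f ` B) * indicator S x"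
      by (simp add: nn_integral_multc)
  qed
  also have "\<dots> = emeasure lborel S * emeasure lborel (f ` B)"
    by (subst nn_integral_cmult_indicator) (auto simp: mult.commute)
  finally show ?thesis .
qed


section \<open>The volume factor of a complex matrix\<close>

definition scales_measure :: "complex^'n^'n \<Rightarrow> real \<Rightarrow> bool" where
  "scales_measure A c \<longleftrightarrow> 0 < c \<and>
     (\<forall>S\<in>sets borel. (*v) A ` S \<in> sets borel \<and> emeasure lborel ((*v) A ` S) = ennreal c * emeasure lborel S)"

lemma linear_matrix_vector_mult_complex:
  fixes A :: "complex^'n^'n"
  shows "linear ((*v) A)"
  by (rule linearI) (simp_all add: vec_eq_iff matrix_vector_mult_def scaleR_sum_right distrib_left sum.distrib)

lemma bij_matrix_vector_mult:
  fixes A :: "complex^'n^'n"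
  assumes "det A \<noteq> 0"
  shows "bij ((*v) A)"
proof -
  obtain B where "A ** B = mat 1" "B ** A = mat 1"
    using assms by (metis invertible_def invertible_det_nz)
  then have "A *v (B *v x) = x" "B *v (A *v x) = x" for x
    by (simp_all add: matrix_vector_mul_assoc)
  then show ?thesis by (metis bijI' )
qed

lemma borel_linear_image:
  fixes f :: "'a::euclidean_space \<Rightarrow> 'a"
  assumes "linear f" "bij f" "S \<in> sets borel"
  shows "f ` S \<in> sets borel"
proof -
  have "linear (inv f)"
    using assms by (simp add: linear_injective_imp_surjective bij_is_inj inj_linear_imp_inv_linear)
  then have m: "inv f \<in> borel_measurable borel"
    by (intro borel_measurable_continuous_onI linear_continuous_on) (simp add: linear_conv_bounded_linear)
  have "f ` S = inv f -` S"
    using bij_vimage_eq_inv_image[OF bij_imp_bij_inv[OF assms(2)], of S] inv_inv_eq[OF assms(2)] by simp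
  then show ?thesis using measurable_sets[OF m assms(3)] by simp
qed

text \<open>By proportionality a single test set of finite positive measure determines the factor
  for all Borel sets.\<close>

lemma scales_measureI:
  fixes A :: "complex^'n^'n"
  assumes A: "det A \<noteq> 0" and B: "bounded B" "B \<in> sets borel" "emeasure lborel B = ennreal b" "0 < b"
    and eq: "emeasure lborel ((*v) A ` B) = ennreal c" "0 < c"
  shows "scales_measure A (c / b)"
  unfolding scales_measure_def
proof (intro conjI ballI)
  note f = linear_matrix_vector_mult_complex bij_matrix_vector_mult[OF A]
  show "0 < c / b" using B(4) eq(2) by simp
  fix S :: "(complex^'n) set" assume S: "S \<in> sets borel"
  show "(*v) A ` S \<in> sets borel" by (rule borel_linear_image[OF f S])
  have "ennreal b * emeasure lborel ((*v) A ` S) = emeasure lborel S * ennreal c"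
    using emeasure_linear_image_proportional[OF f S B(2)] B(3) eq(1) by simp
  then have "ennreal (1 / b) * (ennreal b * emeasure lborel ((*v) A ` S)) = ennreal (1 / b) * (ennreal c * emeasure lborel S)"
    by (simp add: mult.commute)
  then show "emeasure lborel ((*v) A ` S) = ennreal (c / b) * emeasure lborel S"
    using B(4) eq(2) by (simp add: mult.assoc[symmetric] ennreal_mult[symmetric])
qed

lemma emeasure_cball_pos:
  "\<exists>b>0. emeasure lborel (cball (0::'a::euclidean_space) 1) = ennreal b"
proof -
  have "emeasure lborel (cball (0::'a) 1) \<noteq> 0"
    using content_cball_pos[of 1 "0::'a"] by (auto simp: measure_def)
  moreover have "emeasure lborel (cball (0::'a) 1) < top"
    using emeasure_bounded_finite[OF bounded_cball] by (simp add: top.not_eq_extremum)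
  ultimately show ?thesis
    by (metis ennreal_cases ennreal_0 less_eq_real_def less_irrefl)
qed

lemma scales_measure_exists:
  fixes A :: "complex^'n^'n"
  assumes A: "det A \<noteq> 0"
  shows "\<exists>c. scales_measure A c"
proof -
  note f = linear_matrix_vector_mult_complex bij_matrix_vector_mult[OF A]
  obtain b where b: "b > 0" "emeasure lborel (cball (0::complex^'n) 1) = ennreal b"
    using emeasure_cball_pos by blast
  have cb: "cball (0::complex^'n) 1 \<in> sets borel" by simp
  have "bounded ((*v) A ` cball 0 1)"
    using f(1) by (simp add: bounded_linear_image linear_conv_bounded_linear)
  then have "emeasure lborel ((*v) A ` cball 0 1) < top"
    using emeasure_bounded_finite by (simp add: top.not_eq_extremum)
  moreover have "emeasure lborel ((*v) A ` cball 0 1) \<noteq> 0"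
  proof
    assume "emeasure lborel ((*v) A ` cball 0 1) = 0"
    \<comment> \<open>Were the image of the ball null, comparing the ball with the whole space would
      make the image of the whole space null.\<close>
    then have "ennreal b * emeasure lborel ((*v) A ` UNIV) = 0"
      using emeasure_linear_image_proportional[OF f _ cb, of UNIV] b(2) by simp
    moreover have "range ((*v) A) = UNIV" using f(2) by (simp add: bij_is_surj)
    ultimately show False using b(1) by (simp add: emeasure_lborel_UNIV)
  qed
  ultimately obtain c where "c > 0" "emeasure lborel ((*v) A ` cball 0 1) = ennreal c"
    by (metis ennreal_cases ennreal_0 less_eq_real_def less_irrefl)
  then show ?thesis using scales_measureI[OF A bounded_cball cb b(2,1)] by blast
qed

lemma scales_measure_mult:
  assumes "scales_measure A a" "scales_measure B b"
  shows "scales_measure (A ** B) (a * b)"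
proof -
  have "(*v) (A ** B) ` S = (*v) A ` (*v) B ` S" for S
    by (simp add: image_image matrix_vector_mul_assoc)
  then show ?thesis
    using assms unfolding scales_measure_def by (simp add: ennreal_mult mult.assoc)
qed

lemma scales_measure_unique:
  fixes A :: "complex^'n^'n"
  assumes "scales_measure A a" "scales_measure A b"
  shows "a = b"
proof -
  obtain c where c: "c > 0" "emeasure lborel (cball (0::complex^'n) 1) = ennreal c"
    using emeasure_cball_pos by blast
  have "cball (0::complex^'n) 1 \<in> sets borel" by simp
  then have "ennreal a * ennreal c = ennreal b * ennreal c" "0 < a" "0 < b"
    using assms c(2) unfolding scales_measure_def by metis+
  then show ?thesis using c(1) by (simp add: ennreal_mult[symmetric])
qed

definition diag :: "('n \<Rightarrow> 'a::zero) \<Rightarrow> 'a^'n^'n" where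
  "diag a = (\<chi> i j. if i = j then a i else 0)"

lemma diag_mult_vec: "(diag a *v x) $ i = a i * (x $ i :: 'a::semiring_1)"
  by (simp add: matrix_vector_mult_def diag_def if_distrib [of "\<lambda>u. u * _"] cong: if_cong)

lemma diag_mult_left: "(diag a ** B) $ i $ j = a i * (B $ i $ j :: 'a::semiring_1)"
  by (simp add: matrix_matrix_mult_def diag_def if_distrib [of "\<lambda>u. u * _"] cong: if_cong)

lemma diag_mult_right: "(B ** diag a) $ i $ j = (B $ i $ j :: 'a::semiring_1) * a j"
  by (simp add: matrix_matrix_mult_def diag_def if_distrib [of "\<lambda>u. _ * u"] cong: if_cong)

lemma det_diag: "det (diag a :: 'a::comm_ring_1^'n^'n) = (\<Prod>i\<in>UNIV. a i)"
  using det_diagonal[of "diag a"] by (simp add: diag_def)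

text \<open>Conjugation by a diagonal matrix turns a transvection into its square, so its factor is 1.\<close>

lemma scales_measure_transvection:
  fixes i j :: "'n::finite"
  assumes ij: "i \<noteq> j"
  shows "scales_measure (transvection i j c) 1"
proof -
  let ?T = "transvection i j c" and ?D = "diag (\<lambda>k. if k = i then 2 else 1) :: complex^'n^'n"
  have eq: "?D ** ?T = (?T ** ?T) ** ?D"
    unfolding transvection_add[OF ij]
    using ij by (auto simp: vec_eq_iff diag_mult_left diag_mult_right transvection_def)
  have "det ?T \<noteq> 0" unfolding det_transvection[OF ij] by simp
  then obtain t where t: "scales_measure ?T t" using scales_measure_exists by blast
  have "det ?D \<noteq> 0" unfolding det_diag by simp
  then obtain d where d: "scales_measure ?D d" using scales_measure_exists by blast
  have "d * t = (t * t) * d"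
    using scales_measure_unique scales_measure_mult[OF d t] scales_measure_mult[OF scales_measure_mult[OF t t] d]
    unfolding eq by blast
  moreover have "t > 0" "d > 0" using t d by (simp_all add: scales_measure_def)
  ultimately have "t = 1" by simp
  then show ?thesis using t by simp
qed

text \<open>Unimodular scalars in the coordinates map the unit ball onto itself.\<close>

lemma scales_measure_unitary_diag:
  fixes u :: "'n::finite \<Rightarrow> complex"
  assumes u: "\<And>i. cmod (u i) = 1"
  shows "scales_measure (diag u) 1"
proof -
  have u0: "u i \<noteq> 0" for i using u[of i] by auto
  have n: "norm (diag v *v x) = norm x" if "\<And>i. cmod (v i) = 1" for v :: "'n \<Rightarrow> complex" and x
    using that by (simp add: norm_vec_def L2_set_def diag_mult_vec norm_mult)
  have "(*v) (diag u) ` cball 0 1 = cball 0 1"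
  proof (intro set_eqI iffI)
    fix x :: "complex^'n" assume x: "x \<in> cball 0 1"
    have "x = diag u *v (diag (\<lambda>i. inverse (u i)) *v x)"
      using u0 by (simp add: vec_eq_iff diag_mult_vec)
    moreover have "diag (\<lambda>i. inverse (u i)) *v x \<in> cball 0 1"
      using x u by (simp add: n norm_inverse)
    ultimately show "x \<in> (*v) (diag u) ` cball 0 1" by blast
  next
    fix x assume "x \<in> (*v) (diag u) ` cball 0 1"
    then show "x \<in> cball 0 1" using n[OF u] by auto
  qed
  moreover obtain b where b: "b > 0" "emeasure lborel (cball (0::complex^'n) 1) = ennreal b"
    using emeasure_cball_pos by blast
  moreover have "det (diag u) \<noteq> 0" unfolding det_diag using u0 by simp
  ultimately show ?thesis
    using scales_measureI[of "diag u" "cball 0 1" b b] by simp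
qed

lemma Basis_vec_image: "(Basis :: ('a::euclidean_space^'n) set) = (\<lambda>(i, u). axis i u) ` (UNIV \<times> Basis)"
  by (auto simp: Basis_vec_def)

text \<open>The unit cube becomes a box with side \<open>r i\<close> in both real directions of the
  complex coordinate \<open>i\<close>, hence the square.\<close>

lemma scales_measure_real_diag:
  fixes r :: "'n::finite \<Rightarrow> real"
  assumes r: "\<And>i. 0 < r i"
  shows "scales_measure (diag (\<lambda>i. complex_of_real (r i))) ((\<Prod>i\<in>UNIV. r i)\<^sup>2)"
proof -
  let ?D = "diag (\<lambda>i. complex_of_real (r i))"
  have ax: "(?D *v x) \<bullet> axis i u = r i * (x \<bullet> axis i u)" for x i u
    by (simp add: inner_axis diag_mult_vec inner_complex_def algebra_simps)
  have inv: "?D *v (diag (\<lambda>i. complex_of_real (inverse (r i))) *v x) = x" for x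
    using r by (simp add: vec_eq_iff diag_mult_vec less_imp_neq[symmetric])
  have B1: "(One :: complex^'n) \<bullet> axis i u = 1" if "u \<in> Basis" for i u
    using that by (intro inner_sum_Basis) (auto simp: Basis_vec_image)
  have cbox_iff: "x \<in> cbox 0 v \<longleftrightarrow> (\<forall>i. \<forall>u\<in>Basis. 0 \<le> x \<bullet> axis i u \<and> x \<bullet> axis i u \<le> v \<bullet> axis i u)"
    for x v :: "complex^'n" unfolding mem_box Basis_vec_image by auto
  have "(*v) ?D ` cbox 0 One = cbox 0 (?D *v One)"
  proof (intro set_eqI iffI)
    fix x assume "x \<in> cbox 0 (?D *v One)"
    then have x: "0 \<le> x \<bullet> axis i u" "x \<bullet> axis i u \<le> r i" if "u \<in> Basis" for i u
      using that unfolding cbox_iff by (auto simp: ax B1)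
    let ?y = "diag (\<lambda>i. complex_of_real (inverse (r i))) *v x"
    have "r i * (?y \<bullet> axis i u) = x \<bullet> axis i u" for i u
      using ax[of ?y i u] inv[of x] by simp
    then have "?y \<bullet> axis i u = x \<bullet> axis i u / r i" for i u
      using r[of i] by (simp add: field_simps)
    then have "?y \<in> cbox 0 One"
      unfolding cbox_iff using x r by (simp add: B1 less_imp_le)
    then show "x \<in> (*v) ?D ` cbox 0 One" using inv[of x] by (metis imageI)
  next
    fix x assume "x \<in> (*v) ?D ` cbox 0 One"
    then show "x \<in> cbox 0 (?D *v One)"
      using r unfolding cbox_iff by (auto simp: cbox_iff ax B1 less_imp_le)
  qed
  moreover have "emeasure lborel (cbox 0 (?D *v One)) = ennreal ((\<Prod>i\<in>UNIV. r i)\<^sup>2)"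
  proof -
    have "emeasure lborel (cbox 0 (?D *v One)) = ennreal (\<Prod>b\<in>Basis. (?D *v One) \<bullet> b)"
    proof (subst emeasure_lborel_cbox)
      fix b :: "complex^'n" assume "b \<in> Basis"
      then obtain i u where b: "b = axis i u" "u \<in> Basis" by (auto simp: Basis_vec_image)
      show "0 \<bullet> b \<le> (?D *v One) \<bullet> b" unfolding b(1) ax B1[OF b(2)] using r[of i] by simp
    qed simp
    also have "(\<Prod>b\<in>Basis. (?D *v One) \<bullet> b) = (\<Prod>(i, u)\<in>UNIV \<times> Basis. (?D *v One) \<bullet> axis i u)"
      unfolding Basis_vec_image
      by (subst prod.reindex) (auto simp: inj_on_def axis_eq_axis comp_def case_prod_unfold)
    also have "\<dots> = (\<Prod>i\<in>UNIV. \<Prod>u\<in>(Basis::complex set). r i)"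
      unfolding prod.cartesian_product[symmetric] by (intro prod.cong refl) (simp add: ax B1)
    also have "\<dots> = (\<Prod>i\<in>UNIV. r i)\<^sup>2" by (simp add: prod_power_distrib)
    finally show ?thesis .
  qed
  moreover have "emeasure lborel (cbox 0 (One::complex^'n)) = ennreal 1"
    by (subst emeasure_lborel_cbox) auto
  moreover have "det ?D \<noteq> 0" unfolding det_diag using r by (simp add: less_imp_neq[symmetric])
  ultimately show ?thesis
    using scales_measureI[of ?D "cbox 0 One" 1 "(\<Prod>i\<in>UNIV. r i)\<^sup>2"] r by (simp add: less_imp_neq[symmetric])
qed

text \<open>Transvections have factor 1, and a nonsingular diagonal matrix is a positive one times a
  unitary one. The squared modulus is the determinant of the underlying real linear map.\<close>

theorem scales_measure_det:
  fixes A :: "complex^'n^'n"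
  shows "det A \<noteq> 0 \<Longrightarrow> scales_measure A ((cmod (det A))\<^sup>2)"
proof (induction A rule: matrix_induct_transvection)
  case (1 A i)
  then show ?case using det_zero_row by blast
next
  case (2 A)
  have A: "A = diag (\<lambda>i. A $ i $ i)" using 2(1) by (auto simp: vec_eq_iff diag_def)
  have nz: "A $ i $ i \<noteq> 0" for i
    using 2(2) det_diagonal[of A] 2(1) by auto
  let ?r = "\<lambda>i. cmod (A $ i $ i)" and ?u = "\<lambda>i. sgn (A $ i $ i)"
  have "A = diag (\<lambda>i. complex_of_real (?r i)) ** diag ?u"
    using 2(1) nz unfolding vec_eq_iff diag_mult_left by (auto simp: diag_def sgn_eq)
  moreover have "scales_measure (diag (\<lambda>i. complex_of_real (?r i)) ** diag ?u) ((\<Prod>i\<in>UNIV. ?r i)\<^sup>2 * 1)"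
    by (intro scales_measure_mult scales_measure_real_diag scales_measure_unitary_diag)
      (use nz in \<open>auto simp: norm_sgn\<close>)
  moreover have "cmod (det A) = (\<Prod>i\<in>UNIV. ?r i)" using det_diagonal[of A] 2(1) by (simp add: prod_norm)
  ultimately show ?case by simp
next
  case (3 A i j c)
  have "transvection i j (- c) ** (transvection i j c ** A) = A"
    by (simp add: matrix_mul_assoc transvection_add[OF 3(1)] transvection_0)
  moreover have "det (transvection i j c ** A) = det A" by (simp add: det_mul det_transvection[OF 3(1)])
  ultimately show ?case
    using scales_measure_mult[OF scales_measure_transvection[OF 3(1), of "- c"] 3(2)] 3(3) by simp
next
  case (4 A i j c)
  have "(A ** transvection i j c) ** transvection i j (- c) = A"
    by (simp add: matrix_mul_assoc[symmetric] transvection_add[OF 4(1)] transvection_0)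
  moreover have "det (A ** transvection i j c) = det A" by (simp add: det_mul det_transvection[OF 4(1)])
  ultimately show ?case
    using scales_measure_mult[OF 4(2) scales_measure_transvection[OF 4(1), of "- c"]] 4(3) by simp
qed

section \<open>Logarithms of moduli of holomorphic functions\<close>

text \<open>\<open>d_zbar k\<close> of the logarithm is the conjugate of the logarithmic derivative
  \<open>g k\<close>, which is holomorphic, so a further \<open>d_z j\<close> annihilates
  it.\<close>

lemma ln_cmod_holo_on_pluriharmonic:
  assumes S: "open S" and c: "holo_on S c" "\<And>z. z \<in> S \<Longrightarrow> c z \<noteq> 0"
  shows "Ck_on 2 S (\<lambda>z. ln ((cmod (c z))\<^sup>2))"
    and "z \<in> S \<Longrightarrow> complex_hessian (\<lambda>z. ln ((cmod (c z))\<^sup>2)) z = 0"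
proof -
  let ?u = "\<lambda>z. (cmod (c z))\<^sup>2"
  have Ck: "Ck_on k S c" for k by (rule holo_on_Ck_on[OF S c(1)])
  have u: "?u = (\<lambda>z. Re (c z) * Re (c z) + Im (c z) * Im (c z))"
    by (simp only: cmod_power2) (simp only: power2_eq_square)
  have uCk: "Ck_on k S ?u" for k
    unfolding u by (intro Ck_on_add Ck_on_mult Ck_on_bounded_linear[OF S bounded_linear_Re]
        Ck_on_bounded_linear[OF S bounded_linear_Im] S Ck)
  have upos: "0 < ?u z" if "z \<in> S" for z using c(2)[OF that] by simp
  show "Ck_on 2 S (\<lambda>z. ln (?u z))"
    by (rule Ck_on_compose[OF S _ uCk Ck_on_ln_gt0]) (use upos in auto)
  have diff: "c differentiable (at z)" "?u differentiable (at z)" if "z \<in> S" for z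
    using Ck_on_differentiable[OF Ck _ that] Ck_on_differentiable[OF uCk _ that] by auto
  define g where "g k z = d_z k c z * inverse (c z)" for k z
  have Ck_inv: "(\<lambda>z. inverse (c z)) differentiable (at z)" if "z \<in> S" for z
    using differentiable_inverse[OF diff(1)[OF that] c(2)[OF that]] .
  have Ck_dz: "d_z k c differentiable (at z)" if "z \<in> S" for k z
    using Ck_on_differentiable[OF Ck_on_d_z(1)[OF S Ck, of 1 k] _ that] by simp
  have gd: "g k differentiable (at z)" if "z \<in> S" for k z
    unfolding g_def[abs_def] by (rule differentiable_mult[OF Ck_dz[OF that] Ck_inv[OF that]])
  have 1: "d_zbar k (\<lambda>y. complex_of_real (ln (?u y))) z = cnj (g k z)" if z: "z \<in> S" for k z
  proof -
    have "d_zbar k (\<lambda>y. complex_of_real (ln (?u y))) z = of_real (inverse (?u z)) * d_zbar k (\<lambda>y. of_real (?u y)) z"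
      by (rule d_z_of_real_compose(2)[OF diff(2)[OF z]]) (use upos[OF z] in \<open>auto intro!: derivative_eq_intros simp: divide_inverse\<close>)
    also have "(\<lambda>y. complex_of_real (?u y)) = (\<lambda>y. c y * cnj (c y))"
      by (simp only: complex_norm_square)
    also have "d_zbar k (\<lambda>y. c y * cnj (c y)) z = c z * cnj (d_z k c z)"
      using d_z_mult(2)[OF diff(1)[OF z] cnj_differentiable[OF diff(1)[OF z]], of k] d_z_cnj(2)[OF diff(1)[OF z], of k]
        holo_on_d_zbar[OF c(1) z, of k] by simp
    also have "of_real (inverse (?u z)) = inverse (c z) * inverse (cnj (c z))"
      by (simp only: of_real_inverse complex_norm_square inverse_mult_distrib)
    finally show ?thesis using c(2)[OF z] by (simp add: g_def)
  qed
  have 2: "d_zbar j (g k) z = 0" if z: "z \<in> S" for j k z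
  proof -
    have "d_zbar j (d_z k c) z = d_z k (d_zbar j c) z"
      by (rule d_z_commute(1)[OF S Ck z, symmetric])
    also have "\<dots> = d_z k (\<lambda>_. 0) z"
      by (rule d_z_cong(1)[OF S z]) (rule holo_on_d_zbar[OF c(1)])
    finally have "d_zbar j (d_z k c) z = 0" by simp
    moreover have "d_zbar j (d_z k c) z = d_zbar j (\<lambda>y. g k y * c y) z"
      by (rule d_z_cong(2)[OF S z]) (use c(2) in \<open>simp add: g_def\<close>)
    moreover have "d_zbar j (\<lambda>y. g k y * c y) z = d_zbar j (g k) z * c z"
      using d_z_mult(2)[OF gd[OF z] diff(1)[OF z], of j k] holo_on_d_zbar[OF c(1) z, of j] by simp
    ultimately show ?thesis using c(2)[OF z] by simp
  qed
  assume z: "z \<in> S"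
  have "d_z j (d_zbar k (\<lambda>y. complex_of_real (ln (?u y)))) z = d_z j (\<lambda>y. cnj (g k y)) z" for j k
    by (rule d_z_cong(1)[OF S z]) (rule 1)
  then show "complex_hessian (\<lambda>z. ln (?u z)) z = 0"
    by (simp add: complex_hessian_def vec_eq_iff d_z_cnj(1)[OF gd[OF z]] 2[OF z])
qed

lemma complex_hessian_cong:
  assumes "open S" "z \<in> S" "\<And>y. y \<in> S \<Longrightarrow> u y = v y"
  shows "complex_hessian u z = complex_hessian v z"
proof -
  have "d_zbar k (\<lambda>y. complex_of_real (u y)) x = d_zbar k (\<lambda>y. complex_of_real (v y)) x" if "x \<in> S" for k x
    by (rule d_z_cong(2)[OF assms(1) that]) (simp add: assms(3))
  then have "d_z j (d_zbar k (\<lambda>y. complex_of_real (u y))) z = d_z j (d_zbar k (\<lambda>y. complex_of_real (v y))) z" for j k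
    by (rule d_z_cong(1)[OF assms(1,2)])
  then show ?thesis by (simp add: complex_hessian_def)
qed

lemma complex_hessian_add:
  assumes S: "open S" "z \<in> S" and uv: "Ck_on 2 S u" "Ck_on 2 S v"
  shows "complex_hessian (\<lambda>y. u y + v y) z = complex_hessian u z + complex_hessian v z"
proof -
  let ?c = complex_of_real
  have C: "Ck_on (Suc 1) S (\<lambda>y. ?c (u y))" "Ck_on (Suc 1) S (\<lambda>y. ?c (v y))"
    using Ck_on_of_real[OF S(1) uv(1)] Ck_on_of_real[OF S(1) uv(2)] by (simp_all only: numeral_2_eq_2 One_nat_def)
  have d: "(\<lambda>y. ?c (u y)) differentiable (at x)" "(\<lambda>y. ?c (v y)) differentiable (at x)" if "x \<in> S" for x
    using Ck_on_differentiable[OF C(1) _ that] Ck_on_differentiable[OF C(2) _ that] by simp_all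
  have dd: "d_zbar k (\<lambda>y. ?c (u y)) differentiable (at z)" "d_zbar k (\<lambda>y. ?c (v y)) differentiable (at z)" for k
    using Ck_on_differentiable[OF Ck_on_d_z(2)[OF S(1) C(1)] _ S(2)] Ck_on_differentiable[OF Ck_on_d_z(2)[OF S(1) C(2)] _ S(2)] by simp_all
  have "d_z j (d_zbar k (\<lambda>y. ?c (u y + v y))) z = d_z j (\<lambda>x. d_zbar k (\<lambda>y. ?c (u y)) x + d_zbar k (\<lambda>y. ?c (v y)) x) z" for j k
    by (rule d_z_cong(1)[OF S]) (simp add: d_z_add(2)[OF d])
  then show ?thesis by (simp add: complex_hessian_def vec_eq_iff d_z_add(1)[OF dd])
qed

lemma complex_hessian_const: "complex_hessian (\<lambda>y. a) z = 0"
proof -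
  have "d_z j (d_zbar k (\<lambda>y. complex_of_real a)) z = d_z j (\<lambda>y. 0) z" for j k
    by (rule d_z_cong(1)[of UNIV]) auto
  then show ?thesis by (simp add: complex_hessian_def vec_eq_iff)
qed

section \<open>The determinant line of a fibre\<close>

text \<open>The functional whose coefficients with respect to the coordinates \<phi> form the row
  \<open>x\<close>; it is 0 off the fibre, as \<open>dual_fibre\<close> prescribes.\<close>

definition row_functional ::
    "('x, 'e, 'n::finite, 'm::finite) vbundle \<Rightarrow> 'x \<Rightarrow> ('e \<Rightarrow> complex^'m) \<Rightarrow> complex^'m \<Rightarrow> 'e \<Rightarrow> complex"
  where
  "row_functional E t \<phi> x v = (if v \<in> fibre E t then \<Sum>j\<in>UNIV. x $ j * \<phi> v $ j else 0)"

lemma row_functional_add: "row_functional E t \<phi> (x + y) = (\<lambda>v. row_functional E t \<phi> x v + row_functional E t \<phi> y v)"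
  by (rule ext) (simp add: row_functional_def algebra_simps sum.distrib)

lemma row_functional_scale: "row_functional E t \<phi> (c *s x) = (\<lambda>v. c * row_functional E t \<phi> x v)"
  by (rule ext) (simp add: row_functional_def algebra_simps sum_distrib_left)

lemma row_functional_axis: "row_functional E t \<phi> (axis i 1) = (\<lambda>v. if v \<in> fibre E t then \<phi> v $ i else 0)"
proof (rule ext)
  fix v
  have "(\<Sum>j\<in>UNIV. axis i 1 $ j * \<phi> v $ j) = (\<Sum>j\<in>UNIV. if j = i then \<phi> v $ i else 0)"
    by (intro sum.cong) (auto simp: axis_def)
  then show "row_functional E t \<phi> (axis i 1) v = (if v \<in> fibre E t then \<phi> v $ i else 0)"
    by (simp add: row_functional_def)
qed

locale linear_fibre =
  fixes E :: "('x, 'e, 'n::finite, 'm::finite) vbundle" and t :: 'x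
  assumes add_closed: "v \<in> fibre E t \<Longrightarrow> w \<in> fibre E t \<Longrightarrow> vadd E v w \<in> fibre E t"
    and scale_closed: "v \<in> fibre E t \<Longrightarrow> vscale E c v \<in> fibre E t"
begin

lemma row_functional_dual:
  assumes "fibre_frame E t e \<phi>"
  shows "row_functional E t \<phi> x \<in> dual_fibre E t"
  using assms add_closed scale_closed unfolding dual_fibre_def fibre_frame_def
  by (simp add: row_functional_def algebra_simps sum.distrib sum_distrib_left)

lemma frame_eqI:
  assumes "fibre_frame E t e \<phi>" "v \<in> fibre E t" "w \<in> fibre E t" "\<phi> v = \<phi> w"
  shows "v = w"
  using assms unfolding fibre_frame_def bij_betw_def by (meson inj_onD)

text \<open>The fibre has only binary addition and scaling, so the vector with prescribed
  coordinates on \<open>K\<close> is built by induction, together with the value of \<open>L\<close>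
  on it; the start is \<open>vscale E 0 v\<close>.\<close>

lemma frame_expansion:
  assumes f: "fibre_frame E t e \<phi>"
    and L: "\<And>v w. v \<in> fibre E t \<Longrightarrow> w \<in> fibre E t \<Longrightarrow> L (vadd E v w) = L v + L w"
      "\<And>c v. v \<in> fibre E t \<Longrightarrow> L (vscale E c v) = c * (L v :: complex)"
    and v: "v \<in> fibre E t"
  shows "L v = (\<Sum>j\<in>UNIV. \<phi> v $ j * L (e j))"
proof -
  have e: "e j \<in> fibre E t" "\<phi> (e j) = axis j 1" for j using f unfolding fibre_frame_def by auto
  have \<phi>: "\<phi> (vadd E v w) = \<phi> v + \<phi> w" "\<phi> (vscale E c v) = c *s \<phi> v"
    if "v \<in> fibre E t" "w \<in> fibre E t" for v w c using f that unfolding fibre_frame_def by auto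
  define x where "x = \<phi> v"
  have "\<exists>w\<in>fibre E t. \<phi> w = (\<Sum>j\<in>K. x $ j *s axis j 1) \<and> L w = (\<Sum>j\<in>K. x $ j * L (e j))" if "finite K" for K
    using that
  proof (induction K rule: finite_induct)
    case empty
    have "vscale E 0 v \<in> fibre E t" "\<phi> (vscale E 0 v) = 0" "L (vscale E 0 v) = 0"
      using scale_closed[OF v] \<phi>(2)[OF v v] L(2)[OF v] by (simp_all add: vec_eq_iff)
    then show ?case by (auto intro!: bexI[of _ "vscale E 0 v"])
  next
    case (insert k K)
    then obtain w where w: "w \<in> fibre E t" "\<phi> w = (\<Sum>j\<in>K. x $ j *s axis j 1)" "L w = (\<Sum>j\<in>K. x $ j * L (e j))"
      by blast
    note s = scale_closed[OF e(1), of "x $ k" k]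
    have "\<phi> (vadd E (vscale E (x $ k) (e k)) w) = (\<Sum>j\<in>insert k K. x $ j *s axis j 1)"
      using insert.hyps by (simp add: \<phi>(1)[OF s w(1)] \<phi>(2)[OF e(1) e(1)] e(2) w(2))
    moreover have "L (vadd E (vscale E (x $ k) (e k)) w) = (\<Sum>j\<in>insert k K. x $ j * L (e j))"
      using insert.hyps by (simp add: L(1)[OF s w(1)] L(2)[OF e(1)] w(3))
    ultimately show ?case using add_closed[OF s w(1)] by blast
  qed
  from this[of UNIV] obtain w where w: "w \<in> fibre E t" "\<phi> w = (\<Sum>j\<in>UNIV. x $ j *s axis j 1)" "L w = (\<Sum>j\<in>UNIV. x $ j * L (e j))"
    by auto
  have "\<phi> w = \<phi> v" unfolding w(2) x_def by (rule basis_expansion)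
  then have "w = v" by (rule frame_eqI[OF f w(1) v])
  then show ?thesis using w(3) by (simp add: x_def)
qed

lemma dual_eq_row_functional:
  assumes f: "fibre_frame E t e \<phi>" and \<alpha>: "\<alpha> \<in> dual_fibre E t"
  shows "\<alpha> = row_functional E t \<phi> (\<chi> j. \<alpha> (e j))"
proof (rule ext)
  fix v show "\<alpha> v = row_functional E t \<phi> (\<chi> j. \<alpha> (e j)) v"
  proof (cases "v \<in> fibre E t")
    case True
    then have "\<alpha> v = (\<Sum>j\<in>UNIV. \<phi> v $ j * \<alpha> (e j))"
      by (intro frame_expansion[OF f]) (use \<alpha> in \<open>auto simp: dual_fibre_def\<close>)
    then show ?thesis using True by (simp add: row_functional_def mult.commute)
  next
    case False
    then show ?thesis using \<alpha> by (simp add: row_functional_def dual_fibre_def)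
  qed
qed

text \<open>In the coordinates of a frame an alternating form on the dual space becomes an
  alternating function of the rows of a matrix, hence a multiple of the determinant. The factor is
  its value on the dual basis.\<close>

lemma det_fibre_eq_wedge:
  assumes f: "fibre_frame E t e \<phi>" and \<omega>: "\<omega> \<in> det_fibre E t"
  shows "\<omega> = (\<lambda>\<alpha>. \<omega> (\<lambda>i v. if v \<in> fibre E t then \<phi> v $ i else 0) * wedge E t e \<alpha>)"
proof (rule ext)
  fix \<alpha>
  define F where "F A = \<omega> (\<lambda>i. row_functional E t \<phi> (A $ i))" for A :: "complex^'m^'m"
  note dual = row_functional_dual[OF f]
  have upd: "(\<lambda>k. row_functional E t \<phi> (row_upd A i x $ k)) = (\<lambda>k. row_functional E t \<phi> (A $ k))(i := row_functional E t \<phi> x)"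
    for A i x by (auto simp: row_upd_nth)
  have "row_alternating F"
    unfolding row_alternating_def F_def upd
  proof (intro conjI allI impI)
    fix A :: "complex^'m^'m" and i x y
    show "\<omega> ((\<lambda>k. row_functional E t \<phi> (A $ k))(i := row_functional E t \<phi> (x + y)))
        = \<omega> ((\<lambda>k. row_functional E t \<phi> (A $ k))(i := row_functional E t \<phi> x)) + \<omega> ((\<lambda>k. row_functional E t \<phi> (A $ k))(i := row_functional E t \<phi> y))"
      using \<omega> dual unfolding det_fibre_def row_functional_add by simp
  next
    fix A :: "complex^'m^'m" and i c x
    let ?\<beta> = "(\<lambda>k. row_functional E t \<phi> (A $ k))(i := row_functional E t \<phi> x)"
    have "\<forall>j. ?\<beta> j \<in> dual_fibre E t" using dual by simp
    then have "\<omega> (?\<beta>(i := (\<lambda>v. c * ?\<beta> i v))) = c * \<omega> ?\<beta>"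
      using \<omega> unfolding det_fibre_def by blast
    then show "\<omega> ((\<lambda>k. row_functional E t \<phi> (A $ k))(i := row_functional E t \<phi> (c *s x))) = c * \<omega> ?\<beta>"
      by (simp add: row_functional_scale)
  next
    fix A :: "complex^'m^'m" and i j assume "i \<noteq> j" "A $ i = A $ j"
    then show "\<omega> (\<lambda>i. row_functional E t \<phi> (A $ i)) = 0"
      using \<omega> dual unfolding det_fibre_def by simp
  qed
  then have F: "F A = det A * F (mat 1)" for A by (rule row_alternating_eq_det)
  have "(mat 1 :: complex^'m^'m) $ i = axis i 1" for i by (simp add: vec_eq_iff mat_def axis_def eq_commute)
  then have F1: "F (mat 1) = \<omega> (\<lambda>i v. if v \<in> fibre E t then \<phi> v $ i else 0)"
    by (simp add: F_def row_functional_axis)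
  show "\<omega> \<alpha> = \<omega> (\<lambda>i v. if v \<in> fibre E t then \<phi> v $ i else 0) * wedge E t e \<alpha>"
  proof (cases "\<forall>i. \<alpha> i \<in> dual_fibre E t")
    case True
    have "\<alpha> i = row_functional E t \<phi> ((\<chi> i j. \<alpha> i (e j)) $ i)" for i
      using dual_eq_row_functional[OF f, of "\<alpha> i"] True by simp
    then have "\<alpha> = (\<lambda>i. row_functional E t \<phi> ((\<chi> i j. \<alpha> i (e j)) $ i))"
      by (rule ext)
    then have "\<omega> \<alpha> = F (\<chi> i j. \<alpha> i (e j))" unfolding F_def by (rule arg_cong)
    then show ?thesis using F[of "\<chi> i j. \<alpha> i (e j)"] F1 True by (simp add: wedge_def)
  next
    case False
    then show ?thesis using \<omega> by (auto simp: wedge_def det_fibre_def)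
  qed
qed

text \<open>The columns of the matrix are the new coordinates of the old frame; it is invertible
  because the matrix of the opposite change is its inverse.\<close>

lemma frame_change:
  assumes f: "fibre_frame E t e \<phi>" and f': "fibre_frame E t e' \<phi>'"
  shows "\<exists>A. det A \<noteq> 0 \<and> (\<forall>v\<in>fibre E t. \<phi>' v = A *v \<phi> v) \<and>
    wedge E t e (\<lambda>i v. if v \<in> fibre E t then \<phi>' v $ i else 0) = det A"
proof -
  define M where "M e \<phi>' = (\<chi> i j. \<phi>' (e j) $ i)" for e :: "'m \<Rightarrow> 'e" and \<phi>' :: "'e \<Rightarrow> complex^'m"
  have M: "\<phi>' v = M e \<phi>' *v \<phi> v" if f: "fibre_frame E t e \<phi>" and f': "fibre_frame E t e' \<phi>'" and v: "v \<in> fibre E t"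
    for e e' \<phi> \<phi>' v
  proof -
    have "\<phi>' v $ i = (\<Sum>j\<in>UNIV. \<phi> v $ j * \<phi>' (e j) $ i)" for i
      by (rule frame_expansion[OF f _ _ v]) (use f' in \<open>auto simp: fibre_frame_def\<close>)
    then show ?thesis by (simp add: vec_eq_iff M_def matrix_vector_mult_def mult.commute)
  qed
  have "M e \<phi>' ** M e' \<phi> = mat 1"
  proof -
    have "(M e \<phi>' ** M e' \<phi>) *v x = mat 1 *v x" for x
    proof -
      obtain v where v: "v \<in> fibre E t" "\<phi>' v = x" using f' unfolding fibre_frame_def bij_betw_def by (metis UNIV_I imageE)
      have "(M e \<phi>' ** M e' \<phi>) *v x = M e \<phi>' *v (M e' \<phi> *v \<phi>' v)"
        by (simp add: matrix_vector_mul_assoc v(2))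
      also have "\<dots> = x" using M[OF f' f v(1)] M[OF f f' v(1)] v(2) by metis
      finally show ?thesis by simp
    qed
    then show ?thesis using matrix_eq by blast
  qed
  then have "det (M e \<phi>') * det (M e' \<phi>) = 1" by (metis det_mul det_I)
  then have "det (M e \<phi>') \<noteq> 0" by auto
  moreover have "wedge E t e (\<lambda>i v. if v \<in> fibre E t then \<phi>' v $ i else 0) = det (M e \<phi>')"
  proof -
    have "(\<lambda>v. if v \<in> fibre E t then \<phi>' v $ i else 0) \<in> dual_fibre E t" for i
      using row_functional_dual[OF f', of "axis i 1"] by (simp add: row_functional_axis)
    moreover have "e j \<in> fibre E t" for j using f by (simp add: fibre_frame_def)
    ultimately show ?thesis by (simp add: wedge_def M_def)
  qed
  ultimately show ?thesis using M[OF f f'] by blast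
qed

lemma wedge_self:
  assumes f: "fibre_frame E t e \<phi>"
  shows "wedge E t e (\<lambda>i v. if v \<in> fibre E t then \<phi> v $ i else 0) = 1"
proof -
  have "(\<lambda>v. if v \<in> fibre E t then \<phi> v $ i else 0) \<in> dual_fibre E t" for i
    using row_functional_dual[OF f, of "axis i 1"] by (simp add: row_functional_axis)
  moreover have "e j \<in> fibre E t" "\<phi> (e j) = axis j 1" for j using f by (simp_all add: fibre_frame_def)
  moreover have "(\<chi> i j. axis j 1 $ i) = (mat 1 :: complex^'m^'m)" by (simp add: vec_eq_iff mat_def axis_def eq_commute)
  ultimately show ?thesis by (simp add: wedge_def det_I)
qed

text \<open>The definite description has exactly one solution: passing to another frame multiplies
  the coefficient by \<open>det A\<close> and the volume of the ball by the squared modulus of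
  \<open>det A\<close>, and the two effects cancel.\<close>

lemma det_metric_eq:
  assumes f: "fibre_frame E t e \<phi>" and B: "\<phi> ` finsler_ball E h t \<in> sets borel"
  shows "det_metric E h (t, \<lambda>\<alpha>. c * wedge E t e \<alpha>) = sqrt ((cmod c)\<^sup>2 / measure lborel (\<phi> ` finsler_ball E h t))"
proof -
  have "(THE r. \<exists>e' \<phi>' c'. fibre_frame E t e' \<phi>' \<and> (\<lambda>\<alpha>. c * wedge E t e \<alpha>) = (\<lambda>\<alpha>. c' * wedge E t e' \<alpha>) \<and>
     r = (cmod c')\<^sup>2 / measure lborel (\<phi>' ` finsler_ball E h t)) = (cmod c)\<^sup>2 / measure lborel (\<phi> ` finsler_ball E h t)"
    (is "The ?P = ?r")
  proof (rule the_equality)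
    show "?P ?r" using f by blast
    fix r assume "?P r"
    then obtain e' \<phi>' c' where f': "fibre_frame E t e' \<phi>'"
      and eq: "(\<lambda>\<alpha>. c * wedge E t e \<alpha>) = (\<lambda>\<alpha>. c' * wedge E t e' \<alpha>)"
      and r: "r = (cmod c')\<^sup>2 / measure lborel (\<phi>' ` finsler_ball E h t)" by blast
    obtain A where A: "det A \<noteq> 0" "\<And>v. v \<in> fibre E t \<Longrightarrow> \<phi>' v = A *v \<phi> v"
      "wedge E t e (\<lambda>i v. if v \<in> fibre E t then \<phi>' v $ i else 0) = det A"
      using frame_change[OF f f'] by blast
    have c': "c' = c * det A"
      using fun_cong[OF eq, of "\<lambda>i v. if v \<in> fibre E t then \<phi>' v $ i else 0"] A(3) wedge_self[OF f'] by simp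
    have "\<phi>' ` finsler_ball E h t = (*v) A ` \<phi> ` finsler_ball E h t"
      unfolding image_image by (rule image_cong) (auto simp: finsler_ball_def A(2))
    then have "measure lborel (\<phi>' ` finsler_ball E h t) = (cmod (det A))\<^sup>2 * measure lborel (\<phi> ` finsler_ball E h t)"
      using scales_measure_det[OF A(1)] B by (simp add: scales_measure_def measure_def enn2real_mult)
    then show "r = ?r" using A(1) by (simp add: r c' norm_mult power_mult_distrib)
  qed
  then show ?thesis by (simp add: det_metric_def)
qed

end

section \<open>Charts of the bundle\<close>

definition volume_factor :: "'m::finite itself \<Rightarrow> real" where
  "volume_factor _ = (SOME C. 0 < C \<and> (\<forall>G :: complex^'m \<Rightarrow> real. continuous_on UNIV G \<longrightarrow>
     (\<forall>r>0. \<forall>w. G (r *\<^sub>R w) = r * G w) \<longrightarrow> (\<forall>w. w \<noteq> 0 \<longrightarrow> 0 < G w) \<longrightarrow>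
     measure lborel {w. G w \<le> 1} = C * Re (J (\<lambda>w. of_real (inverse (G w) ^ (2 * CARD('m)))))))"

lemma volume_factor:
  "0 < volume_factor TYPE('m::finite)"
  "\<lbrakk>continuous_on UNIV G; \<forall>r>0. \<forall>w. G (r *\<^sub>R w) = r * G w; \<forall>w. w \<noteq> 0 \<longrightarrow> 0 < G w\<rbrakk> \<Longrightarrow>
     measure lborel {w :: complex^'m. G w \<le> 1}
       = volume_factor TYPE('m) * Re (J (\<lambda>w. of_real (inverse (G w) ^ (2 * CARD('m)))))"
  using someI_ex[OF ball_volume_eq_J[where 'm = 'm]] unfolding volume_factor_def by blast+

lemma trivs_cover:
  assumes "holomorphic_vector_bundle E" "t \<in> topspace (mtop (vbase E))"
  shows "\<exists>W \<tau>. (W, \<tau>) \<in> trivs E \<and> t \<in> W"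
proof -
  have "(\<Union>(W, \<tau>) \<in> trivs E. W) = topspace (mtop (vbase E))"
    using assms(1) unfolding holomorphic_vector_bundle_def by (elim conjE)
  then obtain p where "p \<in> trivs E" "t \<in> (case p of (W, \<tau>) \<Rightarrow> W)" using assms(2) by blast
  then show ?thesis by (cases p) auto
qed

lemma atlas_cover:
  assumes "holomorphic_vector_bundle E" "t \<in> topspace (mtop (vbase E))"
  shows "\<exists>U \<phi>. (U, \<phi>) \<in> atlas (vbase E) \<and> t \<in> U"
proof -
  have "(\<Union>(U, \<phi>) \<in> atlas (vbase E). U) = topspace (mtop (vbase E))"
    using assms(1) unfolding holomorphic_vector_bundle_def complex_manifold_def by (elim conjE)
  then obtain p where "p \<in> atlas (vbase E)" "t \<in> (case p of (U, \<phi>) \<Rightarrow> U)" using assms(2) by blast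
  then show ?thesis by (cases p) auto
qed

locale finsler_bundle_chart =
  fixes E :: "('x, 'e, 'n::finite, 'm::finite) vbundle" and h :: "'e \<Rightarrow> real"
    and U \<phi> W \<tau>
  assumes vb: "holomorphic_vector_bundle E" and finsler: "smooth_finsler_metric E h"
    and curved: "strictly_negatively_curved E h"
    and chart: "(U, \<phi>) \<in> atlas (vbase E)" and triv: "(W, \<tau>) \<in> trivs E"
begin

lemmas triv_props = vb[unfolded holomorphic_vector_bundle_def, THEN conjunct2, THEN conjunct2,
    THEN conjunct2, THEN conjunct1, THEN bspec, OF triv, unfolded prod.case]

lemmas chart_props = vb[unfolded holomorphic_vector_bundle_def, THEN conjunct1,
    unfolded complex_manifold_def, THEN conjunct2, THEN conjunct2, THEN conjunct2, THEN conjunct1,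
    THEN bspec, OF chart, unfolded prod.case]

lemmas triv_homeo = triv_props[THEN conjunct2, THEN conjunct1]
lemmas chart_homeo = chart_props[THEN conjunct2, THEN conjunct2]

lemma W: "openin (mtop (vbase E)) W" "W \<subseteq> topspace (mtop (vbase E))"
  using triv_props openin_subset by blast+

lemma topspace_above: "topspace (subtopology (vtop E) (above E W)) = above E W"
  "topspace (prod_topology (subtopology (mtop (vbase E)) W) (euclidean :: (complex^'m) topology)) = W \<times> UNIV"
  using W(2) by (auto simp: above_def)

lemma triv_image: "(\<lambda>v. (vproj E v, \<tau> v)) ` above E W = W \<times> UNIV"
  using homeomorphic_imp_surjective_map[OF triv_homeo] unfolding topspace_above .

lemma triv_inj: "inj_on (\<lambda>v. (vproj E v, \<tau> v)) (above E W)"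
  using homeomorphic_imp_injective_map[OF triv_homeo] unfolding topspace_above .

lemma fibre_subset: "t \<in> W \<Longrightarrow> fibre E t \<subseteq> above E W"
  by (auto simp: fibre_def above_def)

lemma fibre_bij: 
  assumes t: "t \<in> W"
  shows "bij_betw \<tau> (fibre E t) UNIV"
proof -
  have "inj_on \<tau> (fibre E t)"
  proof (rule inj_onI)
    fix v w assume vw: "v \<in> fibre E t" "w \<in> fibre E t" "\<tau> v = \<tau> w"
    then have "vproj E v = vproj E w" by (simp add: fibre_def above_def)
    then show "v = w" using triv_inj fibre_subset[OF t] vw unfolding inj_on_def by blast
  qed
  moreover have "\<exists>v\<in>fibre E t. \<tau> v = w" for w
  proof -
    have "(t, w) \<in> (\<lambda>v. (vproj E v, \<tau> v)) ` above E W" using t unfolding triv_image by simp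
    then show ?thesis by (auto simp: fibre_def above_def)
  qed
  ultimately show ?thesis unfolding bij_betw_def by (auto simp: image_iff) metis
qed

definition \<sigma> :: "'x \<Rightarrow> complex^'m \<Rightarrow> 'e" where
  "\<sigma> t w = inv_into (fibre E t) \<tau> w"

lemma \<sigma>: "t \<in> W \<Longrightarrow> \<sigma> t w \<in> fibre E t" "t \<in> W \<Longrightarrow> \<tau> (\<sigma> t w) = w"
  "t \<in> W \<Longrightarrow> v \<in> fibre E t \<Longrightarrow> \<sigma> t (\<tau> v) = v"
  using fibre_bij[of t] unfolding \<sigma>_def bij_betw_def by (auto intro: inv_into_into f_inv_into_f)

lemma vproj_fibre: "v \<in> fibre E t \<Longrightarrow> vproj E v = t" "v \<in> fibre E t \<Longrightarrow> v \<in> topspace (vtop E)"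
  by (auto simp: fibre_def above_def)

lemma fibre_ops:
  assumes "t \<in> W"
  shows "vzero E t \<in> fibre E t" "\<tau> (vzero E t) = 0"
    "v \<in> fibre E t \<Longrightarrow> w \<in> fibre E t \<Longrightarrow> vadd E v w \<in> fibre E t"
    "v \<in> fibre E t \<Longrightarrow> w \<in> fibre E t \<Longrightarrow> \<tau> (vadd E v w) = \<tau> v + \<tau> w"
    "v \<in> fibre E t \<Longrightarrow> vscale E c v \<in> fibre E t"
    "v \<in> fibre E t \<Longrightarrow> \<tau> (vscale E c v) = c *s \<tau> v"
  using triv_props assms by blast+

lemma linear_fibre: "t \<in> W \<Longrightarrow> linear_fibre E t"
  by unfold_locales (rule fibre_ops; assumption)+

lemma fibre_frame: "t \<in> W \<Longrightarrow> fibre_frame E t (\<lambda>j. \<sigma> t (axis j 1)) \<tau>"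
  unfolding fibre_frame_def using fibre_bij fibre_ops \<sigma> by simp

lemma inj_\<phi>: "inj_on \<phi> U"
proof -
  have "topspace (subtopology (mtop (vbase E)) U) = U"
    using chart_props openin_subset by (metis inf.absorb_iff2 topspace_subtopology)
  then show ?thesis
    using homeomorphic_imp_injective_map[OF chart_homeo] by simp
qed

lemma open_chart_image:
  assumes "openin (mtop (vbase E)) T"
  shows "open (\<phi> ` (U \<inter> T))"
proof -
  have "openin (subtopology (mtop (vbase E)) U) (U \<inter> T)"
    using assms by (auto simp: openin_subtopology)
  then have "openin (top_of_set (\<phi> ` U)) (\<phi> ` (U \<inter> T))"
    using homeomorphic_imp_open_map[OF chart_homeo] unfolding open_map_def by blast
  then show ?thesis using chart_props openin_open_trans by blast
qed

definition \<kappa> :: "'e \<Rightarrow> complex^('n + 'm)" where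
  "\<kappa> v = join (\<phi> (vproj E v)) (\<tau> v)"

definition H :: "complex^('n + 'm) \<Rightarrow> real" where
  "H = h \<circ> inv_into (above E (U \<inter> W)) \<kappa>"

definition D :: "(complex^'n) set" where
  "D = \<phi> ` (U \<inter> W)"

lemma inj_\<kappa>: "inj_on \<kappa> (above E (U \<inter> W))"
proof (rule inj_onI)
  fix v w assume vw: "v \<in> above E (U \<inter> W)" "w \<in> above E (U \<inter> W)" "\<kappa> v = \<kappa> w"
  then have "\<phi> (vproj E v) = \<phi> (vproj E w)" "\<tau> v = \<tau> w" by (simp_all add: \<kappa>_def)
  moreover have "vproj E v \<in> U" "vproj E w \<in> U" "v \<in> above E W" "w \<in> above E W"
    using vw(1,2) by (auto simp: above_def)
  ultimately show "v = w" using inj_\<phi> triv_inj unfolding inj_on_def by blast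
qed

lemma H_\<sigma>:
  assumes t: "t \<in> U \<inter> W"
  shows "H (join (\<phi> t) w) = h (\<sigma> t w)"
proof -
  have m: "\<sigma> t w \<in> above E (U \<inter> W)" using \<sigma>(1)[of t w] t by (auto simp: fibre_def above_def)
  have "\<kappa> (\<sigma> t w) = join (\<phi> t) w" using t by (simp add: \<kappa>_def \<sigma>(2) vproj_fibre(1)[OF \<sigma>(1)])
  then have "inv_into (above E (U \<inter> W)) \<kappa> (join (\<phi> t) w) = \<sigma> t w"
    using inv_into_f_f[OF inj_\<kappa> m] by simp
  then show ?thesis by (simp add: H_def)
qed

lemma \<kappa>_image: "\<kappa> ` (above E (U \<inter> W) \<inter> (topspace (vtop E) - zero_section E)) = (fibres D :: (complex^('n + 'm)) set)"
proof (intro set_eqI iffI)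
  fix p assume "p \<in> \<kappa> ` (above E (U \<inter> W) \<inter> (topspace (vtop E) - zero_section E))"
  then obtain v where v: "p = \<kappa> v" "v \<in> above E (U \<inter> W)" "v \<in> topspace (vtop E)" "v \<notin> zero_section E" by blast
  let ?t = "vproj E v"
  have t: "?t \<in> U \<inter> W" "v \<in> fibre E ?t" using v(2) by (auto simp: above_def fibre_def)
  have "\<tau> v \<noteq> 0"
  proof
    assume "\<tau> v = 0"
    then have "v = vzero E ?t"
      using \<sigma>(3)[of ?t v] \<sigma>(3)[of ?t "vzero E ?t"] fibre_ops(1,2)[of ?t] t by simp
    then show False using v(4) t(1) W(2) unfolding zero_section_def by blast
  qed
  then show "p \<in> fibres D" using t by (simp add: v(1) \<kappa>_def D_def)
next
  fix p :: "complex^('n + 'm)" assume "p \<in> fibres D"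
  then obtain t w where t: "t \<in> U \<inter> W" and w: "w \<noteq> 0" and p: "p = join (\<phi> t) w"
    by (auto simp: fibres_def D_def)
  have tW: "t \<in> W" using t by simp
  have "\<sigma> t w \<notin> zero_section E"
  proof
    assume "\<sigma> t w \<in> zero_section E"
    then obtain s where s: "s \<in> topspace (mtop (vbase E))" "\<sigma> t w = vzero E s" unfolding zero_section_def by blast
    \<comment> \<open>The point \<open>s\<close> is not yet known to lie in \<open>W\<close>, so its
      zero vector is located through a trivialisation around \<open>s\<close>.\<close>
    obtain W' \<tau>' where W': "(W', \<tau>') \<in> trivs E" "s \<in> W'"
      using trivs_cover[OF vb s(1)] by blast
    interpret s: finsler_bundle_chart E h U \<phi> W' \<tau>'
      by (rule finsler_bundle_chart.intro[OF vb finsler curved chart W'(1)])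
    have "vproj E (vzero E s) = s" using vproj_fibre(1)[OF s.fibre_ops(1)[OF W'(2)]] .
    then have "s = t" using vproj_fibre(1)[OF \<sigma>(1)[OF tW, of w]] s(2) by simp
    then show False using fibre_ops(2)[OF tW] \<sigma>(2)[OF tW, of w] s(2) w by simp
  qed
  moreover have "\<sigma> t w \<in> above E (U \<inter> W)" using \<sigma>(1)[OF tW, of w] t by (auto simp: fibre_def above_def)
  moreover have "\<kappa> (\<sigma> t w) = p" using tW by (simp add: \<kappa>_def p \<sigma>(2) vproj_fibre(1)[OF \<sigma>(1)])
  ultimately show "p \<in> \<kappa> ` (above E (U \<inter> W) \<inter> (topspace (vtop E) - zero_section E))"
    by (auto simp: above_def intro!: image_eqI[of _ _ "\<sigma> t w"])
qed

lemma H_psh: "Ck_on 2 (fibres D) H" "p \<in> fibres D \<Longrightarrow> hermitian_pos_def (complex_hessian H p)"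
proof -
  have "(above E (U \<inter> W), \<kappa>) \<in> atlas (total_space E)"
    using chart triv unfolding total_space_def \<kappa>_def[abs_def] join_def by auto
  with curved have "Ck_on 2 (\<kappa> ` (above E (U \<inter> W) \<inter> (topspace (vtop E) - zero_section E))) (h \<circ> inv_into (above E (U \<inter> W)) \<kappa>) \<and>
      (\<forall>p\<in>\<kappa> ` (above E (U \<inter> W) \<inter> (topspace (vtop E) - zero_section E)).
        hermitian_pos_def (complex_hessian (h \<circ> inv_into (above E (U \<inter> W)) \<kappa>) p))"
    unfolding strictly_negatively_curved_def strictly_psh_def by blast
  then show "Ck_on 2 (fibres D) H" "p \<in> fibres D \<Longrightarrow> hermitian_pos_def (complex_hessian H p)"
    unfolding \<kappa>_image H_def by blast+
qed

lemma \<sigma>_scale: "t \<in> W \<Longrightarrow> \<sigma> t (c *s w) = vscale E c (\<sigma> t w)"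
  using \<sigma>(3)[of t "vscale E c (\<sigma> t w)"] fibre_ops(5,6)[of t "\<sigma> t w" c] \<sigma>(1,2)[of t w] by simp

lemma h_\<sigma>:
  assumes t: "t \<in> W"
  shows "0 \<le> h (\<sigma> t w)" "h (\<sigma> t (c *s w)) = cmod c * h (\<sigma> t w)"
  using finsler vproj_fibre(2)[OF \<sigma>(1)[OF t, of w]] unfolding smooth_finsler_metric_def \<sigma>_scale[OF t] by blast+

sublocale finsler_chart D H
proof
  show "open D" unfolding D_def by (rule open_chart_image[OF W(1)])
  show "Ck_on 2 (fibres D) H" by (rule H_psh(1))
  show "hermitian_pos_def (complex_hessian H p)" if "p \<in> fibres D" for p by (rule H_psh(2)[OF that])
  show "H (join z (c *s w)) = cmod c * H (join z w)" "0 \<le> H (join z w)" if "z \<in> D" for z c w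
    using that h_\<sigma> by (auto simp: D_def H_\<sigma>)
qed

lemma finsler_ball_image: 
  assumes t: "t \<in> U \<inter> W"
  shows "\<tau> ` finsler_ball E h t = {w. H (join (\<phi> t) w) \<le> 1}"
proof (intro set_eqI iffI)
  have tW: "t \<in> W" using t by simp
  fix w
  show "w \<in> {w. H (join (\<phi> t) w) \<le> 1}" if "w \<in> \<tau> ` finsler_ball E h t"
    using that \<sigma>(3)[OF tW] by (auto simp: finsler_ball_def H_\<sigma>[OF t])
  assume "w \<in> {w. H (join (\<phi> t) w) \<le> 1}"
  then have "\<sigma> t w \<in> finsler_ball E h t" using \<sigma>(1)[OF tW] by (simp add: finsler_ball_def H_\<sigma>[OF t])
  then show "w \<in> \<tau> ` finsler_ball E h t" using \<sigma>(2)[OF tW] by (metis imageI)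
qed

text \<open>Differentiability is given only off the zero section, whereas the volume formula asks
  for continuity at \<open>w = 0\<close> as well; it comes from the continuity of \<open>h\<close>
  and of the inverse trivialisation.\<close>

lemma continuous_H:
  assumes t: "t \<in> U \<inter> W"
  shows "continuous_on UNIV (\<lambda>w. H (join (\<phi> t) w))"
proof -
  have tW: "t \<in> W" using t by simp
  let ?X = "subtopology (vtop E) (above E W)"
  let ?Y = "prod_topology (subtopology (mtop (vbase E)) W) (euclidean :: (complex^'m) topology)"
  obtain g where "homeomorphic_maps ?X ?Y (\<lambda>v. (vproj E v, \<tau> v)) g"
    using triv_homeo homeomorphic_map_maps by blast
  then have g: "continuous_map ?Y ?X g" "\<And>v. v \<in> above E W \<Longrightarrow> g (vproj E v, \<tau> v) = v"
    unfolding homeomorphic_maps_def topspace_above by auto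
  have "g (t, w) = \<sigma> t w" for w
    using g(2)[of "\<sigma> t w"] \<sigma>(1,2)[OF tW, of w] fibre_subset[OF tW] vproj_fibre(1)[OF \<sigma>(1)[OF tW, of w]] by auto
  moreover have "continuous_map euclidean ?Y (\<lambda>w. (t, w))"
    using t W(2) by (auto simp: continuous_map_pairwise comp_def)
  then have "continuous_map euclidean ?X (\<lambda>w. g (t, w))"
    using continuous_map_compose[OF _ g(1)] by (simp add: comp_def)
  ultimately have "continuous_map euclidean (vtop E) (\<sigma> t)"
    by (simp add: continuous_map_in_subtopology)
  then have "continuous_map euclidean euclideanreal (h \<circ> \<sigma> t)"
    using finsler unfolding smooth_finsler_metric_def by (blast intro: continuous_map_compose)
  then show ?thesis by (simp add: H_\<sigma>[OF t] comp_def)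
qed

text \<open>\<open>exp (- \<psi>)\<close> is \<open>H\<close> to the power
  \<open>- 2 * CARD('m)\<close>, the integrand of the volume formula.\<close>

lemma finsler_ball_measure:
  assumes t: "t \<in> U \<inter> W"
  shows "measure lborel (\<tau> ` finsler_ball E h t) = volume_factor TYPE('m) * V (\<phi> t)" "\<tau> ` finsler_ball E h t \<in> sets borel"
proof -
  have z: "\<phi> t \<in> D" using t by (simp add: D_def)
  let ?G = "\<lambda>w. H (join (\<phi> t) w)"
  have 1: "r *\<^sub>R w = complex_of_real r *s w" for r and w :: "complex^'m"
    by (simp add: vec_eq_iff scaleR_conv_of_real[where 'a = complex])
  have pos: "0 < ?G w" if "w \<noteq> 0" for w using H_pos[of "join (\<phi> t) w"] z that by simp
  have "J (\<lambda>w. of_real (inverse (?G w) ^ (2 * CARD('m)))) = J (\<lambda>w. EE (join (\<phi> t) w))"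
  proof (rule J_cong)
    fix w :: "complex^'m" assume "w \<noteq> 0"
    then have "exp (- \<psi> (join (\<phi> t) w)) = inverse (?G w) ^ (2 * CARD('m))"
      using pos[of w] exp_of_nat_mult[of "2 * CARD('m)" "ln (?G w)"] unfolding \<psi>_def
      by (simp add: exp_minus power_inverse)
    then show "of_real (inverse (?G w) ^ (2 * CARD('m))) = EE (join (\<phi> t) w)" by (simp add: EE_def)
  qed
  moreover have "measure lborel {w. ?G w \<le> 1} = volume_factor TYPE('m) * Re (J (\<lambda>w. of_real (inverse (?G w) ^ (2 * CARD('m)))))"
    by (rule volume_factor(2)[OF continuous_H[OF t]]) (use pos H_scale[OF z] in \<open>simp_all add: 1\<close>)
  ultimately show "measure lborel (\<tau> ` finsler_ball E h t) = volume_factor TYPE('m) * V (\<phi> t)"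
    unfolding finsler_ball_image[OF t] by (simp add: V_def VC_def)
  have "closed {w. ?G w \<le> 1}" by (intro closed_Collect_le continuous_H[OF t] continuous_on_const)
  then show "\<tau> ` finsler_ball E h t \<in> sets borel" unfolding finsler_ball_image[OF t] by simp
qed

end

section \<open>The induced metric on the determinant bundle\<close>

lemma det_bundle_sel [simp]:
  "vbase (det_bundle E) = vbase E" "vproj (det_bundle E) = fst" "vzero (det_bundle E) t = (t, \<lambda>_. 0)"
  "vscale (det_bundle E) c (t, \<omega>) = (t, \<lambda>\<alpha>. c * \<omega> \<alpha>)"
  "trivs (det_bundle E) = {(W, det_coord E \<tau>) | W \<tau>. (W, \<tau>) \<in> trivs E}"
  by (simp_all add: det_bundle_def)

lemma topspace_det_bundle:
  assumes "v \<in> topspace (vtop (det_bundle E))"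
  shows "\<exists>t \<omega> W \<tau>. v = (t, \<omega>) \<and> (W, \<tau>) \<in> trivs E \<and> t \<in> W \<and> \<omega> \<in> det_fibre E t"
  using assms by (auto simp: det_bundle_def topology_generated_by_topspace)

context finsler_bundle_chart
begin

lemma det_metric_trivialization:
  assumes t: "t \<in> U \<inter> W" and \<omega>: "\<omega> \<in> det_fibre E t"
  shows "det_metric E h (t, \<omega>) = sqrt ((cmod (det_coord E \<tau> (t, \<omega>) $ 1))\<^sup>2 / (volume_factor TYPE('m) * V (\<phi> t)))"
    and "det_coord E \<tau> (t, \<omega>) $ 1 = 0 \<longleftrightarrow> \<omega> = (\<lambda>_. 0)"
proof -
  have tW: "t \<in> W" using t by simp
  interpret F: linear_fibre E t by (rule linear_fibre[OF tW])
  let ?c = "det_coord E \<tau> (t, \<omega>) $ 1" and ?e = "\<lambda>j. \<sigma> t (axis j 1)"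
  have c: "?c = \<omega> (\<lambda>i v. if v \<in> fibre E t then \<tau> v $ i else 0)" by (simp add: det_coord_def)
  have eq: "\<omega> = (\<lambda>\<alpha>. ?c * wedge E t ?e \<alpha>)"
    unfolding c by (rule F.det_fibre_eq_wedge[OF fibre_frame[OF tW] \<omega>])
  note m = finsler_ball_measure[OF t]
  have "det_metric E h (t, \<omega>) = det_metric E h (t, \<lambda>\<alpha>. ?c * wedge E t ?e \<alpha>)" by (rule arg_cong[OF eq])
  also have "\<dots> = sqrt ((cmod ?c)\<^sup>2 / (volume_factor TYPE('m) * V (\<phi> t)))"
    unfolding F.det_metric_eq[OF fibre_frame[OF tW] m(2)] m(1) ..
  finally show "det_metric E h (t, \<omega>) = sqrt ((cmod ?c)\<^sup>2 / (volume_factor TYPE('m) * V (\<phi> t)))" .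
  show "?c = 0 \<longleftrightarrow> \<omega> = (\<lambda>_. 0)"
  proof
    assume "?c = 0"
    then have "(\<lambda>\<alpha>. ?c * wedge E t ?e \<alpha>) = (\<lambda>_. 0)" by simp
    then show "\<omega> = (\<lambda>_. 0)" by (rule trans[OF eq])
  qed (simp add: det_coord_def)
qed

text \<open>The logarithm of the squared norm splits into that of the squared modulus of the
  holomorphic coordinate of \<open>s\<close>, which is pluriharmonic, the function
  \<open>- ln V\<close> and a constant; only \<open>- ln V\<close> contributes to the
  Hessian.\<close>

lemma det_metric_curvature:
  assumes T: "openin (mtop (vbase E)) T"
    and fib: "\<And>t. t \<in> T \<Longrightarrow> s t \<in> {t} \<times> det_fibre E t" and nz: "\<And>t. t \<in> T \<Longrightarrow> s t \<noteq> (t, \<lambda>_. 0)"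
    and holo: "holomorphic_fun (vbase E) (T \<inter> W) (\<lambda>t. det_coord E \<tau> (s t) $ 1)"
  shows "Ck_on 2 (\<phi> ` (U \<inter> (T \<inter> W))) (\<lambda>y. ln ((det_metric E h (s (inv_into U \<phi> y)))\<^sup>2))"
    and "z \<in> \<phi> ` (U \<inter> (T \<inter> W)) \<Longrightarrow> hermitian_pos_def (complex_hessian (\<lambda>y. ln ((det_metric E h (s (inv_into U \<phi> y)))\<^sup>2)) z)"
proof -
  let ?S = "\<phi> ` (U \<inter> (T \<inter> W))" and ?f = "\<lambda>y. ln ((det_metric E h (s (inv_into U \<phi> y)))\<^sup>2)"
  let ?C = "volume_factor TYPE('m)"
  define c where "c = (\<lambda>t. det_coord E \<tau> (s t) $ 1) \<circ> inv_into U \<phi>"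
  have S: "open ?S" by (rule open_chart_image[OF openin_Int[OF T W(1)]])
  have SD: "?S \<subseteq> D" unfolding D_def by blast
  have c: "holo_on ?S c" using holo chart unfolding holomorphic_fun_def c_def by blast
  have pt: "\<exists>t \<omega>. t \<in> U \<inter> W \<and> t \<in> T \<and> y = \<phi> t \<and> inv_into U \<phi> y = t \<and> s t = (t, \<omega>) \<and> \<omega> \<in> det_fibre E t" if "y \<in> ?S" for y
  proof -
    obtain t where t: "t \<in> U \<inter> W" "t \<in> T" "y = \<phi> t" using \<open>y \<in> ?S\<close> by blast
    moreover obtain \<omega> where "s t = (t, \<omega>)" "\<omega> \<in> det_fibre E t" using fib[OF t(2)] by blast
    ultimately show ?thesis using inv_into_f_f[OF inj_\<phi>, of t] by blast
  qed
  have cnz: "c y \<noteq> 0" and f: "?f y = ln ((cmod (c y))\<^sup>2) + (- ln (V y) + - ln ?C)" if y: "y \<in> ?S" for y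
  proof -
    obtain t \<omega> where t: "t \<in> U \<inter> W" "t \<in> T" "y = \<phi> t" "inv_into U \<phi> y = t" "s t = (t, \<omega>)" "\<omega> \<in> det_fibre E t"
      using pt[OF y] by blast
    note m = det_metric_trivialization[OF t(1,6)]
    have cy: "c y = det_coord E \<tau> (t, \<omega>) $ 1" by (simp add: c_def t(4,5))
    show c0: "c y \<noteq> 0" using m(2) nz[OF t(2)] unfolding cy t(5) by simp
    have "0 < V y" using V_pos(1) SD y by blast
    then show "?f y = ln ((cmod (c y))\<^sup>2) + (- ln (V y) + - ln ?C)"
      unfolding t(4,5) m(1) cy[symmetric] t(3)[symmetric] using c0 volume_factor(1)[where 'm = 'm] by (simp add: ln_div ln_mult)
  qed
  have lc: "Ck_on 2 ?S (\<lambda>y. ln ((cmod (c y))\<^sup>2))" "y \<in> ?S \<Longrightarrow> complex_hessian (\<lambda>y. ln ((cmod (c y))\<^sup>2)) y = 0" for y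
    using ln_cmod_holo_on_pluriharmonic[OF S c] cnz by simp_all
  note lV = Ck_on_subset[OF ln_V_Ck SD]
  note lVC = Ck_on_add[OF S lV Ck_on_const[of _ _ "- ln ?C"]]
  have "Ck_on 2 ?S (\<lambda>y. ln ((cmod (c y))\<^sup>2) + (- ln (V y) + - ln ?C))"
    by (rule Ck_on_add[OF S lc(1) lVC])
  then show "Ck_on 2 ?S ?f" by (rule Ck_on_cong_imp[OF S, rotated]) (rule f[symmetric])
  assume z: "z \<in> ?S"
  have "complex_hessian ?f z = complex_hessian (\<lambda>y. ln ((cmod (c y))\<^sup>2) + (- ln (V y) + - ln ?C)) z"
    by (rule complex_hessian_cong[OF S z]) (rule f)
  also have "\<dots> = complex_hessian (\<lambda>y. - ln (V y)) z"
    unfolding complex_hessian_add[OF S z lc(1) lVC] complex_hessian_add[OF S z lV Ck_on_const] lc(2)[OF z] complex_hessian_const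
    by simp
  finally show "hermitian_pos_def (complex_hessian ?f z)"
    using ln_V_strictly_psh SD z by auto
qed

end

text \<open>The curvature matrix is minus a complex Hessian, so negative curvature is positivity of
  that Hessian, which can be checked near each point.\<close>

theorem corollary1p9:
  fixes E :: "('x, 'e, 'n::finite, 'm::finite) vbundle" and h :: "'e \<Rightarrow> real"
  assumes "holomorphic_vector_bundle E"
    and "smooth_finsler_metric E h"
    and "strictly_negatively_curved E h"
  shows "curvature_strictly_negative (det_bundle E) (det_metric E h)"
proof -
  note E = assms
  let ?L = "det_bundle E" and ?N = "det_metric E h"
  let ?C = "volume_factor TYPE('m)"
  have norm: "0 \<le> ?N v" "?N v = 0 \<longleftrightarrow> v \<in> zero_section ?L" "?N (vscale ?L c v) = cmod c * ?N v"
    if v: "v \<in> topspace (vtop ?L)" for v c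
  proof -
    obtain t \<omega> W \<tau> where t: "v = (t, \<omega>)" "(W, \<tau>) \<in> trivs E" "t \<in> W" "\<omega> \<in> det_fibre E t"
      using topspace_det_bundle[OF v] by blast
    have "(\<Union>(W, \<tau>) \<in> trivs E. W) = topspace (mtop (vbase E))"
      using E(1) unfolding holomorphic_vector_bundle_def by (elim conjE)
    then have tb: "t \<in> topspace (mtop (vbase E))" using t(2,3) by blast
    obtain U \<phi> where U: "(U, \<phi>) \<in> atlas (vbase E)" "t \<in> U" using atlas_cover[OF E(1) tb] by blast
    interpret finsler_bundle_chart E h U \<phi> W \<tau> by (rule finsler_bundle_chart.intro[OF E U(1) t(2)])
    have tUW: "t \<in> U \<inter> W" using U(2) t(3) by blast
    have V: "0 < ?C * V (\<phi> t)" using V_pos(1)[of "\<phi> t"] tUW volume_factor(1)[where 'm = 'm] by (simp add: D_def)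
    note m = det_metric_trivialization[OF tUW]
    note m\<omega> = m[OF t(4)]
    show "0 \<le> ?N v" unfolding t(1) m\<omega>(1) using V by simp
    have "?N v = 0 \<longleftrightarrow> \<omega> = (\<lambda>_. 0)" unfolding t(1) m\<omega>(1) m\<omega>(2)[symmetric] using V by auto
    also have "\<dots> \<longleftrightarrow> v \<in> zero_section ?L" using tb by (auto simp: t(1) zero_section_def)
    finally show "?N v = 0 \<longleftrightarrow> v \<in> zero_section ?L" .
    have c\<omega>: "(\<lambda>\<alpha>. c * \<omega> \<alpha>) \<in> det_fibre E t"
      using t(4) unfolding det_fibre_def by (simp add: distrib_left mult.left_commute)
    show "?N (vscale ?L c v) = cmod c * ?N v"
      unfolding t(1) det_bundle_sel m(1)[OF c\<omega>] m\<omega>(1)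
      by (simp add: det_coord_def norm_mult power_mult_distrib real_sqrt_mult real_sqrt_divide)
  qed
  then have metric: "line_bundle_metric ?L ?N" unfolding line_bundle_metric_def by blast
  have curv: "Ck_on 2 (\<phi> ` (U \<inter> T)) (\<lambda>y. ln ((?N (s (inv_into U \<phi> y)))\<^sup>2)) \<and>
      (\<forall>z\<in>\<phi> ` (U \<inter> T). hermitian_neg_def (curvature_matrix ?N s U \<phi> z))"
    if s: "holomorphic_section ?L T s" and nz: "\<forall>t\<in>T. s t \<noteq> vzero ?L t" and U: "(U, \<phi>) \<in> atlas (vbase ?L)" for T s U \<phi>
  proof -
    let ?f = "\<lambda>y. ln ((?N (s (inv_into U \<phi> y)))\<^sup>2)"
    have U': "(U, \<phi>) \<in> atlas (vbase E)" using U by simp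
    have T: "openin (mtop (vbase E)) T" using s by (simp add: holomorphic_section_def)
    have fib: "s t \<in> {t} \<times> det_fibre E t" if t: "t \<in> T" for t
    proof -
      have "s t \<in> topspace (vtop ?L)" "fst (s t) = t"
        using s t by (auto simp: holomorphic_section_def fibre_def above_def)
      then show ?thesis using topspace_det_bundle[of "s t" E] by auto
    qed
    \<comment> \<open>The domain \<open>T\<close> of a section need not lie in one trivialising set,
      so both claims are established on the part of \<open>T\<close> inside a trivialising set
      around the given point.\<close>
    have loc: "\<exists>S. open S \<and> z \<in> S \<and> S \<subseteq> \<phi> ` (U \<inter> T) \<and> Ck_on 2 S ?f \<and> hermitian_pos_def (complex_hessian ?f z)"
      if z: "z \<in> \<phi> ` (U \<inter> T)" for z
    proof -
      obtain t where t: "t \<in> U" "t \<in> T" "z = \<phi> t" using z by blast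
      have "t \<in> topspace (mtop (vbase E))" using openin_subset[OF T] t(2) by blast
      then obtain W \<tau> where W\<tau>: "(W, \<tau>) \<in> trivs E" "t \<in> W" using trivs_cover[OF E(1)] by blast
      interpret finsler_bundle_chart E h U \<phi> W \<tau> by (rule finsler_bundle_chart.intro[OF E U' W\<tau>(1)])
      have "(W, det_coord E \<tau>) \<in> trivs ?L" using W\<tau>(1) by auto
      then have holo: "holomorphic_fun (vbase E) (T \<inter> W) (\<lambda>t. det_coord E \<tau> (s t) $ 1)"
        using s unfolding holomorphic_section_def by auto
      have nz': "s t \<noteq> (t, \<lambda>_. 0)" if "t \<in> T" for t using nz that by simp
      have m: "Ck_on 2 (\<phi> ` (U \<inter> (T \<inter> W))) ?f"
        "y \<in> \<phi> ` (U \<inter> (T \<inter> W)) \<Longrightarrow> hermitian_pos_def (complex_hessian ?f y)" for y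
        using det_metric_curvature[OF T _ _ holo] fib nz' by blast+
      have zS: "z \<in> \<phi> ` (U \<inter> (T \<inter> W))" using t W\<tau>(2) by blast
      show ?thesis
        using open_chart_image[OF openin_Int[OF T W(1)]] zS m(1) m(2)[OF zS]
        by (intro exI[of _ "\<phi> ` (U \<inter> (T \<inter> W))"] conjI) auto
    qed
    have chart: "open (\<phi> ` (U \<inter> T))"
      unfolding open_subopen[of "\<phi> ` (U \<inter> T)"] using loc by blast
    have "Ck_on 2 (\<phi> ` (U \<inter> T)) ?f"
      by (rule Ck_on_Un_local[OF chart]) (use loc in blast)
    moreover have "hermitian_neg_def (curvature_matrix ?N s U \<phi> z)" if "z \<in> \<phi> ` (U \<inter> T)" for z
      using loc[OF that] by (auto simp: hermitian_neg_def_def curvature_matrix_def)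
    ultimately show ?thesis by blast
  qed
  show ?thesis
    unfolding curvature_strictly_negative_def using metric curv by blast
qed

end
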